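(* Let $0<p<q\le 1$ and let $f:[0,\infty)\to[0,1]$ be nonincreasing with $0<\sup\{a: f(a)>0\}<\infty$. For $s\in(0,1]$ define $S_sf(r):=s\, f(\sqrt{s}\,r)$. Then $\lambda_{S_pf}<\lambda_{S_qf}$. Moreover, $\lambda_f > \left(2\pi\int_0^\infty r f(r)\,dr\right)^{-1}$ (strict inequality).
   Context: For $\lambda>0$, $\mathscr{P}_\lambda$ is a homogeneous Poisson point process of intensity $\lambda$ in $\mathbb{R}^2$. Given a connection function $g:[0,\infty)\to[0,1]$, the random connection model $RCM(\lambda,g)$ is the random graph with vertex set $\mathscr{P}_\lambda$ in which each pair of vertices $x,y$ is joined by an edge with probability $g(|x-y|)$, independently of all other pairs. When $0<\int_0^\infty r g(r)\,dr<\infty$ there is a critical intensity $\lambda_g\in(0,\infty)$ such that for $\lambda>\lambda_g$ the graph $RCM(\lambda,g)$ a.s. has an infinite connected component and for $\lambda<\lambda_g$ a.s. it has none. *)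

theory Defs
  imports "HOL-Probability.Probability"
begin

text \<open>Labels of potential Poisson points: a unit cell (c1,c2) of Z^2 and an index i.
  The Poisson process of intensity lam on R^2 is built in the standard way:
  each cell c gets an independent Poisson(lam) number N c of points, and the
  point with label (c,i) (present iff i < N c) is uniform in the cell c,
  independently of everything else.  Edges are decided by independent
  Uniform[0,1] variables U indexed by ordered pairs of labels (only pairs with
  to_nat l < to_nat l' are used, to_nat a fixed injection into nat), so that, given the points, distinct pairs are joined
  independently with probability g(|x-y|).\<close>

type_synonym lab = "(int \<times> int) \<times> nat"

type_synonym rcm_sample =
  "((int \<times> int) \<Rightarrow> nat) \<times> ((lab \<Rightarrow> real \<times> real) \<times> (lab \<times> lab \<Rightarrow> real))"

definition cell :: "int \<times> int \<Rightarrow> (real \<times> real) set" where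
  "cell c = cbox (real_of_int (fst c), real_of_int (snd c))
                 (real_of_int (fst c) + 1, real_of_int (snd c) + 1)"

definition RCM_space :: "real \<Rightarrow> rcm_sample measure" where
  "RCM_space lam =
     (PiM UNIV (\<lambda>_. measure_pmf (poisson_pmf lam))) \<Otimes>\<^sub>M
     ((PiM UNIV (\<lambda>l. uniform_measure lborel (cell (fst l)))) \<Otimes>\<^sub>M
      (PiM UNIV (\<lambda>_. uniform_measure lborel {0..1::real})))"

definition present :: "rcm_sample \<Rightarrow> lab \<Rightarrow> bool" where
  "present \<omega> l \<longleftrightarrow> snd l < fst \<omega> (fst l)"

definition position :: "rcm_sample \<Rightarrow> lab \<Rightarrow> real \<times> real" where
  "position \<omega> l = fst (snd \<omega>) l"

definition edge_unif :: "rcm_sample \<Rightarrow> lab \<Rightarrow> lab \<Rightarrow> real" where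
  "edge_unif \<omega> l l' = (if to_nat l < to_nat l' then snd (snd \<omega>) (l, l') else snd (snd \<omega>) (l', l))"

definition rcm_adj :: "(real \<Rightarrow> real) \<Rightarrow> rcm_sample \<Rightarrow> lab \<Rightarrow> lab \<Rightarrow> bool" where
  "rcm_adj g \<omega> l l' \<longleftrightarrow> present \<omega> l \<and> present \<omega> l' \<and> l \<noteq> l' \<and>
      edge_unif \<omega> l l' < g (dist (position \<omega> l) (position \<omega> l'))"

definition has_infinite_component :: "(real \<Rightarrow> real) \<Rightarrow> rcm_sample \<Rightarrow> bool" where
  "has_infinite_component g \<omega> \<longleftrightarrow>
     (\<exists>l. present \<omega> l \<and> infinite {l'. (rcm_adj g \<omega>)\<^sup>*\<^sup>* l l'})"

definition crit_intensity :: "(real \<Rightarrow> real) \<Rightarrow> real" where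
  "crit_intensity g =
     Sup {lam. 0 < lam \<and> (AE \<omega> in RCM_space lam. \<not> has_infinite_component g \<omega>)}"

definition scale_conn :: "real \<Rightarrow> (real \<Rightarrow> real) \<Rightarrow> real \<Rightarrow> real" where
  "scale_conn s f r = s * f (sqrt s * r)"

end

theory Submission
  imports Defs
begin

text \<open>
  In a box, and with \<open>s f\<close> in place of \<open>f\<close>, the probability that a small set is connected to the
  outside of a large square is a function of the intensity \<open>\<lambda>\<close> and of \<open>s\<close>. Its derivative in \<open>\<lambda>\<close>
  counts pivotal vertices and its derivative in \<open>s\<close> counts pivotal edges (Russo). The pivotal edges lie on
  a path through the pivotal vertices, so there are fewer of them, and a local modification (adding a vertex that turns
  a pivotal edge into a triangle) shows that the difference is a fixed proportion of the number of pivotal vertices.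
  Hence connection probabilities decrease along curves \<open>\<lambda> = C s\<^sup>\<eta>\<close> with some \<open>\<eta> > 0\<close>, where
  \<open>\<lambda>\<close> is the intensity after rescaling space by \<open>\<surd>s\<close>, and this separates the critical intensities.
  The weak form of the lower bound is path counting; applied to \<open>s = 1/2\<close> it becomes strict for \<open>s = 1\<close>.
  The critical intensities are finite by comparison with Lipschitz percolation.\<close>

section \<open>Pivotal vertices and edges\<close>

text \<open>The obstacle is crowding. Planting a vertex joined to exactly the two ends of a pivotal
  edge costs a factor \<open>\<theta>\<close> for every point within reach, and the number of these
  points is unbounded. Edges with at most \<open>k\<close> near points are handled by planting; the
  others are controlled by counting pairs (pivotal vertex, near point). Non-pivotal near points are
  integrated out by the Mecke formula; pairs of pivotal points are reduced to pairs in one small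
  cell, where opening a missing edge again creates a non-pivotal edge between pivotal vertices. For
  large \<open>k\<close> these pairs are absorbed. The factor \<open>\<theta>\<close> is positive
  only if edge probabilities stay below 1. So the strict gain is made between p and a midpoint q' <
  q; from q' to q the plain inequality |PE| \<le> |PV| suffices. The curve comes from m dF/dm =
  E|PV| and s dF/ds = E|PE|. All constants are uniform in the box, the target and a compact range of
  intensities, so the comparison survives the infinite-volume limit. The integral of r s f(sqrt(s)
  r) does not depend on s, so the weak lower bound has the same value for s = 1/2 as for s =
  1.\<close>

definition path_between :: "'i set \<Rightarrow> 'i set \<Rightarrow> 'i set \<Rightarrow> 'i set set \<Rightarrow> 'i list \<Rightarrow> bool" where
  "path_between V S T E xs \<longleftrightarrow> xs \<noteq> [] \<and> set xs \<subseteq> V \<and> successively (\<lambda>i j. {i, j} \<in> E) xs \<and>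
     hd xs \<in> S \<and> last xs \<in> T"

definition conn :: "'i set \<Rightarrow> 'i set \<Rightarrow> 'i set \<Rightarrow> 'i set set \<Rightarrow> bool" where
  "conn V S T E \<longleftrightarrow> (\<exists>xs. path_between V S T E xs)"

definition PV :: "'i set \<Rightarrow> 'i set \<Rightarrow> 'i set \<Rightarrow> 'i set set \<Rightarrow> 'i set" where
  "PV V S T E = {v \<in> V. conn V S T E \<and> \<not> conn (V - {v}) S T E}"

definition PE :: "'i set \<Rightarrow> 'i set \<Rightarrow> 'i set \<Rightarrow> 'i set set \<Rightarrow> 'i set set" where
  "PE V S T E = {e \<in> E. conn V S T E \<and> \<not> conn V S T (E - {e})}"

text \<open>The link between the two counts: \<open>PE\<close> is contained in \<open>AP\<close>,
  and \<open>AP\<close> has fewer elements than a nonempty \<open>PV\<close>. Hence every edge of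
  \<open>AP\<close> outside \<open>PE\<close> widens the gap between pivotal vertices and pivotal
  edges.\<close>

definition AP :: "'i set \<Rightarrow> 'i set \<Rightarrow> 'i set \<Rightarrow> 'i set set \<Rightarrow> 'i set set" where
  "AP V S T E = {e \<in> E. \<exists>u\<in>PV V S T E. \<exists>v\<in>PV V S T E. u \<noteq> v \<and> e = {u, v}}"

text \<open>Vertices that complete a triangle over an edge which is pivotal without them. With
  \<open>w\<close> present the two ends of the edge remain pivotal, but the edge does not, because a
  path can pass through \<open>w\<close>. Marked vertices are excluded since they could start or end
  a path themselves.\<close>

definition detour :: "'i set \<Rightarrow> 'i set \<Rightarrow> 'i set \<Rightarrow> 'i set set \<Rightarrow> 'i set" where
  "detour V S T E = {w \<in> V. w \<notin> S \<and> w \<notin> T \<and>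
     (\<exists>u v. u \<noteq> v \<and> {i \<in> V. {w, i} \<in> E} = {u, v} \<and> {u, v} \<in> PE (V - {w}) S T E)}"

lemma path_between_mono:
  assumes "path_between V S T E xs" "V \<subseteq> V'" "E \<subseteq> E'"
  shows "path_between V' S T E' xs"
proof -
  have "successively (\<lambda>i j. {i, j} \<in> E') xs"
    using assms by (auto simp: path_between_def successively_conv_nth)
  then show ?thesis using assms by (auto simp: path_between_def)
qed

lemma conn_mono: "conn V S T E \<Longrightarrow> V \<subseteq> V' \<Longrightarrow> E \<subseteq> E' \<Longrightarrow> conn V' S T E'"
  unfolding conn_def by (blast intro: path_between_mono)

lemma conn_mono_marks: "conn V S T E \<Longrightarrow> V \<inter> S \<subseteq> S' \<Longrightarrow> V \<inter> T \<subseteq> T' \<Longrightarrow> conn V S' T' E"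
  unfolding conn_def path_between_def by (meson IntI hd_in_set last_in_set subsetD)

text \<open>A path inside \<open>V\<close> traverses only edges inside \<open>V\<close>. This
  decouples a connection event from the edges at a vertex that is added or removed.\<close>

lemma conn_restrict_edges:
  "conn V S T E \<longleftrightarrow> conn V S T (E \<inter> {e. e \<subseteq> V})"
proof
  assume "conn V S T E"
  then obtain xs where xs: "path_between V S T E xs" by (auto simp: conn_def)
  then have "successively (\<lambda>i j. {i, j} \<in> E \<inter> {e. e \<subseteq> V}) xs"
    unfolding path_between_def successively_conv_nth
    by (smt (verit, best) IntI Suc_lessD empty_subsetI insert_subset mem_Collect_eq nth_mem subset_iff)
  then show "conn V S T (E \<inter> {e. e \<subseteq> V})"
    using xs unfolding path_between_def conn_def by blast
qed (rule conn_mono, auto)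

definition step_in :: "'i set \<Rightarrow> 'i set set \<Rightarrow> 'i \<Rightarrow> 'i \<Rightarrow> bool" where
  "step_in V E i j \<longleftrightarrow> i \<in> V \<and> j \<in> V \<and> {i, j} \<in> E"

text \<open>The closure form serves the bypass argument and the components of the random connection
  model, while lists are kept for paths of minimal length.\<close>

lemma conn_iff_rtranclp:
  "conn V S T E \<longleftrightarrow> (\<exists>u\<in>V \<inter> S. \<exists>v\<in>V \<inter> T. (step_in V E)\<^sup>*\<^sup>* u v)"
proof
  assume "conn V S T E"
  then obtain xs where xs: "path_between V S T E xs" by (auto simp: conn_def)
  have "(step_in V E)\<^sup>*\<^sup>* (hd xs) (last xs)"
    if "xs \<noteq> []" "set xs \<subseteq> V" "successively (\<lambda>i j. {i, j} \<in> E) xs" for xs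
    using that
  proof (induction xs)
    case (Cons a xs)
    show ?case
    proof (cases xs)
      case (Cons b ys)
      then have "step_in V E a b" "(step_in V E)\<^sup>*\<^sup>* b (last xs)"
        using Cons.prems Cons.IH by (auto simp: step_in_def[of V E a])
      then show ?thesis using Cons by (auto intro: converse_rtranclp_into_rtranclp)
    qed auto
  qed auto
  then show "\<exists>u\<in>V \<inter> S. \<exists>v\<in>V \<inter> T. (step_in V E)\<^sup>*\<^sup>* u v"
    using xs unfolding path_between_def
    by (intro bexI[of _ "hd xs"] bexI[of _ "last xs"]) auto
next
  assume "\<exists>u\<in>V \<inter> S. \<exists>v\<in>V \<inter> T. (step_in V E)\<^sup>*\<^sup>* u v"
  then obtain u v where uv: "u \<in> V" "u \<in> S" "v \<in> T" "(step_in V E)\<^sup>*\<^sup>* u v" by auto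
  have "\<exists>xs. xs \<noteq> [] \<and> set xs \<subseteq> V \<and> successively (\<lambda>i j. {i, j} \<in> E) xs \<and> hd xs = u \<and> last xs = v"
    using uv(4)
  proof (induction)
    case base
    then show ?case using uv(1) by (intro exI[of _ "[u]"]) auto
  next
    case (step y z)
    then obtain xs where "xs \<noteq> []" "set xs \<subseteq> V" "successively (\<lambda>i j. {i, j} \<in> E) xs" "hd xs = u" "last xs = y"
      by blast
    then show ?case using step(2)
      by (intro exI[of _ "xs @ [z]"]) (auto simp: step_in_def successively_append_iff)
  qed
  then show "conn V S T E" using uv unfolding conn_def path_between_def by blast
qed

text \<open>A shortest connecting path is induced, starts at its only vertex in \<open>S\<close> and ends at its
  only vertex in \<open>T\<close>. All pivotal vertices and edges lie on it.\<close>

definition geodesic :: "'i set \<Rightarrow> 'i set \<Rightarrow> 'i set \<Rightarrow> 'i set set \<Rightarrow> 'i list \<Rightarrow> bool" where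
  "geodesic V S T E xs \<longleftrightarrow> path_between V S T E xs \<and>
     (\<forall>ys. path_between V S T E ys \<longrightarrow> length xs \<le> length ys)"

lemma geodesic_exists: "conn V S T E \<Longrightarrow> \<exists>xs. geodesic V S T E xs"
  unfolding conn_def geodesic_def using ex_has_least_nat[of "path_between V S T E" _ length] by blast

text \<open>Dropping the stretch from \<open>i\<close> up to but excluding \<open>j\<close> leaves a
  connecting path, which is shorter unless \<open>i = j\<close>. For \<open>i > 0\<close> the cut is
  closed by a chord; for \<open>i = 0\<close> the vertex \<open>xs ! j\<close> becomes the new
  start. Distinctness, absence of chords and the single visit to \<open>S\<close> are all
  instances.\<close>

lemma geodesic_splice:
  assumes "geodesic V S T E xs" "i \<le> j" "j < length xs"
    and "i > 0 \<Longrightarrow> {xs ! (i - 1), xs ! j} \<in> E" "i = 0 \<Longrightarrow> xs ! j \<in> S"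
  shows "i = j"
proof -
  let ?ys = "take i xs @ drop j xs"
  have p: "xs \<noteq> []" "set xs \<subseteq> V" "successively (\<lambda>i j. {i, j} \<in> E) xs" "hd xs \<in> S" "last xs \<in> T"
    using assms(1) by (auto simp: geodesic_def path_between_def)
  have "successively (\<lambda>i j. {i, j} \<in> E) (take i xs)" "successively (\<lambda>i j. {i, j} \<in> E) (drop j xs)"
    using p(3) by (auto simp: successively_conv_nth)
  moreover have "{last (take i xs), hd (drop j xs)} \<in> E" if "i > 0"
  proof -
    have "last (take i xs) = xs ! (i - 1)" using assms that by (subst last_conv_nth) (auto simp: min_def)
    then show ?thesis using assms that by (simp add: hd_drop_conv_nth)
  qed
  ultimately have "path_between V S T E ?ys"
    using p assms by (cases "i = 0")
      (auto simp: path_between_def successively_append_iff hd_drop_conv_nth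
        dest: in_set_takeD in_set_dropD)
  then have "length xs \<le> length ?ys" using assms by (auto simp: geodesic_def)
  then show ?thesis using assms by auto
qed

lemma geodesic_distinct: "geodesic V S T E xs \<Longrightarrow> distinct xs"
proof (rule ccontr)
  assume g: "geodesic V S T E xs" and "\<not> distinct xs"
  then obtain i j where ij: "i < length xs" "j < length xs" "i < j" "xs ! i = xs ! j"
    by (metis distinct_conv_nth nat_neq_iff)
  have p: "successively (\<lambda>i j. {i, j} \<in> E) xs" "hd xs \<in> S" "xs \<noteq> []"
    using g by (auto simp: geodesic_def path_between_def)
  have "i > 0 \<Longrightarrow> {xs ! (i - 1), xs ! i} \<in> E"
    using successively_nth[OF p(1), of "i - 1"] ij by auto
  then have "i = j" using p ij by (intro geodesic_splice[OF g]) (auto simp: hd_conv_nth)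
  then show False using ij by simp
qed

lemma geodesic_chord:
  assumes "geodesic V S T E xs" "i < j" "j < length xs" "{xs ! i, xs ! j} \<in> E"
  shows "j = Suc i"
proof -
  have "Suc i = j"
    using assms(4) by (intro geodesic_splice[OF assms(1) _ assms(3)]) (simp_all add: Suc_leI assms(2))
  then show ?thesis by simp
qed

lemma geodesic_start: "geodesic V S T E xs \<Longrightarrow> i < length xs \<Longrightarrow> xs ! i \<in> S \<Longrightarrow> i = 0"
  using geodesic_splice[of V S T E xs 0 i] by auto

lemma geodesic_end:
  assumes "geodesic V S T E xs" "i < length xs" "xs ! i \<in> T"
  shows "Suc i = length xs"
proof -
  have p: "xs \<noteq> []" "set xs \<subseteq> V" "successively (\<lambda>i j. {i, j} \<in> E) xs" "hd xs \<in> S" "last xs \<in> T"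
    using assms(1) by (auto simp: geodesic_def path_between_def)
  have "path_between V S T E (take (Suc i) xs)"
    using p assms by (auto simp: path_between_def successively_conv_nth last_conv_nth dest: in_set_takeD)
  then have "length xs \<le> length (take (Suc i) xs)" using assms by (auto simp: geodesic_def)
  then show ?thesis using assms by auto
qed

lemma geodesic_PV:
  assumes "geodesic V S T E xs" shows "PV V S T E \<subseteq> set xs"
proof
  fix v assume v: "v \<in> PV V S T E"
  show "v \<in> set xs"
  proof (rule ccontr)
    assume "v \<notin> set xs"
    then have "path_between (V - {v}) S T E xs"
      using assms by (auto simp: geodesic_def path_between_def)
    then show False using v by (auto simp: PV_def conn_def)
  qed
qed

lemma geodesic_PE:
  assumes g: "geodesic V S T E xs" and "e \<in> PE V S T E"
  shows "\<exists>i. Suc i < length xs \<and> e = {xs ! i, xs ! Suc i}"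
proof (rule ccontr)
  assume "\<not> ?thesis"
  then have "path_between V S T (E - {e}) xs"
    using g by (auto simp: geodesic_def path_between_def successively_conv_nth)
  then show False using assms by (auto simp: PE_def conn_def)
qed

text \<open>A path that avoids \<open>u\<close> traverses no edge at \<open>u\<close>, so it
  survives the deletion of any edge containing \<open>u\<close>. Hence the ends of pivotal edges are
  pivotal vertices.\<close>

lemma conn_remove_edge:
  assumes "conn (V - {u}) S T E" "u \<in> e" shows "conn V S T (E - {e})"
proof -
  obtain xs where xs: "path_between (V - {u}) S T E xs" using assms by (auto simp: conn_def)
  have "successively (\<lambda>i j. {i, j} \<in> E - {e}) xs"
    unfolding successively_conv_nth
  proof (intro allI impI)
    fix i assume i: "Suc i < length xs"
    then have "xs ! i \<noteq> u" "xs ! Suc i \<noteq> u" "{xs ! i, xs ! Suc i} \<in> E"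
      using xs nth_mem[of i xs] nth_mem[of "Suc i" xs]
      by (auto simp: path_between_def successively_conv_nth simp del: nth_mem)
    then show "{xs ! i, xs ! Suc i} \<in> E - {e}" using assms(2) by auto
  qed
  then have "path_between V S T (E - {e}) xs" using xs by (auto simp: path_between_def)
  then show ?thesis by (auto simp: conn_def)
qed

lemma PE_ends_pivotal:
  assumes "e \<in> PE V S T E" "u \<in> e" shows "u \<in> PV V S T E"
proof -
  have "conn V S T E" using assms by (auto simp: PE_def)
  then obtain xs where g: "geodesic V S T E xs" using geodesic_exists by blast
  then have "u \<in> V" using geodesic_PE[OF g assms(1)] assms(2)
    by (auto simp: geodesic_def path_between_def subset_iff)
  then show ?thesis using conn_remove_edge[of V u S T E e] assms by (auto simp: PE_def PV_def)
qed

lemma PE_ends: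
  assumes "e \<in> PE V S T E" obtains u v where "u \<noteq> v" "e = {u, v}" "u \<in> V" "v \<in> V"
proof -
  have "conn V S T E" using assms by (auto simp: PE_def)
  then obtain xs where g: "geodesic V S T E xs" using geodesic_exists by blast
  then obtain i where "Suc i < length xs" "e = {xs ! i, xs ! Suc i}" using geodesic_PE[OF g assms(1)] by auto
  with geodesic_distinct[OF g] show ?thesis
    using g by (intro that[of "xs ! i" "xs ! Suc i"])
      (auto simp: nth_eq_iff_index_eq geodesic_def path_between_def subset_iff)
qed

lemma PE_subset_AP: "PE V S T E \<subseteq> AP V S T E"
proof
  fix e assume e: "e \<in> PE V S T E"
  then obtain u v where "u \<noteq> v" "e = {u, v}" using PE_ends by metis
  then show "e \<in> AP V S T E" using PE_ends_pivotal[OF e] e by (auto simp: AP_def PE_def)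
qed

text \<open>All pivotal vertices lie on a geodesic, and a geodesic has no chords, so an edge between
  two of them joins consecutive vertices. Sending it to its later end is injective and misses the
  first pivotal vertex. The map is provided, and not only the resulting inequality, because sums
  over edges are later bounded by sums over vertices.\<close>

lemma AP_head_map:
  "\<exists>\<phi>. inj_on \<phi> (AP V S T E) \<and> (\<forall>e\<in>AP V S T E. \<phi> e \<in> e) \<and> \<phi> ` AP V S T E \<subseteq> PV V S T E \<and>
     (PV V S T E \<noteq> {} \<longrightarrow> \<phi> ` AP V S T E \<noteq> PV V S T E)"
proof (cases "PV V S T E = {}")
  case True
  then show ?thesis by (auto simp: AP_def)
next
  case False
  then have "conn V S T E" by (auto simp: PV_def)
  then obtain xs where g: "geodesic V S T E xs" using geodesic_exists by blast
  have d: "distinct xs" using geodesic_distinct[OF g] .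
  have "\<exists>i. Suc i < length xs \<and> e = {xs ! i, xs ! Suc i}" if e: "e \<in> AP V S T E" for e
  proof -
    obtain u v where uv: "u \<in> PV V S T E" "v \<in> PV V S T E" "u \<noteq> v" "e = {u, v}" "e \<in> E"
      using e by (auto simp: AP_def)
    then obtain i j where ij: "u = xs ! i" "v = xs ! j" "i < length xs" "j < length xs"
      using geodesic_PV[OF g] by (metis in_set_conv_nth subsetD)
    then have "i \<noteq> j" using uv by auto
    then consider "i < j" | "j < i" by linarith
    then show ?thesis
    proof cases
      case 1 then show ?thesis using geodesic_chord[OF g 1] uv ij by auto
    next
      case 2 then show ?thesis using geodesic_chord[OF g 2] uv ij by (auto simp: insert_commute)
    qed
  qed
  then obtain ix where ix: "\<And>e. e \<in> AP V S T E \<Longrightarrow> Suc (ix e) < length xs \<and> e = {xs ! ix e, xs ! Suc (ix e)}"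
    by metis
  define \<phi> where "\<phi> e = xs ! Suc (ix e)" for e
  have "inj_on \<phi> (AP V S T E)"
  proof (rule inj_onI)
    fix e e' assume a: "e \<in> AP V S T E" "e' \<in> AP V S T E" "\<phi> e = \<phi> e'"
    then have "ix e = ix e'" using ix[of e] ix[of e'] d by (simp add: \<phi>_def nth_eq_iff_index_eq)
    then show "e = e'" using ix[OF a(1)] ix[OF a(2)] by metis
  qed
  moreover have \<phi>e: "\<phi> e \<in> e" if "e \<in> AP V S T E" for e using ix[OF that] by (auto simp: \<phi>_def)
  moreover have sub: "e \<subseteq> PV V S T E" if "e \<in> AP V S T E" for e using that by (auto simp: AP_def)
  moreover have "\<phi> ` AP V S T E \<noteq> PV V S T E"
  proof
    assume eq: "\<phi> ` AP V S T E = PV V S T E"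
    \<comment> \<open>The first pivotal vertex on the geodesic is not hit: an edge mapped to it
      would have its other end, also pivotal, at a smaller index.\<close>
    define I where "I = {i. i < length xs \<and> xs ! i \<in> PV V S T E}"
    obtain v where "v \<in> PV V S T E" using False by blast
    then have "I \<noteq> {}" using geodesic_PV[OF g] by (auto simp: I_def in_set_conv_nth subset_iff)
    then have m: "Min I \<in> I" by (intro Min_in) (auto simp: I_def)
    then have "xs ! Min I \<in> \<phi> ` AP V S T E" using eq I_def by blast
    then obtain e where e: "e \<in> AP V S T E" "\<phi> e = xs ! Min I" by auto
    then have "Suc (ix e) = Min I" using ix[of e] d m by (simp add: \<phi>_def I_def nth_eq_iff_index_eq)
    moreover have "ix e \<in> I" using ix[OF e(1)] sub[OF e(1)] by (auto simp: I_def)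
    moreover have "finite I" by (simp add: I_def)
    ultimately show False using Min_le[of I "ix e"] by linarith
  qed
  moreover have "\<phi> ` AP V S T E \<subseteq> PV V S T E" using \<phi>e sub by blast
  ultimately show ?thesis by (intro exI[of _ \<phi>]) simp
qed

lemma finite_PV: "finite V \<Longrightarrow> finite (PV V S T E)" by (auto simp: PV_def)

lemma finite_AP: "finite V \<Longrightarrow> finite (AP V S T E)"
  by (rule finite_subset[of _ "Pow (PV V S T E)"]) (auto simp: AP_def finite_PV)

lemma finite_PE: "finite V \<Longrightarrow> finite (PE V S T E)"
  using PE_subset_AP finite_AP finite_subset by metis

lemma card_AP_less:
  assumes "finite V" "PV V S T E \<noteq> {}"
  shows "card (AP V S T E) < card (PV V S T E)"
proof -
  obtain \<phi> where "inj_on \<phi> (AP V S T E)" "\<phi> ` AP V S T E \<subseteq> PV V S T E" "\<phi> ` AP V S T E \<noteq> PV V S T E"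
    using AP_head_map[of V S T E] assms by auto
  then show ?thesis
    by (metis assms(1) card_image finite_PV psubsetI psubset_card_mono)
qed

text \<open>A geodesic meets \<open>S\<close> only at its start and \<open>T\<close> only at its
  end, and pivotal edges are among its steps, so only the first and the last step can touch a mark.
  These edges are set aside because vertices are planted only over edges with unmarked ends.\<close>

lemma card_PE_marked:
  assumes "finite V"
  shows "card {e \<in> PE V S T E. e \<inter> (S \<union> T) \<noteq> {}} \<le> 2"
proof (cases "PE V S T E = {}")
  case False
  then have "conn V S T E" by (auto simp: PE_def)
  then obtain xs where g: "geodesic V S T E xs" using geodesic_exists by blast
  let ?l = "length xs"
  have "{e \<in> PE V S T E. e \<inter> (S \<union> T) \<noteq> {}} \<subseteq> {{xs ! 0, xs ! 1}, {xs ! (?l - 2), xs ! (?l - 1)}}"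
  proof
    fix e assume e: "e \<in> {e \<in> PE V S T E. e \<inter> (S \<union> T) \<noteq> {}}"
    then obtain i where i: "Suc i < ?l" "e = {xs ! i, xs ! Suc i}" using geodesic_PE[OF g] by auto
    have "xs ! Suc i \<notin> S" "xs ! i \<notin> T" using geodesic_start[OF g, of "Suc i"] geodesic_end[OF g, of i] i by auto
    then have "xs ! i \<in> S \<or> xs ! Suc i \<in> T" using e i by auto
    then have "i = 0 \<or> Suc (Suc i) = ?l" using geodesic_start[OF g, of i] geodesic_end[OF g, of "Suc i"] i by auto
    moreover have "Suc (Suc i) = ?l \<Longrightarrow> i = ?l - 2 \<and> Suc i = ?l - 1" by linarith
    ultimately show "e \<in> {{xs ! 0, xs ! 1}, {xs ! (?l - 2), xs ! (?l - 1)}}" using i by auto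
  qed
  from card_mono[OF _ this] show ?thesis
    using card_insert_le_m1[of 2 "{{xs ! (?l - 2), xs ! (?l - 1)}}"] by (auto simp: card_insert_if split: if_splits)
qed simp

text \<open>Every passage along \<open>{u, v}\<close> is replaced by the two steps through
  \<open>w\<close>.\<close>

lemma conn_bypass:
  assumes "conn V S T E" "w \<in> V" "u \<in> V" "v \<in> V" "w \<noteq> u" "w \<noteq> v" "{w, u} \<in> E" "{w, v} \<in> E"
  shows "conn V S T (E - {{u, v}})"
proof -
  have "(step_in V (E - {{u, v}}))\<^sup>*\<^sup>* i j" if "step_in V E i j" for i j
  proof (cases "{i, j} = {u, v}")
    case True
    then have "(i = u \<and> j = v) \<or> (i = v \<and> j = u)" by (auto simp: doubleton_eq_iff)
    then have "step_in V (E - {{u, v}}) i w" "step_in V (E - {{u, v}}) w j"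
      using assms by (auto simp: step_in_def insert_commute doubleton_eq_iff)
    then show ?thesis by auto
  next
    case False
    then have "step_in V (E - {{u, v}}) i j" using that by (auto simp: step_in_def)
    then show ?thesis by blast
  qed
  then have "step_in V E \<le> (step_in V (E - {{u, v}}))\<^sup>*\<^sup>*" by blast
  from rtranclp_mono[OF this] have "(step_in V E)\<^sup>*\<^sup>* \<le> (step_in V (E - {{u, v}}))\<^sup>*\<^sup>*" by simp
  with assms(1) show ?thesis unfolding conn_iff_rtranclp by blast
qed

text \<open>A geodesic avoiding \<open>u\<close> cannot pass through \<open>w\<close>: both
  neighbours of \<open>w\<close> on it would be \<open>v\<close>, against distinctness. It therefore
  lies in \<open>V - {w}\<close>, where it would connect without the pivotal edge
  \<open>{u, v}\<close>.\<close>

lemma detour_end_pivotal: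
  assumes "w \<notin> S" "w \<notin> T" "{i \<in> V. {w, i} \<in> E} = {u, v}" "{u, v} \<in> PE (V - {w}) S T E"
  shows "u \<in> PV V S T E"
proof -
  have c: "conn (V - {w}) S T E" using assms by (auto simp: PE_def)
  have "\<not> conn (V - {u}) S T E"
  proof
    assume "conn (V - {u}) S T E"
    then obtain xs where g: "geodesic (V - {u}) S T E xs" using geodesic_exists by blast
    have p: "xs \<noteq> []" "set xs \<subseteq> V - {u}" "successively (\<lambda>i j. {i, j} \<in> E) xs" "hd xs \<in> S" "last xs \<in> T"
      using g by (auto simp: geodesic_def path_between_def)
    have "w \<notin> set xs"
    proof
      assume "w \<in> set xs"
      then obtain i where i: "i < length xs" "xs ! i = w" by (auto simp: in_set_conv_nth)
      have "i \<noteq> 0" using i p assms by (metis hd_conv_nth)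
      moreover have "Suc i \<noteq> length xs" using i p assms by (metis diff_Suc_1 last_conv_nth)
      ultimately obtain k where k: "i = Suc k" "Suc i < length xs" using i by (metis Suc_lessI not0_implies_Suc)
      have "{xs ! k, w} \<in> E" "{w, xs ! Suc i} \<in> E"
        using successively_nth[OF p(3), of k] successively_nth[OF p(3), of i] i k by auto
      moreover have V: "xs ! k \<in> V - {u}" "xs ! Suc i \<in> V - {u}"
        using p(2) k by (auto simp: subset_iff)
      ultimately have "xs ! k \<in> {u, v}" "xs ! Suc i \<in> {u, v}"
        unfolding assms(3)[symmetric] by (auto simp: insert_commute)
      then have "xs ! k = xs ! Suc i" using V by auto
      then show False using geodesic_distinct[OF g] k i by (simp add: nth_eq_iff_index_eq)
    qed
    then have "path_between (V - {w} - {u}) S T E xs" using p by (auto simp: path_between_def)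
    then have "conn (V - {w} - {u}) S T E" by (auto simp: conn_def)
    from conn_remove_edge[OF this, of "{u, v}"] show False using assms by (auto simp: PE_def)
  qed
  moreover have "u \<in> V" using assms by auto
  ultimately show ?thesis using conn_mono[OF c, of V E] by (auto simp: PV_def)
qed

lemma detour_edge:
  assumes "w \<in> detour V S T E"
  shows "{i \<in> V. {w, i} \<in> E} \<in> AP V S T E - PE V S T E"
proof -
  obtain u v where uv: "w \<in> V" "w \<notin> S" "w \<notin> T" "u \<noteq> v" "{i \<in> V. {w, i} \<in> E} = {u, v}" "{u, v} \<in> PE (V - {w}) S T E"
    using assms by (auto simp: detour_def)
  have ne: "u \<in> V - {w}" "v \<in> V - {w}" using PE_ends_pivotal[OF uv(6)] by (auto simp: PV_def)
  have E: "{w, u} \<in> E" "{w, v} \<in> E" using uv(5) by auto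
  have c: "conn V S T E" using uv(6) conn_mono[of "V - {w}" S T E V E] by (auto simp: PE_def)
  have "conn V S T (E - {{u, v}})" using ne E uv by (intro conn_bypass[OF c]) auto
  moreover have "u \<in> PV V S T E" "v \<in> PV V S T E"
    using detour_end_pivotal[OF uv(2,3), of V E u v] detour_end_pivotal[OF uv(2,3), of V E v u] uv
    by (auto simp: insert_commute)
  ultimately show ?thesis using uv by (auto simp: PE_def AP_def)
qed

text \<open>Two detour vertices over the same edge exclude each other: with \<open>w\<close>
  deleted, \<open>w'\<close> still bypasses the edge, which then cannot be pivotal in
  \<open>V - {w}\<close>. Thus every detour vertex accounts for an edge of \<open>AP - PE\<close> of
  its own.\<close>

lemma detour_inj: "inj_on (\<lambda>w. {i \<in> V. {w, i} \<in> E}) (detour V S T E)"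
proof (rule inj_onI, rule ccontr)
  fix w w' assume w: "w \<in> detour V S T E" and w': "w' \<in> detour V S T E"
    and eq: "{i \<in> V. {w, i} \<in> E} = {i \<in> V. {w', i} \<in> E}" and "w \<noteq> w'"
  obtain u v where uv: "w \<in> V" "u \<noteq> v" "{i \<in> V. {w, i} \<in> E} = {u, v}" "{u, v} \<in> PE (V - {w}) S T E"
    using w by (auto simp: detour_def)
  obtain u' v' where uv': "w' \<in> V" "{i \<in> V. {w', i} \<in> E} = {u', v'}" "{u', v'} \<in> PE (V - {w'}) S T E"
    using w' by (auto simp: detour_def)
  have eq': "{u', v'} = {u, v}" using eq uv uv' by simp
  have ne: "u \<in> V - {w}" "v \<in> V - {w}" using PE_ends_pivotal[OF uv(4)] by (auto simp: PV_def)
  have ne': "u \<in> V - {w'}" "v \<in> V - {w'}" using PE_ends_pivotal[OF uv'(3)] unfolding eq' by (auto simp: PV_def)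
  have "conn (V - {w}) S T (E - {{u, v}})"
    using uv ne ne' uv' eq \<open>w \<noteq> w'\<close> by (intro conn_bypass[of _ S T E w']) (auto simp: PE_def)
  then show False using uv by (auto simp: PE_def)
qed

lemma card_detour_le:
  assumes "finite V" shows "card (detour V S T E) \<le> card (AP V S T E - PE V S T E)"
proof (rule card_inj_on_le[OF detour_inj])
  show "(\<lambda>w. {i \<in> V. {w, i} \<in> E}) ` detour V S T E \<subseteq> AP V S T E - PE V S T E"
    using detour_edge by (intro image_subsetI)
qed (simp add: finite_AP assms)

definition pairs :: "'i set \<Rightarrow> 'i set set" where
  "pairs V = {e. \<exists>i\<in>V. \<exists>j\<in>V. i \<noteq> j \<and> e = {i, j}}"

lemma pairs_subset_Pow: "pairs V \<subseteq> Pow V" by (auto simp: pairs_def)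

lemma finite_pairs[simp]: "finite V \<Longrightarrow> finite (pairs V)"
  by (rule finite_subset[OF pairs_subset_Pow]) simp

lemma pairs_mono: "V \<subseteq> W \<Longrightarrow> pairs V \<subseteq> pairs W" by (auto simp: pairs_def)

lemma in_pairs[simp]: "{i, j} \<in> pairs V \<longleftrightarrow> i \<in> V \<and> j \<in> V \<and> i \<noteq> j"
proof
  assume "{i, j} \<in> pairs V"
  then obtain a b where "a \<in> V" "b \<in> V" "a \<noteq> b" "{i, j} = {a, b}" unfolding pairs_def by blast
  then show "i \<in> V \<and> j \<in> V \<and> i \<noteq> j" by (auto simp: doubleton_eq_iff)
next
  assume "i \<in> V \<and> j \<in> V \<and> i \<noteq> j"
  then show "{i, j} \<in> pairs V" unfolding pairs_def by blast
qed

lemma pairs_image: "inj_on \<beta> W \<Longrightarrow> pairs (\<beta> ` W) = (`) \<beta> ` pairs W"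
proof (intro equalityI subsetI)
  fix e assume "e \<in> pairs (\<beta> ` W)"
  then obtain i j where ij: "i \<in> W" "j \<in> W" "\<beta> i \<noteq> \<beta> j" "e = {\<beta> i, \<beta> j}" by (auto simp: pairs_def)
  then have p: "{i, j} \<in> pairs W" by auto
  have "e = \<beta> ` {i, j}" using ij(4) by simp
  then show "e \<in> (`) \<beta> ` pairs W" using imageI[OF p, of "(`) \<beta>"] by simp
next
  fix e assume "inj_on \<beta> W" "e \<in> (`) \<beta> ` pairs W"
  then obtain i j where ij: "i \<in> W" "j \<in> W" "i \<noteq> j" "e = {\<beta> i, \<beta> j}"
    by (auto simp: pairs_def)
  then have "\<beta> i \<noteq> \<beta> j" using \<open>inj_on \<beta> W\<close> by (simp add: inj_on_eq_iff)
  then show "e \<in> pairs (\<beta> ` W)" using ij by simp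
qed

lemma edge_image_iff:
  assumes "inj_on \<beta> W" "E \<subseteq> pairs W" "i \<in> W" "j \<in> W"
  shows "{\<beta> i, \<beta> j} \<in> (`) \<beta> ` E \<longleftrightarrow> {i, j} \<in> E"
proof
  assume "{\<beta> i, \<beta> j} \<in> (`) \<beta> ` E"
  then obtain e where e: "e \<in> E" "\<beta> ` {i, j} = \<beta> ` e" by auto
  moreover have "e \<subseteq> W" using e assms pairs_subset_Pow by blast
  ultimately show "{i, j} \<in> E" using inj_on_image_eq_iff[OF assms(1), of "{i, j}" e] assms by auto
qed (metis image_empty image_eqI image_insert)

lemma conn_relabel:
  assumes \<beta>: "inj_on \<beta> W" "E \<subseteq> pairs W" "V \<subseteq> W"
  shows "conn (\<beta> ` V) S T ((`) \<beta> ` E) \<longleftrightarrow> conn V (\<beta> -` S) (\<beta> -` T) E"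
proof -
  have *: "path_between (\<beta> ` V) S T ((`) \<beta> ` E) (map \<beta> xs) \<longleftrightarrow> path_between V (\<beta> -` S) (\<beta> -` T) E xs"
    if "set xs \<subseteq> V" for xs
  proof -
    have "successively (\<lambda>i j. {\<beta> i, \<beta> j} \<in> (`) \<beta> ` E) xs \<longleftrightarrow> successively (\<lambda>i j. {i, j} \<in> E) xs"
      using that edge_image_iff[OF \<beta>(1,2)] \<beta>(3) unfolding successively_conv_nth
      by (metis Suc_lessD nth_mem subset_iff)
    then show ?thesis using that
      by (auto simp: path_between_def successively_map hd_map last_map)
  qed
  show ?thesis
  proof
    assume "conn (\<beta> ` V) S T ((`) \<beta> ` E)"
    then obtain ys where ys: "path_between (\<beta> ` V) S T ((`) \<beta> ` E) ys" by (auto simp: conn_def)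
    then have "set ys \<subseteq> \<beta> ` V" by (auto simp: path_between_def)
    then have "ys \<in> map \<beta> ` lists V" by (simp add: lists_image[symmetric] in_lists_conv_set subset_iff)
    then obtain xs where "ys = map \<beta> xs" "set xs \<subseteq> V" by auto
    with ys *[of xs] show "conn V (\<beta> -` S) (\<beta> -` T) E" by (auto simp: conn_def)
  next
    assume "conn V (\<beta> -` S) (\<beta> -` T) E"
    then show "conn (\<beta> ` V) S T ((`) \<beta> ` E)" using * unfolding conn_def
      by (metis path_between_def)
  qed
qed

section \<open>Random graphs on independent points\<close>

text \<open>The expectation of \<open>Y\<close> over a random subset of \<open>Q\<close> that
  contains each \<open>e\<close> independently with probability \<open>w e\<close>. As a finite sum
  it is a polynomial in the weights, so that Russo's formula becomes an induction on
  \<open>Q\<close>.\<close>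

definition bsum :: "'e set \<Rightarrow> ('e \<Rightarrow> real) \<Rightarrow> ('e set \<Rightarrow> real) \<Rightarrow> real" where
  "bsum Q w Y = (\<Sum>E\<in>Pow Q. (\<Prod>e\<in>E. w e) * (\<Prod>e\<in>Q - E. 1 - w e) * Y E)"

lemma bsum_empty[simp]: "bsum {} w Y = Y {}" by (simp add: bsum_def)

lemma bsum_insert:
  assumes "finite Q" "a \<notin> Q"
  shows "bsum (insert a Q) w Y = w a * bsum Q w (\<lambda>E. Y (insert a E)) + (1 - w a) * bsum Q w Y"
proof -
  have inj: "inj_on (insert a) (Pow Q)" using assms(2) by (auto simp: inj_on_def)
  have fin: "finite E" if "E \<in> Pow Q" for E using that assms(1) finite_subset by auto
  have 1: "(\<Prod>e\<in>insert a E. w e) * (\<Prod>e\<in>insert a Q - insert a E. 1 - w e) * Y (insert a E) =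
    w a * ((\<Prod>e\<in>E. w e) * (\<Prod>e\<in>Q - E. 1 - w e) * Y (insert a E))" if E: "E \<in> Pow Q" for E
  proof -
    have "insert a Q - insert a E = Q - E" "a \<notin> E" using E assms by auto
    then show ?thesis using fin[OF E] by (simp add: mult.assoc)
  qed
  have 2: "(\<Prod>e\<in>E. w e) * (\<Prod>e\<in>insert a Q - E. 1 - w e) * Y E =
    (1 - w a) * ((\<Prod>e\<in>E. w e) * (\<Prod>e\<in>Q - E. 1 - w e) * Y E)" if E: "E \<in> Pow Q" for E
  proof -
    have "insert a Q - E = insert a (Q - E)" "a \<notin> Q - E" "finite (Q - E)" using E assms by auto
    then show ?thesis by simp
  qed
  have "bsum (insert a Q) w Y = (\<Sum>E\<in>Pow Q \<union> insert a ` Pow Q. (\<Prod>e\<in>E. w e) * (\<Prod>e\<in>insert a Q - E. 1 - w e) * Y E)"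
    by (simp add: bsum_def Pow_insert)
  also have "\<dots> = (\<Sum>E\<in>Pow Q. (\<Prod>e\<in>E. w e) * (\<Prod>e\<in>insert a Q - E. 1 - w e) * Y E)
     + (\<Sum>E\<in>insert a ` Pow Q. (\<Prod>e\<in>E. w e) * (\<Prod>e\<in>insert a Q - E. 1 - w e) * Y E)"
    using assms by (intro sum.union_disjoint) auto
  also have "(\<Sum>E\<in>insert a ` Pow Q. (\<Prod>e\<in>E. w e) * (\<Prod>e\<in>insert a Q - E. 1 - w e) * Y E) =
    (\<Sum>E\<in>Pow Q. w a * ((\<Prod>e\<in>E. w e) * (\<Prod>e\<in>Q - E. 1 - w e) * Y (insert a E)))"
    unfolding sum.reindex[OF inj] comp_def by (intro sum.cong refl 1)
  also have "(\<Sum>E\<in>Pow Q. (\<Prod>e\<in>E. w e) * (\<Prod>e\<in>insert a Q - E. 1 - w e) * Y E) =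
    (\<Sum>E\<in>Pow Q. (1 - w a) * ((\<Prod>e\<in>E. w e) * (\<Prod>e\<in>Q - E. 1 - w e) * Y E))"
    by (intro sum.cong refl 2)
  finally show ?thesis unfolding bsum_def by (simp only: sum_distrib_left add.commute)
qed

lemma bsum_cong:
  assumes "\<And>e. e \<in> Q \<Longrightarrow> w e = w' e" "\<And>E. E \<subseteq> Q \<Longrightarrow> Y E = Y' E"
  shows "bsum Q w Y = bsum Q w' Y'"
  unfolding bsum_def using assms by (intro sum.cong arg_cong2[where f="(*)"] prod.cong) auto

lemma bsum_mono:
  assumes "\<And>e. e \<in> Q \<Longrightarrow> 0 \<le> w e \<and> w e \<le> 1" "\<And>E. E \<subseteq> Q \<Longrightarrow> Y E \<le> Y' E"
  shows "bsum Q w Y \<le> bsum Q w Y'"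
  unfolding bsum_def using assms
  by (intro sum_mono mult_left_mono mult_nonneg_nonneg prod_nonneg) (auto simp: subset_iff)

lemma bsum_add: "bsum Q w (\<lambda>E. Y E + Y' E) = bsum Q w Y + bsum Q w Y'"
  by (simp add: bsum_def algebra_simps sum.distrib)

lemma bsum_diff: "bsum Q w (\<lambda>E. Y E - Y' E) = bsum Q w Y - bsum Q w Y'"
  by (simp add: bsum_def algebra_simps sum_subtractf)

lemma bsum_cmult: "bsum Q w (\<lambda>E. c * Y E) = c * bsum Q w Y"
  by (simp add: bsum_def sum_distrib_left algebra_simps)

lemma bsum_sum: "bsum Q w (\<lambda>E. \<Sum>i\<in>I. Y i E) = (\<Sum>i\<in>I. bsum Q w (Y i))"
  unfolding bsum_def by (subst sum.swap) (simp add: sum_distrib_left)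

lemma bsum_const: "finite Q \<Longrightarrow> bsum Q w (\<lambda>E. c) = c"
proof (induction Q rule: finite_induct)
  case (insert a Q)
  then show ?case by (simp add: bsum_insert algebra_simps)
qed simp

lemma bsum_nonneg:
  assumes "\<And>e. e \<in> Q \<Longrightarrow> 0 \<le> w e \<and> w e \<le> 1" "\<And>E. E \<subseteq> Q \<Longrightarrow> 0 \<le> Y E"
  shows "0 \<le> bsum Q w Y"
  unfolding bsum_def using assms
  by (intro sum_nonneg mult_nonneg_nonneg prod_nonneg) (auto simp: subset_iff)

text \<open>Pairing each set without \<open>a\<close> with the same set plus \<open>a\<close> trades
  the weight \<open>1 - w a\<close> for \<open>w a\<close>. This is the cost of opening one absent
  edge.\<close>

lemma bsum_flip:
  assumes "finite Q" "a \<in> Q"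
  shows "w a * bsum Q w (\<lambda>E. if a \<notin> E then Y E else 0) =
    (1 - w a) * bsum Q w (\<lambda>E. if a \<in> E then Y (E - {a}) else 0)"
proof -
  define R where "R = Q - {a}"
  have Q: "Q = insert a R" "a \<notin> R" "finite R" using assms by (auto simp: R_def)
  have "bsum R w (\<lambda>E. if a \<in> insert a E then Y (insert a E - {a}) else 0) = bsum R w Y"
    "bsum R w (\<lambda>E. if a \<notin> E then Y E else 0) = bsum R w Y"
    using Q(2) by (auto intro!: bsum_cong simp: subset_iff insert_Diff_if) (metis Diff_empty Diff_insert0 subsetD)
  moreover have "bsum R w (\<lambda>E. if a \<in> E then Y (E - {a}) else 0) = bsum R w (\<lambda>E. 0)"
    using Q(2) by (intro bsum_cong) auto
  ultimately show ?thesis using Q(3)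
    unfolding Q(1) bsum_insert[OF Q(3,2)] by (simp add: bsum_const)
qed

text \<open>Disjoint families of edges are independent, so one of them can be averaged
  first.\<close>

lemma bsum_Un:
  assumes "finite R" "finite Q" "Q \<inter> R = {}"
  shows "bsum (Q \<union> R) w Y = bsum Q w (\<lambda>E. bsum R w (\<lambda>E'. Y (E \<union> E')))"
  using assms
proof (induction R arbitrary: Y rule: finite_induct)
  case (insert a R)
  have "bsum (Q \<union> insert a R) w Y = bsum (insert a (Q \<union> R)) w Y" by simp
  also have "\<dots> = w a * bsum (Q \<union> R) w (\<lambda>E. Y (insert a E)) + (1 - w a) * bsum (Q \<union> R) w Y"
    using insert by (intro bsum_insert) auto
  also have "\<dots> = bsum Q w (\<lambda>E. w a * bsum R w (\<lambda>E'. Y (insert a (E \<union> E'))) + (1 - w a) * bsum R w (\<lambda>E'. Y (E \<union> E')))"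
    using insert by (simp add: bsum_add bsum_cmult)
  also have "\<dots> = bsum Q w (\<lambda>E. bsum (insert a R) w (\<lambda>E'. Y (E \<union> E')))"
    using insert by (simp add: bsum_insert)
  finally show ?case .
qed simp

lemma bsum_image:
  assumes "finite Q" "inj_on \<gamma> Q"
  shows "bsum (\<gamma> ` Q) w Y = bsum Q (\<lambda>e. w (\<gamma> e)) (\<lambda>E. Y (\<gamma> ` E))"
  using assms
proof (induction Q arbitrary: Y rule: finite_induct)
  case (insert a Q)
  then have "\<gamma> a \<notin> \<gamma> ` Q" "inj_on \<gamma> Q" by (auto simp: inj_on_def)
  with insert show ?case by (simp add: bsum_insert)
qed simp

text \<open>Russo's formula. Only edges present in \<open>E\<close> are summed: the presence of
  \<open>e\<close> contributes the factor \<open>s * f e\<close>, and the division by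
  \<open>s\<close> leaves the derivative \<open>f e\<close> of the edge probability.\<close>

lemma bsum_has_derivative:
  assumes "finite Q" "s \<noteq> 0"
  shows "((\<lambda>s. bsum Q (\<lambda>e. s * f e) Y) has_real_derivative
     bsum Q (\<lambda>e. s * f e) (\<lambda>E. \<Sum>e\<in>E. Y E - Y (E - {e})) / s) (at s)"
  using assms
proof (induction Q arbitrary: Y rule: finite_induct)
  case (insert a Q)
  let ?d = "\<lambda>Y E. \<Sum>e\<in>E. Y E - Y (E - {e})"
  let ?Z = "\<lambda>E. Y (insert a E)"
  have d: "?d Y (insert a E) = (?Z E - Y E) + ?d ?Z E" if "E \<subseteq> Q" for E
  proof -
    have E: "finite E" "a \<notin> E" using that insert finite_subset by auto
    have "?d Y (insert a E) = (?Z E - Y (insert a E - {a})) + (\<Sum>e\<in>E. ?Z E - Y (insert a E - {e}))"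
      using E by simp
    also have "insert a E - {a} = E" using E by auto
    also have "(\<Sum>e\<in>E. ?Z E - Y (insert a E - {e})) = ?d ?Z E"
      using E by (intro sum.cong refl) (metis insert_Diff_if singletonD)
    finally show ?thesis by simp
  qed
  have A: "((\<lambda>s. s * f a * bsum Q (\<lambda>e. s * f e) ?Z + (1 - s * f a) * bsum Q (\<lambda>e. s * f e) Y) has_real_derivative
    (f a * bsum Q (\<lambda>e. s * f e) ?Z + s * f a * (bsum Q (\<lambda>e. s * f e) (?d ?Z) / s)
     - f a * bsum Q (\<lambda>e. s * f e) Y + (1 - s * f a) * (bsum Q (\<lambda>e. s * f e) (?d Y) / s))) (at s)"
    using insert.prems
    by (auto intro!: derivative_eq_intros insert.IH simp: algebra_simps diff_divide_distrib)
  have B: "bsum (insert a Q) (\<lambda>e. s * f e) (?d Y) = s * f a * (bsum Q (\<lambda>e. s * f e) ?Z - bsum Q (\<lambda>e. s * f e) Y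
     + bsum Q (\<lambda>e. s * f e) (?d ?Z)) + (1 - s * f a) * bsum Q (\<lambda>e. s * f e) (?d Y)"
  proof -
    have "bsum Q (\<lambda>e. s * f e) (\<lambda>E. ?d Y (insert a E)) = bsum Q (\<lambda>e. s * f e) (\<lambda>E. (?Z E - Y E) + ?d ?Z E)"
      by (intro bsum_cong refl d)
    then show ?thesis using insert by (simp add: bsum_insert bsum_add bsum_diff)
  qed
  have C: "bsum (insert a Q) (\<lambda>e. s * f e) Y = s * f a * bsum Q (\<lambda>e. s * f e) ?Z + (1 - s * f a) * bsum Q (\<lambda>e. s * f e) Y" for s
    using insert by (simp add: bsum_insert)
  show ?case unfolding C B
    using insert.prems by (intro DERIV_cong[OF A]) (simp add: field_simps)
qed simp

text \<open>Edges are unordered while a kernel takes ordered arguments; the description is well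
  defined as soon as the kernel is symmetric.\<close>

definition wt :: "('a \<Rightarrow> 'a \<Rightarrow> real) \<Rightarrow> ('i \<Rightarrow> 'a) \<Rightarrow> 'i set \<Rightarrow> real" where
  "wt w x e = (THE r. \<exists>i j. e = {i, j} \<and> r = w (x i) (x j))"

text \<open>Positions are independent with laws \<open>D i\<close>, and given the positions the
  edges on \<open>V\<close> are independent. Values in \<open>ennreal\<close> allow sums and
  integrals to be exchanged on the strength of measurability alone.\<close>

definition ex :: "'i set \<Rightarrow> ('i \<Rightarrow> 'a measure) \<Rightarrow> ('a \<Rightarrow> 'a \<Rightarrow> real) \<Rightarrow> (('i \<Rightarrow> 'a) \<Rightarrow> 'i set set \<Rightarrow> real) \<Rightarrow> ennreal" where
  "ex V D w Y = (\<integral>\<^sup>+x. ennreal (bsum (pairs V) (wt w x) (Y x)) \<partial>PiM V D)"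

definition pex :: "real \<Rightarrow> 'a measure \<Rightarrow> ('a \<Rightarrow> 'a \<Rightarrow> real) \<Rightarrow> (nat \<Rightarrow> (nat \<Rightarrow> 'a) \<Rightarrow> nat set set \<Rightarrow> real) \<Rightarrow> ennreal" where
  "pex m D w Y = (\<integral>\<^sup>+n. ex {..<n} (\<lambda>_. D) w (Y n) \<partial>measure_pmf (poisson_pmf m))"

definition adm :: "'i set \<Rightarrow> (('i \<Rightarrow> 'a::topological_space) \<Rightarrow> 'i set set \<Rightarrow> real) \<Rightarrow> bool" where
  "adm V Y \<longleftrightarrow> (\<forall>E\<subseteq>pairs V. (\<lambda>x. Y x E) \<in> borel_measurable (PiM V (\<lambda>_. borel)) \<and> (\<forall>x. 0 \<le> Y x E))"

lemma measurable_PiM_borel_cong: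
  assumes "\<And>i. i \<in> V \<Longrightarrow> sets (D i) = sets borel"
  shows "borel_measurable (PiM V D) = borel_measurable (PiM V (\<lambda>_. borel))"
  using assms by (intro measurable_cong_sets sets_PiM_cong) auto

locale kernel =
  fixes w :: "'a::second_countable_topology \<Rightarrow> 'a \<Rightarrow> real"
  assumes w_sym: "w a b = w b a" and w_nonneg: "0 \<le> w a b" and w_le1: "w a b \<le> 1"
    and w_measurable[measurable]: "(\<lambda>p. w (fst p) (snd p)) \<in> borel_measurable (borel \<Otimes>\<^sub>M borel)"
begin

lemma wt_pair[simp]: "wt w x {i, j} = w (x i) (x j)"
  unfolding wt_def by (rule the_equality) (auto simp: doubleton_eq_iff w_sym)

lemma wt_cong: "e \<in> pairs V \<Longrightarrow> (\<And>i. i \<in> V \<Longrightarrow> x i = y i) \<Longrightarrow> wt w x e = wt w y e"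
  unfolding pairs_def by auto

lemma wt_range: "e \<in> pairs V \<Longrightarrow> 0 \<le> wt w x e \<and> wt w x e \<le> 1"
  unfolding pairs_def by (auto simp: w_nonneg w_le1)

lemma wt_measurable:
  assumes "e \<in> pairs V" shows "(\<lambda>x. wt w x e) \<in> borel_measurable (PiM V (\<lambda>_. borel))"
proof -
  obtain i j where ij: "i \<in> V" "j \<in> V" "e = {i, j}" using assms unfolding pairs_def by auto
  have "(\<lambda>x. w (fst (x i, x j)) (snd (x i, x j))) \<in> borel_measurable (PiM V (\<lambda>_. borel))"
    using ij by (intro measurable_compose[OF _ w_measurable] measurable_Pair measurable_component_singleton)
  then show ?thesis using ij by simp
qed

lemma bsum_wt_measurable:
  assumes "adm V Y" "finite V"
  shows "(\<lambda>x. bsum (pairs V) (wt w x) (Y x)) \<in> borel_measurable (PiM V (\<lambda>_. borel))"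
  unfolding bsum_def
proof (intro borel_measurable_sum borel_measurable_times borel_measurable_prod borel_measurable_diff borel_measurable_const)
  fix E assume E: "E \<in> Pow (pairs V)"
  then show "(\<lambda>x. Y x E) \<in> borel_measurable (PiM V (\<lambda>_. borel))" using assms by (auto simp: adm_def)
  { fix e assume "e \<in> E"
    then show "(\<lambda>x. wt w x e) \<in> borel_measurable (PiM V (\<lambda>_. borel))" using E by (intro wt_measurable) auto }
  { fix e assume "e \<in> pairs V - E"
    then show "(\<lambda>x. wt w x e) \<in> borel_measurable (PiM V (\<lambda>_. borel))" by (intro wt_measurable) auto }
qed

lemma bsum_wt_measurable':
  assumes "adm V Y" "finite V" "\<And>i. i \<in> V \<Longrightarrow> sets (D i) = sets borel"
  shows "(\<lambda>x. ennreal (bsum (pairs V) (wt w x) (Y x))) \<in> borel_measurable (PiM V D)"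
proof -
  have "(\<lambda>x. bsum (pairs V) (wt w x) (Y x)) \<in> borel_measurable (PiM V D)"
    using bsum_wt_measurable[OF assms(1,2)] measurable_PiM_borel_cong[of V D] assms(3) by blast
  then show ?thesis by (rule measurable_compose[OF _ measurable_ennreal])
qed

lemma bsum_wt_nonneg: "adm V Y \<Longrightarrow> 0 \<le> bsum (pairs V) (wt w x) (Y x)"
  by (intro bsum_nonneg wt_range) (auto simp: adm_def)

lemma ex_mono:
  assumes "\<And>x E. x \<in> space (PiM V D) \<Longrightarrow> E \<subseteq> pairs V \<Longrightarrow> Y x E \<le> Y' x E"
  shows "ex V D w Y \<le> ex V D w Y'"
  unfolding ex_def using assms by (intro nn_integral_mono ennreal_leI bsum_mono wt_range) auto

lemma ex_cong:
  assumes "\<And>x E. x \<in> space (PiM V D) \<Longrightarrow> E \<subseteq> pairs V \<Longrightarrow> Y x E = Y' x E"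
  shows "ex V D w Y = ex V D w Y'"
  using assms by (intro antisym ex_mono) auto

lemma ex_sum:
  assumes "finite V" "finite I" "\<And>i. i \<in> I \<Longrightarrow> adm V (Y i)" "\<And>i. i \<in> V \<Longrightarrow> sets (D i) = sets borel"
  shows "ex V D w (\<lambda>x E. \<Sum>i\<in>I. Y i x E) = (\<Sum>i\<in>I. ex V D w (Y i))"
proof -
  have "ex V D w (\<lambda>x E. \<Sum>i\<in>I. Y i x E) = (\<integral>\<^sup>+x. (\<Sum>i\<in>I. ennreal (bsum (pairs V) (wt w x) (Y i x))) \<partial>PiM V D)"
    unfolding ex_def bsum_sum using assms by (intro nn_integral_cong sum_ennreal[symmetric] bsum_wt_nonneg) auto
  also have "\<dots> = (\<Sum>i\<in>I. ex V D w (Y i))"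
    unfolding ex_def using assms
    by (intro nn_integral_sum bsum_wt_measurable') auto
  finally show ?thesis .
qed

lemma ex_add:
  assumes "finite V" "adm V Y" "adm V Y'" "\<And>i. i \<in> V \<Longrightarrow> sets (D i) = sets borel"
  shows "ex V D w (\<lambda>x E. Y x E + Y' x E) = ex V D w Y + ex V D w Y'"
proof -
  have "ex V D w (\<lambda>x E. Y x E + Y' x E) = (\<integral>\<^sup>+x. ennreal (bsum (pairs V) (wt w x) (Y x)) + ennreal (bsum (pairs V) (wt w x) (Y' x)) \<partial>PiM V D)"
    unfolding ex_def bsum_add using assms by (intro nn_integral_cong ennreal_plus bsum_wt_nonneg)
  also have "\<dots> = ex V D w Y + ex V D w Y'"
    unfolding ex_def using assms
    by (intro nn_integral_add bsum_wt_measurable')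
  finally show ?thesis .
qed

lemma ex_cmult:
  assumes "finite V" "adm V Y" "0 \<le> c" "\<And>i. i \<in> V \<Longrightarrow> sets (D i) = sets borel"
  shows "ex V D w (\<lambda>x E. c * Y x E) = ennreal c * ex V D w Y"
proof -
  have "ex V D w (\<lambda>x E. c * Y x E) = (\<integral>\<^sup>+x. ennreal c * ennreal (bsum (pairs V) (wt w x) (Y x)) \<partial>PiM V D)"
    unfolding ex_def bsum_cmult using assms by (intro nn_integral_cong ennreal_mult bsum_wt_nonneg)
  also have "\<dots> = ennreal c * ex V D w Y"
    unfolding ex_def using assms
    by (intro nn_integral_cmult bsum_wt_measurable')
  finally show ?thesis .
qed

lemma ex_le:
  assumes "\<And>x E. E \<subseteq> pairs V \<Longrightarrow> Y x E \<le> c" "finite V" "\<And>i. i \<in> V \<Longrightarrow> prob_space (D i)"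
  shows "ex V D w Y \<le> ennreal c"
proof -
  interpret prob_space "PiM V D" using assms by (intro prob_space_PiM) auto
  have "ex V D w Y \<le> (\<integral>\<^sup>+x. ennreal c \<partial>PiM V D)"
    unfolding ex_def
  proof (intro nn_integral_mono ennreal_leI)
    fix x
    have "bsum (pairs V) (wt w x) (Y x) \<le> bsum (pairs V) (wt w x) (\<lambda>_. c)"
      using assms by (intro bsum_mono wt_range) auto
    then show "bsum (pairs V) (wt w x) (Y x) \<le> c" using assms by (simp add: bsum_const)
  qed
  then show ?thesis by (simp add: emeasure_space_1)
qed

text \<open>The source of exchangeability in the Mecke formula, and of the passage from numbered
  points to points labelled by a cell and an index.\<close>

lemma ex_relabel:
  assumes bij: "bij_betw \<beta> V V'" and fin: "finite V" and adm: "adm V' Y"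
    and D: "\<And>i. i \<in> V \<Longrightarrow> D i = D' (\<beta> i)" "\<And>i. i \<in> V \<Longrightarrow> prob_space (D i)" "\<And>i. i \<in> V \<Longrightarrow> sets (D i) = sets borel"
  shows "ex V' D' w Y = ex V D w (\<lambda>x E. Y (\<lambda>j\<in>V'. x (inv_into V \<beta> j)) ((`) \<beta> ` E))"
proof -
  have inj: "inj_on \<beta> V" and img: "\<beta> ` V = V'" using bij by (auto simp: bij_betw_def)
  have fin': "finite V'" using fin img by auto
  let ?f = "inv_into V \<beta>"
  let ?t = "\<lambda>x. \<lambda>j\<in>V'. x (?f j)"
  have f: "inj_on ?f V'" "?f \<in> V' \<rightarrow> V" "\<And>i. i \<in> V \<Longrightarrow> ?f (\<beta> i) = i" "\<And>j. j \<in> V' \<Longrightarrow> \<beta> (?f j) = j"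
    using inj img by (auto simp: inj_on_inv_into inv_into_into f_inv_into_f)
  have fV: "?f j \<in> V" if "j \<in> V'" for j using f(2) that by auto
  have PiM_eq: "PiM V' D' = PiM V' (\<lambda>j. D (?f j))"
    using fV f(4) D(1) by (intro PiM_cong refl) metis
  have distr: "distr (PiM V D) (PiM V' (\<lambda>j. D (?f j))) ?t = PiM V' (\<lambda>j. D (?f j))"
    by (intro distr_PiM_reindex D(2) f(1,2))
  have sets': "\<And>j. j \<in> V' \<Longrightarrow> sets (D (?f j)) = sets borel" using fV D(3) by blast
  have meas: "?t \<in> PiM V D \<rightarrow>\<^sub>M PiM V' (\<lambda>j. D (?f j))"
    by (intro measurable_restrict measurable_component_singleton fV)
  have "ex V' D' w Y = (\<integral>\<^sup>+x. ennreal (bsum (pairs V') (wt w x) (Y x)) \<partial>distr (PiM V D) (PiM V' (\<lambda>j. D (?f j))) ?t)"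
    unfolding ex_def PiM_eq distr ..
  also have "\<dots> = (\<integral>\<^sup>+x. ennreal (bsum (pairs V') (wt w (?t x)) (Y (?t x))) \<partial>PiM V D)"
    using bsum_wt_measurable'[OF adm fin' sets'] by (intro nn_integral_distr meas) simp
  also have "\<dots> = ex V D w (\<lambda>x E. Y (?t x) ((`) \<beta> ` E))"
    unfolding ex_def
  proof (intro nn_integral_cong arg_cong[where f=ennreal])
    fix x
    have "inj_on ((`) \<beta>) (pairs V)"
      using inj pairs_subset_Pow[of V] by (meson inj_on_image_Pow inj_on_subset)
    then have "bsum (pairs V') (wt w (?t x)) (Y (?t x)) = bsum (pairs V) (\<lambda>e. wt w (?t x) (\<beta> ` e)) (\<lambda>E. Y (?t x) ((`) \<beta> ` E))"
      using fin unfolding img[symmetric] pairs_image[OF inj] by (simp add: bsum_image)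
    also have "\<dots> = bsum (pairs V) (wt w x) (\<lambda>E. Y (?t x) ((`) \<beta> ` E))"
      using img f(3) by (intro bsum_cong) (auto simp: pairs_def)
    finally show "bsum (pairs V') (wt w (?t x)) (Y (?t x)) = bsum (pairs V) (wt w x) (\<lambda>E. Y (?t x) ((`) \<beta> ` E))" .
  qed
  finally show ?thesis .
qed

end

section \<open>Poisson number of points: adding a last point and the Mecke formula\<close>

lemma nn_integral_poisson:
  assumes "0 < m"
  shows "(\<integral>\<^sup>+n. F n \<partial>measure_pmf (poisson_pmf m)) = (\<Sum>n. ennreal (m ^ n / fact n * exp (- m)) * F n)"
  using assms by (simp add: nn_integral_measure_pmf nn_integral_count_space_nat)

text \<open>Size bias: n P(N = n) = m P(N = n - 1) for a Poisson variable N of mean m.\<close>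

lemma nn_integral_poisson_Suc:
  assumes m: "0 < m" and F0: "F 0 = 0"
  shows "(\<integral>\<^sup>+n. F n \<partial>measure_pmf (poisson_pmf m)) =
    ennreal m * (\<integral>\<^sup>+n. ennreal (1 / real (Suc n)) * F (Suc n) \<partial>measure_pmf (poisson_pmf m))"
proof -
  let ?p = "\<lambda>n. ennreal (m ^ n / fact n * exp (- m))"
  have "(\<lambda>n. ?p (Suc n) * F (Suc n)) sums (\<Sum>n. ?p (Suc n) * F (Suc n))"
    by (rule summable_sums) simp
  then have "(\<lambda>n. ?p n * F n) sums ((\<Sum>n. ?p (Suc n) * F (Suc n)) + ?p 0 * F 0)"
    by (rule sums_Suc)
  then have "(\<Sum>n. ?p n * F n) = (\<Sum>n. ?p (Suc n) * F (Suc n))"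
    using F0 by (simp add: sums_iff)
  also have "?p (Suc n) * F (Suc n) = ennreal m * (?p n * (ennreal (1 / real (Suc n)) * F (Suc n)))" for n
  proof -
    have "?p (Suc n) = ennreal m * (?p n * ennreal (1 / real (Suc n)))"
      using m by (simp add: ennreal_mult[symmetric] field_simps)
    then show ?thesis by (simp add: mult.assoc)
  qed
  then have "(\<Sum>n. ?p (Suc n) * F (Suc n)) = ennreal m * (\<Sum>n. ?p n * (ennreal (1 / real (Suc n)) * F (Suc n)))"
    by (simp add: ennreal_suminf_cmult)
  finally show ?thesis using m by (simp add: nn_integral_poisson)
qed

definition star :: "nat \<Rightarrow> nat set set" where "star n = (\<lambda>i. {i, n}) ` {..<n}"

lemma finite_star[simp]: "finite (star n)" by (simp add: star_def)

lemma pairs_Suc: "pairs {..<Suc n} = pairs {..<n} \<union> star n"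
proof (intro equalityI subsetI)
  fix e assume "e \<in> pairs {..<Suc n}"
  then obtain i j where "i < Suc n" "j < Suc n" "i \<noteq> j" "e = {i, j}" by (auto simp: pairs_def)
  moreover consider "i < n \<and> j < n" | "i = n \<and> j < n" | "i < n \<and> j = n" using calculation by linarith
  ultimately show "e \<in> pairs {..<n} \<union> star n"
    by cases (auto simp: star_def insert_commute)
next
  fix e assume "e \<in> pairs {..<n} \<union> star n"
  then show "e \<in> pairs {..<Suc n}"
  proof
    assume "e \<in> pairs {..<n}"
    then show ?thesis using pairs_mono[of "{..<n}" "{..<Suc n}"] by auto
  qed (auto simp: star_def)
qed

lemma pairs_star_disjoint: "pairs {..<n} \<inter> star n = {}"
  by (auto simp: star_def)

context kernel begin

text \<open>The last point is placed after the others and its edges are drawn last, by Fubini for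
  positions and \<open>bsum_Un\<close> for edges. Every insertion or deletion of a vertex is carried
  out on this point.\<close>

lemma ex_Suc:
  assumes D: "prob_space D" "sets D = sets borel" and adm: "adm {..<Suc n} Y"
  shows "ex {..<Suc n} (\<lambda>_. D) w Y = (\<integral>\<^sup>+x. \<integral>\<^sup>+y. ennreal (bsum (pairs {..<n}) (wt w x)
     (\<lambda>E. bsum (star n) (wt w (x(n := y))) (\<lambda>E'. Y (x(n := y)) (E \<union> E')))) \<partial>D \<partial>PiM {..<n} (\<lambda>_. D))"
proof -
  interpret D: prob_space D by fact
  interpret product_sigma_finite "\<lambda>_::nat. D"
    by unfold_locales
  have "ex {..<Suc n} (\<lambda>_. D) w Y = (\<integral>\<^sup>+x. \<integral>\<^sup>+y. ennreal (bsum (pairs {..<Suc n}) (wt w (x(n := y))) (Y (x(n := y)))) \<partial>D \<partial>PiM {..<n} (\<lambda>_. D))"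
    unfolding ex_def lessThan_Suc
    using bsum_wt_measurable'[OF adm, of "\<lambda>_. D"] D(2)
    by (intro product_nn_integral_insert) (auto simp: lessThan_Suc)
  also have "\<dots> = (\<integral>\<^sup>+x. \<integral>\<^sup>+y. ennreal (bsum (pairs {..<n}) (wt w x)
     (\<lambda>E. bsum (star n) (wt w (x(n := y))) (\<lambda>E'. Y (x(n := y)) (E \<union> E')))) \<partial>D \<partial>PiM {..<n} (\<lambda>_. D))"
  proof (intro nn_integral_cong arg_cong[where f=ennreal])
    fix x y
    show "bsum (pairs {..<Suc n}) (wt w (x(n := y))) (Y (x(n := y))) = bsum (pairs {..<n}) (wt w x)
     (\<lambda>E. bsum (star n) (wt w (x(n := y))) (\<lambda>E'. Y (x(n := y)) (E \<union> E')))"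
      unfolding pairs_Suc using pairs_star_disjoint
      by (subst bsum_Un) (auto intro!: bsum_cong wt_cong)
  qed
  finally show ?thesis .
qed

text \<open>A Mecke-type formula: by exchangeability, every point may be taken to be the last one.\<close>

lemma mecke:
  assumes D: "prob_space D" "sets D = sets borel" and m: "0 < m"
    and adm: "\<And>n i. i \<le> n \<Longrightarrow> adm {..<Suc n} (q (Suc n) i)"
    and equiv: "\<And>n i x E. i \<le> n \<Longrightarrow> E \<subseteq> pairs {..<Suc n} \<Longrightarrow>
       q (Suc n) n (\<lambda>j\<in>{..<Suc n}. x (Transposition.transpose i n j)) ((`) (Transposition.transpose i n) ` E) = q (Suc n) i x E"
  shows "pex m D w (\<lambda>n x E. \<Sum>i<n. q n i x E) =
    ennreal m * (\<integral>\<^sup>+n. ex {..<Suc n} (\<lambda>_. D) w (q (Suc n) n) \<partial>measure_pmf (poisson_pmf m))"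
proof -
  have 1: "ex {..<Suc n} (\<lambda>_. D) w (q (Suc n) i) = ex {..<Suc n} (\<lambda>_. D) w (q (Suc n) n)" if "i \<le> n" for n i
  proof -
    let ?t = "Transposition.transpose i n"
    have bij: "bij_betw ?t {..<Suc n} {..<Suc n}"
      using that by (intro bij_betw_byWitness[where f'="?t"]) (auto simp: Transposition.transpose_def)
    have inv: "inv_into {..<Suc n} ?t j = ?t j" if "j < Suc n" for j
      using that bij \<open>i \<le> n\<close> by (intro inv_into_f_eq) (auto simp: bij_betw_def Transposition.transpose_def)
    have r: "(\<lambda>j\<in>{..<Suc n}. x (inv_into {..<Suc n} ?t j)) = (\<lambda>j\<in>{..<Suc n}. x (?t j))" for x :: "nat \<Rightarrow> 'a"
      by (intro restrict_ext) (simp add: inv)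
    have "ex {..<Suc n} (\<lambda>_. D) w (q (Suc n) n) =
      ex {..<Suc n} (\<lambda>_. D) w (\<lambda>x E. q (Suc n) n (\<lambda>j\<in>{..<Suc n}. x (inv_into {..<Suc n} ?t j)) ((`) ?t ` E))"
      using D adm by (intro ex_relabel[OF bij]) auto
    also have "\<dots> = ex {..<Suc n} (\<lambda>_. D) w (q (Suc n) i)"
      unfolding r using equiv[OF that] by (intro ex_cong) auto
    finally show ?thesis ..
  qed
  \<comment> \<open>By exchangeability the \<open>Suc n\<close> summands agree; this factor cancels
    the \<open>1 / real (Suc n)\<close> of the size-biased Poisson law.\<close>
  have 2: "ex {..<Suc n} (\<lambda>_. D) w (\<lambda>x E. \<Sum>i<Suc n. q (Suc n) i x E) = ennreal (real (Suc n)) * ex {..<Suc n} (\<lambda>_. D) w (q (Suc n) n)" for n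
  proof -
    have "ex {..<Suc n} (\<lambda>_. D) w (\<lambda>x E. \<Sum>i<Suc n. q (Suc n) i x E) = (\<Sum>i<Suc n. ex {..<Suc n} (\<lambda>_. D) w (q (Suc n) i))"
      using D adm by (intro ex_sum) auto
    also have "\<dots> = (\<Sum>i<Suc n. ex {..<Suc n} (\<lambda>_. D) w (q (Suc n) n))"
      by (intro sum.cong refl 1) auto
    finally show ?thesis by (simp add: ennreal_of_nat_eq_real_of_nat del: sum.lessThan_Suc)
  qed
  have "pex m D w (\<lambda>n x E. \<Sum>i<n. q n i x E) = ennreal m * (\<integral>\<^sup>+n. ennreal (1 / real (Suc n)) *
      ex {..<Suc n} (\<lambda>_. D) w (\<lambda>x E. \<Sum>i<Suc n. q (Suc n) i x E) \<partial>measure_pmf (poisson_pmf m))"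
    unfolding pex_def by (rule nn_integral_poisson_Suc[OF m]) (simp add: ex_def bsum_def)
  also have "\<dots> = ennreal m * (\<integral>\<^sup>+n. ex {..<Suc n} (\<lambda>_. D) w (q (Suc n) n) \<partial>measure_pmf (poisson_pmf m))"
  proof (intro arg_cong2[where f="(*)"] refl nn_integral_cong)
    fix n
    have "ennreal (1 / real (Suc n)) * ennreal (real (Suc n)) = 1"
      by (simp add: ennreal_mult[symmetric] del: of_nat_Suc)
    then show "ennreal (1 / real (Suc n)) * ex {..<Suc n} (\<lambda>_. D) w (\<lambda>x E. \<Sum>i<Suc n. q (Suc n) i x E)
      = ex {..<Suc n} (\<lambda>_. D) w (q (Suc n) n)"
      unfolding 2 by (simp add: mult.assoc[symmetric] del: of_nat_Suc)
  qed
  finally show ?thesis .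
qed

end

definition mk :: "'i set \<Rightarrow> ('i \<Rightarrow> 'a) \<Rightarrow> 'a set \<Rightarrow> 'i set" where
  "mk V x S = {i \<in> V. x i \<in> S}"

lemma mk_subset: "mk V x S \<subseteq> V" by (auto simp: mk_def)

lemma conn_cong_marks:
  "V \<inter> S = V \<inter> S' \<Longrightarrow> V \<inter> T = V \<inter> T' \<Longrightarrow> conn V S T E \<longleftrightarrow> conn V S' T' E"
  by (rule iffI; erule conn_mono_marks) auto

text \<open>With the statements derived from it for pivotality and detours, this supplies the
  symmetry premise of the Mecke formula.\<close>

lemma conn_image:
  assumes \<beta>: "inj_on \<beta> W" "E \<subseteq> pairs W" "V \<subseteq> W" "S \<subseteq> W" "T \<subseteq> W"
  shows "conn (\<beta> ` V) (\<beta> ` S) (\<beta> ` T) ((`) \<beta> ` E) \<longleftrightarrow> conn V S T E"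
proof -
  have "V \<inter> (\<beta> -` \<beta> ` A) = V \<inter> A" if "A \<subseteq> W" for A
    using that \<beta>(1,3) by (auto simp: inj_on_def subset_iff)
  then show ?thesis unfolding conn_relabel[OF \<beta>(1-3)] using \<beta>(4,5) by (intro conn_cong_marks) auto
qed

lemma image_minus_single: "inj_on \<beta> W \<Longrightarrow> V \<subseteq> W \<Longrightarrow> v \<in> W \<Longrightarrow> \<beta> ` V - {\<beta> v} = \<beta> ` (V - {v})"
  by (auto simp: inj_on_def subset_iff)

lemma PV_image_iff:
  assumes \<beta>: "inj_on \<beta> W" "E \<subseteq> pairs W" "S \<subseteq> W" "T \<subseteq> W" "V \<subseteq> W" "v \<in> W"
  shows "\<beta> v \<in> PV (\<beta> ` V) (\<beta> ` S) (\<beta> ` T) ((`) \<beta> ` E) \<longleftrightarrow> v \<in> PV V S T E"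
proof -
  have V: "V - {v} \<subseteq> W" using \<beta>(5) by auto
  show ?thesis unfolding PV_def mem_Collect_eq image_minus_single[OF \<beta>(1,5,6)]
      conn_image[OF \<beta>(1,2,5,3,4)] conn_image[OF \<beta>(1,2) V \<beta>(3,4)] inj_on_image_mem_iff[OF \<beta>(1,6,5)] ..
qed

lemma PE_image_iff:
  assumes \<beta>: "inj_on \<beta> W" "E \<subseteq> pairs W" "S \<subseteq> W" "T \<subseteq> W" "V \<subseteq> W" "e \<subseteq> W"
  shows "\<beta> ` e \<in> PE (\<beta> ` V) (\<beta> ` S) (\<beta> ` T) ((`) \<beta> ` E) \<longleftrightarrow> e \<in> PE V S T E"
proof -
  have inj: "inj_on ((`) \<beta>) (Pow W)" using \<beta>(1) by (rule inj_on_image_Pow)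
  have E: "E \<subseteq> Pow W" using \<beta>(2) pairs_subset_Pow[of W] by auto
  have eW: "e \<in> Pow W" using \<beta>(6) by simp
  have E': "E - {e} \<subseteq> pairs W" using \<beta>(2) by auto
  show ?thesis unfolding PE_def mem_Collect_eq image_minus_single[OF inj E eW]
      inj_on_image_mem_iff[OF inj eW E] conn_image[OF \<beta>(1,2,5,3,4)] conn_image[OF \<beta>(1) E' \<beta>(5,3,4)] ..
qed

text \<open>Counting the neighbours instead of naming them makes invariance under relabelling
  visible.\<close>

lemma detour_iff_card:
  "w \<in> detour V S T E \<longleftrightarrow> w \<in> V \<and> w \<notin> S \<and> w \<notin> T \<and> card {i \<in> V. {w, i} \<in> E} = 2 \<and>
     {i \<in> V. {w, i} \<in> E} \<in> PE (V - {w}) S T E"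
  unfolding detour_def card_2_iff mem_Collect_eq by metis

lemma detour_image_iff:
  assumes \<beta>: "inj_on \<beta> W" "E \<subseteq> pairs W" "S \<subseteq> W" "T \<subseteq> W" "V \<subseteq> W" "w \<in> W"
  shows "\<beta> w \<in> detour (\<beta> ` V) (\<beta> ` S) (\<beta> ` T) ((`) \<beta> ` E) \<longleftrightarrow> w \<in> detour V S T E"
proof -
  have mem: "\<beta> w \<in> \<beta> ` A \<longleftrightarrow> w \<in> A" if "A \<subseteq> W" for A
    using inj_on_image_mem_iff[OF \<beta>(1) \<beta>(6) that] .
  let ?A = "{i \<in> V. {w, i} \<in> E}"
  have A: "{j \<in> \<beta> ` V. {\<beta> w, j} \<in> (`) \<beta> ` E} = \<beta> ` ?A"
    using edge_image_iff[OF \<beta>(1,2,6)] \<beta>(5) by auto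
  have AW: "?A \<subseteq> W" using \<beta> by auto
  have card: "card (\<beta> ` ?A) = card ?A" using AW \<beta>(1) by (intro card_image) (rule inj_on_subset)
  have VW: "V - {w} \<subseteq> W" using \<beta> by auto
  have PE: "\<beta> ` ?A \<in> PE (\<beta> ` (V - {w})) (\<beta> ` S) (\<beta> ` T) ((`) \<beta> ` E) \<longleftrightarrow> ?A \<in> PE (V - {w}) S T E"
    by (rule PE_image_iff[OF \<beta>(1-4) VW AW])
  show ?thesis unfolding detour_iff_card A card image_minus_single[OF \<beta>(1,5,6)] PE
    using mem[OF \<beta>(3)] mem[OF \<beta>(4)] mem[OF \<beta>(5)] by simp
qed

lemma transpose_relabel:
  assumes i: "i \<le> n" and x': "x' = (\<lambda>j\<in>{..<Suc n}. x (Transposition.transpose i n j))"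
  shows "inj_on (Transposition.transpose i n) {..<Suc n}"
    and "Transposition.transpose i n ` {..<Suc n} = {..<Suc n}"
    and "mk {..<Suc n} x' S = Transposition.transpose i n ` mk {..<Suc n} x S"
    and "j < Suc n \<Longrightarrow> Transposition.transpose i n j < Suc n"
    and "j < Suc n \<Longrightarrow> x' (Transposition.transpose i n j) = x j"
proof -
  let ?t = "Transposition.transpose i n"
  show inj: "inj_on ?t {..<Suc n}" by (rule inj_on_subset[OF inj_transpose]) simp
  show lt: "\<And>j. j < Suc n \<Longrightarrow> ?t j < Suc n" using i by (auto simp: Transposition.transpose_def)
  have tt: "?t (?t j) = j" for j by simp
  show im: "?t ` {..<Suc n} = {..<Suc n}"
    using lt by (auto simp: image_iff) (metis lessThan_iff tt)
  show xj: "\<And>j. j < Suc n \<Longrightarrow> x' (?t j) = x j" using lt by (simp add: x')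
  show "mk {..<Suc n} x' S = ?t ` mk {..<Suc n} x S"
  proof (intro equalityI subsetI)
    fix j assume "j \<in> mk {..<Suc n} x' S"
    then have "j < Suc n" "x (?t j) \<in> S" by (auto simp: mk_def x')
    then have "?t j \<in> mk {..<Suc n} x S" using lt by (auto simp: mk_def)
    then show "j \<in> ?t ` mk {..<Suc n} x S" by (metis image_eqI tt)
  qed (auto simp: mk_def xj dest: lt)
qed

text \<open>Positions enter the combinatorial quantities only through the sets of indices that lie
  in \<open>S\<close> and in \<open>T\<close>. There are finitely many possibilities, so any
  function of these sets is a finite combination of indicators.\<close>

lemma mark_measurable:
  fixes \<Phi> :: "'i set \<Rightarrow> 'i set \<Rightarrow> real"
  assumes V: "finite V" and S[measurable]: "S \<in> sets borel" "T \<in> sets borel"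
  shows "(\<lambda>x. \<Phi> (mk V x S) (mk V x T)) \<in> borel_measurable (PiM V (\<lambda>_. borel :: 'a::topological_space measure))"
proof -
  have m: "(\<lambda>x. if mk V x S = A then 1 else 0 :: real) \<in> borel_measurable (PiM V (\<lambda>_. borel :: 'a measure))"
    if "A \<subseteq> V" "S \<in> sets borel" for A S
  proof -
    have eq: "(\<lambda>x. mk V x S = A) = (\<lambda>x. \<forall>i\<in>V. (x i \<in> S) = (i \<in> A))"
      using that by (auto simp: mk_def fun_eq_iff)
    have [measurable]: "S \<in> sets borel" by fact
    have "Measurable.pred (PiM V (\<lambda>_. borel :: 'a measure)) (\<lambda>x. mk V x S = A)"
      unfolding eq by (intro pred_intros_finite V) measurable
    then show ?thesis by (intro measurable_If) auto
  qed
  have "\<Phi> (mk V x S) (mk V x T) = (\<Sum>A\<in>Pow V. (if mk V x S = A then 1 else 0) * (\<Sum>B\<in>Pow V. (if mk V x T = B then 1 else 0) * \<Phi> A B))" for x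
  proof -
    have *: "(\<Sum>A\<in>Pow V. (if mk V x R = A then 1 else 0) * g A) = g (mk V x R)" for g :: "'i set \<Rightarrow> real" and R
    proof -
      have "(\<Sum>A\<in>Pow V. (if mk V x R = A then 1 else 0) * g A) = (\<Sum>A\<in>Pow V. if mk V x R = A then g A else 0)"
        by (intro sum.cong) auto
      also have "\<dots> = g (mk V x R)" using V mk_subset[of V x R] by (simp add: sum.delta')
      finally show ?thesis .
    qed
    show ?thesis unfolding * ..
  qed
  moreover have "(\<lambda>x. \<Sum>A\<in>Pow V. (if mk V x S = A then 1 else 0) * (\<Sum>B\<in>Pow V. (if mk V x T = B then 1 else 0) * \<Phi> A B))
      \<in> borel_measurable (PiM V (\<lambda>_. borel :: 'a measure))"
    by (intro borel_measurable_sum borel_measurable_times m S borel_measurable_const) auto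
  ultimately show ?thesis by presburger
qed

lemma adm_mark:
  assumes "finite V" "S \<in> sets borel" "T \<in> sets borel" "\<And>A B E. 0 \<le> \<Phi> A B E"
  shows "adm V (\<lambda>x E. \<Phi> (mk V x S) (mk V x T) E)"
  unfolding adm_def using assms mark_measurable[of V S T "\<lambda>A B. \<Phi> A B _"] by auto

lemma adm_sum: "(\<And>i. i \<in> I \<Longrightarrow> adm V (Y i)) \<Longrightarrow> adm V (\<lambda>x E. \<Sum>i\<in>I. Y i x E)"
  unfolding adm_def by (auto intro!: sum_nonneg borel_measurable_sum)

lemma adm_mult: "adm V Y \<Longrightarrow> adm V Y' \<Longrightarrow> adm V (\<lambda>x E. Y x E * Y' x E)"
  unfolding adm_def by (auto intro!: borel_measurable_times)

lemma adm_add: "adm V Y \<Longrightarrow> adm V Y' \<Longrightarrow> adm V (\<lambda>x E. Y x E + Y' x E)"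
  unfolding adm_def by (auto intro!: borel_measurable_add)

lemma adm_cmult: "adm V Y \<Longrightarrow> 0 \<le> c \<Longrightarrow> adm V (\<lambda>x E. c * Y x E)"
  unfolding adm_def by (auto intro!: borel_measurable_times)

lemma adm_pair_pred:
  assumes "Measurable.pred (borel \<Otimes>\<^sub>M borel) (\<lambda>p. R (fst p) (snd p))" "i \<in> V" "j \<in> V"
  shows "Measurable.pred (PiM V (\<lambda>_. borel :: 'a::topological_space measure)) (\<lambda>x. R (x i) (x j))"
  using measurable_compose[OF measurable_Pair[OF measurable_component_singleton[OF assms(2)] measurable_component_singleton[OF assms(3)]] assms(1)]
  by simp

text \<open>Edge sets with an edge of weight zero have probability zero, so a pointwise inequality
  may assume that every present edge joins points within range of each other.\<close>

lemma bsum_mono_pos: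
  assumes w: "\<And>e. e \<in> Q \<Longrightarrow> 0 \<le> w e \<and> w e \<le> 1"
    and Y: "\<And>E. E \<subseteq> Q \<Longrightarrow> (\<And>e. e \<in> E \<Longrightarrow> 0 < w e) \<Longrightarrow> Y E \<le> Y' E"
    and fin: "finite Q"
  shows "bsum Q w Y \<le> bsum Q w Y'"
  unfolding bsum_def
proof (intro sum_mono)
  fix E assume E: "E \<in> Pow Q"
  show "prod w E * (\<Prod>e\<in>Q - E. 1 - w e) * Y E \<le> prod w E * (\<Prod>e\<in>Q - E. 1 - w e) * Y' E"
  proof (cases "\<forall>e\<in>E. 0 < w e")
    case True
    then show ?thesis using E w Y
      by (intro mult_left_mono mult_nonneg_nonneg prod_nonneg) (auto simp: subset_iff)
  next
    case False
    then obtain e where "e \<in> E" "w e = 0" using w E by (metis PowD antisym_conv2 subset_iff)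
    then have "prod w E = 0" using E fin finite_subset[of E Q] by (auto simp: prod_zero_iff)
    then show ?thesis by simp
  qed
qed

text \<open>With k(a) points in cell a, the pairs at cell offset t number the sum of k(a) k(a + t).
  By 2xy \<le> x^2 + y^2 this is at most the sum of k(a)^2, the number of ordered pairs in a common
  cell. Finally there are \<open>card Off\<close> offsets.\<close>

lemma near_pairs_le:
  fixes c :: "'i \<Rightarrow> int \<times> int"
  assumes P: "finite P" and Off: "finite Off" and R: "\<And>v j. v \<in> P \<Longrightarrow> j \<in> P \<Longrightarrow> R v j \<Longrightarrow> c j - c v \<in> Off"
  shows "card {(v, j) \<in> P \<times> P. R v j} \<le> card Off * card {(v, j) \<in> P \<times> P. c v = c j}"
proof -
  define k where "k a = card {v \<in> P. c v = a}" for a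
  define C where "C = c ` P"
  have fC: "finite C" using P by (simp add: C_def)
  have k0: "k a = 0" if "a \<notin> C" for a
  proof -
    have "{v \<in> P. c v = a} = {}" using that by (auto simp: C_def)
    then show ?thesis unfolding k_def by (metis card.empty)
  qed
  have cnt: "card {(v, j) \<in> P \<times> P. c j = c v + t} = (\<Sum>a\<in>C. k a * k (a + t))" for t
  proof -
    have "{(v, j) \<in> P \<times> P. c j = c v + t} = (\<Union>a\<in>C. {v \<in> P. c v = a} \<times> {j \<in> P. c j = a + t})"
      by (auto simp: C_def)
    also have "card \<dots> = (\<Sum>a\<in>C. card ({v \<in> P. c v = a} \<times> {j \<in> P. c j = a + t}))"
      using fC P by (intro card_UN_disjoint) auto
    finally show ?thesis by (simp add: k_def card_cartesian_product)
  qed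
  have bound: "card {(v, j) \<in> P \<times> P. c j = c v + t} \<le> card {(v, j) \<in> P \<times> P. c v = c j}" for t
  proof -
    have "(\<Sum>a\<in>C. k (a + t) * k (a + t)) = (\<Sum>b\<in>(\<lambda>a. a + t) ` C. k b * k b)"
      by (subst sum.reindex) (auto simp: inj_on_def)
    also have "\<dots> = (\<Sum>b\<in>(\<lambda>a. a + t) ` C \<inter> C. k b * k b)"
      using fC k0 by (intro sum.mono_neutral_right) auto
    also have "\<dots> \<le> (\<Sum>b\<in>C. k b * k b)" using fC by (intro sum_mono2) auto
    finally have s: "(\<Sum>a\<in>C. k (a + t) * k (a + t)) \<le> (\<Sum>b\<in>C. k b * k b)" .
    have ag: "2 * (x * y) \<le> x * x + y * y" for x y :: nat
    proof -
      have "0 \<le> (int x - int y)\<^sup>2" by simp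
      then have "2 * (int x * int y) \<le> int x * int x + int y * int y"
        by (simp add: power2_eq_square algebra_simps)
      then show ?thesis by (simp flip: of_nat_mult of_nat_add)
    qed
    have "2 * (\<Sum>a\<in>C. k a * k (a + t)) = (\<Sum>a\<in>C. 2 * (k a * k (a + t)))" by (simp add: sum_distrib_left)
    also have "\<dots> \<le> (\<Sum>a\<in>C. k a * k a + k (a + t) * k (a + t))" by (intro sum_mono ag)
    also have "\<dots> \<le> 2 * (\<Sum>b\<in>C. k b * k b)" using s by (simp add: sum.distrib)
    finally have "(\<Sum>a\<in>C. k a * k (a + t)) \<le> (\<Sum>a\<in>C. k a * k (a + 0))" by simp
    then show ?thesis using cnt[of t] cnt[of 0] by (simp add: eq_commute)
  qed
  have "{(v, j) \<in> P \<times> P. R v j} \<subseteq> (\<Union>t\<in>Off. {(v, j) \<in> P \<times> P. c j = c v + t})"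
    using R by force
  then have "card {(v, j) \<in> P \<times> P. R v j} \<le> card (\<Union>t\<in>Off. {(v, j) \<in> P \<times> P. c j = c v + t})"
    using P Off by (intro card_mono finite_UN_I finite_subset[of "{(v, j) \<in> P \<times> P. c j = c v + _}" "P \<times> P"]) auto
  also have "\<dots> \<le> (\<Sum>t\<in>Off. card {(v, j) \<in> P \<times> P. c j = c v + t})" by (rule card_UN_le[OF Off])
  also have "\<dots> \<le> (\<Sum>t\<in>Off. card {(v, j) \<in> P \<times> P. c v = c j})" by (intro sum_mono bound)
  finally show ?thesis by simp
qed

lemma ordered_pairs_le:
  assumes "finite P"
  shows "card {(v, j) \<in> P \<times> P. c v = c j} \<le> card P + 2 * card {e \<in> pairs P. \<forall>i\<in>e. \<forall>j\<in>e. c i = c j}"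
proof -
  let ?B = "{e \<in> pairs P. \<forall>i\<in>e. \<forall>j\<in>e. c i = c j}"
  have fB: "finite ?B" using assms by auto
  have two: "card {(v, j) \<in> P \<times> P. v \<noteq> j \<and> {v, j} = e} \<le> 2" if "e \<in> ?B" for e
  proof -
    have "e \<in> pairs P" using that by blast
    then obtain a b where "e = {a, b}" unfolding pairs_def by auto
    then have "{(v, j) \<in> P \<times> P. v \<noteq> j \<and> {v, j} = e} \<subseteq> {(a, b), (b, a)}" by (auto simp: doubleton_eq_iff)
    from card_mono[OF _ this] show ?thesis using card_insert_le_m1[of 2 "{(b, a)}" "(a, b)"] by simp
  qed
  have "{(v, j) \<in> P \<times> P. c v = c j} \<subseteq> (\<lambda>v. (v, v)) ` P \<union> (\<Union>e\<in>?B. {(v, j) \<in> P \<times> P. v \<noteq> j \<and> {v, j} = e})"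
  proof
    fix p assume "p \<in> {(v, j) \<in> P \<times> P. c v = c j}"
    then obtain v j where p: "p = (v, j)" "v \<in> P" "j \<in> P" "c v = c j" by auto
    show "p \<in> (\<lambda>v. (v, v)) ` P \<union> (\<Union>e\<in>?B. {(v, j) \<in> P \<times> P. v \<noteq> j \<and> {v, j} = e})"
    proof (cases "v = j")
      case False
      then have "{v, j} \<in> ?B" using p by auto
      then show ?thesis using False p by auto
    qed (use p in auto)
  qed
  then have "card {(v, j) \<in> P \<times> P. c v = c j} \<le> card ((\<lambda>v. (v, v)) ` P \<union> (\<Union>e\<in>?B. {(v, j) \<in> P \<times> P. v \<noteq> j \<and> {v, j} = e}))"
    using assms fB by (intro card_mono finite_UnI finite_UN_I finite_subset[of "{(v, j) \<in> P \<times> P. v \<noteq> j \<and> {v, j} = _}" "P \<times> P"]) auto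
  also have "\<dots> \<le> card ((\<lambda>v. (v, v)) ` P) + card (\<Union>e\<in>?B. {(v, j) \<in> P \<times> P. v \<noteq> j \<and> {v, j} = e})"
    by (rule card_Un_le)
  also have "card ((\<lambda>v. (v, v)) ` P) \<le> card P" using assms by (rule card_image_le)
  also have "card (\<Union>e\<in>?B. {(v, j) \<in> P \<times> P. v \<noteq> j \<and> {v, j} = e}) \<le> (\<Sum>e\<in>?B. card {(v, j) \<in> P \<times> P. v \<noteq> j \<and> {v, j} = e})"
    by (rule card_UN_le[OF fB])
  also have "\<dots> \<le> (\<Sum>e\<in>?B. 2)" by (intro sum_mono two)
  finally show ?thesis by simp
qed

section \<open>Comparison of pivotal vertices and pivotal edges\<close>

context kernel begin

lemma pex_mono:
  assumes "\<And>n x E. E \<subseteq> pairs {..<n} \<Longrightarrow> Y n x E \<le> Y' n x E"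
  shows "pex m D w Y \<le> pex m D w Y'"
  unfolding pex_def using assms by (intro nn_integral_mono ex_mono) auto

lemma pex_add:
  assumes "sets D = sets borel" "\<And>n. adm {..<n} (Y n)" "\<And>n. adm {..<n} (Y' n)"
  shows "pex m D w (\<lambda>n x E. Y n x E + Y' n x E) = pex m D w Y + pex m D w Y'"
  unfolding pex_def using assms by (subst nn_integral_add[symmetric]) (auto simp: ex_add)

lemma pex_cmult:
  assumes "sets D = sets borel" "\<And>n. adm {..<n} (Y n)" "0 \<le> c"
  shows "pex m D w (\<lambda>n x E. c * Y n x E) = ennreal c * pex m D w Y"
  unfolding pex_def using assms by (subst nn_integral_cmult[symmetric]) (auto simp: ex_cmult)

end

lemma conn_avoid_edge:
  assumes "u \<in> e" shows "conn (V - {u}) S T E \<longleftrightarrow> conn (V - {u}) S T (E - {e})"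
proof
  assume "conn (V - {u}) S T E"
  then have "conn (V - {u}) S T (E \<inter> {e. e \<subseteq> V - {u}})" using conn_restrict_edges by blast
  then show "conn (V - {u}) S T (E - {e})" by (rule conn_mono) (use assms in auto)
qed (erule conn_mono, auto)

text \<open>An end of \<open>e\<close> that is pivotal without \<open>e\<close> stays pivotal when
  \<open>e\<close> opens, as paths avoiding that end do not use \<open>e\<close>. The edge itself is
  not pivotal, since the connection existed before.\<close>

lemma inserted_edge:
  assumes "e \<in> pairs V" "e \<in> E" "e \<subseteq> PV V S T (E - {e})"
  shows "e \<in> AP V S T E - PE V S T E"
proof -
  obtain u v where uv: "u \<noteq> v" "e = {u, v}" using assms(1) by (auto simp: pairs_def)
  have c: "conn V S T (E - {e})" using assms(3) uv by (auto simp: PV_def)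
  then have c': "conn V S T E" by (rule conn_mono) auto
  have "e \<subseteq> PV V S T E"
  proof
    fix a assume a: "a \<in> e"
    then have "a \<in> PV V S T (E - {e})" using assms(3) by auto
    then show "a \<in> PV V S T E" using conn_avoid_edge[OF a, of V S T E] c' by (auto simp: PV_def)
  qed
  then show ?thesis using uv c assms(2) by (auto simp: AP_def PE_def)
qed

lemma star_image: "bsum (star n) W Y = bsum {..<n} (\<lambda>i. W {i, n}) (\<lambda>J. Y ((\<lambda>i. {i, n}) ` J))"
  unfolding star_def by (rule bsum_image) (auto simp: inj_on_def doubleton_eq_iff)

text \<open>Paths that avoid the new vertex \<open>n\<close> see neither its position nor its
  edges.\<close>

lemma conn_new_vertex:
  assumes "E \<subseteq> pairs {..<n}" "E' \<subseteq> star n" "V \<subseteq> {..<n}"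
  shows "conn V (mk {..<Suc n} (x(n := y)) S) (mk {..<Suc n} (x(n := y)) T) (E \<union> E') \<longleftrightarrow>
     conn V (mk {..<n} x S) (mk {..<n} x T) E"
proof -
  have "(E \<union> E') \<inter> {e. e \<subseteq> V} = E \<inter> {e. e \<subseteq> V}" using assms by (auto simp: star_def)
  then have "conn V A B (E \<union> E') \<longleftrightarrow> conn V A B E" for A B
    using conn_restrict_edges[of V A B "E \<union> E'"] conn_restrict_edges[of V A B E] by simp
  moreover have "V \<inter> mk {..<Suc n} (x(n := y)) R = V \<inter> mk {..<n} x R" for R
    using assms(3) by (auto simp: mk_def subset_iff)
  ultimately show ?thesis using conn_cong_marks by metis
qed

lemma sum_of_bool_card: "finite A \<Longrightarrow> (\<Sum>i\<in>A. of_bool (P i)) = real (card {i \<in> A. P i})"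
  by (simp add: of_bool_def sum.If_cases Int_def)

text \<open>The geometric input of the comparison. The points have intensity measure m D, so
  \<open>\<kappa> / m\<close> and \<open>c0 / m\<close> express bounds \<open>\<kappa>\<close> and
  \<open>c0\<close> for intensity measures. \<open>Rg a b\<close> is the region where a vertex may
  be planted over the edge between \<open>a\<close> and \<open>b\<close>: it is joined to each end
  with probability at least \<open>w1\<close>, and every point it can reach is near both ends.
  \<open>w0\<close> bounds edge probabilities within a cell from below, and \<open>\<theta>\<close>
  the probability that an edge is absent.\<close>

locale pivotal = kernel w for w :: "'a::second_countable_topology \<Rightarrow> 'a \<Rightarrow> real" +
  fixes D :: "'a measure" and m :: real and S T :: "'a set" and near :: "'a \<Rightarrow> 'a \<Rightarrow> bool"
    and cellf :: "'a \<Rightarrow> int \<times> int" and Off :: "(int \<times> int) set" and Rg :: "'a \<Rightarrow> 'a \<Rightarrow> 'a set"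
    and w0 w1 \<theta> \<kappa> c0 :: real
  assumes D: "prob_space D" "sets D = sets borel" and m: "0 < m"
    and ST[measurable]: "S \<in> sets borel" "T \<in> sets borel"
    and near_meas: "Measurable.pred (borel \<Otimes>\<^sub>M borel) (\<lambda>p. near (fst p) (snd p))"
    and cell_meas: "Measurable.pred (borel \<Otimes>\<^sub>M borel) (\<lambda>p. cellf (fst p) = cellf (snd p))"
    and Off: "finite Off" "near a b \<Longrightarrow> cellf b - cellf a \<in> Off"
    and same_cell: "cellf a = cellf b \<Longrightarrow> w0 \<le> w a b"
    and near_vol: "emeasure D {y. near a y} \<le> ennreal (\<kappa> / m)"
    and Rg: "a \<notin> S \<union> T \<Longrightarrow> b \<notin> S \<union> T \<Longrightarrow> 0 < w a b \<Longrightarrow>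
       Rg a b \<in> sets borel \<and> ennreal (c0 / m) \<le> emeasure D (Rg a b) \<and>
       (\<forall>y\<in>Rg a b. y \<notin> S \<union> T \<and> w1 \<le> w a y \<and> w1 \<le> w b y \<and> (\<forall>z. 0 < w z y \<longrightarrow> near a z \<and> near b z))"
    and w_le: "w a b \<le> 1 - \<theta>"
    and pos: "0 < w0" "0 < w1" "0 < \<theta>" "\<theta> \<le> 1" "0 \<le> \<kappa>" "0 < c0"
begin

abbreviation "pv (n::nat) x E \<equiv> PV {..<n} (mk {..<n} x S) (mk {..<n} x T) E"
abbreviation "pe (n::nat) x E \<equiv> PE {..<n} (mk {..<n} x S) (mk {..<n} x T) E"
abbreviation "ap (n::nat) x E \<equiv> AP {..<n} (mk {..<n} x S) (mk {..<n} x T) E"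

text \<open>The common currency of both local modifications: each produces an edge that joins two
  pivotal vertices without being pivotal itself.\<close>

definition "NE (n::nat) x E = real (card (ap n x E - pe n x E))"
definition "Df (n::nat) x E = real (card (pv n x E)) - real (card (pe n x E))"

text \<open>Combines \<open>PE\<close> \<subseteq> \<open>AP\<close> with |AP| < |PV|. The extra 1,
  present whenever there is a pivotal vertex, later pays for the at most two pivotal edges at marked
  vertices.\<close>

lemma NE_le_Df:
  "NE n x E + of_bool (pv n x E \<noteq> {}) \<le> Df n x E"
proof (cases "pv n x E = {}")
  case True
  then have "ap n x E = {}" by (auto simp: AP_def)
  moreover then have "pe n x E = {}" using PE_subset_AP by blast
  ultimately show ?thesis using True by (simp add: NE_def Df_def)
next
  case False
  have fin: "finite (pe n x E)" "finite (ap n x E)" by (auto simp: finite_PE finite_AP)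
  have "card (ap n x E) < card (pv n x E)" using False by (intro card_AP_less) auto
  moreover have "card (ap n x E - pe n x E) = card (ap n x E) - card (pe n x E)"
    by (rule card_Diff_subset[OF fin(1) PE_subset_AP])
  moreover have "card (pe n x E) \<le> card (ap n x E)" by (rule card_mono[OF fin(2) PE_subset_AP])
  ultimately show ?thesis using False by (simp add: NE_def Df_def)
qed

lemma adm_NE: "adm {..<n} (NE n)"
  unfolding NE_def by (rule adm_mark[where \<Phi>="\<lambda>A B E. real (card (AP {..<n} A B E - PE {..<n} A B E))"]) auto

lemma Df_nonneg: "0 \<le> Df n x E"
proof -
  have "0 \<le> NE n x E + of_bool (pv n x E \<noteq> {})" by (simp add: NE_def)
  then show ?thesis using NE_le_Df[of n x E] by linarith
qed

lemma adm_Df: "adm {..<n} (Df n)"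
  unfolding adm_def
proof (intro allI impI conjI Df_nonneg)
  fix E :: "nat set set"
  show "(\<lambda>x. Df n x E) \<in> borel_measurable (PiM {..<n} (\<lambda>_. borel))"
    unfolding Df_def
    by (rule mark_measurable[where \<Phi>="\<lambda>A B. real (card (PV {..<n} A B E)) - real (card (PE {..<n} A B E))"]) auto
qed

lemma adm_pv: "adm {..<n} (\<lambda>x E. real (card (pv n x E)))"
  by (rule adm_mark[where \<Phi>="\<lambda>A B E. real (card (PV {..<n} A B E))"]) auto

lemma adm_near: "i \<in> V \<Longrightarrow> j \<in> V \<Longrightarrow> adm V (\<lambda>x E. of_bool (near (x i) (x j)))"
  using adm_pair_pred[OF near_meas, of i V j] unfolding adm_def by simp

section \<open>Edge insertion and crowding around pivotal vertices\<close>

definition same :: "(nat \<Rightarrow> 'a) \<Rightarrow> nat set \<Rightarrow> bool" where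
  "same x e \<longleftrightarrow> (\<forall>i\<in>e. \<forall>j\<in>e. cellf (x i) = cellf (x j))"

definition "Z (n::nat) x E = (\<Sum>e\<in>pairs {..<n}. of_bool (same x e) * (of_bool (e \<subseteq> pv n x E \<and> e \<notin> E) :: real))"

lemma adm_same: "e \<in> pairs V \<Longrightarrow> adm V (\<lambda>x E. of_bool (same x e))"
proof -
  assume "e \<in> pairs V"
  then obtain i j where ij: "i \<in> V" "j \<in> V" "e = {i, j}" by (auto simp: pairs_def)
  have "same x e \<longleftrightarrow> cellf (x i) = cellf (x j)" for x unfolding same_def ij(3) by (metis insert_iff singletonD)
  then show ?thesis using adm_pair_pred[OF cell_meas, of i V j] ij unfolding adm_def by simp
qed

lemma adm_Z: "adm {..<n} (Z n)"
  unfolding Z_def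
proof (intro adm_sum adm_mult adm_same)
  fix e
  show "adm {..<n} (\<lambda>x E. of_bool (e \<subseteq> pv n x E \<and> e \<notin> E))"
    by (rule adm_mark[where \<Phi>="\<lambda>A B E. of_bool (e \<subseteq> PV {..<n} A B E \<and> e \<notin> E)"]) auto
qed

text \<open>Opening a missing edge between two pivotal vertices of one cell costs a factor of at
  most \<open>1 / w0\<close> by \<open>bsum_flip\<close>, and the opened edge lands in
  \<open>AP - PE\<close> by \<open>inserted_edge\<close>. The edge that is opened is the edge that
  is counted, so nothing is counted twice.\<close>

lemma edge_insertion: "pex m D w Z \<le> ennreal (1 / w0) * pex m D w NE"
proof -
  have "bsum (pairs {..<n}) (wt w x) (Z n x) \<le> bsum (pairs {..<n}) (wt w x) (\<lambda>E. 1 / w0 * NE n x E)" for n x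
  proof -
    let ?Q = "pairs {..<n}" and ?W = "wt w x"
    have 1: "of_bool (same x e) * bsum ?Q ?W (\<lambda>E. of_bool (e \<subseteq> pv n x E \<and> e \<notin> E)) \<le>
      1 / w0 * bsum ?Q ?W (\<lambda>E. of_bool (e \<in> ap n x E - pe n x E))" (is "_ * ?B \<le> 1 / w0 * ?R") if e: "e \<in> ?Q" for e
    proof (cases "same x e")
      case False
      have "0 \<le> ?R" by (intro bsum_nonneg wt_range) auto
      with False pos show ?thesis by simp
    next
      case True
      obtain i j where ij: "e = {i, j}" using e by (auto simp: pairs_def)
      have "cellf (x i) = cellf (x j)" using True[unfolded same_def, rule_format, of i j] ij by simp
      then have we: "w0 \<le> ?W e" unfolding ij wt_pair by (rule same_cell)
      have B0: "0 \<le> ?B" by (intro bsum_nonneg wt_range) auto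
      have B: "?B = bsum ?Q ?W (\<lambda>E. if e \<notin> E then of_bool (e \<subseteq> pv n x E) else 0)"
        by (intro bsum_cong) auto
      have "w0 * ?B \<le> ?W e * bsum ?Q ?W (\<lambda>E. if e \<notin> E then of_bool (e \<subseteq> pv n x E) else 0)"
        unfolding B[symmetric] using we B0 by (rule mult_right_mono)
      also have "\<dots> = (1 - ?W e) * bsum ?Q ?W (\<lambda>E. if e \<in> E then of_bool (e \<subseteq> pv n x (E - {e})) else 0)"
        using e by (intro bsum_flip) auto
      \<comment> \<open>Only \<open>w0\<close> appears in the cost, because the other factor of the
        exchange, the probability that the edge is absent, is at most 1.\<close>
      also have "\<dots> \<le> 1 * bsum ?Q ?W (\<lambda>E. if e \<in> E then of_bool (e \<subseteq> pv n x (E - {e})) else 0)"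
        using wt_range[OF e, of x] by (intro mult_right_mono bsum_nonneg wt_range) auto
      also have "\<dots> \<le> ?R"
        unfolding mult_1
      proof (intro bsum_mono wt_range)
        fix E
        show "(if e \<in> E then of_bool (e \<subseteq> pv n x (E - {e})) else 0) \<le> (of_bool (e \<in> ap n x E - pe n x E) :: real)"
          using inserted_edge[OF e, of E "mk {..<n} x S" "mk {..<n} x T"] by auto
      qed
      finally show ?thesis using True pos by (simp add: field_simps)
    qed
    have "bsum ?Q ?W (Z n x) = (\<Sum>e\<in>?Q. of_bool (same x e) * bsum ?Q ?W (\<lambda>E. of_bool (e \<subseteq> pv n x E \<and> e \<notin> E)))"
      unfolding Z_def bsum_sum bsum_cmult ..
    also have "\<dots> \<le> (\<Sum>e\<in>?Q. 1 / w0 * bsum ?Q ?W (\<lambda>E. of_bool (e \<in> ap n x E - pe n x E)))"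
      by (intro sum_mono 1)
    also have "\<dots> = 1 / w0 * bsum ?Q ?W (\<lambda>E. \<Sum>e\<in>?Q. of_bool (e \<in> ap n x E - pe n x E))"
      unfolding bsum_sum sum_distrib_left ..
    also have "bsum ?Q ?W (\<lambda>E. \<Sum>e\<in>?Q. of_bool (e \<in> ap n x E - pe n x E)) = bsum ?Q ?W (NE n x)"
    proof (intro bsum_cong refl)
      fix E assume E: "E \<subseteq> ?Q"
      have "{e \<in> ?Q. e \<in> ap n x E - pe n x E} = ap n x E - pe n x E" using E by (auto simp: AP_def)
      then show "(\<Sum>e\<in>?Q. of_bool (e \<in> ap n x E - pe n x E)) = NE n x E"
        by (subst sum_of_bool_card) (auto simp: NE_def)
    qed
    finally show ?thesis unfolding bsum_cmult .
  qed
  then have "pex m D w Z \<le> pex m D w (\<lambda>n x E. 1 / w0 * NE n x E)"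
    unfolding pex_def ex_def by (intro nn_integral_mono ennreal_leI)
  then show ?thesis using pex_cmult[OF D(2) adm_NE, of "1 / w0" m] pos by simp
qed

text \<open>The pivotal vertices near a non-pivotal point \<open>j\<close>. The count is attached to
  \<open>j\<close> because \<open>j\<close> is the point to which the Mecke formula is
  applied.\<close>

definition "q1 (n::nat) j x E = (\<Sum>v<n. of_bool (near (x v) (x j)) * (of_bool (v \<in> pv n x E \<and> j \<notin> pv n x E) :: real))"

lemma adm_q1: "j < n \<Longrightarrow> adm {..<n} (q1 n j)"
  unfolding q1_def
proof (intro adm_sum adm_mult adm_near)
  fix v
  show "adm {..<n} (\<lambda>x E. of_bool (v \<in> pv n x E \<and> j \<notin> pv n x E))"
    by (rule adm_mark[where \<Phi>="\<lambda>A B E. of_bool (v \<in> PV {..<n} A B E \<and> j \<notin> PV {..<n} A B E)"]) auto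
qed auto

text \<open>Deleting a non-pivotal point \<open>j\<close> keeps the connection, and the pivotal
  vertices remain pivotal. After the Mecke formula \<open>j\<close> is therefore integrated freely
  over the surroundings of a pivotal vertex, whose intensity measure is at most
  \<open>\<kappa>\<close>.\<close>

lemma crowding_nonpivotal:
  "pex m D w (\<lambda>n x E. \<Sum>j<n. q1 n j x E) \<le> ennreal \<kappa> * pex m D w (\<lambda>n x E. real (card (pv n x E)))"
proof -
  have "pex m D w (\<lambda>n x E. \<Sum>j<n. q1 n j x E) =
    ennreal m * (\<integral>\<^sup>+n. ex {..<Suc n} (\<lambda>_. D) w (q1 (Suc n) n) \<partial>measure_pmf (poisson_pmf m))"
  proof (rule mecke[OF D m])
    fix n i and x :: "nat \<Rightarrow> 'a" and E assume i: "i \<le> n" and E: "E \<subseteq> pairs {..<Suc n}"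
    let ?t = "Transposition.transpose i n"
    define x' where "x' = (\<lambda>j\<in>{..<Suc n}. x (?t j))"
    note t = transpose_relabel[OF i x'_def]
    have piv: "?t v \<in> pv (Suc n) x' ((`) ?t ` E) \<longleftrightarrow> v \<in> pv (Suc n) x E" if "v < Suc n" for v
      using PV_image_iff[OF t(1) E mk_subset mk_subset order_refl, of v x S x T] that t(2) t(3)[of S] t(3)[of T] by simp
    have pi: "n \<in> pv (Suc n) x' ((`) ?t ` E) \<longleftrightarrow> i \<in> pv (Suc n) x E" and xi: "x' n = x i"
      using piv[of i] t(5)[of i] i by simp_all
    have "q1 (Suc n) n x' ((`) ?t ` E) = (\<Sum>v\<in>?t ` {..<Suc n}. of_bool (near (x' v) (x' n)) * of_bool (v \<in> pv (Suc n) x' ((`) ?t ` E) \<and> n \<notin> pv (Suc n) x' ((`) ?t ` E)))"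
      unfolding q1_def t(2) ..
    also have "\<dots> = (\<Sum>v<Suc n. of_bool (near (x' (?t v)) (x' n)) * of_bool (?t v \<in> pv (Suc n) x' ((`) ?t ` E) \<and> n \<notin> pv (Suc n) x' ((`) ?t ` E)))"
      unfolding sum.reindex[OF t(1)] comp_def ..
    also have "\<dots> = q1 (Suc n) i x E"
      unfolding q1_def by (intro sum.cong refl) (simp add: piv t(5) pi xi)
    finally show "q1 (Suc n) n (\<lambda>j\<in>{..<Suc n}. x (?t j)) ((`) ?t ` E) = q1 (Suc n) i x E" unfolding x'_def .
  qed (auto intro!: adm_q1)
  also have "\<dots> \<le> ennreal m * (\<integral>\<^sup>+n. ennreal (\<kappa> / m) * ex {..<n} (\<lambda>_. D) w (\<lambda>x E. real (card (pv n x E))) \<partial>measure_pmf (poisson_pmf m))"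
  proof (intro mult_left_mono nn_integral_mono)
    fix n
    have "ex {..<Suc n} (\<lambda>_. D) w (q1 (Suc n) n) = (\<integral>\<^sup>+x. \<integral>\<^sup>+y. ennreal (bsum (pairs {..<n}) (wt w x)
       (\<lambda>E. bsum (star n) (wt w (x(n := y))) (\<lambda>E'. q1 (Suc n) n (x(n := y)) (E \<union> E')))) \<partial>D \<partial>PiM {..<n} (\<lambda>_. D))"
      by (rule ex_Suc[OF D adm_q1]) simp
    also have "\<dots> \<le> (\<integral>\<^sup>+x. ennreal (\<kappa> / m) * ennreal (bsum (pairs {..<n}) (wt w x) (\<lambda>E. real (card (pv n x E)))) \<partial>PiM {..<n} (\<lambda>_. D))"
    proof (intro nn_integral_mono)
      fix x :: "nat \<Rightarrow> 'a"
      let ?Q = "pairs {..<n}" and ?W = "wt w x"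
      have star_in: "e \<in> star n \<Longrightarrow> e \<in> pairs {..<Suc n}" for e by (simp add: pairs_Suc)
      define b where "b v = bsum ?Q ?W (\<lambda>E. of_bool (v \<in> pv n x E))" for v
      have b0: "0 \<le> b v" for v unfolding b_def by (intro bsum_nonneg wt_range) auto
      have point: "q1 (Suc n) n (x(n := y)) (E \<union> E') \<le> (\<Sum>v<n. of_bool (near (x v) y) * of_bool (v \<in> pv n x E))"
        if E: "E \<subseteq> ?Q" "E' \<subseteq> star n" for y E E'
      proof -
        \<comment> \<open>The connection persists without \<open>n\<close> because \<open>n\<close>
          is not pivotal; a connection avoiding both \<open>n\<close> and \<open>v\<close> would
          contradict the pivotality of \<open>v\<close>.\<close>
        have "v \<in> pv n x E" if v: "v < n" "v \<in> pv (Suc n) (x(n := y)) (E \<union> E')" "n \<notin> pv (Suc n) (x(n := y)) (E \<union> E')" for v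
        proof -
          let ?A = "mk {..<Suc n} (x(n := y)) S" and ?B = "mk {..<Suc n} (x(n := y)) T"
          have n: "{..<Suc n} - {n} = {..<n}" by auto
          have "conn {..<Suc n} ?A ?B (E \<union> E')" using v(2) unfolding PV_def by blast
          then have "conn {..<n} ?A ?B (E \<union> E')" using v(3) by (simp add: PV_def n)
          then have "conn {..<n} (mk {..<n} x S) (mk {..<n} x T) E"
            unfolding conn_new_vertex[OF E order_refl, of x y S T] .
          moreover have "\<not> conn ({..<n} - {v}) ?A ?B (E \<union> E')"
          proof
            assume "conn ({..<n} - {v}) ?A ?B (E \<union> E')"
            moreover have "{..<n} - {v} \<subseteq> {..<Suc n} - {v}" by auto
            ultimately have "conn ({..<Suc n} - {v}) ?A ?B (E \<union> E')" using conn_mono[OF _ _ order_refl] by metis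
            then show False using v(2) unfolding PV_def by blast
          qed
          then have "\<not> conn ({..<n} - {v}) (mk {..<n} x S) (mk {..<n} x T) E"
            unfolding conn_new_vertex[OF E Diff_subset, of "{v}" x y S T] .
          ultimately show ?thesis using v(1) by (simp add: PV_def)
        qed
        then have tm: "of_bool (near ((x(n := y)) v) ((x(n := y)) n)) * of_bool (v \<in> pv (Suc n) (x(n := y)) (E \<union> E') \<and> n \<notin> pv (Suc n) (x(n := y)) (E \<union> E'))
           \<le> (of_bool (near (x v) y) * of_bool (v \<in> pv n x E) :: real)" if "v \<in> {..<n}" for v
          using that by (auto simp: of_bool_def)
        have last: "of_bool (n \<in> pv (Suc n) (x(n := y)) (E \<union> E') \<and> n \<notin> pv (Suc n) (x(n := y)) (E \<union> E')) = (0 :: real)" by simp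
        show ?thesis unfolding q1_def sum.lessThan_Suc last mult_zero_right add_0_right by (intro sum_mono tm)
      qed
      have "(\<integral>\<^sup>+y. ennreal (bsum ?Q ?W (\<lambda>E. bsum (star n) (wt w (x(n := y))) (\<lambda>E'. q1 (Suc n) n (x(n := y)) (E \<union> E')))) \<partial>D)
        \<le> (\<integral>\<^sup>+y. (\<Sum>v<n. ennreal (b v) * indicator {y. near (x v) y} y) \<partial>D)"
      proof (intro nn_integral_mono)
        fix y
        have "bsum ?Q ?W (\<lambda>E. bsum (star n) (wt w (x(n := y))) (\<lambda>E'. q1 (Suc n) n (x(n := y)) (E \<union> E')))
          \<le> bsum ?Q ?W (\<lambda>E. bsum (star n) (wt w (x(n := y))) (\<lambda>E'. \<Sum>v<n. of_bool (near (x v) y) * of_bool (v \<in> pv n x E)))"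
        proof (rule bsum_mono)
          fix E assume E: "E \<subseteq> ?Q"
          show "bsum (star n) (wt w (x(n := y))) (\<lambda>E'. q1 (Suc n) n (x(n := y)) (E \<union> E'))
            \<le> bsum (star n) (wt w (x(n := y))) (\<lambda>E'. \<Sum>v<n. of_bool (near (x v) y) * of_bool (v \<in> pv n x E))"
          proof (rule bsum_mono)
            fix E' assume "E' \<subseteq> star n"
            then show "q1 (Suc n) n (x(n := y)) (E \<union> E') \<le> (\<Sum>v<n. of_bool (near (x v) y) * of_bool (v \<in> pv n x E))"
              by (rule point[OF E])
          qed (rule wt_range, rule star_in)
        qed (rule wt_range)
        also have "\<dots> = (\<Sum>v<n. of_bool (near (x v) y) * b v)"
          unfolding bsum_const[OF finite_star] bsum_sum bsum_cmult b_def ..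
        finally have "ennreal (bsum ?Q ?W (\<lambda>E. bsum (star n) (wt w (x(n := y))) (\<lambda>E'. q1 (Suc n) n (x(n := y)) (E \<union> E'))))
          \<le> ennreal (\<Sum>v<n. of_bool (near (x v) y) * b v)" by (rule ennreal_leI)
        also have "\<dots> = (\<Sum>v<n. ennreal (of_bool (near (x v) y) * b v))" using b0 by (intro sum_ennreal[symmetric]) auto
        also have "\<dots> = (\<Sum>v<n. ennreal (b v) * indicator {y. near (x v) y} y)"
          by (intro sum.cong) (auto simp: indicator_def)
        finally show "ennreal (bsum ?Q ?W (\<lambda>E. bsum (star n) (wt w (x(n := y))) (\<lambda>E'. q1 (Suc n) n (x(n := y)) (E \<union> E'))))
          \<le> (\<Sum>v<n. ennreal (b v) * indicator {y. near (x v) y} y)" .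
      qed
      also have "\<dots> = (\<Sum>v<n. ennreal (b v) * emeasure D {y. near (x v) y})"
      proof -
        have "{y. near a y} \<in> sets D" for a
          using measurable_compose[OF measurable_Pair[OF measurable_const[of a borel borel] measurable_ident] near_meas] D(2)
          by (simp add: pred_def)
        then show ?thesis
          by (subst nn_integral_sum) (auto intro!: sum.cong nn_integral_cmult_indicator borel_measurable_times_ennreal)
      qed
      also have "\<dots> \<le> (\<Sum>v<n. ennreal (b v) * ennreal (\<kappa> / m))"
        by (intro sum_mono mult_left_mono near_vol) auto
      also have "\<dots> = ennreal (\<kappa> / m) * ennreal (\<Sum>v<n. b v)"
        unfolding sum_distrib_right[symmetric] using b0 by (subst sum_ennreal) (auto simp: mult.commute)
      also have "(\<Sum>v<n. b v) = bsum ?Q ?W (\<lambda>E. real (card (pv n x E)))"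
      proof -
        have c: "(\<Sum>v<n. of_bool (v \<in> pv n x E)) = real (card (pv n x E))" for E
        proof -
          have "{v \<in> {..<n}. v \<in> pv n x E} = pv n x E" by (auto simp: PV_def)
          then show ?thesis unfolding sum_of_bool_card[OF finite_lessThan] by simp
        qed
        show ?thesis unfolding b_def bsum_sum[symmetric] c ..
      qed
      finally show "(\<integral>\<^sup>+y. ennreal (bsum ?Q ?W (\<lambda>E. bsum (star n) (wt w (x(n := y))) (\<lambda>E'. q1 (Suc n) n (x(n := y)) (E \<union> E')))) \<partial>D)
        \<le> ennreal (\<kappa> / m) * ennreal (bsum ?Q ?W (\<lambda>E. real (card (pv n x E))))" .
    qed
    also have "\<dots> = ennreal (\<kappa> / m) * ex {..<n} (\<lambda>_. D) w (\<lambda>x E. real (card (pv n x E)))"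
      unfolding ex_def using D(2) by (intro nn_integral_cmult bsum_wt_measurable'[OF adm_pv]) auto
    finally show "ex {..<Suc n} (\<lambda>_. D) w (q1 (Suc n) n) \<le> ennreal (\<kappa> / m) * ex {..<n} (\<lambda>_. D) w (\<lambda>x E. real (card (pv n x E)))" .
  qed auto
  also have "\<dots> = ennreal \<kappa> * pex m D w (\<lambda>n x E. real (card (pv n x E)))"
  proof -
    have "ennreal m * ennreal (\<kappa> / m) = ennreal \<kappa>" using m pos by (simp add: ennreal_mult[symmetric])
    then show ?thesis unfolding pex_def by (simp add: nn_integral_cmult mult.assoc[symmetric])
  qed
  finally show ?thesis .
qed

definition "C (n::nat) x E = (\<Sum>v<n. \<Sum>j<n. of_bool (near (x v) (x j)) * (of_bool (v \<in> pv n x E) :: real))"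

lemma adm_C: "adm {..<n} (C n)"
  unfolding C_def
proof (intro adm_sum adm_mult adm_near)
  fix v
  show "adm {..<n} (\<lambda>x E. of_bool (v \<in> pv n x E))"
    by (rule adm_mark[where \<Phi>="\<lambda>A B E. of_bool (v \<in> PV {..<n} A B E)"]) auto
qed auto

text \<open>Near points that are not pivotal are counted by \<open>q1\<close>. Near pairs of pivotal
  points reduce to ordered pairs in a common cell: the diagonal gives |P|, the pairs joined by an
  edge lie in \<open>AP\<close>, which gives at most 2|P|, and the pairs without an edge give twice
  \<open>Z\<close>. Hence the coefficients 3 and 2.\<close>

lemma C_le:
  assumes E: "E \<subseteq> pairs {..<n}"
  shows "C n x E \<le> (\<Sum>j<n. q1 n j x E) + (3 * real (card Off) * real (card (pv n x E)) + 2 * real (card Off) * Z n x E)"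
proof -
  let ?P = "pv n x E"
  have fP: "finite ?P" by (simp add: finite_PV)
  have PV: "?P \<subseteq> {..<n}" by (auto simp: PV_def)
  have "C n x E = (\<Sum>v<n. \<Sum>j<n. of_bool (near (x v) (x j)) * of_bool (v \<in> ?P \<and> j \<notin> ?P)) +
     (\<Sum>v<n. \<Sum>j<n. of_bool (near (x v) (x j)) * of_bool (v \<in> ?P \<and> j \<in> ?P))"
    unfolding C_def sum.distrib[symmetric] by (intro sum.cong refl) auto
  also have "(\<Sum>v<n. \<Sum>j<n. of_bool (near (x v) (x j)) * of_bool (v \<in> ?P \<and> j \<notin> ?P)) = (\<Sum>j<n. q1 n j x E)"
    unfolding q1_def by (rule sum.swap)
  also have "(\<Sum>v<n. \<Sum>j<n. of_bool (near (x v) (x j)) * (of_bool (v \<in> ?P \<and> j \<in> ?P) :: real)) =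
     real (card {(v, j) \<in> ?P \<times> ?P. near (x v) (x j)})"
  proof -
    have "{p \<in> {..<n} \<times> {..<n}. near (x (fst p)) (x (snd p)) \<and> fst p \<in> ?P \<and> snd p \<in> ?P} = {(v, j) \<in> ?P \<times> ?P. near (x v) (x j)}"
      using PV by auto
    then show ?thesis unfolding sum.cartesian_product of_bool_conj[symmetric] case_prod_beta
      by (subst sum_of_bool_card) (simp_all add: case_prod_beta)
  qed
  finally have C: "C n x E = (\<Sum>j<n. q1 n j x E) + real (card {(v, j) \<in> ?P \<times> ?P. near (x v) (x j)})" .
  let ?W = "{e \<in> pairs {..<n}. same x e \<and> e \<subseteq> ?P \<and> e \<notin> E}"
  let ?U = "{e \<in> pairs ?P. \<forall>i\<in>e. \<forall>j\<in>e. cellf (x i) = cellf (x j)}"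
  have 1: "card {(v, j) \<in> ?P \<times> ?P. near (x v) (x j)} \<le> card Off * card {(v, j) \<in> ?P \<times> ?P. cellf (x v) = cellf (x j)}"
    by (rule near_pairs_le[OF fP Off(1), of "\<lambda>v j. near (x v) (x j)" "\<lambda>v. cellf (x v)"]) (rule Off(2))
  have 2: "card {(v, j) \<in> ?P \<times> ?P. cellf (x v) = cellf (x j)} \<le> card ?P + 2 * card ?U"
    by (rule ordered_pairs_le[OF fP, of "\<lambda>v. cellf (x v)"])
  have "?U \<subseteq> ap n x E \<union> ?W"
  proof
    fix e assume e: "e \<in> ?U"
    then have eP: "e \<in> pairs ?P" unfolding mem_Collect_eq by (rule conjunct1)
    then obtain u v where uv: "u \<in> ?P" "v \<in> ?P" "u \<noteq> v" "e = {u, v}" unfolding pairs_def by auto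
    have "same x e" using e unfolding same_def mem_Collect_eq by (rule conjunct2)
    moreover have "e \<in> pairs {..<n}" using eP pairs_mono[OF PV] by (rule rev_subsetD)
    moreover have "e \<subseteq> ?P" using uv by simp
    moreover have "e \<in> E \<Longrightarrow> e \<in> ap n x E" using uv unfolding AP_def by (intro CollectI conjI bexI[of _ u] bexI[of _ v])
    ultimately show "e \<in> ap n x E \<union> ?W" by blast
  qed
  then have "card ?U \<le> card (ap n x E \<union> ?W)" by (intro card_mono) (simp_all add: finite_AP)
  also have "\<dots> \<le> card (ap n x E) + card ?W" by (rule card_Un_le)
  finally have 3: "card ?U \<le> card (ap n x E) + card ?W" .
  have 4: "card (ap n x E) \<le> card ?P"
  proof (cases "?P = {}")
    case True
    then have "ap n x E = {}" unfolding AP_def by blast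
    then show ?thesis by simp
  qed (use card_AP_less[of "{..<n}" "mk {..<n} x S" "mk {..<n} x T" E] in simp)
  have "card {(v, j) \<in> ?P \<times> ?P. near (x v) (x j)} \<le> card Off * (3 * card ?P + 2 * card ?W)"
    by (rule order_trans[OF 1], rule mult_left_mono) (use 2 3 4 in linarith)+
  then have "real (card {(v, j) \<in> ?P \<times> ?P. near (x v) (x j)}) \<le> real (card Off * (3 * card ?P + 2 * card ?W))"
    by (simp only: of_nat_le_iff)
  also have "\<dots> = real (card Off) * (3 * real (card ?P) + 2 * real (card ?W))" by simp
  also have "real (card ?W) = Z n x E"
    unfolding Z_def of_bool_conj[symmetric] sum_of_bool_card[OF finite_pairs[OF finite_lessThan]] ..
  finally show ?thesis unfolding C by (simp add: algebra_simps)
qed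

end

lemma nat_pair_Min_Max:
  assumes "e \<in> pairs (V :: nat set)"
  shows "e = {Min e, Max e}" "Min e \<noteq> Max e" "Min e \<in> V" "Max e \<in> V" "card e = 2"
proof -
  obtain i j where ij: "i \<in> V" "j \<in> V" "i \<noteq> j" "e = {i, j}" using assms unfolding pairs_def by auto
  have "Min e = min i j" "Max e = max i j" unfolding ij(4) by (simp_all add: min_def max_def)
  then show "e = {Min e, Max e}" "Min e \<noteq> Max e" "Min e \<in> V" "Max e \<in> V" "card e = 2"
    using ij by (auto simp: min_def max_def)
qed

text \<open>Deleting the planted vertex restores the old graph, in which \<open>e\<close> is
  pivotal; so a vertex joined to the two ends of \<open>e\<close> and to nothing else is a detour
  vertex.\<close>

lemma new_detour:
  assumes E: "E \<subseteq> pairs {..<n}" and e: "e \<in> PE {..<n} (mk {..<n} x S) (mk {..<n} x T) E" and y: "y \<notin> S \<union> T"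
  shows "n \<in> detour {..<Suc n} (mk {..<Suc n} (x(n := y)) S) (mk {..<Suc n} (x(n := y)) T) (E \<union> (\<lambda>i. {i, n}) ` e)"
proof -
  let ?g = "\<lambda>i. {i, n}"
  have eE: "e \<in> E" using e by (simp add: PE_def)
  then have ep: "e \<in> pairs {..<n}" using E by (rule rev_subsetD)
  then have en: "e \<subseteq> {..<n}" using pairs_subset_Pow[of "{..<n}"] by blast
  have st: "?g ` e \<subseteq> star n" unfolding star_def using en by (rule image_mono)
  have n: "{..<Suc n} - {n} = {..<n}" by auto
  have nE: "{n, i} \<notin> E" for i
  proof
    assume "{n, i} \<in> E"
    then have "{n, i} \<in> pairs {..<n}" using E by (rule rev_subsetD)
    then show False by simp
  qed
  have A: "{i \<in> {..<Suc n}. {n, i} \<in> E \<union> ?g ` e} = e"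
  proof (intro equalityI subsetI)
    fix i assume "i \<in> {i \<in> {..<Suc n}. {n, i} \<in> E \<union> ?g ` e}"
    then have "{n, i} \<in> ?g ` e" using nE by simp
    then obtain j where "j \<in> e" "{n, i} = {j, n}" by auto
    moreover have "j \<noteq> n" using \<open>j \<in> e\<close> en by auto
    ultimately show "i \<in> e" by (auto simp: doubleton_eq_iff)
  next
    fix i assume i: "i \<in> e"
    then have "i < Suc n" using en by auto
    moreover have "{n, i} \<in> ?g ` e" using imageI[OF i, of ?g] by (simp add: insert_commute)
    ultimately show "i \<in> {i \<in> {..<Suc n}. {n, i} \<in> E \<union> ?g ` e}" by simp
  qed
  have eg: "e \<notin> ?g ` e" using en by auto
  then have min: "E \<union> ?g ` e - {e} = (E - {e}) \<union> ?g ` e" by blast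
  have E': "E - {e} \<subseteq> pairs {..<n}" using E by blast
  have "e \<in> PE {..<n} (mk {..<Suc n} (x(n := y)) S) (mk {..<Suc n} (x(n := y)) T) (E \<union> ?g ` e)"
    using e unfolding PE_def mem_Collect_eq min conn_new_vertex[OF E st order_refl] conn_new_vertex[OF E' st order_refl] by simp
  then show ?thesis unfolding detour_iff_card A n using nat_pair_Min_Max(5)[OF ep] y by (simp add: mk_def)
qed

section \<open>Vertex insertion and the bound for pivotal vertices\<close>

context pivotal begin

definition "q2 (n::nat) i x E = (of_bool (i \<in> detour {..<n} (mk {..<n} x S) (mk {..<n} x T) E) :: real)"

text \<open>The pivotal edges over which a vertex can be planted, as the properties of
  \<open>Rg\<close> are guaranteed only for unmarked ends.\<close>

definition "pe0 (n::nat) x E = {e \<in> pe n x E. e \<inter> (mk {..<n} x S \<union> mk {..<n} x T) = {}}"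

text \<open>A lower bound for the probability that a vertex planted over \<open>e\<close> has no
  unwanted edge: points near both ends are missed with probability at least \<open>\<theta>\<close>,
  and all others are out of range. The ends of \<open>e\<close> may contribute factors too, which
  only lowers the bound.\<close>

definition "ke (n::nat) x e = (\<Prod>j<n. if \<forall>i\<in>e. near (x i) (x j) then \<theta> else 1)"

definition "X (n::nat) x E = (\<Sum>e\<in>pairs {..<n}. ke n x e * (of_bool (e \<in> pe0 n x E) :: real))"

lemma adm_q2: "adm {..<n} (q2 n i)"
  unfolding q2_def
  by (rule adm_mark[where \<Phi>="\<lambda>A B E. of_bool (i \<in> detour {..<n} A B E)"]) auto

lemma ke_bounds: "0 \<le> ke n x e" "ke n x e \<le> 1"
  unfolding ke_def using pos by (auto intro!: prod_nonneg prod_le_1)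

lemma adm_ke: "e \<in> pairs {..<n} \<Longrightarrow> adm {..<n} (\<lambda>x E. ke n x e)"
proof -
  assume e: "e \<in> pairs {..<n}"
  have "(\<lambda>x. ke n x e) \<in> borel_measurable (PiM {..<n} (\<lambda>_. borel))"
    unfolding ke_def
  proof (intro borel_measurable_prod)
    fix j assume j: "j \<in> {..<n}"
    have p: "(\<forall>i\<in>e. near (x i) (x j)) \<longleftrightarrow> near (x (Min e)) (x j) \<and> near (x (Max e)) (x j)" for x
      by (subst nat_pair_Min_Max(1)[OF e]) simp
    have "Measurable.pred (PiM {..<n} (\<lambda>_. borel)) (\<lambda>x. near (x (Min e)) (x j) \<and> near (x (Max e)) (x j))"
      using nat_pair_Min_Max(3,4)[OF e] j
      by (intro pred_intros_logic adm_pair_pred[OF near_meas])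
    then show "(\<lambda>x. if \<forall>i\<in>e. near (x i) (x j) then \<theta> else 1) \<in> borel_measurable (PiM {..<n} (\<lambda>_. borel))"
      unfolding p by (intro measurable_If) auto
  qed
  then show ?thesis unfolding adm_def using ke_bounds by blast
qed

lemma adm_X: "adm {..<n} (X n)"
  unfolding X_def
proof (intro adm_sum adm_mult adm_ke)
  fix e
  show "adm {..<n} (\<lambda>x E. of_bool (e \<in> pe0 n x E))"
    unfolding pe0_def
    by (rule adm_mark[where \<Phi>="\<lambda>A B E. of_bool (e \<in> {e \<in> PE {..<n} A B E. e \<inter> (A \<union> B) = {}})"]) auto
qed

lemma sum_q2_le: "(\<Sum>i<n. q2 n i x E) \<le> NE n x E"
proof -
  let ?d = "detour {..<n} (mk {..<n} x S) (mk {..<n} x T) E"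
  have "{i \<in> {..<n}. i \<in> ?d} = ?d" unfolding detour_def by blast
  then have "(\<Sum>i<n. q2 n i x E) = real (card ?d)"
    unfolding q2_def sum_of_bool_card[OF finite_lessThan] by simp
  also have "\<dots> \<le> NE n x E"
    unfolding NE_def of_nat_le_iff by (rule card_detour_le) simp
  finally show ?thesis .
qed

text \<open>The right-hand side is the probability that a vertex at \<open>y\<close> is joined to
  the two ends of \<open>e\<close> and to nothing else.\<close>

lemma detour_weight:
  assumes e: "e \<in> pairs {..<n}" and ok: "x (Min e) \<notin> S \<union> T" "x (Max e) \<notin> S \<union> T" "0 < w (x (Min e)) (x (Max e))"
    and y: "y \<in> Rg (x (Min e)) (x (Max e))"
  shows "w1\<^sup>2 * ke n x e \<le> (\<Prod>i\<in>e. w (x i) y) * (\<Prod>i\<in>{..<n} - e. 1 - w (x i) y)"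
proof (rule mult_mono)
  note ee = nat_pair_Min_Max[OF e]
  have R: "w1 \<le> w (x (Min e)) y" "w1 \<le> w (x (Max e)) y"
    and R2: "\<And>z. 0 < w z y \<Longrightarrow> near (x (Min e)) z \<and> near (x (Max e)) z"
    using Rg[OF ok] y by auto
  have "(\<Prod>i\<in>e. w (x i) y) = (\<Prod>i\<in>{Min e, Max e}. w (x i) y)" using ee(1) by simp
  also have "\<dots> = w (x (Min e)) y * w (x (Max e)) y" using ee(2) by simp
  finally have "(\<Prod>i\<in>e. w (x i) y) = w (x (Min e)) y * w (x (Max e)) y" .
  then show "w1\<^sup>2 \<le> (\<Prod>i\<in>e. w (x i) y)"
    unfolding power2_eq_square using R pos by (simp add: mult_mono w_nonneg)
  let ?c = "\<lambda>j. if \<forall>i\<in>e. near (x i) (x j) then \<theta> else 1"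
  have en: "e \<subseteq> {..<n}" using e pairs_subset_Pow[of "{..<n}"] by blast
  have "ke n x e = (\<Prod>j\<in>{..<n} - e. ?c j) * (\<Prod>j\<in>e. ?c j)"
    unfolding ke_def by (rule prod.subset_diff[OF en finite_lessThan])
  also have "\<dots> \<le> (\<Prod>j\<in>{..<n} - e. ?c j) * 1"
    using pos by (intro mult_left_mono prod_le_1 prod_nonneg) auto
  also have "\<dots> \<le> (\<Prod>i\<in>{..<n} - e. 1 - w (x i) y)"
    unfolding mult_1_right
  proof (intro prod_mono conjI)
    fix j
    show "0 \<le> ?c j" using pos by simp
    show "?c j \<le> 1 - w (x j) y"
    proof (cases "0 < w (x j) y")
      case True
      have "\<forall>i\<in>{Min e, Max e}. near (x i) (x j)" using R2[OF True] by simp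
      then have "\<forall>i\<in>e. near (x i) (x j)" using ee(1) by simp
      then show ?thesis using w_le[of "x j" y] by simp
    next
      case False
      then have "w (x j) y = 0" using w_nonneg[of "x j" y] by linarith
      then show ?thesis using pos by simp
    qed
  qed
  finally show "ke n x e \<le> (\<Prod>i\<in>{..<n} - e. 1 - w (x i) y)" .
qed (auto intro!: prod_nonneg simp: w_nonneg ke_bounds)

text \<open>For different edges \<open>e\<close> the events that the new vertex has exactly the
  neighbours \<open>e\<close> are disjoint. Their probabilities therefore add up to at most the
  probability that the new vertex is a detour vertex.\<close>

lemma vertex_insertion_pointwise:
  fixes x :: "nat \<Rightarrow> 'a"
  assumes E: "E \<subseteq> pairs {..<n}"
    and G: "G \<subseteq> pairs {..<n}" "\<And>e. e \<in> G \<Longrightarrow> x (Min e) \<notin> S \<union> T \<and> x (Max e) \<notin> S \<union> T \<and> 0 < w (x (Min e)) (x (Max e))"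
  shows "(\<Sum>e\<in>G. w1\<^sup>2 * ke n x e * indicator (Rg (x (Min e)) (x (Max e))) y * of_bool (e \<in> pe0 n x E))
    \<le> bsum (star n) (wt w (x(n := y))) (\<lambda>E'. q2 (Suc n) n (x(n := y)) (E \<union> E'))"
proof -
  let ?g = "\<lambda>i. {i, n}"
  let ?W = "\<lambda>J. (\<Prod>i\<in>J. w (x i) y) * (\<Prod>i\<in>{..<n} - J. 1 - w (x i) y)"
  let ?q = "\<lambda>J. q2 (Suc n) n (x(n := y)) (E \<union> ?g ` J)"
  define G' where "G' = {e \<in> G. e \<in> pe0 n x E \<and> y \<in> Rg (x (Min e)) (x (Max e))}"
  have fG: "finite G" using G(1) finite_subset[of G "pairs {..<n}"] by simp
  have q0: "0 \<le> q2 k i z F" for k i z F by (simp add: q2_def)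
  have W0: "0 \<le> ?W J" for J by (intro mult_nonneg_nonneg prod_nonneg) (auto simp: w_nonneg w_le1)
  have "(\<Sum>e\<in>G. w1\<^sup>2 * ke n x e * indicator (Rg (x (Min e)) (x (Max e))) y * of_bool (e \<in> pe0 n x E)) =
    (\<Sum>e\<in>G'. w1\<^sup>2 * ke n x e)"
    unfolding G'_def sum.inter_filter[OF fG] by (intro sum.cong refl) (auto simp: indicator_def)
  also have "\<dots> \<le> (\<Sum>J\<in>G'. ?W J * ?q J)"
  proof (intro sum_mono)
    fix e assume e: "e \<in> G'"
    then have eG: "e \<in> G" and e0: "e \<in> pe0 n x E" and y: "y \<in> Rg (x (Min e)) (x (Max e))"
      unfolding G'_def mem_Collect_eq by simp_all
    have ep: "e \<in> pairs {..<n}" using eG G(1) by (rule rev_subsetD)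
    note ok = G(2)[OF eG]
    have "y \<notin> S \<union> T" using Rg[of "x (Min e)" "x (Max e)"] ok y by blast
    moreover have "e \<in> pe n x E" using e0 by (simp add: pe0_def)
    ultimately have "?q e = 1" unfolding q2_def using new_detour[OF E, of e x S T y] by simp
    then show "w1\<^sup>2 * ke n x e \<le> ?W e * ?q e" using detour_weight[OF ep _ _ _ y] ok by simp
  qed
  also have "\<dots> \<le> (\<Sum>J\<in>Pow {..<n}. ?W J * ?q J)"
  proof (intro sum_mono2)
    show "G' \<subseteq> Pow {..<n}" using G(1) pairs_subset_Pow[of "{..<n}"] unfolding G'_def by blast
  qed (use W0 q0 in \<open>auto intro!: mult_nonneg_nonneg simp del: mult_eq_0_iff\<close>)
  also have "\<dots> = bsum {..<n} (\<lambda>i. w (x i) y) ?q" unfolding bsum_def ..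
  also have "\<dots> = bsum {..<n} (\<lambda>i. wt w (x(n := y)) {i, n}) ?q" by (intro bsum_cong) auto
  also have "\<dots> = bsum (star n) (wt w (x(n := y))) (\<lambda>E'. q2 (Suc n) n (x(n := y)) (E \<union> E'))"
    unfolding star_image ..
  finally show ?thesis .
qed

text \<open>With the old graph fixed, the new position is integrated over \<open>Rg\<close>, whose
  measure is at least \<open>c0 / m\<close>; the two desired edges give the factor
  \<open>w1\<^sup>2\<close>.\<close>

lemma vertex_insertion_ex:
  "ennreal (c0 * w1\<^sup>2 / m) * ex {..<n} (\<lambda>_. D) w (X n) \<le> ex {..<Suc n} (\<lambda>_. D) w (q2 (Suc n) n)"
proof -
  have "ennreal (c0 * w1\<^sup>2 / m) * ex {..<n} (\<lambda>_. D) w (X n) =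
     (\<integral>\<^sup>+x. ennreal (c0 * w1\<^sup>2 / m) * ennreal (bsum (pairs {..<n}) (wt w x) (X n x)) \<partial>PiM {..<n} (\<lambda>_. D))"
    unfolding ex_def using D(2) by (intro nn_integral_cmult[symmetric] bsum_wt_measurable'[OF adm_X]) auto
  also have "\<dots> \<le> (\<integral>\<^sup>+x. \<integral>\<^sup>+y. ennreal (bsum (pairs {..<n}) (wt w x)
       (\<lambda>E. bsum (star n) (wt w (x(n := y))) (\<lambda>E'. q2 (Suc n) n (x(n := y)) (E \<union> E')))) \<partial>D \<partial>PiM {..<n} (\<lambda>_. D))"
  proof (intro nn_integral_mono)
    fix x :: "nat \<Rightarrow> 'a"
    let ?Q = "pairs {..<n}" and ?W = "wt w x"
    let ?R = "\<lambda>e. Rg (x (Min e)) (x (Max e))"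
    \<comment> \<open>The edges to which the properties of \<open>Rg\<close> apply. They include
      every edge of \<open>pe0\<close> with positive weight, so \<open>bsum_mono_pos\<close> reduces
      \<open>X\<close> to a sum over \<open>G\<close>.\<close>
    define G where "G = {e \<in> ?Q. x (Min e) \<notin> S \<union> T \<and> x (Max e) \<notin> S \<union> T \<and> 0 < w (x (Min e)) (x (Max e))}"
    have GQ: "G \<subseteq> ?Q" by (auto simp: G_def)
    have fG: "finite G" using GQ finite_subset[of G ?Q] by simp
    have GR: "?R e \<in> sets borel" "ennreal (c0 / m) \<le> emeasure D (?R e)" if "e \<in> G" for e
      using that Rg[of "x (Min e)" "x (Max e)"] by (auto simp: G_def)
    define b where "b e = w1\<^sup>2 * ke n x e * bsum ?Q ?W (\<lambda>E. of_bool (e \<in> pe0 n x E))" for e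
    have b0: "0 \<le> b e" for e
      unfolding b_def by (intro mult_nonneg_nonneg ke_bounds bsum_nonneg wt_range) auto
    have "bsum ?Q ?W (X n x) \<le> bsum ?Q ?W (\<lambda>E. \<Sum>e\<in>G. ke n x e * of_bool (e \<in> pe0 n x E))"
    proof (rule bsum_mono_pos)
      fix E assume E: "E \<subseteq> ?Q" "\<And>e. e \<in> E \<Longrightarrow> 0 < ?W e"
      have "X n x E = (\<Sum>e\<in>G. ke n x e * of_bool (e \<in> pe0 n x E))"
        unfolding X_def
      proof (rule sum.mono_neutral_right[OF _ GQ])
        show "\<forall>e\<in>?Q - G. ke n x e * of_bool (e \<in> pe0 n x E) = 0"
        proof
          fix e assume e: "e \<in> ?Q - G"
          have "e \<notin> pe0 n x E"
          proof
            assume e0: "e \<in> pe0 n x E"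
            note ee = nat_pair_Min_Max[of e "{..<n}"]
            have eE: "e \<in> E" using e0 by (auto simp: pe0_def PE_def)
            have "?W {Min e, Max e} > 0" using E(2)[OF eE] ee(1) e by auto
            moreover have "Min e \<in> e" "Max e \<in> e" using ee(1) e by blast+
            then have "x (Min e) \<notin> S \<union> T \<and> x (Max e) \<notin> S \<union> T"
              using e0 ee(3,4) e by (auto simp: pe0_def mk_def)
            ultimately show False using e by (auto simp: G_def)
          qed
          then show "ke n x e * of_bool (e \<in> pe0 n x E) = 0" by simp
        qed
      qed simp
      then show "X n x E \<le> (\<Sum>e\<in>G. ke n x e * of_bool (e \<in> pe0 n x E))" by simp
    qed (rule wt_range, simp_all)
    then have 1: "w1\<^sup>2 * bsum ?Q ?W (X n x) \<le> (\<Sum>e\<in>G. b e)"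
      unfolding bsum_sum bsum_cmult b_def using pos
      by (simp add: mult.assoc sum_distrib_left[symmetric] mult_left_mono)
    have "ennreal (c0 * w1\<^sup>2 / m) * ennreal (bsum ?Q ?W (X n x)) = ennreal (c0 / m) * ennreal (w1\<^sup>2 * bsum ?Q ?W (X n x))"
      using pos m bsum_wt_nonneg[OF adm_X, of n x] by (simp add: ennreal_mult[symmetric] field_simps)
    also have "\<dots> \<le> ennreal (c0 / m) * ennreal (\<Sum>e\<in>G. b e)"
      using 1 by (intro mult_left_mono ennreal_leI) auto
    also have "\<dots> = (\<Sum>e\<in>G. ennreal (b e) * ennreal (c0 / m))"
    proof -
      have "ennreal (\<Sum>e\<in>G. b e) = (\<Sum>e\<in>G. ennreal (b e))" using b0 by (intro sum_ennreal[symmetric])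
      then show ?thesis by (simp only: sum_distrib_left mult.commute)
    qed
    also have "\<dots> \<le> (\<Sum>e\<in>G. ennreal (b e) * emeasure D (?R e))"
      using GR(2) by (intro sum_mono mult_left_mono) auto
    also have "\<dots> = (\<integral>\<^sup>+y. (\<Sum>e\<in>G. ennreal (b e) * indicator (?R e) y) \<partial>D)"
    proof -
      have "(\<integral>\<^sup>+y. (\<Sum>e\<in>G. ennreal (b e) * indicator (?R e) y) \<partial>D) = (\<Sum>e\<in>G. \<integral>\<^sup>+y. ennreal (b e) * indicator (?R e) y \<partial>D)"
        using GR(1) D(2) by (intro nn_integral_sum) auto
      also have "\<dots> = (\<Sum>e\<in>G. ennreal (b e) * emeasure D (?R e))"
        using GR(1) D(2) by (intro sum.cong refl nn_integral_cmult_indicator) auto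
      finally show ?thesis ..
    qed
    also have "\<dots> \<le> (\<integral>\<^sup>+y. ennreal (bsum ?Q ?W
       (\<lambda>E. bsum (star n) (wt w (x(n := y))) (\<lambda>E'. q2 (Suc n) n (x(n := y)) (E \<union> E')))) \<partial>D)"
    proof (intro nn_integral_mono)
      fix y
      have "(\<Sum>e\<in>G. ennreal (b e) * indicator (?R e) y) = (\<Sum>e\<in>G. ennreal (b e * indicator (?R e) y))"
        by (intro sum.cong) (auto simp: indicator_def)
      also have "\<dots> = ennreal (\<Sum>e\<in>G. b e * indicator (?R e) y)" using b0 by (intro sum_ennreal) auto
      also have "(\<Sum>e\<in>G. b e * indicator (?R e) y) =
        bsum ?Q ?W (\<lambda>E. \<Sum>e\<in>G. w1\<^sup>2 * ke n x e * indicator (?R e) y * of_bool (e \<in> pe0 n x E))"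
        unfolding bsum_sum bsum_cmult b_def by (intro sum.cong refl) simp
      also have "ennreal \<dots> \<le> ennreal (bsum ?Q ?W (\<lambda>E. bsum (star n) (wt w (x(n := y))) (\<lambda>E'. q2 (Suc n) n (x(n := y)) (E \<union> E'))))"
      proof (rule ennreal_leI, rule bsum_mono)
        fix E assume "E \<subseteq> ?Q"
        then show "(\<Sum>e\<in>G. w1\<^sup>2 * ke n x e * indicator (?R e) y * of_bool (e \<in> pe0 n x E)) \<le>
          bsum (star n) (wt w (x(n := y))) (\<lambda>E'. q2 (Suc n) n (x(n := y)) (E \<union> E'))"
          by (rule vertex_insertion_pointwise[OF _ GQ]) (simp add: G_def)
      qed (rule wt_range)
      finally show "(\<Sum>e\<in>G. ennreal (b e) * indicator (?R e) y) \<le> ennreal (bsum ?Q ?W (\<lambda>E. bsum (star n) (wt w (x(n := y))) (\<lambda>E'. q2 (Suc n) n (x(n := y)) (E \<union> E'))))" .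
    qed
    finally show "ennreal (c0 * w1\<^sup>2 / m) * ennreal (bsum ?Q ?W (X n x)) \<le> (\<integral>\<^sup>+y. ennreal (bsum ?Q ?W
       (\<lambda>E. bsum (star n) (wt w (x(n := y))) (\<lambda>E'. q2 (Suc n) n (x(n := y)) (E \<union> E')))) \<partial>D)" .
  qed
  also have "\<dots> = ex {..<Suc n} (\<lambda>_. D) w (q2 (Suc n) n)"
    by (rule ex_Suc[OF D adm_q2, symmetric])
  finally show ?thesis .
qed

text \<open>The Mecke formula turns the planted last point into a sum over all points, which is the
  number of detour vertices; these inject into \<open>AP - PE\<close>.\<close>

lemma vertex_insertion: "ennreal (c0 * w1\<^sup>2) * pex m D w X \<le> pex m D w NE"
proof -
  have "ennreal (c0 * w1\<^sup>2) = ennreal m * ennreal (c0 * w1\<^sup>2 / m)"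
    using m pos by (simp add: ennreal_mult[symmetric])
  then have "ennreal (c0 * w1\<^sup>2) * pex m D w X =
     ennreal m * (\<integral>\<^sup>+n. ennreal (c0 * w1\<^sup>2 / m) * ex {..<n} (\<lambda>_. D) w (X n) \<partial>measure_pmf (poisson_pmf m))"
    unfolding pex_def by (simp add: nn_integral_cmult mult.assoc)
  also have "\<dots> \<le> ennreal m * (\<integral>\<^sup>+n. ex {..<Suc n} (\<lambda>_. D) w (q2 (Suc n) n) \<partial>measure_pmf (poisson_pmf m))"
    by (intro mult_left_mono nn_integral_mono vertex_insertion_ex) auto
  also have "\<dots> = pex m D w (\<lambda>n x E. \<Sum>i<n. q2 n i x E)"
  proof (rule mecke[OF D m, symmetric])
    fix n i and x :: "nat \<Rightarrow> 'a" and E assume i: "i \<le> n" and E: "E \<subseteq> pairs {..<Suc n}"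
    let ?t = "Transposition.transpose i n"
    define x' where "x' = (\<lambda>j\<in>{..<Suc n}. x (?t j))"
    note t = transpose_relabel[OF i x'_def]
    have "?t i \<in> detour (?t ` {..<Suc n}) (?t ` mk {..<Suc n} x S) (?t ` mk {..<Suc n} x T) ((`) ?t ` E)
      \<longleftrightarrow> i \<in> detour {..<Suc n} (mk {..<Suc n} x S) (mk {..<Suc n} x T) E"
      using i by (intro detour_image_iff[OF t(1) E mk_subset mk_subset order_refl]) simp
    then have "q2 (Suc n) n x' ((`) ?t ` E) = q2 (Suc n) i x E"
      unfolding q2_def t(2) t(3)[symmetric] by simp
    then show "q2 (Suc n) n (\<lambda>j\<in>{..<Suc n}. x (?t j)) ((`) ?t ` E) = q2 (Suc n) i x E" unfolding x'_def .
  qed (rule adm_q2)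
  also have "\<dots> \<le> pex m D w NE" by (intro pex_mono sum_q2_le)
  finally show ?thesis .
qed

text \<open>A point near both ends of an edge is near the end selected by
  \<open>AP_head_map\<close>. As the selection is injective, crowding around edges is bounded by
  crowding around pivotal vertices.\<close>

lemma sum_near_pe0:
  "(\<Sum>e\<in>pe0 n x E. real (card {j \<in> {..<n}. \<forall>i\<in>e. near (x i) (x j)})) \<le> C n x E"
proof -
  obtain \<phi> where \<phi>: "inj_on \<phi> (ap n x E)" "\<forall>e\<in>ap n x E. \<phi> e \<in> e" "\<phi> ` ap n x E \<subseteq> pv n x E"
    using AP_head_map[of "{..<n}" "mk {..<n} x S" "mk {..<n} x T" E] by blast
  have sub: "pe0 n x E \<subseteq> ap n x E" using PE_subset_AP unfolding pe0_def by blast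
  have inj: "inj_on \<phi> (pe0 n x E)" by (rule inj_on_subset[OF \<phi>(1) sub])
  have img: "\<phi> ` pe0 n x E \<subseteq> pv n x E" using \<phi>(3) image_mono[OF sub, of \<phi>] by (rule order_trans[rotated])
  let ?N = "\<lambda>v. real (card {j \<in> {..<n}. near (x v) (x j)})"
  have "(\<Sum>e\<in>pe0 n x E. real (card {j \<in> {..<n}. \<forall>i\<in>e. near (x i) (x j)})) \<le> (\<Sum>e\<in>pe0 n x E. ?N (\<phi> e))"
  proof (intro sum_mono, unfold of_nat_le_iff, rule card_mono)
    fix e assume "e \<in> pe0 n x E"
    then have "\<phi> e \<in> e" using \<phi>(2) sub by blast
    then show "{j \<in> {..<n}. \<forall>i\<in>e. near (x i) (x j)} \<subseteq> {j \<in> {..<n}. near (x (\<phi> e)) (x j)}" by blast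
  qed simp
  also have "\<dots> = (\<Sum>v\<in>\<phi> ` pe0 n x E. ?N v)" by (simp add: sum.reindex[OF inj])
  also have "\<dots> \<le> (\<Sum>v\<in>pv n x E. ?N v)" by (intro sum_mono2 img) (simp_all add: finite_PV)
  also have "\<dots> = (\<Sum>v<n. ?N v * of_bool (v \<in> pv n x E))"
  proof -
    have "pv n x E \<subseteq> {..<n}" by (auto simp: PV_def)
    then show ?thesis by (intro sum.mono_neutral_cong_left) auto
  qed
  also have "\<dots> = C n x E"
    unfolding C_def sum_distrib_right[symmetric] sum_of_bool_card[OF finite_lessThan] ..
  finally show ?thesis .
qed

text \<open>An edge with at most \<open>k\<close> points near both ends has \<open>ke\<close> at
  least \<open>\<theta> ^ k\<close>; an edge with more is outweighed by its crowding divided by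
  \<open>k\<close>. The coefficient 3 consists of |PV| - |PE| itself and the at most two pivotal
  edges at marks, which are paid by the strict inequality in \<open>NE_le_Df\<close>.\<close>

lemma card_pv_le:
  assumes E: "E \<subseteq> pairs {..<n}" and k: "0 < (k::nat)"
  shows "real (card (pv n x E)) \<le> 3 * Df n x E + (1 / \<theta> ^ k * X n x E + 1 / real k * C n x E)"
proof -
  let ?N = "\<lambda>e. card {j \<in> {..<n}. \<forall>i\<in>e. near (x i) (x j)}"
  have f0: "finite (pe0 n x E)" unfolding pe0_def by (simp add: finite_PE)
  have ke: "ke n x e = \<theta> ^ ?N e" for e
    unfolding ke_def by (simp add: prod.If_cases Int_def)
  have one: "1 \<le> 1 / \<theta> ^ k * ke n x e + 1 / real k * real (?N e)" for e
  proof (cases "?N e \<le> k")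
    case True
    have "\<theta> ^ k \<le> \<theta> ^ ?N e" using pos True by (intro power_decreasing) auto
    then have "1 \<le> 1 / \<theta> ^ k * ke n x e" unfolding ke using pos by (simp add: field_simps)
    moreover have "0 \<le> 1 / real k * real (?N e)" by simp
    ultimately show ?thesis by linarith
  next
    case False
    then have "1 \<le> 1 / real k * real (?N e)" using k by (simp add: field_simps)
    moreover have "0 \<le> 1 / \<theta> ^ k * ke n x e" using pos ke_bounds(1)[of n x e] by simp
    ultimately show ?thesis by linarith
  qed
  have "real (card (pe0 n x E)) = (\<Sum>e\<in>pe0 n x E. 1)" by simp
  also have "\<dots> \<le> (\<Sum>e\<in>pe0 n x E. 1 / \<theta> ^ k * ke n x e + 1 / real k * real (?N e))" by (intro sum_mono one)
  also have "\<dots> = 1 / \<theta> ^ k * (\<Sum>e\<in>pe0 n x E. ke n x e) + 1 / real k * (\<Sum>e\<in>pe0 n x E. real (?N e))"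
    unfolding sum.distrib sum_distrib_left ..
  also have "(\<Sum>e\<in>pe0 n x E. ke n x e) = X n x E"
  proof -
    have "pe0 n x E \<subseteq> pairs {..<n}" using E by (auto simp: pe0_def PE_def)
    then show ?thesis unfolding X_def by (intro sum.mono_neutral_cong_left) auto
  qed
  also have "1 / \<theta> ^ k * X n x E + 1 / real k * (\<Sum>e\<in>pe0 n x E. real (?N e)) \<le> 1 / \<theta> ^ k * X n x E + 1 / real k * C n x E"
    using sum_near_pe0[of n x E] by (intro add_left_mono mult_left_mono) auto
  finally have A: "real (card (pe0 n x E)) \<le> 1 / \<theta> ^ k * X n x E + 1 / real k * C n x E" .
  let ?M = "{e \<in> pe n x E. e \<inter> (mk {..<n} x S \<union> mk {..<n} x T) \<noteq> {}}"
  have "pe n x E = pe0 n x E \<union> ?M" unfolding pe0_def by blast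
  then have "card (pe n x E) \<le> card (pe0 n x E) + card ?M" using card_Un_le[of "pe0 n x E" ?M] by simp
  moreover have "real (card ?M) \<le> 2 * of_bool (pv n x E \<noteq> {})"
  proof (cases "pv n x E = {}")
    case True
    then have "ap n x E = {}" unfolding AP_def by blast
    then have "pe n x E = {}" using PE_subset_AP by blast
    then show ?thesis by simp
  next
    case False
    then show ?thesis using card_PE_marked[of "{..<n}" "mk {..<n} x S" "mk {..<n} x T" E] by simp
  qed
  moreover have "of_bool (pv n x E \<noteq> {}) \<le> Df n x E"
    using NE_le_Df[of n x E] by (simp add: NE_def)
  moreover have "real (card (pv n x E)) = Df n x E + real (card (pe n x E))" by (simp add: Df_def)
  ultimately show ?thesis using A by linarith
qed

text \<open>For \<open>k\<close> this large, the crowding term returns at most half of E|PV|, which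
  is moved to the left side. Everything else is a multiple of E(|PV| - |PE|); this is the fixed
  proportion that yields the exponent of the curve.\<close>

theorem pivotal_bound:
  assumes k: "0 < (k::nat)" "2 * (\<kappa> + 3 * real (card Off)) \<le> real k"
  shows "pex m D w (\<lambda>n x E. real (card (pv n x E))) \<le>
    ennreal (2 * (3 + 1 / (\<theta> ^ k * (c0 * w1\<^sup>2)) + 2 * real (card Off) / (w0 * real k))) * pex m D w Df"
proof -
  let ?P = "pex m D w (\<lambda>n x E. real (card (pv n x E)))" and ?D = "pex m D w Df" and ?K = "real (card Off)"
  have NE: "pex m D w NE \<le> ?D"
  proof (rule pex_mono)
    fix n :: nat and x and E :: "nat set set"
    show "NE n x E \<le> Df n x E" using NE_le_Df[of n x E] by (simp add: of_bool_def split: if_splits)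
  qed
  have X: "pex m D w X \<le> ennreal (1 / (c0 * w1\<^sup>2)) * ?D"
  proof -
    have "pex m D w X = ennreal (1 / (c0 * w1\<^sup>2)) * (ennreal (c0 * w1\<^sup>2) * pex m D w X)"
      using pos by (simp add: mult.assoc[symmetric] ennreal_mult[symmetric])
    also have "\<dots> \<le> ennreal (1 / (c0 * w1\<^sup>2)) * ?D"
      using vertex_insertion NE by (intro mult_left_mono) (auto intro: order_trans)
    finally show ?thesis .
  qed
  have Z: "pex m D w Z \<le> ennreal (1 / w0) * ?D"
    using edge_insertion mult_left_mono[OF NE, of "ennreal (1 / w0)"] by (auto intro: order_trans)
  have C: "pex m D w C \<le> ennreal (\<kappa> + 3 * ?K) * ?P + ennreal (2 * ?K / w0) * ?D"
  proof -
    have "pex m D w C \<le> pex m D w (\<lambda>n x E. (\<Sum>j<n. q1 n j x E) + (3 * ?K * real (card (pv n x E)) + 2 * ?K * Z n x E))"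
      by (rule pex_mono) (rule C_le)
    also have "\<dots> = pex m D w (\<lambda>n x E. \<Sum>j<n. q1 n j x E) + (ennreal (3 * ?K) * ?P + ennreal (2 * ?K) * pex m D w Z)"
    proof -
      have a1: "adm {..<n} (\<lambda>x E. \<Sum>j<n. q1 n j x E)" for n by (intro adm_sum adm_q1) simp
      have a2: "adm {..<n} (\<lambda>x E. 3 * ?K * real (card (pv n x E)))" for n by (intro adm_cmult adm_pv) simp
      have a3: "adm {..<n} (\<lambda>x E. 2 * ?K * Z n x E)" for n by (intro adm_cmult adm_Z) simp
      show ?thesis
        by (simp only: pex_add[OF D(2) a1 adm_add[OF a2 a3]] pex_add[OF D(2) a2 a3]
            pex_cmult[OF D(2) adm_pv, of "3 * ?K"] pex_cmult[OF D(2) adm_Z, of "2 * ?K"] mult_nonneg_nonneg of_nat_0_le_iff zero_le_numeral)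
    qed
    also have "\<dots> \<le> ennreal \<kappa> * ?P + (ennreal (3 * ?K) * ?P + ennreal (2 * ?K) * (ennreal (1 / w0) * ?D))"
      by (intro add_mono mult_left_mono crowding_nonpivotal Z order_refl) auto
    also have "\<dots> = ennreal (\<kappa> + 3 * ?K) * ?P + ennreal (2 * ?K / w0) * ?D"
    proof -
      have "ennreal (2 * ?K) * (ennreal (1 / w0) * ?D) = ennreal (2 * ?K / w0) * ?D"
        using pos by (simp add: mult.assoc[symmetric] ennreal_mult[symmetric])
      moreover have "ennreal (\<kappa> + 3 * ?K) = ennreal \<kappa> + ennreal (3 * ?K)" using pos by (intro ennreal_plus) auto
      ultimately show ?thesis by (simp add: distrib_right add.assoc)
    qed
    finally show ?thesis .
  qed
  have "?P \<le> pex m D w (\<lambda>n x E. 3 * Df n x E + (1 / \<theta> ^ k * X n x E + 1 / real k * C n x E))"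
    by (rule pex_mono) (rule card_pv_le[OF _ k(1)])
  also have "\<dots> = ennreal 3 * ?D + (ennreal (1 / \<theta> ^ k) * pex m D w X + ennreal (1 / real k) * pex m D w C)"
  proof -
    have t: "0 \<le> 1 / \<theta> ^ k" "0 \<le> 1 / real k" "(0::real) \<le> 3" using pos by auto
    have a1: "adm {..<n} (\<lambda>x E. 3 * Df n x E)" for n by (intro adm_cmult adm_Df) simp
    have a2: "adm {..<n} (\<lambda>x E. 1 / \<theta> ^ k * X n x E)" for n by (intro adm_cmult adm_X t)
    have a3: "adm {..<n} (\<lambda>x E. 1 / real k * C n x E)" for n by (intro adm_cmult adm_C t)
    show ?thesis
      by (simp only: pex_add[OF D(2) a1 adm_add[OF a2 a3]] pex_add[OF D(2) a2 a3]
          pex_cmult[OF D(2) adm_Df t(3)] pex_cmult[OF D(2) adm_X t(1)] pex_cmult[OF D(2) adm_C t(2)])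
  qed
  also have "\<dots> \<le> ennreal 3 * ?D + (ennreal (1 / \<theta> ^ k) * (ennreal (1 / (c0 * w1\<^sup>2)) * ?D) +
      ennreal (1 / real k) * (ennreal (\<kappa> + 3 * ?K) * ?P + ennreal (2 * ?K / w0) * ?D))"
    by (intro add_mono mult_left_mono X C order_refl) auto
  finally have main: "?P \<le> ennreal 3 * ?D + (ennreal (1 / \<theta> ^ k) * (ennreal (1 / (c0 * w1\<^sup>2)) * ?D) +
      ennreal (1 / real k) * (ennreal (\<kappa> + 3 * ?K) * ?P + ennreal (2 * ?K / w0) * ?D))" .
  \<comment> \<open>Absorbing half of \<open>?P\<close> requires it to be finite: |PV| is at most
    the number of points, whose mean is \<open>m\<close>.\<close>
  have Pfin: "?P < \<top>"
  proof -
    have "?P \<le> (\<integral>\<^sup>+n. ennreal (real n) \<partial>measure_pmf (poisson_pmf m))"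
      unfolding pex_def
    proof (intro nn_integral_mono ex_le)
      fix n x and E :: "nat set set"
      have "card (pv n x E) \<le> card {..<n}" by (rule card_mono) (auto simp: PV_def)
      then show "real (card (pv n x E)) \<le> real n" by simp
    qed (use D(1) in auto)
    also have "\<dots> = ennreal m * (\<integral>\<^sup>+n. ennreal (1 / real (Suc n)) * ennreal (real (Suc n)) \<partial>measure_pmf (poisson_pmf m))"
      by (rule nn_integral_poisson_Suc[OF m]) simp
    also have "\<dots> = ennreal m * (\<integral>\<^sup>+n. 1 \<partial>measure_pmf (poisson_pmf m))"
      by (simp add: ennreal_mult[symmetric] del: of_nat_Suc)
    also have "\<dots> = ennreal m" by simp
    finally show ?thesis using ennreal_less_top le_less_trans by blast
  qed
  show ?thesis
  proof (cases "?D = \<top>")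
    case True
    have "0 < 2 * (3 + 1 / (\<theta> ^ k * (c0 * w1\<^sup>2)) + 2 * ?K / (w0 * real k))"
      using pos by (intro mult_pos_pos add_pos_nonneg) auto
    then show ?thesis using True by (simp add: ennreal_mult_top)
  next
    case False
    obtain P where P: "?P = ennreal P" "0 \<le> P" using Pfin by (cases ?P) auto
    obtain Q where Q: "?D = ennreal Q" "0 \<le> Q" using False by (cases ?D) auto
    have r: "0 \<le> 1 / \<theta> ^ k" "0 \<le> 1 / (c0 * w1\<^sup>2)" "0 \<le> 1 / real k" "0 \<le> \<kappa> + 3 * ?K" "0 \<le> 2 * ?K / w0"
      using pos by auto
    have "ennreal P \<le> ennreal (3 * Q + (1 / \<theta> ^ k * (1 / (c0 * w1\<^sup>2) * Q) + 1 / real k * ((\<kappa> + 3 * ?K) * P + 2 * ?K / w0 * Q)))"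
      using main unfolding P Q using P(2) Q(2) r
      by (simp only: ennreal_mult[symmetric] ennreal_plus[symmetric] mult_nonneg_nonneg add_nonneg_nonneg zero_le_numeral)
    moreover have "0 \<le> 3 * Q + (1 / \<theta> ^ k * (1 / (c0 * w1\<^sup>2) * Q) + 1 / real k * ((\<kappa> + 3 * ?K) * P + 2 * ?K / w0 * Q))"
      using P(2) Q(2) r pos by (intro add_nonneg_nonneg mult_nonneg_nonneg) auto
    ultimately have le: "P \<le> 3 * Q + (1 / \<theta> ^ k * (1 / (c0 * w1\<^sup>2) * Q) + 1 / real k * ((\<kappa> + 3 * ?K) * P + 2 * ?K / w0 * Q))"
      by (simp only: ennreal_le_iff)
    have half: "1 / real k * ((\<kappa> + 3 * ?K) * P) \<le> 1 / 2 * P"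
    proof -
      have "(\<kappa> + 3 * ?K) / real k \<le> 1 / 2" using k by (simp add: field_simps)
      from mult_right_mono[OF this P(2)] show ?thesis by simp
    qed
    have e1: "1 / real k * ((\<kappa> + 3 * ?K) * P + 2 * ?K / w0 * Q) =
        1 / real k * ((\<kappa> + 3 * ?K) * P) + 2 * ?K / (w0 * real k) * Q"
      by (simp add: distrib_left mult.commute)
    have e2: "1 / \<theta> ^ k * (1 / (c0 * w1\<^sup>2) * Q) = 1 / (\<theta> ^ k * (c0 * w1\<^sup>2)) * Q" by simp
    have arith: "P \<le> 2 * (q + a' + d)" if "P \<le> q + (a + b)" "b = c + d" "c \<le> 1 / 2 * P" "a = a'" for q a a' b c d :: real
      using that by argo
    have "P \<le> 2 * (3 * Q + 1 / (\<theta> ^ k * (c0 * w1\<^sup>2)) * Q + 2 * ?K / (w0 * real k) * Q)"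
      by (rule arith[OF le e1 half e2])
    also have "\<dots> = 2 * (3 + 1 / (\<theta> ^ k * (c0 * w1\<^sup>2)) + 2 * ?K / (w0 * real k)) * Q" by (simp only: distrib_right mult.assoc)
    finally have "P \<le> 2 * (3 + 1 / (\<theta> ^ k * (c0 * w1\<^sup>2)) + 2 * ?K / (w0 * real k)) * Q" .
    then show ?thesis unfolding P Q using Q(2) pos by (subst ennreal_mult[symmetric]) (auto intro!: ennreal_leI add_nonneg_nonneg mult_nonneg_nonneg)
  qed
qed

end

section \<open>Monotonicity along a curve of parameters\<close>

text \<open>Difference quotients are dominated by \<open>K\<close> through the mean value
  inequality, for which the derivative is bounded on all of the convex set. The derivative is taken
  within \<open>S\<close> since the parameter runs over a closed interval.\<close>

lemma integral_has_derivative_within: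
  fixes u u' :: "'x \<Rightarrow> real \<Rightarrow> real"
  assumes M: "prob_space M" and S: "convex S" "s0 \<in> S"
    and u: "\<And>x s. s \<in> S \<Longrightarrow> (u x has_real_derivative u' x s) (at s within S)"
    and meas: "\<And>s. s \<in> S \<Longrightarrow> (\<lambda>x. u x s) \<in> borel_measurable M" "(\<lambda>x. u' x s0) \<in> borel_measurable M"
    and bound: "\<And>x s. s \<in> S \<Longrightarrow> \<bar>u x s\<bar> \<le> K" "\<And>x s. s \<in> S \<Longrightarrow> \<bar>u' x s\<bar> \<le> K"
  shows "((\<lambda>s. \<integral>x. u x s \<partial>M) has_real_derivative (\<integral>x. u' x s0 \<partial>M)) (at s0 within S)"
proof -
  interpret prob_space M by fact
  have int: "integrable M (\<lambda>x. u x s)" if "s \<in> S" for s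
    using meas(1)[OF that] bound(1)[OF that] by (intro integrable_const_bound[of _ K]) auto
  show ?thesis
    unfolding has_field_derivative_iff tendsto_at_iff_sequentially
  proof (intro allI impI)
    fix X assume X: "\<forall>i. X i \<in> S - {s0}" "X \<longlonglongrightarrow> s0"
    have "(\<lambda>i. \<integral>x. (u x (X i) - u x s0) / (X i - s0) \<partial>M) \<longlonglongrightarrow> (\<integral>x. u' x s0 \<partial>M)"
    proof (rule integral_dominated_convergence[where w="\<lambda>_. K"])
      show "(\<lambda>x. (u x (X i) - u x s0) / (X i - s0)) \<in> borel_measurable M" for i
        using meas(1)[of "X i"] meas(1)[OF S(2)] X by (intro borel_measurable_divide borel_measurable_diff) auto
      show "AE x in M. (\<lambda>i. (u x (X i) - u x s0) / (X i - s0)) \<longlonglongrightarrow> u' x s0"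
      proof (rule AE_I2)
        fix x
        have "((\<lambda>y. (u x y - u x s0) / (y - s0)) \<longlongrightarrow> u' x s0) (at s0 within S)"
          using u[OF S(2), of x] by (simp only: has_field_derivative_iff)
        then show "(\<lambda>i. (u x (X i) - u x s0) / (X i - s0)) \<longlonglongrightarrow> u' x s0"
          using X unfolding tendsto_at_iff_sequentially comp_def by blast
      qed
      show "AE x in M. norm ((u x (X i) - u x s0) / (X i - s0)) \<le> K" for i
      proof (rule AE_I2)
        fix x
        have Xi: "X i \<in> S" "X i \<noteq> s0" using X(1) by auto
        have "norm (u x (X i) - u x s0) \<le> K * norm (X i - s0)"
          by (rule field_differentiable_bound[OF S(1) u _ Xi(1) S(2)]) (use bound(2) in auto)
        then show "norm ((u x (X i) - u x s0) / (X i - s0)) \<le> K" using Xi(2) by (simp add: field_simps)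
      qed
    qed (use meas in auto)
    moreover have "(\<integral>x. (u x (X i) - u x s0) / (X i - s0) \<partial>M) = ((\<integral>x. u x (X i) \<partial>M) - (\<integral>x. u x s0 \<partial>M)) / (X i - s0)" for i
    proof -
      have "X i \<in> S" using X by auto
      from Bochner_Integration.integral_diff[OF int[OF this] int[OF S(2)]] show ?thesis by simp
    qed
    ultimately show "((\<lambda>y. ((\<integral>x. u x y \<partial>M) - (\<integral>x. u x s0 \<partial>M)) / (y - s0)) \<circ> X) \<longlonglongrightarrow> (\<integral>x. u' x s0 \<partial>M)"
      unfolding comp_def by (simp only:)
  qed
qed

definition pois :: "real \<Rightarrow> nat \<Rightarrow> real" where "pois m n = m ^ n / fact n * exp (- m)"

lemma pois_nonneg: "0 \<le> m \<Longrightarrow> 0 \<le> pois m n" by (simp add: pois_def)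

lemma pois_has_derivative:
  assumes "m \<noteq> 0"
  shows "((\<lambda>m. pois m n) has_real_derivative pois m n * (real n - m) / m) (at m)"
proof -
  have "((\<lambda>m. m ^ n * exp (- m)) has_real_derivative (real n * m ^ (n - 1) * exp (- m) - m ^ n * exp (- m))) (at m)"
    by (auto intro!: derivative_eq_intros)
  from DERIV_cdivide[OF this, of "fact n"]
  have "((\<lambda>m. pois m n) has_real_derivative (real n * m ^ (n - 1) * exp (- m) - m ^ n * exp (- m)) / fact n) (at m)"
    by (simp add: pois_def)
  moreover have "real n * m ^ (n - 1) = real n * m ^ n / m" using assms by (cases n) auto
  then have "(real n * m ^ (n - 1) * exp (- m) - m ^ n * exp (- m)) / fact n = pois m n * (real n - m) / m"
    using assms by (simp add: pois_def field_simps)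
  ultimately show ?thesis by simp
qed

text \<open>One majorant for all series that occur: connection probabilities, numbers of pivotal
  edges, and the factor \<open>n - m\<close> from differentiating the Poisson weights.\<close>

lemma summable_pois_poly:
  fixes M :: real
  shows "summable (\<lambda>n. M ^ n / fact n * (real n * real n + real n + c))"
proof -
  have s0: "summable (\<lambda>n. M ^ n / fact n)" using summable_exp[of M] by (simp add: field_simps)
  have s1: "summable (\<lambda>n. M ^ n / fact n * real n)"
  proof (subst summable_Suc_iff[symmetric])
    have "M ^ Suc n / fact (Suc n) * real (Suc n) = M * (M ^ n / fact n)" for n
      by (simp add: field_simps del: of_nat_Suc)
    then show "summable (\<lambda>n. M ^ Suc n / fact (Suc n) * real (Suc n))" using summable_mult[OF s0, of M] by simp
  qed
  have s2: "summable (\<lambda>n. M ^ n / fact n * (real n * real n))"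
  proof (subst summable_Suc_iff[symmetric])
    have "M ^ Suc n / fact (Suc n) * (real (Suc n) * real (Suc n)) = M * (M ^ n / fact n * real n) + M * (M ^ n / fact n)" for n
    proof -
      have "M ^ Suc n / fact (Suc n) * (real (Suc n) * real (Suc n)) = M ^ Suc n / fact n * real (Suc n)"
        by (simp add: field_simps del: of_nat_Suc)
      then show ?thesis by (simp add: field_simps)
    qed
    then show "summable (\<lambda>n. M ^ Suc n / fact (Suc n) * (real (Suc n) * real (Suc n)))"
      using summable_add[OF summable_mult[OF s1, of M] summable_mult[OF s0, of M]] by simp
  qed
  show ?thesis
    using summable_add[OF summable_add[OF s2 s1] summable_mult2[OF s0, of c]] by (simp add: algebra_simps)
qed

lemma pois_le: "0 \<le> m \<Longrightarrow> m \<le> M \<Longrightarrow> pois m n \<le> M ^ n / fact n"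
proof -
  assume m: "0 \<le> m" "m \<le> M"
  have "pois m n \<le> m ^ n / fact n * 1" unfolding pois_def using m by (intro mult_left_mono) auto
  also have "\<dots> \<le> M ^ n / fact n" using m by (simp add: divide_right_mono power_mono)
  finally show ?thesis .
qed

lemma summable_pois_mult:
  assumes "0 \<le> m" "\<And>n. \<bar>a n\<bar> \<le> real n * real n + real n + c"
  shows "summable (\<lambda>n. pois m n * a n)"
proof (rule summable_comparison_test[OF _ summable_pois_poly[of m c]], intro exI allI impI)
  fix n
  show "norm (pois m n * a n) \<le> m ^ n / fact n * (real n * real n + real n + c)"
    unfolding real_norm_def abs_mult
    using assms pois_le[of m m n] pois_nonneg[of m n] by (intro mult_mono) auto
qed

lemma nn_integral_poisson_real:
  assumes "0 < m" "\<And>n. 0 \<le> a n" "summable (\<lambda>n. pois m n * a n)"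
  shows "(\<integral>\<^sup>+n. ennreal (a n) \<partial>measure_pmf (poisson_pmf m)) = ennreal (\<Sum>n. pois m n * a n)"
proof -
  have "ennreal (m ^ n / fact n * exp (- m)) * ennreal (a n) = ennreal (pois m n * a n)" for n
    unfolding pois_def using assms(1,2) by (intro ennreal_mult[symmetric]) auto
  then show ?thesis unfolding nn_integral_poisson[OF assms(1)]
    using assms by (simp add: suminf_ennreal2 pois_nonneg)
qed

lemma pex_eq_suminf:
  assumes "0 < m" "\<And>n. ex {..<n} (\<lambda>_. D) w (Y n) = ennreal (a n)" "\<And>n. 0 \<le> a n" "\<And>n. a n \<le> real n * real n + real n + c"
  shows "pex m D w Y = ennreal (\<Sum>n. pois m n * a n)"
  unfolding pex_def assms(2) using assms by (intro nn_integral_poisson_real summable_pois_mult[of _ _ c]) auto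

context kernel begin

lemma kernel_scale:
  assumes "0 \<le> s" "s \<le> 1" shows "kernel (\<lambda>a b. s * w a b)"
  using w_sym w_nonneg w_le1 assms by unfold_locales (auto intro: mult_le_one)

lemma wt_scale: "e \<in> pairs V \<Longrightarrow> 0 \<le> s \<Longrightarrow> s \<le> 1 \<Longrightarrow> wt (\<lambda>a b. s * w a b) x e = s * wt w x e"
proof -
  assume e: "e \<in> pairs V" and s: "0 \<le> s" "s \<le> 1"
  interpret K: kernel "\<lambda>a b. s * w a b" by (rule kernel_scale[OF s])
  obtain i j where "e = {i, j}" using e unfolding pairs_def by auto
  then show ?thesis by simp
qed

end

text \<open>Only the edge probabilities carry the parameter \<open>s\<close>; the range of the
  connection function stays fixed, and the spatial rescaling is moved into the intensity.\<close>

locale curve = kernel g for g :: "'a::second_countable_topology \<Rightarrow> 'a \<Rightarrow> real" +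
  fixes D :: "'a measure" and S T :: "'a set"
  assumes D: "prob_space D" "sets D = sets borel" and ST: "S \<in> sets borel" "T \<in> sets borel"
begin

abbreviation "W s \<equiv> (\<lambda>a b. s * g a b)"
definition "cn (n::nat) x E = (of_bool (conn {..<n} (mk {..<n} x S) (mk {..<n} x T) E) :: real)"
definition "nE (n::nat) x E = real (card (PE {..<n} (mk {..<n} x S) (mk {..<n} x T) E))"
definition "nV (n::nat) x E = real (card (PV {..<n} (mk {..<n} x S) (mk {..<n} x T) E))"
definition "A n s = (\<integral>x. bsum (pairs {..<n}) (wt (W s) x) (cn n x) \<partial>PiM {..<n} (\<lambda>_. D))"
definition "B n s = (\<integral>x. bsum (pairs {..<n}) (wt (W s) x) (nE n x) \<partial>PiM {..<n} (\<lambda>_. D))"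

lemma adm_cn: "adm {..<n} (cn n)"
  unfolding cn_def by (rule adm_mark[where \<Phi>="\<lambda>A B E. of_bool (conn {..<n} A B E)"]) (auto simp: ST)
lemma adm_nE: "adm {..<n} (nE n)"
  unfolding nE_def by (rule adm_mark[where \<Phi>="\<lambda>A B E. real (card (PE {..<n} A B E))"]) (auto simp: ST)
lemma adm_nV: "adm {..<n} (nV n)"
  unfolding nV_def by (rule adm_mark[where \<Phi>="\<lambda>A B E. real (card (PV {..<n} A B E))"]) (auto simp: ST)

lemma nV_le: "nV n x E \<le> real n"
proof -
  have "card (PV {..<n} (mk {..<n} x S) (mk {..<n} x T) E) \<le> card {..<n}" by (rule card_mono) (auto simp: PV_def)
  then show ?thesis by (simp add: nV_def)
qed

lemma nE_le_nV: "nE n x E \<le> nV n x E"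
proof (cases "PV {..<n} (mk {..<n} x S) (mk {..<n} x T) E = {}")
  case True
  then have "AP {..<n} (mk {..<n} x S) (mk {..<n} x T) E = {}" unfolding AP_def by blast
  then have "PE {..<n} (mk {..<n} x S) (mk {..<n} x T) E = {}" using PE_subset_AP by blast
  then show ?thesis by (simp add: nE_def nV_def)
next
  case False
  have "card (PE {..<n} (mk {..<n} x S) (mk {..<n} x T) E) \<le> card (AP {..<n} (mk {..<n} x S) (mk {..<n} x T) E)"
    by (intro card_mono finite_AP PE_subset_AP) simp
  also have "\<dots> < card (PV {..<n} (mk {..<n} x S) (mk {..<n} x T) E)" by (rule card_AP_less[OF _ False]) simp
  finally show ?thesis by (simp add: nE_def nV_def)
qed

lemma ex_real:
  fixes n :: nat
  assumes s: "0 \<le> s" "s \<le> 1" and adm: "adm {..<n} Y" and Y: "\<And>x E. Y x E \<le> K"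
  shows "ex {..<n} (\<lambda>_. D) (W s) Y = ennreal (\<integral>x. bsum (pairs {..<n}) (wt (W s) x) (Y x) \<partial>PiM {..<n} (\<lambda>_. D))"
    and "0 \<le> (\<integral>x. bsum (pairs {..<n}) (wt (W s) x) (Y x) \<partial>PiM {..<n} (\<lambda>_. D))"
    and "(\<integral>x. bsum (pairs {..<n}) (wt (W s) x) (Y x) \<partial>PiM {..<n} (\<lambda>_. D)) \<le> K"
    and "(\<lambda>x. bsum (pairs {..<n}) (wt (W s) x) (Y x)) \<in> borel_measurable (PiM {..<n} (\<lambda>_. D))"
    and "0 \<le> bsum (pairs {..<n}) (wt (W s) x) (Y x)" and "bsum (pairs {..<n}) (wt (W s) x) (Y x) \<le> K"
proof -
  interpret K: kernel "W s" by (rule kernel_scale[OF s])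
  interpret prob_space "PiM {..<n} (\<lambda>_. D)" using D by (intro prob_space_PiM)
  show nn: "0 \<le> bsum (pairs {..<n}) (wt (W s) x) (Y x)" for x by (rule K.bsum_wt_nonneg[OF adm])
  show le: "bsum (pairs {..<n}) (wt (W s) x) (Y x) \<le> K" for x
  proof -
    have "bsum (pairs {..<n}) (wt (W s) x) (Y x) \<le> bsum (pairs {..<n}) (wt (W s) x) (\<lambda>_. K)"
      by (rule bsum_mono[OF K.wt_range Y])
    then show ?thesis by (simp add: bsum_const)
  qed
  show meas: "(\<lambda>x. bsum (pairs {..<n}) (wt (W s) x) (Y x)) \<in> borel_measurable (PiM {..<n} (\<lambda>_. D))"
    using K.bsum_wt_measurable[OF adm] measurable_PiM_borel_cong[of "{..<n}" "\<lambda>_. D"] D(2) by blast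
  have int: "integrable (PiM {..<n} (\<lambda>_. D)) (\<lambda>x. bsum (pairs {..<n}) (wt (W s) x) (Y x))"
    using nn le meas by (intro integrable_const_bound[of _ K]) auto
  show "ex {..<n} (\<lambda>_. D) (W s) Y = ennreal (\<integral>x. bsum (pairs {..<n}) (wt (W s) x) (Y x) \<partial>PiM {..<n} (\<lambda>_. D))"
    unfolding ex_def by (rule nn_integral_eq_integral[OF int]) (simp add: nn)
  show "0 \<le> (\<integral>x. bsum (pairs {..<n}) (wt (W s) x) (Y x) \<partial>PiM {..<n} (\<lambda>_. D))" using nn by simp
  show "(\<integral>x. bsum (pairs {..<n}) (wt (W s) x) (Y x) \<partial>PiM {..<n} (\<lambda>_. D)) \<le> K"
    using integral_mono[OF int integrable_const[of K]] le by (simp add: prob_space)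
qed

lemma cn_le1: "cn n x E \<le> 1" by (simp add: cn_def)

lemma nE_le: "nE n x E \<le> real n" using nE_le_nV[of n x E] nV_le[of n x E] by linarith

text \<open>Deleting a present edge changes the connection indicator exactly if the edge is pivotal,
  so the sum in \<open>bsum_has_derivative\<close> counts pivotal edges.\<close>

lemma russo_sum:
  assumes "E \<subseteq> pairs {..<n}"
  shows "(\<Sum>e\<in>E. cn n x E - cn n x (E - {e})) = nE n x E"
proof -
  have fin: "finite E" using assms finite_subset[of E "pairs {..<n}"] by simp
  have "cn n x E - cn n x (E - {e}) = of_bool (e \<in> PE {..<n} (mk {..<n} x S) (mk {..<n} x T) E)" if "e \<in> E" for e
    using that conn_mono[of "{..<n}" "mk {..<n} x S" "mk {..<n} x T" "E - {e}" "{..<n}" E]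
    unfolding cn_def PE_def by (auto simp: of_bool_def)
  then have "(\<Sum>e\<in>E. cn n x E - cn n x (E - {e})) = (\<Sum>e\<in>E. of_bool (e \<in> PE {..<n} (mk {..<n} x S) (mk {..<n} x T) E))"
    by (intro sum.cong refl)
  also have "\<dots> = nE n x E"
    unfolding sum_of_bool_card[OF fin] nE_def by (intro arg_cong[where f="\<lambda>X. real (card X)"]) (auto simp: PE_def)
  finally show ?thesis .
qed

lemma A_has_derivative:
  assumes p: "0 < p" "q \<le> 1" and s: "s \<in> {p..q}"
  shows "(A n has_real_derivative B n s / s) (at s within {p..q})"
proof -
  let ?Q = "pairs {..<n}"
  have s01: "0 \<le> s" "s \<le> 1" "s \<noteq> 0" if "s \<in> {p..q}" for s using that p by auto
  have "((\<lambda>s. \<integral>x. bsum ?Q (wt (W s) x) (cn n x) \<partial>PiM {..<n} (\<lambda>_. D)) has_real_derivative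
     (\<integral>x. bsum ?Q (wt (W s) x) (nE n x) / s \<partial>PiM {..<n} (\<lambda>_. D))) (at s within {p..q})"
  proof (rule integral_has_derivative_within[where K="max 1 (real n / p)"])
    show "prob_space (PiM {..<n} (\<lambda>_. D))" using D by (intro prob_space_PiM)
    fix x t assume t: "t \<in> {p..q}"
    have d: "((\<lambda>s. bsum ?Q (\<lambda>e. s * wt g x e) (cn n x)) has_real_derivative
       bsum ?Q (\<lambda>e. t * wt g x e) (\<lambda>E. \<Sum>e\<in>E. cn n x E - cn n x (E - {e})) / t) (at t within {p..q})"
      by (rule has_field_derivative_at_within, rule bsum_has_derivative) (use s01(3)[OF t] in simp_all)
    have eq: "bsum ?Q (wt (W s) x) Y = bsum ?Q (\<lambda>e. s * wt g x e) Y" if "s \<in> {p..q}" for s Y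
      using s01(1,2)[OF that] by (intro bsum_cong refl) (rule wt_scale)
    have "bsum ?Q (\<lambda>e. t * wt g x e) (\<lambda>E. \<Sum>e\<in>E. cn n x E - cn n x (E - {e})) = bsum ?Q (wt (W t) x) (nE n x)"
      unfolding eq[OF t] by (intro bsum_cong refl russo_sum)
    then have d': "((\<lambda>s. bsum ?Q (\<lambda>e. s * wt g x e) (cn n x)) has_real_derivative bsum ?Q (wt (W t) x) (nE n x) / t) (at t within {p..q})"
      using d by (simp only:)
    show "((\<lambda>s. bsum ?Q (wt (W s) x) (cn n x)) has_real_derivative bsum ?Q (wt (W t) x) (nE n x) / t) (at t within {p..q})"
      by (rule has_field_derivative_transform_within[OF d' zero_less_one t]) (simp only: eq)
    note c = ex_real(4-6)[OF s01(1,2)[OF t] adm_cn cn_le1] and e = ex_real(4-6)[OF s01(1,2)[OF t] adm_nE nE_le]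
    show "\<bar>bsum ?Q (wt (W t) x) (cn n x)\<bar> \<le> max 1 (real n / p)" using c(2,3)[of n x] by simp
    have "bsum ?Q (wt (W t) x) (nE n x) / t \<le> real n / p" using e(2,3)[of n x] t p by (intro frac_le) auto
    then show "\<bar>bsum ?Q (wt (W t) x) (nE n x) / t\<bar> \<le> max 1 (real n / p)" using e(2)[of n x] t p by simp
  next
    fix t assume t: "t \<in> {p..q}"
    show "(\<lambda>x. bsum ?Q (wt (W t) x) (cn n x)) \<in> borel_measurable (PiM {..<n} (\<lambda>_. D))"
      by (rule ex_real(4)[OF s01(1,2)[OF t] adm_cn cn_le1])
  next
    show "(\<lambda>x. bsum ?Q (wt (W s) x) (nE n x) / s) \<in> borel_measurable (PiM {..<n} (\<lambda>_. D))"
      using ex_real(4)[OF s01(1,2)[OF s] adm_nE nE_le] by simp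
  qed (use s in auto)
  then show ?thesis unfolding A_def[abs_def] B_def by simp
qed

definition "F m s = (\<Sum>n. pois m n * A n s)"

lemma A_bounds: "0 \<le> s \<Longrightarrow> s \<le> 1 \<Longrightarrow> 0 \<le> A n s" "0 \<le> s \<Longrightarrow> s \<le> 1 \<Longrightarrow> A n s \<le> 1"
  unfolding A_def using ex_real(2,3)[OF _ _ adm_cn cn_le1] by auto

lemma B_bounds: "0 \<le> s \<Longrightarrow> s \<le> 1 \<Longrightarrow> 0 \<le> B n s" "0 \<le> s \<Longrightarrow> s \<le> 1 \<Longrightarrow> B n s \<le> real n"
  unfolding B_def using ex_real(2,3)[OF _ _ adm_nE nE_le] by auto

lemma pex_cn:
  assumes "0 \<le> s" "s \<le> 1" "0 < m" shows "pex m D (W s) cn = ennreal (F m s)"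
  unfolding F_def
proof (rule pex_eq_suminf[OF assms(3), where c=1])
  fix n
  show "ex {..<n} (\<lambda>_. D) (W s) (cn n) = ennreal (A n s)" unfolding A_def by (rule ex_real(1)[OF assms(1,2) adm_cn cn_le1])
  show "0 \<le> A n s" "A n s \<le> real n * real n + real n + 1"
    using A_bounds[OF assms(1,2), of n] by (auto intro: order_trans[of _ 1])
qed

lemma pex_nE:
  assumes "0 \<le> s" "s \<le> 1" "0 < m" shows "pex m D (W s) nE = ennreal (\<Sum>n. pois m n * B n s)"
proof (rule pex_eq_suminf[OF assms(3), where c=0])
  fix n
  show "ex {..<n} (\<lambda>_. D) (W s) (nE n) = ennreal (B n s)" unfolding B_def by (rule ex_real(1)[OF assms(1,2) adm_nE nE_le])
  show "0 \<le> B n s" "B n s \<le> real n * real n + real n + 0"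
    using B_bounds[OF assms(1,2), of n] by (auto intro: order_trans[of _ "real n"])
qed

text \<open>Russo's formula for the intensity: the series is \<open>m\<close> times the derivative
  of \<open>F\<close> in \<open>m\<close>. By the Mecke formula E|PV| is \<open>m\<close> times the
  mean increment of \<open>A\<close> when a point is added, because the last point is pivotal
  exactly if the connection exists with it and not without it.\<close>

lemma pex_nV:
  assumes s: "0 \<le> s" "s \<le> 1" and m: "0 < m"
  shows "pex m D (W s) nV = ennreal (\<Sum>n. pois m n * ((real n - m) * A n s))" and "0 \<le> (\<Sum>n. pois m n * ((real n - m) * A n s))"
proof -
  interpret K: kernel "W s" by (rule kernel_scale[OF s])
  define q where "q n i x E = (of_bool (i \<in> PV {..<n} (mk {..<n} x S) (mk {..<n} x T) E) :: real)" for n :: nat and i x E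
  have admq: "adm {..<n} (q n i)" for n i
    unfolding q_def by (rule adm_mark[where \<Phi>="\<lambda>A B E. of_bool (i \<in> PV {..<n} A B E)"]) (auto simp: ST)
  have "nV n x E = (\<Sum>i<n. q n i x E)" for n x E
    unfolding nV_def q_def sum_of_bool_card[OF finite_lessThan]
    by (intro arg_cong[where f="\<lambda>X. real (card X)"]) (auto simp: PV_def)
  then have "pex m D (W s) nV = pex m D (W s) (\<lambda>n x E. \<Sum>i<n. q n i x E)" by presburger
  also have "\<dots> = ennreal m * (\<integral>\<^sup>+n. ex {..<Suc n} (\<lambda>_. D) (W s) (q (Suc n) n) \<partial>measure_pmf (poisson_pmf m))"
  proof (rule K.mecke[OF D m])
    fix n i and x :: "nat \<Rightarrow> 'a" and E assume i: "i \<le> n" and E: "E \<subseteq> pairs {..<Suc n}"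
    let ?t = "Transposition.transpose i n"
    define x' where "x' = (\<lambda>j\<in>{..<Suc n}. x (?t j))"
    note t = transpose_relabel[OF i x'_def]
    have "?t i \<in> PV (?t ` {..<Suc n}) (?t ` mk {..<Suc n} x S) (?t ` mk {..<Suc n} x T) ((`) ?t ` E)
      \<longleftrightarrow> i \<in> PV {..<Suc n} (mk {..<Suc n} x S) (mk {..<Suc n} x T) E"
      using i by (intro PV_image_iff[OF t(1) E mk_subset mk_subset order_refl]) simp
    then have "q (Suc n) n x' ((`) ?t ` E) = q (Suc n) i x E"
      unfolding q_def t(2) t(3)[symmetric] by simp
    then show "q (Suc n) n (\<lambda>j\<in>{..<Suc n}. x (?t j)) ((`) ?t ` E) = q (Suc n) i x E" unfolding x'_def .
  qed (rule admq)
  finally have P: "pex m D (W s) nV = ennreal m * (\<integral>\<^sup>+n. ex {..<Suc n} (\<lambda>_. D) (W s) (q (Suc n) n) \<partial>measure_pmf (poisson_pmf m))" .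
  \<comment> \<open>Connection of \<open>Suc n\<close> points without use of the last one. The last
    point integrates out, which leaves \<open>A n s\<close>.\<close>
  define c' where "c' n x E = (of_bool (conn {..<n} (mk {..<Suc n} x S) (mk {..<Suc n} x T) E) :: real)" for n :: nat and x E
  have adm': "adm {..<Suc n} (c' n)" for n
    unfolding c'_def by (rule adm_mark[where \<Phi>="\<lambda>A B E. of_bool (conn {..<n} A B E)"]) (auto simp: ST)
  have c'_eq: "ex {..<Suc n} (\<lambda>_. D) (W s) (c' n) = ennreal (A n s)" for n
  proof -
    interpret Dp: prob_space D by (rule D(1))
    have "ex {..<Suc n} (\<lambda>_. D) (W s) (c' n) = (\<integral>\<^sup>+x. \<integral>\<^sup>+y. ennreal (bsum (pairs {..<n}) (wt (W s) x) (cn n x)) \<partial>D \<partial>PiM {..<n} (\<lambda>_. D))"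
      unfolding K.ex_Suc[OF D adm']
    proof (intro nn_integral_cong arg_cong[where f=ennreal] bsum_cong refl)
      fix x :: "nat \<Rightarrow> 'a" and y E assume E: "E \<subseteq> pairs {..<n}"
      have "bsum (star n) (wt (W s) (x(n := y))) (\<lambda>E'. c' n (x(n := y)) (E \<union> E')) = bsum (star n) (wt (W s) (x(n := y))) (\<lambda>E'. cn n x E)"
        unfolding c'_def cn_def by (intro bsum_cong refl) (simp only: conn_new_vertex[OF E _ order_refl])
      then show "bsum (star n) (wt (W s) (x(n := y))) (\<lambda>E'. c' n (x(n := y)) (E \<union> E')) = cn n x E"
        by (simp add: bsum_const)
    qed
    also have "\<dots> = ex {..<n} (\<lambda>_. D) (W s) (cn n)" unfolding ex_def by (simp add: Dp.emeasure_space_1)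
    finally show ?thesis using ex_real(1)[OF s adm_cn cn_le1, of n] by (simp add: A_def)
  qed
  have step: "ex {..<Suc n} (\<lambda>_. D) (W s) (q (Suc n) n) + ennreal (A n s) = ennreal (A (Suc n) s)" for n
  proof -
    have "q (Suc n) n x E + c' n x E = cn (Suc n) x E" for x E
    proof -
      have n: "{..<Suc n} - {n} = {..<n}" by auto
      have "conn {..<n} (mk {..<Suc n} x S) (mk {..<Suc n} x T) E \<Longrightarrow> conn {..<Suc n} (mk {..<Suc n} x S) (mk {..<Suc n} x T) E"
        by (erule conn_mono) auto
      then show ?thesis unfolding q_def c'_def cn_def PV_def mem_Collect_eq n by (auto simp: of_bool_def)
    qed
    then have "ex {..<Suc n} (\<lambda>_. D) (W s) (cn (Suc n)) = ex {..<Suc n} (\<lambda>_. D) (W s) (\<lambda>x E. q (Suc n) n x E + c' n x E)"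
      by presburger
    also have "\<dots> = ex {..<Suc n} (\<lambda>_. D) (W s) (q (Suc n) n) + ex {..<Suc n} (\<lambda>_. D) (W s) (c' n)"
      by (rule K.ex_add[OF _ admq adm']) (simp_all add: D)
    finally show ?thesis using c'_eq ex_real(1)[OF s adm_cn cn_le1, of "Suc n"] by (simp add: A_def)
  qed
  have b: "\<bar>A n s\<bar> \<le> real n * real n + real n + 1" "\<bar>real n * A n s\<bar> \<le> real n * real n + real n + 1" for n
  proof -
    have a: "0 \<le> A n s" "A n s \<le> 1" by (rule A_bounds[OF s])+
    have a2: "real n * A n s \<le> real n * 1" "0 \<le> real n * A n s" "0 \<le> real n * real n" using a by (simp_all add: mult_left_le)
    show "\<bar>A n s\<bar> \<le> real n * real n + real n + 1" "\<bar>real n * A n s\<bar> \<le> real n * real n + real n + 1"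
      unfolding abs_of_nonneg[OF a(1)] abs_of_nonneg[OF a2(2)] using a a2 by linarith+
  qed
  have sA: "summable (\<lambda>n. pois m n * A n s)" "summable (\<lambda>n. pois m n * (real n * A n s))"
    using m b by (auto intro!: summable_pois_mult[where c=1])
  have S1: "(\<integral>\<^sup>+n. ennreal (A n s) \<partial>measure_pmf (poisson_pmf m)) = ennreal (F m s)"
    unfolding F_def by (rule nn_integral_poisson_real[OF m A_bounds(1)[OF s] sA(1)])
  have S2: "(\<integral>\<^sup>+n. ennreal (real n * A n s) \<partial>measure_pmf (poisson_pmf m)) = ennreal (\<Sum>n. pois m n * (real n * A n s))"
    by (rule nn_integral_poisson_real[OF m _ sA(2)]) (simp add: A_bounds(1)[OF s])
  have "pex m D (W s) nV + ennreal m * ennreal (F m s) = ennreal m * (\<integral>\<^sup>+n. ex {..<Suc n} (\<lambda>_. D) (W s) (q (Suc n) n) + ennreal (A n s) \<partial>measure_pmf (poisson_pmf m))"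
    unfolding P S1[symmetric] by (subst nn_integral_add) (simp_all add: distrib_left)
  also have "\<dots> = ennreal m * (\<integral>\<^sup>+n. ennreal (1 / real (Suc n)) * ennreal (real (Suc n) * A (Suc n) s) \<partial>measure_pmf (poisson_pmf m))"
  proof (intro arg_cong2[where f="(*)"] refl nn_integral_cong)
    fix n
    show "ex {..<Suc n} (\<lambda>_. D) (W s) (q (Suc n) n) + ennreal (A n s) = ennreal (1 / real (Suc n)) * ennreal (real (Suc n) * A (Suc n) s)"
    proof -
      have "ennreal (1 / real (Suc n)) * ennreal (real (Suc n) * A (Suc n) s) = ennreal (1 / real (Suc n) * (real (Suc n) * A (Suc n) s))"
        using A_bounds(1)[OF s] by (intro ennreal_mult[symmetric]) simp_all
      then show ?thesis unfolding step by (simp del: of_nat_Suc)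
    qed
  qed
  \<comment> \<open>The size-bias identity read backwards: m E A(N + 1) = E (N A(N)).\<close>
  also have "\<dots> = (\<integral>\<^sup>+n. ennreal (real n * A n s) \<partial>measure_pmf (poisson_pmf m))"
    by (rule nn_integral_poisson_Suc[OF m, symmetric]) simp
  finally have eq: "pex m D (W s) nV + ennreal m * ennreal (F m s) = ennreal (\<Sum>n. pois m n * (real n * A n s))" unfolding S2 .
  have F0: "0 \<le> F m s" unfolding F_def using sA m A_bounds[OF s] by (intro suminf_nonneg) (auto simp: pois_nonneg)
  have N0: "0 \<le> (\<Sum>n. pois m n * (real n * A n s))" using sA m A_bounds[OF s] by (intro suminf_nonneg) (auto simp: pois_nonneg)
  have diff: "(\<Sum>n. pois m n * ((real n - m) * A n s)) = (\<Sum>n. pois m n * (real n * A n s)) - m * F m s"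
  proof -
    have "(\<Sum>n. pois m n * ((real n - m) * A n s)) = (\<Sum>n. pois m n * (real n * A n s) - m * (pois m n * A n s))"
      by (rule arg_cong[where f=suminf]) (simp add: fun_eq_iff algebra_simps)
    also have "\<dots> = (\<Sum>n. pois m n * (real n * A n s)) - (\<Sum>n. m * (pois m n * A n s))"
      by (rule suminf_diff[OF sA(2) summable_mult[OF sA(1)], symmetric])
    also have "(\<Sum>n. m * (pois m n * A n s)) = m * F m s" unfolding F_def by (rule suminf_mult[OF sA(1)])
    finally show ?thesis .
  qed
  have mF: "ennreal m * ennreal (F m s) = ennreal (m * F m s)" using m F0 by (simp add: ennreal_mult)
  \<comment> \<open>Finiteness permits the term \<open>m * F m s\<close> to be moved to the other
    side and the identity to be read in the reals.\<close>
  have fin: "pex m D (W s) nV \<noteq> \<top>" using eq by (metis ennreal_neq_top ennreal_add_eq_top)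
  obtain P where P': "pex m D (W s) nV = ennreal P" "0 \<le> P" using fin by (cases "pex m D (W s) nV") auto
  have "ennreal (P + m * F m s) = ennreal (\<Sum>n. pois m n * (real n * A n s))"
    using eq unfolding P'(1) mF using P'(2) F0 m by (simp add: ennreal_plus)
  then have "P + m * F m s = (\<Sum>n. pois m n * (real n * A n s))"
    using P'(2) F0 m N0 by (subst (asm) ennreal_inj) auto
  then have "P = (\<Sum>n. pois m n * ((real n - m) * A n s))" using diff by simp
  then show "pex m D (W s) nV = ennreal (\<Sum>n. pois m n * ((real n - m) * A n s))" "0 \<le> (\<Sum>n. pois m n * ((real n - m) * A n s))"
    using P' by simp_all
qed

text \<open>Along m = c s^(\<eta> - 1), s times the derivative of F is (\<eta> - 1) E|PV| + E|PE|,
  and \<open>H\<close> says that this is at most 0. The exponent is \<eta> - 1 because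
  \<open>m\<close> belongs to the model of fixed range, whose intensity is \<lambda> / s; thus
  \<lambda> is proportional to s^\<eta>.\<close>

theorem F_decreasing_along_curve:
  assumes p: "0 < p" "p \<le> q" "q \<le> 1" and \<eta>: "0 \<le> \<eta>" "\<eta> \<le> 1" and c: "0 < c"
    and H: "\<And>s. s \<in> {p..q} \<Longrightarrow> ennreal \<eta> * pex (c * s powr (\<eta> - 1)) D (W s) nV \<le>
      pex (c * s powr (\<eta> - 1)) D (W s) (\<lambda>n x E. nV n x E - nE n x E)"
  shows "F (c * q powr (\<eta> - 1)) q \<le> F (c * p powr (\<eta> - 1)) p"
proof -
  define m where "m s = c * s powr (\<eta> - 1)" for s
  define f where "f n s = pois (m s) n * A n s" for n s
  define f' where "f' n s = pois (m s) n * ((\<eta> - 1) * ((real n - m s) * A n s) + B n s) / s" for n s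
  \<comment> \<open>Since \<eta> \<le> 1 the curve is nonincreasing in s, so its value at
    \<open>p\<close> dominates the Poisson weights on the whole interval.\<close>
  define M where "M = m p"
  let ?S = "{p..q}"
  have s01: "0 < s" "0 \<le> s" "s \<le> 1" if "s \<in> ?S" for s using that p by auto
  have mpos: "0 < m s" if "s \<in> ?S" for s using s01[OF that] c by (simp add: m_def)
  have mM: "m s \<le> M" if "s \<in> ?S" for s
    unfolding m_def M_def using that p c \<eta> by (intro mult_left_mono powr_mono2') auto
  have m_der: "(m has_real_derivative (\<eta> - 1) * m s / s) (at s within ?S)" if s: "s \<in> ?S" for s
  proof -
    have "(m has_real_derivative c * ((\<eta> - 1) * s powr (\<eta> - 1 - 1))) (at s within ?S)"
      unfolding m_def[abs_def]
      by (rule DERIV_cmult[OF has_field_derivative_at_within[OF has_real_derivative_powr[OF s01(1)[OF s]]]])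
    moreover have "s powr (\<eta> - 1 - 1) = s powr (\<eta> - 1) / s" unfolding powr_diff[of s "\<eta> - 1" 1] using s01(1)[OF s] by simp
    moreover have "c * ((\<eta> - 1) * (s powr (\<eta> - 1) / s)) = (\<eta> - 1) * m s / s" by (simp add: m_def)
    ultimately show ?thesis by (simp only:)
  qed
  have f_der: "(f n has_real_derivative f' n s) (at s within ?S)" if s: "s \<in> ?S" for n s
  proof -
    have "((\<lambda>s. pois (m s) n) has_real_derivative (pois (m s) n * (real n - m s) / m s) * ((\<eta> - 1) * m s / s)) (at s within ?S)"
      by (rule DERIV_chain2[OF pois_has_derivative m_der[OF s]]) (use mpos[OF s] in simp)
    moreover have "(A n has_real_derivative B n s / s) (at s within ?S)" by (rule A_has_derivative[OF p(1,3) s])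
    ultimately have "(f n has_real_derivative (pois (m s) n * (real n - m s) / m s) * ((\<eta> - 1) * m s / s) * A n s + B n s / s * pois (m s) n) (at s within ?S)"
      unfolding f_def[abs_def] by (rule DERIV_mult)
    moreover have "(pois (m s) n * (real n - m s) / m s) * ((\<eta> - 1) * m s / s) * A n s + B n s / s * pois (m s) n = f' n s"
    proof -
      have e: "(pois (m s) n * (real n - m s) / m s) * ((\<eta> - 1) * m s / s) = pois (m s) n * (real n - m s) * (\<eta> - 1) / s"
        using mpos[OF s] by simp
      show ?thesis unfolding e f'_def by (simp add: distrib_left add_divide_distrib mult_ac)
    qed
    ultimately show ?thesis by simp
  qed
  have f'_bound: "norm (f' n s) \<le> 1 / p * (M ^ n / fact n * (real n * real n + real n + M))" if s: "s \<in> ?S" for n s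
  proof -
    note s' = s01[OF s] and A' = A_bounds[OF s01(2,3)[OF s], of n] and B' = B_bounds[OF s01(2,3)[OF s], of n]
    have "\<bar>(\<eta> - 1) * ((real n - m s) * A n s)\<bar> = \<bar>\<eta> - 1\<bar> * (\<bar>real n - m s\<bar> * A n s)" using A' by (simp add: abs_mult)
    also have "\<dots> \<le> 1 * ((real n + M) * 1)"
      using \<eta> A' mpos[OF s] mM[OF s] by (intro mult_mono) auto
    finally have 1: "\<bar>(\<eta> - 1) * ((real n - m s) * A n s)\<bar> \<le> real n + M" by simp
    have nn: "real n \<le> real n * real n" by (cases n) (auto simp: algebra_simps)
    have "\<bar>(\<eta> - 1) * ((real n - m s) * A n s) + B n s\<bar> \<le> real n * real n + real n + M"
      using 1 B' nn by linarith
    then have "\<bar>pois (m s) n * ((\<eta> - 1) * ((real n - m s) * A n s) + B n s)\<bar> \<le> M ^ n / fact n * (real n * real n + real n + M)"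
      unfolding abs_mult using pois_le[of "m s" M n] mpos[OF s] mM[OF s] pois_nonneg[of "m s" n] by (intro mult_mono) auto
    then have "\<bar>pois (m s) n * ((\<eta> - 1) * ((real n - m s) * A n s) + B n s)\<bar> / s \<le> (M ^ n / fact n * (real n * real n + real n + M)) / p"
      using s p s' by (intro frac_le) auto
    then show ?thesis unfolding f'_def using s' by (simp add: abs_mult mult.commute[of p])
  qed
  have ul: "uniform_limit ?S (\<lambda>n s. \<Sum>i<n. f' i s) (\<lambda>s. \<Sum>i. f' i s) sequentially"
    by (rule Weierstrass_m_test[where M="\<lambda>n. 1 / p * (M ^ n / fact n * (real n * real n + real n + M))"],
        erule f'_bound, intro summable_mult summable_pois_poly)
  have sf: "summable (\<lambda>n. f n s)" if s: "s \<in> ?S" for s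
    unfolding f_def
  proof (rule summable_pois_mult[where c=1])
    fix n show "\<bar>A n s\<bar> \<le> real n * real n + real n + 1"
      using A_bounds[OF s01(2,3)[OF s], of n] zero_le_square[of "real n"] by linarith
  qed (use mpos[OF s] in simp)
  have "p \<in> ?S" using p by simp
  obtain G where G: "\<And>s. s \<in> ?S \<Longrightarrow> (\<lambda>n. f n s) sums G s" "\<And>s. s \<in> ?S \<Longrightarrow> (G has_real_derivative (\<Sum>n. f' n s)) (at s within ?S)"
    using has_field_derivative_series[OF convex_real_interval(5) f_der ul \<open>p \<in> ?S\<close> sf[OF \<open>p \<in> ?S\<close>]] by blast
  have GF: "G s = F (m s) s" if "s \<in> ?S" for s
    using G(1)[OF that] by (simp add: sums_iff F_def f_def)
  have neg: "(\<Sum>n. f' n s) \<le> 0" if s: "s \<in> ?S" for s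
  proof -
    note s' = s01[OF s]
    interpret K: kernel "W s" by (rule kernel_scale[OF s'(2,3)])
    let ?P = "\<Sum>n. pois (m s) n * ((real n - m s) * A n s)" and ?B = "\<Sum>n. pois (m s) n * B n s"
    have sB: "summable (\<lambda>n. pois (m s) n * B n s)"
    proof (rule summable_pois_mult[where c=0])
      fix n show "\<bar>B n s\<bar> \<le> real n * real n + real n + 0"
        using B_bounds[OF s'(2,3), of n] zero_le_square[of "real n"] by linarith
    qed (use mpos[OF s] in simp)
    have sP: "summable (\<lambda>n. pois (m s) n * ((real n - m s) * A n s))"
    proof (rule summable_pois_mult[where c="m s"])
      fix n
      have "\<bar>(real n - m s) * A n s\<bar> = \<bar>real n - m s\<bar> * A n s" using A_bounds[OF s'(2,3), of n] by (simp add: abs_mult)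
      also have "\<dots> \<le> (real n + m s) * 1" using A_bounds[OF s'(2,3), of n] mpos[OF s] by (intro mult_mono) auto
      finally show "\<bar>(real n - m s) * A n s\<bar> \<le> real n * real n + real n + m s"
        by (rule order_trans) simp
    qed (use mpos[OF s] in simp)
    have P0: "0 \<le> ?P" by (rule pex_nV(2)[OF s'(2,3) mpos[OF s]])
    have B0: "0 \<le> ?B" using sB B_bounds[OF s'(2,3)] mpos[OF s] by (intro suminf_nonneg) (auto simp: pois_nonneg)
    have adm: "adm {..<n} (\<lambda>x E. nV n x E - nE n x E)" for n
    proof -
      have "(\<lambda>x. nV n x E - nE n x E) \<in> borel_measurable (PiM {..<n} (\<lambda>_. borel))" if "E \<subseteq> pairs {..<n}" for E
        using adm_nV[of n] adm_nE[of n] that unfolding adm_def by (intro borel_measurable_diff) blast+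
      then show ?thesis unfolding adm_def using nE_le_nV by simp
    qed
    have "ennreal \<eta> * ennreal ?P + ennreal ?B \<le> pex (m s) D (W s) (\<lambda>n x E. nV n x E - nE n x E) + pex (m s) D (W s) nE"
      unfolding pex_nV(1)[OF s'(2,3) mpos[OF s], symmetric] pex_nE[OF s'(2,3) mpos[OF s], symmetric]
      using H[OF s] unfolding m_def by (rule add_right_mono)
    also have "\<dots> = pex (m s) D (W s) (\<lambda>n x E. (nV n x E - nE n x E) + nE n x E)"
      by (rule K.pex_add[OF D(2) adm adm_nE, symmetric])
    also have "\<dots> = ennreal ?P" using pex_nV(1)[OF s'(2,3) mpos[OF s]] by simp
    finally have le0: "ennreal \<eta> * ennreal ?P + ennreal ?B \<le> ennreal ?P" .
    have "ennreal (\<eta> * ?P + ?B) = ennreal (\<eta> * ?P) + ennreal ?B"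
      using \<eta> P0 B0 by (intro ennreal_plus mult_nonneg_nonneg)
    also have "ennreal (\<eta> * ?P) = ennreal \<eta> * ennreal ?P" by (rule ennreal_mult[OF \<eta>(1) P0])
    finally have "ennreal (\<eta> * ?P + ?B) \<le> ennreal ?P" using le0 by (simp only:)
    then have le: "\<eta> * ?P + ?B \<le> ?P" using P0 by (simp only: ennreal_le_iff)
    have "(\<Sum>n. f' n s) = (\<Sum>n. (\<eta> - 1) / s * (pois (m s) n * ((real n - m s) * A n s)) + 1 / s * (pois (m s) n * B n s))"
      by (rule arg_cong[where f=suminf]) (simp add: f'_def fun_eq_iff distrib_left add_divide_distrib mult_ac)
    also have "\<dots> = (\<eta> - 1) / s * ?P + 1 / s * ?B"
      by (simp only: suminf_add[OF summable_mult[OF sP] summable_mult[OF sB], symmetric] suminf_mult[OF sP] suminf_mult[OF sB])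
    also have "\<dots> = (\<eta> * ?P + ?B - ?P) / s" using s'(1) by (simp add: field_simps)
    also have "\<dots> \<le> 0" using le s' by (simp add: divide_nonpos_pos)
    finally show ?thesis .
  qed
  have "G q \<le> G p"
  proof (rule DERIV_nonpos_imp_decreasing_open[OF p(2)])
    fix s assume s: "p < s" "s < q"
    then have "(G has_real_derivative (\<Sum>n. f' n s)) (at s)" using G(2)[of s] by (simp add: at_within_Icc_at)
    then show "\<exists>y. DERIV G s :> y \<and> y \<le> 0" using neg[of s] s by auto
  next
    show "continuous_on ?S G" using G(2) by (rule DERIV_continuous_on)
  qed
  then show ?thesis using GF p by (simp add: m_def)
qed

end

section \<open>Boxes and the random connection model\<close>

definition ind_conn :: "'a set \<Rightarrow> 'a set \<Rightarrow> 'i set \<Rightarrow> ('i \<Rightarrow> 'a) \<Rightarrow> 'i set set \<Rightarrow> real" where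
  "ind_conn S T V x E = of_bool (conn V (mk V x S) (mk V x T) E)"

definition PC :: "real \<Rightarrow> 'a measure \<Rightarrow> ('a \<Rightarrow> 'a \<Rightarrow> real) \<Rightarrow> 'a set \<Rightarrow> 'a set \<Rightarrow> ennreal" where
  "PC m D w S T = pex m D w (\<lambda>n. ind_conn S T {..<n})"

lemma adm_ind_conn:
  "finite V \<Longrightarrow> S \<in> sets borel \<Longrightarrow> T \<in> sets borel \<Longrightarrow> adm V (ind_conn S T V)"
  unfolding ind_conn_def by (rule adm_mark[where \<Phi>="\<lambda>A B E. of_bool (conn V A B E)"]) auto

section \<open>Poisson splitting: points with a mixture law versus independent Poisson counts per
  class\<close>

lemma sum_PiE_insert:
  assumes "i \<notin> I"
  shows "(\<Sum>\<kappa>\<in>PiE (insert i I) (\<lambda>_. K). G \<kappa>) = (\<Sum>c\<in>K. \<Sum>g\<in>PiE I (\<lambda>_. K). G (g(i := c)))"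
proof -
  have "(\<Sum>\<kappa>\<in>PiE (insert i I) (\<lambda>_. K). G \<kappa>) = (\<Sum>p\<in>K \<times> PiE I (\<lambda>_. K). G ((\<lambda>(y, g). g(i := y)) p))"
    unfolding PiE_insert_eq by (subst sum.reindex[OF inj_combinator[OF assms]]) simp
  also have "\<dots> = (\<Sum>c\<in>K. \<Sum>g\<in>PiE I (\<lambda>_. K). G (g(i := c)))"
    unfolding sum.cartesian_product by (intro sum.cong refl) auto
  finally show ?thesis .
qed

lemma measurable_nn_integral_fun_upd:
  fixes M :: "'i \<Rightarrow> 'a::topological_space measure"
  assumes M: "\<And>i. prob_space (M i)" "\<And>i. sets (M i) = sets borel" and I: "finite I"
    and h: "h \<in> borel_measurable (PiM (insert i I) (\<lambda>_. borel))"
  shows "(\<lambda>y. \<integral>\<^sup>+x. h (x(i := y)) \<partial>PiM I M) \<in> borel_measurable borel"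
proof -
  interpret P: prob_space "PiM I M" using M by (intro prob_space_PiM)
  have h': "h \<in> borel_measurable (PiM (insert i I) M)"
  proof -
    have "sets (PiM (insert i I) M) = sets (PiM (insert i I) (\<lambda>_. borel))" by (intro sets_PiM_cong refl M(2))
    from measurable_cong_sets[OF this refl] show ?thesis using h by blast
  qed
  have sw: "(\<lambda>p. (snd p, fst p)) \<in> borel \<Otimes>\<^sub>M PiM I M \<rightarrow>\<^sub>M PiM I M \<Otimes>\<^sub>M M i"
  proof (intro measurable_Pair measurable_snd)
    show "fst \<in> borel \<Otimes>\<^sub>M PiM I M \<rightarrow>\<^sub>M M i"
      by (simp only: measurable_cong_sets[OF refl M(2)[of i]] measurable_fst)
  qed
  have "(\<lambda>p. h ((\<lambda>(f, y). f(i := y)) (snd p, fst p))) \<in> borel_measurable (borel \<Otimes>\<^sub>M PiM I M)"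
    by (rule measurable_compose[OF measurable_compose[OF sw measurable_add_dim] h'])
  then show ?thesis by (intro P.borel_measurable_nn_integral) (simp add: case_prod_beta)
qed

text \<open>Each point first chooses its class and then its position; expanding the product gives a
  sum over the assignments \<open>\<kappa>\<close> of classes to points.\<close>

lemma nn_integral_PiM_mixture:
  fixes D :: "'a::topological_space measure" and I :: "'i set"
  assumes K: "finite K" and I: "finite I"
    and D: "prob_space D" "sets D = sets borel"
    and Dc: "\<And>c. prob_space (Dc c)" "\<And>c. sets (Dc c) = sets borel"
    and mix: "\<And>h. h \<in> borel_measurable borel \<Longrightarrow> (\<integral>\<^sup>+y. h y \<partial>D) = (\<Sum>c\<in>K. ennreal (\<rho> c) * (\<integral>\<^sup>+y. h y \<partial>Dc c))"
    and h: "h \<in> borel_measurable (PiM I (\<lambda>_. borel))"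
  shows "(\<integral>\<^sup>+x. h x \<partial>PiM I (\<lambda>_. D)) = (\<Sum>\<kappa>\<in>PiE I (\<lambda>_. K). (\<Prod>i\<in>I. ennreal (\<rho> (\<kappa> i))) * (\<integral>\<^sup>+x. h x \<partial>PiM I (\<lambda>i. Dc (\<kappa> i))))"
  using I h
proof (induction I arbitrary: h rule: finite_induct)
  case empty
  have "PiM {} (\<lambda>_. D) = PiM {} (\<lambda>i. Dc (\<kappa> i))" for \<kappa> :: "'i \<Rightarrow> _" by (intro PiM_cong) auto
  then show ?case by simp
next
  case (insert i I)
  interpret P: product_sigma_finite "\<lambda>_::'i. D" using D(1) by (simp add: product_sigma_finite_def prob_space_imp_sigma_finite)
  have Q: "product_sigma_finite (\<lambda>i::'i. Dc (\<kappa> i))" for \<kappa>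
    using Dc(1) by (simp add: product_sigma_finite_def prob_space_imp_sigma_finite)
  have hM: "h \<in> borel_measurable (PiM (insert i I) M)" if "\<And>i. sets (M i) = sets borel" for M :: "'i \<Rightarrow> 'a measure"
  proof -
    have "sets (PiM (insert i I) M) = sets (PiM (insert i I) (\<lambda>_. borel))" by (intro sets_PiM_cong refl that)
    from measurable_cong_sets[OF this refl] show ?thesis using insert.prems by blast
  qed
  have hx: "(\<lambda>x. h (x(i := y))) \<in> borel_measurable (PiM I (\<lambda>_. borel))" for y
  proof -
    have "(\<lambda>x. h ((\<lambda>(f, y). f(i := y)) (x, y))) \<in> borel_measurable (PiM I (\<lambda>_. borel))"
      by (rule measurable_compose[OF measurable_compose[OF _ measurable_add_dim] insert.prems]) simp
    then show ?thesis by simp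
  qed
  let ?J = "\<lambda>\<kappa> y. \<integral>\<^sup>+x. h (x(i := y)) \<partial>PiM I (\<lambda>j. Dc (\<kappa> j))"
  have meas: "?J \<kappa> \<in> borel_measurable borel" for \<kappa>
    by (rule measurable_nn_integral_fun_upd[OF Dc insert.hyps(1) insert.prems])
  have "(\<integral>\<^sup>+x. h x \<partial>PiM (insert i I) (\<lambda>_. D)) = (\<integral>\<^sup>+y. \<integral>\<^sup>+x. h (x(i := y)) \<partial>PiM I (\<lambda>_. D) \<partial>D)"
    by (rule P.product_nn_integral_insert_rev[OF insert.hyps hM]) (rule D(2))
  also have "\<dots> = (\<integral>\<^sup>+y. (\<Sum>g\<in>PiE I (\<lambda>_. K). (\<Prod>j\<in>I. ennreal (\<rho> (g j))) * ?J g y) \<partial>D)"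
    by (intro nn_integral_cong insert.IH hx)
  also have "\<dots> = (\<Sum>c\<in>K. ennreal (\<rho> c) * (\<integral>\<^sup>+y. (\<Sum>g\<in>PiE I (\<lambda>_. K). (\<Prod>j\<in>I. ennreal (\<rho> (g j))) * ?J g y) \<partial>Dc c))"
    by (intro mix borel_measurable_sum borel_measurable_times_ennreal borel_measurable_const meas)
  also have "\<dots> = (\<Sum>c\<in>K. \<Sum>g\<in>PiE I (\<lambda>_. K). ennreal (\<rho> c) * ((\<Prod>j\<in>I. ennreal (\<rho> (g j))) * (\<integral>\<^sup>+y. ?J g y \<partial>Dc c)))"
  proof (intro sum.cong refl)
    fix c
    have mc: "?J g \<in> borel_measurable (Dc c)" for g using meas[of g] measurable_cong_sets[OF Dc(2) refl] by blast
    show "ennreal (\<rho> c) * (\<integral>\<^sup>+y. (\<Sum>g\<in>PiE I (\<lambda>_. K). (\<Prod>j\<in>I. ennreal (\<rho> (g j))) * ?J g y) \<partial>Dc c) =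
      (\<Sum>g\<in>PiE I (\<lambda>_. K). ennreal (\<rho> c) * ((\<Prod>j\<in>I. ennreal (\<rho> (g j))) * (\<integral>\<^sup>+y. ?J g y \<partial>Dc c)))"
      by (subst nn_integral_sum, intro borel_measurable_times_ennreal borel_measurable_const mc)
        (simp only: nn_integral_cmult[OF mc] sum_distrib_left)
  qed
  also have "\<dots> = (\<Sum>c\<in>K. \<Sum>g\<in>PiE I (\<lambda>_. K). (\<Prod>j\<in>insert i I. ennreal (\<rho> ((g(i := c)) j))) *
      (\<integral>\<^sup>+x. h x \<partial>PiM (insert i I) (\<lambda>j. Dc ((g(i := c)) j))))"
  proof (intro sum.cong refl)
    fix c g
    have "(\<Prod>j\<in>insert i I. ennreal (\<rho> ((g(i := c)) j))) = ennreal (\<rho> c) * (\<Prod>j\<in>I. ennreal (\<rho> (g j)))"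
      using insert.hyps by (subst prod.insert) (auto intro!: arg_cong2[where f="(*)"] prod.cong)
    moreover have "(\<integral>\<^sup>+x. h x \<partial>PiM (insert i I) (\<lambda>j. Dc ((g(i := c)) j))) = (\<integral>\<^sup>+y. ?J g y \<partial>Dc c)"
    proof -
      have "PiM I (\<lambda>j. Dc ((g(i := c)) j)) = PiM I (\<lambda>j. Dc (g j))" using insert.hyps by (intro PiM_cong) auto
      then show ?thesis
        using product_sigma_finite.product_nn_integral_insert_rev[OF Q[of "g(i := c)"] insert.hyps hM, OF Dc(2)] by simp
    qed
    ultimately show "ennreal (\<rho> c) * ((\<Prod>j\<in>I. ennreal (\<rho> (g j))) * (\<integral>\<^sup>+y. ?J g y \<partial>Dc c)) =
      (\<Prod>j\<in>insert i I. ennreal (\<rho> ((g(i := c)) j))) * (\<integral>\<^sup>+x. h x \<partial>PiM (insert i I) (\<lambda>j. Dc ((g(i := c)) j)))"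
      by (simp add: mult.assoc)
  qed
  also have "\<dots> = (\<Sum>\<kappa>\<in>PiE (insert i I) (\<lambda>_. K). (\<Prod>j\<in>insert i I. ennreal (\<rho> (\<kappa> j))) * (\<integral>\<^sup>+x. h x \<partial>PiM (insert i I) (\<lambda>j. Dc (\<kappa> j))))"
    by (rule sum_PiE_insert[OF insert.hyps(2), symmetric])
  finally show ?case .
qed

definition comp_set :: "'c set \<Rightarrow> nat \<Rightarrow> ('c \<Rightarrow> nat) set" where
  "comp_set K n = {N \<in> PiE K (\<lambda>_. UNIV). sum N K = n}"

lemma finite_comp_set: "finite K \<Longrightarrow> finite (comp_set K n)"
proof -
  assume K: "finite K"
  have "comp_set K n \<subseteq> PiE K (\<lambda>_. {..n})"
  proof
    fix N assume N: "N \<in> comp_set K n"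
    show "N \<in> PiE K (\<lambda>_. {..n})"
      using N K member_le_sum[of _ K N] by (auto simp: comp_set_def PiE_iff)
  qed
  from finite_subset[OF this finite_PiE[OF K]] show ?thesis by simp
qed

definition cnt :: "'c set \<Rightarrow> nat \<Rightarrow> (nat \<Rightarrow> 'c) \<Rightarrow> 'c \<Rightarrow> nat" where
  "cnt K n \<kappa> = (\<lambda>c\<in>K. card {i \<in> {..<n}. \<kappa> i = c})"

lemma cnt_Suc:
  assumes "c \<in> K" shows "cnt K (Suc n) (g(n := c)) = (cnt K n g)(c := Suc (cnt K n g c))"
proof
  fix d
  have "{i \<in> {..<Suc n}. (g(n := c)) i = d} = (if d = c then insert n {i \<in> {..<n}. g i = d} else {i \<in> {..<n}. g i = d})"
    by (auto simp: less_Suc_eq)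
  then have c1: "card {i \<in> {..<Suc n}. (g(n := c)) i = d} = (if d = c then Suc (card {i \<in> {..<n}. g i = d}) else card {i \<in> {..<n}. g i = d})"
    by (simp only:) simp
  have "cnt K (Suc n) (g(n := c)) d = (if d \<in> K then card {i \<in> {..<Suc n}. (g(n := c)) i = d} else undefined)"
    by (simp only: cnt_def restrict_def)
  then show "cnt K (Suc n) (g(n := c)) d = ((cnt K n g)(c := Suc (cnt K n g c))) d"
    unfolding c1 using assms by (auto simp: cnt_def)
qed

text \<open>The multinomial probability of the counts \<open>N\<close> without its factor n!, which
  is cancelled by the n! in the Poisson weight.\<close>

definition multi_wt :: "'c set \<Rightarrow> ('c \<Rightarrow> real) \<Rightarrow> ('c \<Rightarrow> nat) \<Rightarrow> real" where
  "multi_wt K \<rho> N = (\<Prod>c\<in>K. \<rho> c ^ N c / fact (N c))"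

lemma multi_wt_Suc:
  assumes K: "finite K" "c \<in> K"
  shows "real (Suc (N c)) * multi_wt K \<rho> (N(c := Suc (N c))) = \<rho> c * multi_wt K \<rho> N"
proof -
  have A: "multi_wt K \<rho> (N(c := Suc (N c))) = \<rho> c ^ Suc (N c) / fact (Suc (N c)) * (\<Prod>d\<in>K - {c}. \<rho> d ^ N d / fact (N d))"
    unfolding multi_wt_def by (subst prod.remove[OF K]) (auto intro!: arg_cong2[where f="(*)"] prod.cong)
  have B: "multi_wt K \<rho> N = \<rho> c ^ N c / fact (N c) * (\<Prod>d\<in>K - {c}. \<rho> d ^ N d / fact (N d))"
    unfolding multi_wt_def by (rule prod.remove[OF K])
  show ?thesis unfolding A B by (simp add: field_simps del: of_nat_Suc)
qed

text \<open>There are n! divided by the product of the \<open>N c\<close>! assignments with counts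
  \<open>N\<close>. The induction reveals the class of the last point; summed over that class, the
  factors \<open>M c\<close> give \<open>Suc n\<close>, which turns n! into (n + 1)!.\<close>

lemma multinomial_regroup:
  fixes \<Psi> :: "('c \<Rightarrow> nat) \<Rightarrow> ennreal"
  assumes K: "finite K" and \<rho>: "\<And>c. c \<in> K \<Longrightarrow> 0 \<le> \<rho> c"
  shows "(\<Sum>\<kappa>\<in>PiE {..<n} (\<lambda>_. K). (\<Prod>i<n. ennreal (\<rho> (\<kappa> i))) * \<Psi> (cnt K n \<kappa>)) =
     ennreal (fact n) * (\<Sum>N\<in>comp_set K n. ennreal (multi_wt K \<rho> N) * \<Psi> N)"
proof (induction n arbitrary: \<Psi>)
  case 0
  define z where "z = (\<lambda>c\<in>K. 0 :: nat)"
  have "comp_set K 0 = {z}" using K by (auto simp: z_def comp_set_def PiE_iff extensional_def fun_eq_iff)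
  moreover have "cnt K 0 \<kappa> = z" for \<kappa> by (simp add: cnt_def z_def fun_eq_iff)
  moreover have "multi_wt K \<rho> z = 1" unfolding multi_wt_def by (intro prod.neutral) (simp add: z_def)
  ultimately show ?case by simp
next
  case (Suc n)
  let ?up = "\<lambda>c N. N(c := Suc (N c))"
  have mw0: "0 \<le> multi_wt K \<rho> N" for N unfolding multi_wt_def using \<rho> by (intro prod_nonneg) auto
  have "(\<Sum>\<kappa>\<in>PiE {..<Suc n} (\<lambda>_. K). (\<Prod>i<Suc n. ennreal (\<rho> (\<kappa> i))) * \<Psi> (cnt K (Suc n) \<kappa>)) =
    (\<Sum>c\<in>K. \<Sum>g\<in>PiE {..<n} (\<lambda>_. K). (\<Prod>i<Suc n. ennreal (\<rho> ((g(n := c)) i))) * \<Psi> (cnt K (Suc n) (g(n := c))))"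
    unfolding lessThan_Suc[of n] by (rule sum_PiE_insert) simp
  also have "\<dots> = (\<Sum>c\<in>K. ennreal (\<rho> c) * (\<Sum>g\<in>PiE {..<n} (\<lambda>_. K). (\<Prod>i<n. ennreal (\<rho> (g i))) * \<Psi> (?up c (cnt K n g))))"
  proof (intro sum.cong refl)
    fix c assume c: "c \<in> K"
    have "(\<Prod>i<Suc n. ennreal (\<rho> ((g(n := c)) i))) = ennreal (\<rho> c) * (\<Prod>i<n. ennreal (\<rho> (g i)))" for g
    proof -
      have "(\<Prod>i<n. ennreal (\<rho> ((g(n := c)) i))) = (\<Prod>i<n. ennreal (\<rho> (g i)))" by (intro prod.cong) auto
      then show ?thesis by (simp add: mult.commute)
    qed
    then show "(\<Sum>g\<in>PiE {..<n} (\<lambda>_. K). (\<Prod>i<Suc n. ennreal (\<rho> ((g(n := c)) i))) * \<Psi> (cnt K (Suc n) (g(n := c)))) =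
      ennreal (\<rho> c) * (\<Sum>g\<in>PiE {..<n} (\<lambda>_. K). (\<Prod>i<n. ennreal (\<rho> (g i))) * \<Psi> (?up c (cnt K n g)))"
      by (simp only: cnt_Suc[OF c] sum_distrib_left mult.assoc)
  qed
  also have "\<dots> = (\<Sum>c\<in>K. ennreal (\<rho> c) * (ennreal (fact n) * (\<Sum>N\<in>comp_set K n. ennreal (multi_wt K \<rho> N) * \<Psi> (?up c N))))"
  proof (intro sum.cong refl)
    fix c
    show "ennreal (\<rho> c) * (\<Sum>g\<in>PiE {..<n} (\<lambda>_. K). (\<Prod>i<n. ennreal (\<rho> (g i))) * \<Psi> (?up c (cnt K n g))) =
      ennreal (\<rho> c) * (ennreal (fact n) * (\<Sum>N\<in>comp_set K n. ennreal (multi_wt K \<rho> N) * \<Psi> (?up c N)))"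
      by (rule arg_cong[where f="(*) (ennreal (\<rho> c))", OF Suc.IH[of "\<lambda>N. \<Psi> (?up c N)"]])
  qed
  also have "\<dots> = ennreal (fact n) * (\<Sum>c\<in>K. \<Sum>N\<in>comp_set K n. ennreal (\<rho> c) * ennreal (multi_wt K \<rho> N) * \<Psi> (?up c N))"
    by (simp only: sum_distrib_left mult_ac)
  finally have E1: "(\<Sum>\<kappa>\<in>PiE {..<Suc n} (\<lambda>_. K). (\<Prod>i<Suc n. ennreal (\<rho> (\<kappa> i))) * \<Psi> (cnt K (Suc n) \<kappa>)) =
    ennreal (fact n) * (\<Sum>c\<in>K. \<Sum>N\<in>comp_set K n. ennreal (\<rho> c) * ennreal (multi_wt K \<rho> N) * \<Psi> (?up c N))" .
  have "(\<Sum>c\<in>K. \<Sum>N\<in>comp_set K n. ennreal (\<rho> c) * ennreal (multi_wt K \<rho> N) * \<Psi> (?up c N)) =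
    (\<Sum>c\<in>K. \<Sum>M\<in>comp_set K (Suc n). ennreal (real (M c)) * (ennreal (multi_wt K \<rho> M) * \<Psi> M))"
  proof (rule sum.cong[OF refl])
    fix c assume c: "c \<in> K"
    have "(\<Sum>N\<in>comp_set K n. ennreal (\<rho> c) * ennreal (multi_wt K \<rho> N) * \<Psi> (?up c N)) =
      (\<Sum>N\<in>comp_set K n. ennreal (real (Suc (N c))) * (ennreal (multi_wt K \<rho> (?up c N)) * \<Psi> (?up c N)))"
    proof (intro sum.cong refl)
      fix N
      have "ennreal (\<rho> c) * ennreal (multi_wt K \<rho> N) = ennreal (real (Suc (N c))) * ennreal (multi_wt K \<rho> (?up c N))"
        using multi_wt_Suc[OF K c, of N \<rho>] \<rho>[OF c] mw0 by (simp add: ennreal_mult[symmetric] del: of_nat_Suc)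
      then show "ennreal (\<rho> c) * ennreal (multi_wt K \<rho> N) * \<Psi> (?up c N) = ennreal (real (Suc (N c))) * (ennreal (multi_wt K \<rho> (?up c N)) * \<Psi> (?up c N))"
        by (simp only: mult.assoc)
    qed
    also have "\<dots> = (\<Sum>M\<in>{M \<in> comp_set K (Suc n). 0 < M c}. ennreal (real (M c)) * (ennreal (multi_wt K \<rho> M) * \<Psi> M))"
    proof (rule sum.reindex_bij_witness[where i="\<lambda>M. M(c := M c - 1)" and j="?up c"])
      have s: "sum (N(c := k)) K = k + sum N (K - {c})" "sum N K = N c + sum N (K - {c})" for N :: "_ \<Rightarrow> nat" and k
        by (subst sum.remove[OF K c], auto intro!: sum.cong simp: sum.remove[OF K c])
      fix N assume N: "N \<in> comp_set K n"
      show "(?up c N)(c := (?up c N) c - 1) = N" by simp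
      show "?up c N \<in> {M \<in> comp_set K (Suc n). 0 < M c}"
        using N c s(1)[of N] s(2)[of N] by (auto simp: comp_set_def PiE_iff extensional_def)
    next
      have s: "sum (N(c := k)) K = k + sum N (K - {c})" "sum N K = N c + sum N (K - {c})" for N :: "_ \<Rightarrow> nat" and k
        by (subst sum.remove[OF K c], auto intro!: sum.cong simp: sum.remove[OF K c])
      fix M assume M: "M \<in> {M \<in> comp_set K (Suc n). 0 < M c}"
      then show "?up c (M(c := M c - 1)) = M" by auto
      show "M(c := M c - 1) \<in> comp_set K n"
        using M c s(1)[of M "M c - 1"] s(2)[of M] by (auto simp: comp_set_def PiE_iff extensional_def)
    qed simp
    also have "\<dots> = (\<Sum>M\<in>comp_set K (Suc n). ennreal (real (M c)) * (ennreal (multi_wt K \<rho> M) * \<Psi> M))"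
      by (rule sum.mono_neutral_left) (auto simp: finite_comp_set[OF K])
    finally show "(\<Sum>N\<in>comp_set K n. ennreal (\<rho> c) * ennreal (multi_wt K \<rho> N) * \<Psi> (?up c N)) =
      (\<Sum>M\<in>comp_set K (Suc n). ennreal (real (M c)) * (ennreal (multi_wt K \<rho> M) * \<Psi> M))" .
  qed
  also have "\<dots> = (\<Sum>M\<in>comp_set K (Suc n). (\<Sum>c\<in>K. ennreal (real (M c))) * (ennreal (multi_wt K \<rho> M) * \<Psi> M))"
    by (subst sum.swap) (simp only: sum_distrib_right)
  also have "\<dots> = (\<Sum>M\<in>comp_set K (Suc n). ennreal (real (Suc n)) * (ennreal (multi_wt K \<rho> M) * \<Psi> M))"
  proof (intro sum.cong refl arg_cong2[where f="(*)"])
    fix M assume "M \<in> comp_set K (Suc n)"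
    then have "sum M K = Suc n" by (simp add: comp_set_def)
    then show "(\<Sum>c\<in>K. ennreal (real (M c))) = ennreal (real (Suc n))"
      by (simp add: sum_ennreal flip: of_nat_sum del: of_nat_Suc)
  qed
  finally have E2: "(\<Sum>c\<in>K. \<Sum>N\<in>comp_set K n. ennreal (\<rho> c) * ennreal (multi_wt K \<rho> N) * \<Psi> (?up c N)) =
    (\<Sum>M\<in>comp_set K (Suc n). ennreal (real (Suc n)) * (ennreal (multi_wt K \<rho> M) * \<Psi> M))" .
  show ?case unfolding E1 E2
  proof -
    have "ennreal (fact (Suc n)) = ennreal (fact n) * ennreal (real (Suc n))"
      by (simp add: ennreal_mult[symmetric] mult.commute del: of_nat_Suc)
    then show "ennreal (fact n) * (\<Sum>M\<in>comp_set K (Suc n). ennreal (real (Suc n)) * (ennreal (multi_wt K \<rho> M) * \<Psi> M)) =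
      ennreal (fact (Suc n)) * (\<Sum>M\<in>comp_set K (Suc n). ennreal (multi_wt K \<rho> M) * \<Psi> M)"
      by (simp only: sum_distrib_left[symmetric] mult.assoc)
  qed
qed

text \<open>The product space is countable; its atoms are grouped by their total, to match the
  series over the number of points.\<close>

lemma nn_integral_PiM_counts:
  fixes p :: "'c \<Rightarrow> nat pmf"
  assumes K: "finite K"
  shows "(\<integral>\<^sup>+N. \<Psi> N \<partial>PiM K (\<lambda>c. measure_pmf (p c))) =
    (\<Sum>n. \<Sum>N\<in>comp_set K n. ennreal (\<Prod>c\<in>K. pmf (p c) (N c)) * \<Psi> N)"
proof -
  let ?M = "PiM K (\<lambda>c. measure_pmf (p c))"
  interpret product_prob_space "\<lambda>c. measure_pmf (p c)" by unfold_locales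
  have sp: "space ?M = PiE K (\<lambda>_. UNIV)" by (simp add: space_PiM)
  have sing: "{N} \<in> sets ?M" "emeasure ?M {N} = ennreal (\<Prod>c\<in>K. pmf (p c) (N c))" if N: "N \<in> PiE K (\<lambda>_. UNIV)" for N
  proof -
    have eq: "{N} = PiE K (\<lambda>c. {N c})" using N by (subst PiE_singleton) (auto simp: PiE_iff)
    show "{N} \<in> sets ?M" unfolding eq using K by (intro sets_PiM_I_finite) auto
    have "emeasure ?M (PiE K (\<lambda>c. {N c})) = (\<Prod>c\<in>K. emeasure (measure_pmf (p c)) {N c})"
      using K by (intro emeasure_PiM) auto
    also have "\<dots> = ennreal (\<Prod>c\<in>K. pmf (p c) (N c))" by (simp add: emeasure_pmf_single prod_ennreal)
    finally show "emeasure ?M {N} = ennreal (\<Prod>c\<in>K. pmf (p c) (N c))" unfolding eq .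
  qed
  have "(\<integral>\<^sup>+N. \<Psi> N \<partial>?M) = (\<integral>\<^sup>+N. (\<Sum>n. \<Sum>N'\<in>comp_set K n. \<Psi> N' * indicator {N'} N) \<partial>?M)"
  proof (intro nn_integral_cong)
    fix N assume "N \<in> space ?M"
    then have N: "N \<in> PiE K (\<lambda>_. UNIV)" by (simp add: sp)
    have "(\<Sum>N'\<in>comp_set K n. \<Psi> N' * indicator {N'} N) = (if n = sum N K then \<Psi> N else 0)" for n
    proof -
      have "(\<Sum>N'\<in>comp_set K n. \<Psi> N' * indicator {N'} N) = (\<Sum>N'\<in>comp_set K n. if N' = N then \<Psi> N else 0)"
        by (intro sum.cong) (auto simp: indicator_def)
      also have "\<dots> = (if N \<in> comp_set K n then \<Psi> N else 0)" by (simp add: finite_comp_set[OF K])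
      finally show ?thesis using N by (auto simp: comp_set_def)
    qed
    then show "\<Psi> N = (\<Sum>n. \<Sum>N'\<in>comp_set K n. \<Psi> N' * indicator {N'} N)"
      using suminf_finite[of "{sum N K}" "\<lambda>n. if n = sum N K then \<Psi> N else 0"] by simp
  qed
  also have "\<dots> = (\<Sum>n. \<integral>\<^sup>+N. (\<Sum>N'\<in>comp_set K n. \<Psi> N' * indicator {N'} N) \<partial>?M)"
    by (intro nn_integral_suminf borel_measurable_sum borel_measurable_times_ennreal borel_measurable_const borel_measurable_indicator sing(1))
      (auto simp: comp_set_def)
  also have "\<dots> = (\<Sum>n. \<Sum>N\<in>comp_set K n. ennreal (\<Prod>c\<in>K. pmf (p c) (N c)) * \<Psi> N)"
  proof (rule arg_cong[where f=suminf], rule ext)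
    fix n
    have "(\<integral>\<^sup>+N. (\<Sum>N'\<in>comp_set K n. \<Psi> N' * indicator {N'} N) \<partial>?M) = (\<Sum>N'\<in>comp_set K n. \<integral>\<^sup>+N. \<Psi> N' * indicator {N'} N \<partial>?M)"
      by (intro nn_integral_sum borel_measurable_times_ennreal borel_measurable_const borel_measurable_indicator sing(1)) (auto simp: comp_set_def)
    also have "\<dots> = (\<Sum>N\<in>comp_set K n. ennreal (\<Prod>c\<in>K. pmf (p c) (N c)) * \<Psi> N)"
      using sing by (intro sum.cong refl) (auto simp: comp_set_def nn_integral_cmult_indicator mult.commute)
    finally show "(\<integral>\<^sup>+N. (\<Sum>N'\<in>comp_set K n. \<Psi> N' * indicator {N'} N) \<partial>?M) = (\<Sum>N\<in>comp_set K n. ennreal (\<Prod>c\<in>K. pmf (p c) (N c)) * \<Psi> N)" .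
  qed
  finally show ?thesis .
qed

text \<open>For a set \<open>K\<close> of cells and the counts \<open>N\<close> of a sample, these
  are the labels that are present in \<open>K\<close>.\<close>

definition labs :: "'c set \<Rightarrow> ('c \<Rightarrow> nat) \<Rightarrow> ('c \<times> nat) set" where
  "labs K N = Sigma K (\<lambda>c. {..<N c})"

lemma finite_labs: "finite K \<Longrightarrow> finite (labs K N)" by (simp add: labs_def)

text \<open>The points of each class are numbered among themselves, which turns the index of a point
  into a label.\<close>

lemma cnt_bijection:
  assumes \<kappa>: "\<kappa> \<in> PiE {..<n} (\<lambda>_. K)"
  obtains \<beta> where "bij_betw \<beta> {..<n} (labs K (cnt K n \<kappa>))" "\<And>i. i < n \<Longrightarrow> fst (\<beta> i) = \<kappa> i"
proof -
  have "\<exists>b. bij_betw b {i \<in> {..<n}. \<kappa> i = c} {..<card {i \<in> {..<n}. \<kappa> i = c}}" for c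
    using ex_bij_betw_finite_nat[of "{i \<in> {..<n}. \<kappa> i = c}"] by (simp add: lessThan_atLeast0)
  then obtain b where b: "\<And>c. bij_betw (b c) {i \<in> {..<n}. \<kappa> i = c} {..<card {i \<in> {..<n}. \<kappa> i = c}}" by metis
  define \<beta> where "\<beta> i = (\<kappa> i, b (\<kappa> i) i)" for i
  have K: "\<kappa> i \<in> K" if "i < n" for i using \<kappa> that by auto
  have "inj_on \<beta> {..<n}"
  proof (rule inj_onI)
    fix i j assume ij: "i \<in> {..<n}" "j \<in> {..<n}" "\<beta> i = \<beta> j"
    then have "\<kappa> i = \<kappa> j" "b (\<kappa> i) i = b (\<kappa> i) j" by (auto simp: \<beta>_def)
    then show "i = j" using b[of "\<kappa> i"] ij by (auto simp: bij_betw_def inj_on_def)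
  qed
  moreover have "\<beta> ` {..<n} = labs K (cnt K n \<kappa>)"
  proof (intro equalityI subsetI)
    fix l assume "l \<in> \<beta> ` {..<n}"
    then obtain i where i: "i < n" "l = \<beta> i" by auto
    then have "b (\<kappa> i) i \<in> {..<card {j \<in> {..<n}. \<kappa> j = \<kappa> i}}" using b[of "\<kappa> i"] by (auto simp: bij_betw_def)
    then show "l \<in> labs K (cnt K n \<kappa>)" using i K[OF i(1)] by (auto simp: labs_def cnt_def \<beta>_def)
  next
    fix l assume l: "l \<in> labs K (cnt K n \<kappa>)"
    then obtain c k where ck: "l = (c, k)" "c \<in> K" "k < card {i \<in> {..<n}. \<kappa> i = c}" by (auto simp: labs_def cnt_def)
    then have "k \<in> b c ` {i \<in> {..<n}. \<kappa> i = c}" using b[of c] by (auto simp: bij_betw_def)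
    then show "l \<in> \<beta> ` {..<n}" using ck by (auto simp: \<beta>_def)
  qed
  ultimately have "bij_betw \<beta> {..<n} (labs K (cnt K n \<kappa>))" by (simp add: bij_betw_def)
  then show ?thesis by (rule that) (simp add: \<beta>_def)
qed

context kernel begin

lemma ex_ind_conn_relabel:
  assumes bij: "bij_betw \<beta> V V'" and fin: "finite V" and ST: "S \<in> sets borel" "T \<in> sets borel"
    and D: "\<And>i. i \<in> V \<Longrightarrow> D i = D' (\<beta> i)" "\<And>i. i \<in> V \<Longrightarrow> prob_space (D i)" "\<And>i. i \<in> V \<Longrightarrow> sets (D i) = sets borel"
  shows "ex V' D' w (ind_conn S T V') = ex V D w (ind_conn S T V)"
proof -
  have inj: "inj_on \<beta> V" and img: "\<beta> ` V = V'" using bij by (auto simp: bij_betw_def)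
  have fin': "finite V'" using fin img by auto
  have "ex V' D' w (ind_conn S T V') = ex V D w (\<lambda>x E. ind_conn S T V' (\<lambda>j\<in>V'. x (inv_into V \<beta> j)) ((`) \<beta> ` E))"
    by (rule ex_relabel[OF bij fin adm_ind_conn[OF fin' ST]]) (rule D, assumption)+
  also have "\<dots> = ex V D w (ind_conn S T V)"
  proof (rule ex_cong)
    fix x :: "'b \<Rightarrow> 'a" and E assume E: "E \<subseteq> pairs V"
    let ?x = "\<lambda>j\<in>V'. x (inv_into V \<beta> j)"
    have "mk V' ?x R = \<beta> ` mk V x R" for R
      unfolding mk_def img[symmetric] using inj by (auto simp: image_iff inj_on_eq_iff[OF inj])
    then have "conn V' (mk V' ?x S) (mk V' ?x T) ((`) \<beta> ` E) \<longleftrightarrow> conn V (mk V x S) (mk V x T) E"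
      using conn_image[OF inj E order_refl mk_subset mk_subset, of x S x T] by (simp add: img)
    then show "ind_conn S T V' ?x ((`) \<beta> ` E) = ind_conn S T V x E" by (simp add: ind_conn_def)
  qed
  finally show ?thesis .
qed

text \<open>A Poisson number of independent points with a mixture law is a superposition of
  independent Poisson families, one per class. This identifies the model with one common law, in
  which derivatives were taken, with the cellwise construction behind
  \<open>RCM_space\<close>.\<close>

theorem PC_lump:
  assumes K: "finite K" and ST: "S \<in> sets borel" "T \<in> sets borel" and m: "0 < m"
    and D: "prob_space D" "sets D = sets borel"
    and Dc: "\<And>c. prob_space (Dc c)" "\<And>c. sets (Dc c) = sets borel"
    and \<rho>: "\<And>c. c \<in> K \<Longrightarrow> 0 < \<rho> c" "sum \<rho> K = 1"
    and mix: "\<And>h. h \<in> borel_measurable borel \<Longrightarrow> (\<integral>\<^sup>+y. h y \<partial>D) = (\<Sum>c\<in>K. ennreal (\<rho> c) * (\<integral>\<^sup>+y. h y \<partial>Dc c))"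
  shows "PC m D w S T = (\<integral>\<^sup>+N. ex (labs K N) (\<lambda>l. Dc (fst l)) w (ind_conn S T (labs K N))
     \<partial>PiM K (\<lambda>c. measure_pmf (poisson_pmf (m * \<rho> c))))"
proof -
  define \<Psi> where "\<Psi> N = ex (labs K N) (\<lambda>l. Dc (fst l)) w (ind_conn S T (labs K N))" for N
  have \<rho>0: "\<And>c. c \<in> K \<Longrightarrow> 0 \<le> \<rho> c" using \<rho>(1) by (simp add: less_imp_le)
  have ex: "ex {..<n} (\<lambda>_. D) w (ind_conn S T {..<n}) = ennreal (fact n) * (\<Sum>N\<in>comp_set K n. ennreal (multi_wt K \<rho> N) * \<Psi> N)" for n
  proof -
    have "ex {..<n} (\<lambda>_. D) w (ind_conn S T {..<n}) = (\<Sum>\<kappa>\<in>PiE {..<n} (\<lambda>_. K). (\<Prod>i<n. ennreal (\<rho> (\<kappa> i))) *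
        ex {..<n} (\<lambda>i. Dc (\<kappa> i)) w (ind_conn S T {..<n}))"
      unfolding ex_def
      by (rule nn_integral_PiM_mixture[OF K finite_lessThan D Dc mix])
        (auto intro!: bsum_wt_measurable' adm_ind_conn ST)
    also have "\<dots> = (\<Sum>\<kappa>\<in>PiE {..<n} (\<lambda>_. K). (\<Prod>i<n. ennreal (\<rho> (\<kappa> i))) * \<Psi> (cnt K n \<kappa>))"
    proof (intro sum.cong refl arg_cong2[where f="(*)"])
      fix \<kappa> assume "\<kappa> \<in> PiE {..<n} (\<lambda>_. K)"
      then obtain \<beta> where \<beta>: "bij_betw \<beta> {..<n} (labs K (cnt K n \<kappa>))" "\<And>i. i < n \<Longrightarrow> fst (\<beta> i) = \<kappa> i"
        using cnt_bijection by metis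
      show "ex {..<n} (\<lambda>i. Dc (\<kappa> i)) w (ind_conn S T {..<n}) = \<Psi> (cnt K n \<kappa>)"
        unfolding \<Psi>_def
        by (rule ex_ind_conn_relabel[OF \<beta>(1) finite_lessThan ST, symmetric]) (simp_all add: \<beta>(2) Dc)
    qed
    also have "\<dots> = ennreal (fact n) * (\<Sum>N\<in>comp_set K n. ennreal (multi_wt K \<rho> N) * \<Psi> N)"
      by (rule multinomial_regroup[OF K \<rho>0])
    finally show ?thesis .
  qed
  \<comment> \<open>Both m^n and exp(-m) factor over the classes, since the counts add up to n and
    the weights \<open>\<rho>\<close> to 1; so the Poisson weight times the multinomial weight is a
    product of Poisson weights.\<close>
  have wt: "ennreal (m ^ n / fact n * exp (- m)) * (ennreal (fact n) * ennreal (multi_wt K \<rho> N)) =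
      ennreal (\<Prod>c\<in>K. pmf (poisson_pmf (m * \<rho> c)) (N c))" if N: "N \<in> comp_set K n" for n N
  proof -
    have sN: "sum N K = n" using N by (simp add: comp_set_def)
    have mw0: "0 \<le> multi_wt K \<rho> N" unfolding multi_wt_def using \<rho>0 by (intro prod_nonneg) auto
    have "(\<Prod>c\<in>K. pmf (poisson_pmf (m * \<rho> c)) (N c)) = (\<Prod>c\<in>K. (m ^ N c * (\<rho> c ^ N c / fact (N c))) * exp (- (m * \<rho> c)))"
      using \<rho>(1) m by (intro prod.cong refl) (simp add: power_mult_distrib)
    also have "\<dots> = (\<Prod>c\<in>K. m ^ N c) * multi_wt K \<rho> N * (\<Prod>c\<in>K. exp (- (m * \<rho> c)))"
      by (simp only: prod.distrib multi_wt_def)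
    also have "(\<Prod>c\<in>K. m ^ N c) = m ^ n" unfolding sN[symmetric] by (rule power_sum[symmetric])
    also have "(\<Prod>c\<in>K. exp (- (m * \<rho> c))) = exp (- m)"
      using K \<rho>(2) by (simp add: exp_sum[symmetric] sum_negf sum_distrib_left[symmetric])
    finally have "(\<Prod>c\<in>K. pmf (poisson_pmf (m * \<rho> c)) (N c)) = m ^ n / fact n * exp (- m) * (fact n * multi_wt K \<rho> N)" by simp
    then show ?thesis using m mw0 by (simp add: ennreal_mult[symmetric])
  qed
  have "PC m D w S T = (\<Sum>n. ennreal (m ^ n / fact n * exp (- m)) * (ennreal (fact n) * (\<Sum>N\<in>comp_set K n. ennreal (multi_wt K \<rho> N) * \<Psi> N)))"
    unfolding PC_def pex_def ex by (rule nn_integral_poisson[OF m])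
  also have "\<dots> = (\<Sum>n. \<Sum>N\<in>comp_set K n. ennreal (\<Prod>c\<in>K. pmf (poisson_pmf (m * \<rho> c)) (N c)) * \<Psi> N)"
  proof (rule arg_cong[where f=suminf], rule ext)
    fix n
    have "ennreal (m ^ n / fact n * exp (- m)) * (ennreal (fact n) * (\<Sum>N\<in>comp_set K n. ennreal (multi_wt K \<rho> N) * \<Psi> N)) =
      (\<Sum>N\<in>comp_set K n. (ennreal (m ^ n / fact n * exp (- m)) * (ennreal (fact n) * ennreal (multi_wt K \<rho> N))) * \<Psi> N)"
      by (simp only: sum_distrib_left mult.assoc)
    also have "\<dots> = (\<Sum>N\<in>comp_set K n. ennreal (\<Prod>c\<in>K. pmf (poisson_pmf (m * \<rho> c)) (N c)) * \<Psi> N)"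
      by (intro sum.cong refl) (simp only: wt)
    finally show "ennreal (m ^ n / fact n * exp (- m)) * (ennreal (fact n) * (\<Sum>N\<in>comp_set K n. ennreal (multi_wt K \<rho> N) * \<Psi> N)) =
      (\<Sum>N\<in>comp_set K n. ennreal (\<Prod>c\<in>K. pmf (poisson_pmf (m * \<rho> c)) (N c)) * \<Psi> N)" .
  qed
  also have "\<dots> = (\<integral>\<^sup>+N. \<Psi> N \<partial>PiM K (\<lambda>c. measure_pmf (poisson_pmf (m * \<rho> c))))"
    by (rule nn_integral_PiM_counts[OF K, symmetric])
  finally show ?thesis unfolding \<Psi>_def .
qed

end

context kernel begin

text \<open>Points outside \<open>V'\<close> and their edges integrate out of an event that does not
  look at them.\<close>

lemma ex_ind_conn_restrict:
  assumes V: "finite V" "V' \<subseteq> V" and ST: "S \<in> sets borel" "T \<in> sets borel"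
    and D: "\<And>i. prob_space (D i)" "\<And>i. sets (D i) = sets borel"
  shows "ex V D w (ind_conn S T V') = ex V' D w (ind_conn S T V')"
proof -
  have V': "finite V'" using V finite_subset by blast
  have sub: "pairs V' \<subseteq> pairs V" by (rule pairs_mono[OF V(2)])
  let ?R = "pairs V - pairs V'"
  let ?H = "\<lambda>x. ennreal (bsum (pairs V') (wt w x) (ind_conn S T V' x))"
  have fin: "finite ?R" "finite (pairs V')" using V V' by auto
  have 1: "bsum (pairs V) (wt w x) (ind_conn S T V' x) = bsum (pairs V') (wt w x) (ind_conn S T V' x)" for x
  proof -
    have "pairs V = pairs V' \<union> ?R" using sub by blast
    then have "bsum (pairs V) (wt w x) (ind_conn S T V' x) = bsum (pairs V' \<union> ?R) (wt w x) (ind_conn S T V' x)" by simp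
    also have "\<dots> = bsum (pairs V') (wt w x) (\<lambda>E. bsum ?R (wt w x) (\<lambda>E'. ind_conn S T V' x (E \<union> E')))"
      by (rule bsum_Un[OF fin]) blast
    also have "\<dots> = bsum (pairs V') (wt w x) (\<lambda>E. bsum ?R (wt w x) (\<lambda>E'. ind_conn S T V' x E))"
    proof (intro bsum_cong refl)
      fix E E' assume E: "E \<subseteq> pairs V'" "E' \<subseteq> ?R"
      have "e \<notin> E'" if "e \<subseteq> V'" for e
      proof
        assume "e \<in> E'"
        then have e: "e \<in> pairs V" "e \<notin> pairs V'" using E(2) by blast+
        then obtain i j where "e = {i, j}" "i \<noteq> j" unfolding pairs_def by blast
        then show False using e(2) that by simp
      qed
      then have "(E \<union> E') \<inter> {e. e \<subseteq> V'} = E \<inter> {e. e \<subseteq> V'}" by blast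
      then show "ind_conn S T V' x (E \<union> E') = ind_conn S T V' x E"
        unfolding ind_conn_def using conn_restrict_edges[of V' _ _ "E \<union> E'"] conn_restrict_edges[of V' _ _ E] by simp
    qed
    also have "\<dots> = bsum (pairs V') (wt w x) (ind_conn S T V' x)" by (simp only: bsum_const[OF fin(1)])
    finally show ?thesis .
  qed
  have 2: "?H x = ?H (\<lambda>i\<in>V'. x i)" for x
  proof -
    have "mk V' x R = mk V' (\<lambda>i\<in>V'. x i) R" for R by (auto simp: mk_def)
    then have "ind_conn S T V' x = ind_conn S T V' (\<lambda>i\<in>V'. x i)" unfolding ind_conn_def by simp
    moreover have "bsum (pairs V') (wt w x) Y = bsum (pairs V') (wt w (\<lambda>i\<in>V'. x i)) Y" for Y
      by (intro bsum_cong refl, erule wt_cong) simp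
    ultimately show ?thesis by simp
  qed
  have inj: "inj_on (\<lambda>i. i) V'" by simp
  have fn: "(\<lambda>i. i) \<in> V' \<rightarrow> V" using V(2) by auto
  have meas: "(\<lambda>x. \<lambda>i\<in>V'. x i) \<in> PiM V D \<rightarrow>\<^sub>M PiM V' D"
    using V(2) by (intro measurable_restrict measurable_component_singleton) auto
  have distr: "distr (PiM V D) (PiM V' D) (\<lambda>x. \<lambda>i\<in>V'. x i) = PiM V' D"
    using distr_PiM_reindex[of V D "\<lambda>i. i" V', OF D(1) inj fn] .
  have "ex V D w (ind_conn S T V') = (\<integral>\<^sup>+x. ?H (\<lambda>i\<in>V'. x i) \<partial>PiM V D)" unfolding ex_def 1 using 2 by simp
  also have "\<dots> = (\<integral>\<^sup>+x. ?H x \<partial>distr (PiM V D) (PiM V' D) (\<lambda>x. \<lambda>i\<in>V'. x i))"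
    using bsum_wt_measurable'[OF adm_ind_conn[OF V' ST] V', of D] D(2)
    by (intro nn_integral_distr[symmetric] meas) simp
  also have "\<dots> = ex V' D w (ind_conn S T V')" unfolding distr ex_def ..
  finally show ?thesis .
qed

text \<open>Superposition coupling: the larger process consists of a copy of the smaller one, the
  class \<open>True\<close>, and an independent rest. Additional points can only help to
  connect.\<close>

lemma PC_mono_mixture:
  assumes ST: "S \<in> sets borel" "T \<in> sets borel" and m: "0 < m1" "m1 < m2"
    and D: "prob_space D1" "sets D1 = sets borel" "prob_space D2" "sets D2 = sets borel" "prob_space D3" "sets D3 = sets borel"
    and mix: "\<And>h. h \<in> borel_measurable borel \<Longrightarrow>
      (\<integral>\<^sup>+y. h y \<partial>D2) = ennreal (m1 / m2) * (\<integral>\<^sup>+y. h y \<partial>D1) + ennreal (1 - m1 / m2) * (\<integral>\<^sup>+y. h y \<partial>D3)"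
  shows "PC m1 D1 w S T \<le> PC m2 D2 w S T"
proof -
  define Dc where "Dc c = (if c then D1 else D3)" for c
  define \<rho> where "\<rho> c = (if c then m1 / m2 else 1 - m1 / m2)" for c
  have Dc: "prob_space (Dc c)" "sets (Dc c) = sets borel" for c using D by (auto simp: Dc_def)
  have \<rho>: "0 < \<rho> c" "sum \<rho> UNIV = 1" for c using m by (auto simp: \<rho>_def UNIV_bool)
  let ?K = "UNIV :: bool set"
  let ?M = "PiM ?K (\<lambda>c. measure_pmf (poisson_pmf (m2 * \<rho> c)))"
  let ?D = "\<lambda>l :: bool \<times> nat. Dc (fst l)"
  have m2: "0 < m2" using m by simp
  define G where "G n = ex {..<n} (\<lambda>_. D1) w (ind_conn S T {..<n})" for n :: nat
  have "G (N True) \<le> ex (labs ?K N) ?D w (ind_conn S T (labs ?K N))" for N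
  proof -
    let ?V = "Pair True ` {..<N True}"
    have sub: "?V \<subseteq> labs ?K N" by (auto simp: labs_def)
    have bij: "bij_betw (Pair True) {..<N True} ?V" by (auto simp: bij_betw_def inj_on_def)
    have "G (N True) = ex ?V ?D w (ind_conn S T ?V)"
      unfolding G_def by (rule ex_ind_conn_relabel[OF bij finite_lessThan ST, symmetric]) (simp_all add: Dc_def D)
    also have "\<dots> = ex (labs ?K N) ?D w (ind_conn S T ?V)"
      by (rule ex_ind_conn_restrict[OF _ sub ST, symmetric]) (simp_all add: finite_labs Dc)
    also have "\<dots> \<le> ex (labs ?K N) ?D w (ind_conn S T (labs ?K N))"
    proof (rule ex_mono)
      fix x :: "bool \<times> nat \<Rightarrow> 'a" and E
      have "conn ?V (mk ?V x S) (mk ?V x T) E \<Longrightarrow> conn (labs ?K N) (mk (labs ?K N) x S) (mk (labs ?K N) x T) E"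
        using sub by (intro conn_mono_marks[OF conn_mono[OF _ sub order_refl]]) (auto simp: mk_def)
      then show "ind_conn S T ?V x E \<le> ind_conn S T (labs ?K N) x E" by (simp add: ind_conn_def)
    qed
    finally show ?thesis .
  qed
  then have "(\<integral>\<^sup>+N. G (N True) \<partial>?M) \<le> (\<integral>\<^sup>+N. ex (labs ?K N) ?D w (ind_conn S T (labs ?K N)) \<partial>?M)"
    by (intro nn_integral_mono)
  also have "\<dots> = PC m2 D2 w S T"
  proof (rule PC_lump[OF _ ST m2 D(3,4) Dc, symmetric])
    fix h :: "'a \<Rightarrow> ennreal" assume "h \<in> borel_measurable borel"
    from mix[OF this] show "(\<integral>\<^sup>+y. h y \<partial>D2) = (\<Sum>c\<in>?K. ennreal (\<rho> c) * (\<integral>\<^sup>+y. h y \<partial>Dc c))"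
      by (simp add: UNIV_bool \<rho>_def Dc_def add.commute)
  qed (use \<rho> in auto)
  also have "(\<integral>\<^sup>+N. G (N True) \<partial>?M) = (\<integral>\<^sup>+n. G n \<partial>distr ?M (measure_pmf (poisson_pmf (m2 * \<rho> True))) (\<lambda>N. N True))"
    by (intro nn_integral_distr[symmetric] measurable_component_singleton) auto
  also have "\<dots> = (\<integral>\<^sup>+n. G n \<partial>measure_pmf (poisson_pmf (m2 * \<rho> True)))"
    by (subst distr_PiM_component) (auto intro: prob_space_measure_pmf)
  also have "m2 * \<rho> True = m1" using m2 by (simp add: \<rho>_def)
  also have "(\<integral>\<^sup>+n. G n \<partial>measure_pmf (poisson_pmf m1)) = PC m1 D1 w S T" by (simp add: PC_def pex_def G_def)
  finally show ?thesis .
qed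

lemma PC_mono_target:
  assumes "T \<subseteq> T'" shows "PC m D w S T \<le> PC m D w S T'"
  unfolding PC_def
proof (rule pex_mono)
  fix n x E
  have "conn {..<n} (mk {..<n} x S) (mk {..<n} x T) E \<Longrightarrow> conn {..<n} (mk {..<n} x S) (mk {..<n} x T') E"
    using assms by (elim conn_mono_marks) (auto simp: mk_def)
  then show "ind_conn S T {..<n} x E \<le> ind_conn S T' {..<n} x E" by (simp add: ind_conn_def)
qed

end

section \<open>Poisson points in squares\<close>

type_synonym pt = "real \<times> real"

definition sq :: "real \<Rightarrow> pt set" where "sq b = cbox (-b, -b) (b, b)"

abbreviation unif :: "pt set \<Rightarrow> pt measure" where "unif A \<equiv> uniform_measure lborel A"

lemma sq_borel[measurable, simp]: "sq b \<in> sets borel" by (simp add: sq_def)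

lemma emeasure_cbox_prod:
  assumes "a1 \<le> b1" "a2 \<le> (b2::real)"
  shows "emeasure lborel (cbox (a1, a2) (b1, b2 :: real)) = ennreal ((b1 - a1) * (b2 - a2))"
proof -
  have "cbox (a1, a2) (b1, b2) \<noteq> {}" using assms by (auto simp: cbox_Pair_eq)
  then show ?thesis using assms by (simp add: emeasure_lborel_cbox Basis_prod_def inner_prod_def emeasure_lborel_cbox_eq prod.union_disjoint inner_Basis)
qed

lemma emeasure_sq: "0 \<le> b \<Longrightarrow> emeasure lborel (sq b) = ennreal (4 * b\<^sup>2)"
  unfolding sq_def by (subst emeasure_cbox_prod) (auto simp: power2_eq_square)

lemma prob_space_unif:
  assumes "A \<in> sets borel" "emeasure lborel A = ennreal v" "0 < v"
  shows "prob_space (unif A)"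
  using assms by (intro prob_space_uniform_measure) auto

lemma nn_integral_unif:
  assumes "A \<in> sets borel" "emeasure lborel A = ennreal v" "0 < v" "h \<in> borel_measurable borel"
  shows "(\<integral>\<^sup>+y. h y \<partial>unif A) = ennreal (1 / v) * (\<integral>\<^sup>+y. h y * indicator A y \<partial>lborel)"
proof -
  have "(\<integral>\<^sup>+y. h y \<partial>unif A) = (\<integral>\<^sup>+y. h y * indicator A y \<partial>lborel) / emeasure lborel A"
    using assms by (intro nn_integral_uniform_measure) auto
  then show ?thesis using assms by (simp add: divide_ennreal_def inverse_ennreal mult.commute divide_inverse)
qed

lemma unif_split:
  assumes A: "A \<in> sets borel" "emeasure lborel A = ennreal u" "0 < u"
    and B: "B \<in> sets borel" "emeasure lborel B = ennreal v" "u < v" "A \<subseteq> B" and h: "h \<in> borel_measurable borel"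
  shows "(\<integral>\<^sup>+y. h y \<partial>unif B) = ennreal (u / v) * (\<integral>\<^sup>+y. h y \<partial>unif A) + ennreal (1 - u / v) * (\<integral>\<^sup>+y. h y \<partial>unif (B - A))"
    and "emeasure lborel (B - A) = ennreal (v - u)"
proof -
  show BA: "emeasure lborel (B - A) = ennreal (v - u)"
    using A B by (subst emeasure_Diff) (auto simp: ennreal_minus)
  have v: "0 < v" "0 < v - u" using A B by auto
  have split: "h y * indicator B y = h y * indicator A y + h y * indicator (B - A) y" for y
    using B(4) by (auto simp: indicator_def)
  have "(\<integral>\<^sup>+y. h y \<partial>unif B) = ennreal (1 / v) * (\<integral>\<^sup>+y. h y * indicator A y + h y * indicator (B - A) y \<partial>lborel)"
    using nn_integral_unif[OF B(1,2) v(1) h] unfolding split .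
  also have "\<dots> = ennreal (1 / v) * (\<integral>\<^sup>+y. h y * indicator A y \<partial>lborel) + ennreal (1 / v) * (\<integral>\<^sup>+y. h y * indicator (B - A) y \<partial>lborel)"
    using A B h by (subst nn_integral_add) (auto simp: distrib_left)
  also have "ennreal (1 / v) * (\<integral>\<^sup>+y. h y * indicator A y \<partial>lborel) = ennreal (u / v) * (\<integral>\<^sup>+y. h y \<partial>unif A)"
  proof -
    have "ennreal (1 / v) = ennreal (u / v) * ennreal (1 / u)" using A v by (simp add: ennreal_mult[symmetric])
    then show ?thesis unfolding nn_integral_unif[OF A h] by (simp only: mult.assoc)
  qed
  also have "ennreal (1 / v) * (\<integral>\<^sup>+y. h y * indicator (B - A) y \<partial>lborel) = ennreal (1 - u / v) * (\<integral>\<^sup>+y. h y \<partial>unif (B - A))"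
  proof -
    have "1 - u / v = (v - u) / v" using v by (simp add: field_simps)
    then have "ennreal (1 / v) = ennreal (1 - u / v) * ennreal (1 / (v - u))" using v by (simp add: ennreal_mult[symmetric])
    moreover have "B - A \<in> sets borel" using A B by auto
    ultimately show ?thesis using nn_integral_unif[OF _ BA v(2) h] by (simp only: mult.assoc)
  qed
  finally show "(\<integral>\<^sup>+y. h y \<partial>unif B) = ennreal (u / v) * (\<integral>\<^sup>+y. h y \<partial>unif A) + ennreal (1 - u / v) * (\<integral>\<^sup>+y. h y \<partial>unif (B - A))" .
qed

text \<open>The mean number of points is intensity times area, so \<open>\<Lambda>\<close> is the
  intensity in the box \<open>sq b\<close>. Since all points lie in the box, the target is
  effectively the part of it outside \<open>sq t\<close>.\<close>

definition PB :: "real \<Rightarrow> (real \<Rightarrow> real) \<Rightarrow> real \<Rightarrow> pt set \<Rightarrow> real \<Rightarrow> ennreal" where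
  "PB \<Lambda> k b S t = PC (\<Lambda> * (4 * b\<^sup>2)) (unif (sq b)) (\<lambda>x y. k (dist x y)) S (- sq t)"

definition profile :: "(real \<Rightarrow> real) \<Rightarrow> bool" where
  "profile k \<longleftrightarrow> k \<in> borel_measurable borel \<and> (\<forall>r. 0 \<le> k r \<and> k r \<le> 1)"

lemma kernel_profile: "profile k \<Longrightarrow> kernel (\<lambda>(x::pt) y. k (dist x y))"
proof
  assume k: "profile k"
  have [measurable]: "k \<in> borel_measurable borel" using k by (simp add: profile_def)
  show "(\<lambda>p::pt \<times> pt. k (dist (fst p) (snd p))) \<in> borel_measurable (borel \<Otimes>\<^sub>M borel)" by measurable
qed (auto simp: profile_def dist_commute)

lemma prob_space_sq: "0 < b \<Longrightarrow> prob_space (unif (sq b))"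
  by (rule prob_space_unif[OF sq_borel emeasure_sq]) auto

lemma PB_mono_box:
  assumes k: "profile k" and S: "S \<in> sets borel" and L: "0 < \<Lambda>" and b: "0 < b1" "b1 \<le> b2"
  shows "PB \<Lambda> k b1 S t \<le> PB \<Lambda> k b2 S t"
proof (cases "b1 = b2")
  case False
  interpret kernel "\<lambda>(x::pt) y. k (dist x y)" by (rule kernel_profile[OF k])
  have b2: "0 < b2" "b1 < b2" using b False by auto
  have sub: "sq b1 \<subseteq> sq b2" unfolding sq_def using b2 by (auto simp: cbox_Pair_eq)
  have vol: "4 * b1\<^sup>2 < 4 * b2\<^sup>2" "0 < 4 * b1\<^sup>2" using b b2 by (auto intro: power_strict_mono)
  note sp = unif_split[OF sq_borel emeasure_sq vol(2) sq_borel emeasure_sq vol(1) sub]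
  have e: "0 \<le> b1" "0 \<le> b2" using b b2 by auto
  have P3: "prob_space (unif (sq b2 - sq b1))"
    using vol by (intro prob_space_unif[OF _ sp(2)[OF e, of "\<lambda>_. 0"]]) auto
  show ?thesis unfolding PB_def
  proof (rule PC_mono_mixture[OF S _ _ _ prob_space_sq[OF b(1)] _ prob_space_sq[OF b2(1)] _ P3])
    fix h :: "pt \<Rightarrow> ennreal" assume h: "h \<in> borel_measurable borel"
    have "\<Lambda> * (4 * b1\<^sup>2) / (\<Lambda> * (4 * b2\<^sup>2)) = 4 * b1\<^sup>2 / (4 * b2\<^sup>2)" using L by simp
    with sp(1)[OF e h] show "(\<integral>\<^sup>+y. h y \<partial>unif (sq b2)) = ennreal (\<Lambda> * (4 * b1\<^sup>2) / (\<Lambda> * (4 * b2\<^sup>2))) * (\<integral>\<^sup>+y. h y \<partial>unif (sq b1)) +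
      ennreal (1 - \<Lambda> * (4 * b1\<^sup>2) / (\<Lambda> * (4 * b2\<^sup>2))) * (\<integral>\<^sup>+y. h y \<partial>unif (sq b2 - sq b1))" by (simp only:)
  qed (use L b b2 vol in auto)
qed simp

lemma PB_mono_target:
  assumes k: "profile k" and t: "t1 \<le> t2"
  shows "PB \<Lambda> k b S t2 \<le> PB \<Lambda> k b S t1"
proof -
  interpret kernel "\<lambda>(x::pt) y. k (dist x y)" by (rule kernel_profile[OF k])
  show ?thesis unfolding PB_def using t by (intro PC_mono_target) (auto simp: sq_def cbox_Pair_eq)
qed

definition redges :: "(real \<Rightarrow> real) \<Rightarrow> (lab \<Rightarrow> pt) \<Rightarrow> (lab \<times> lab \<Rightarrow> real) \<Rightarrow> lab set set" where
  "redges g pos U = {e. \<exists>l l'. to_nat l < to_nat l' \<and> e = {l, l'} \<and> U (l, l') < g (dist (pos l) (pos l'))}"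

lemma redges_iff:
  assumes "to_nat l < to_nat l'" shows "{l, l'} \<in> redges g pos U \<longleftrightarrow> U (l, l') < g (dist (pos l) (pos l'))"
proof
  assume "{l, l'} \<in> redges g pos U"
  then obtain a b where ab: "to_nat a < to_nat b" "{l, l'} = {a, b}" "U (a, b) < g (dist (pos a) (pos b))"
    unfolding redges_def by blast
  then have "(a = l \<and> b = l') \<or> (a = l' \<and> b = l)" by (auto simp: doubleton_eq_iff)
  then show "U (l, l') < g (dist (pos l) (pos l'))" using ab assms by auto
next
  assume "U (l, l') < g (dist (pos l) (pos l'))"
  then show "{l, l'} \<in> redges g pos U"
    unfolding redges_def mem_Collect_eq by (intro exI[of _ l] exI[of _ l'] conjI assms refl)
qed

text \<open>Every unordered pair has exactly one key, so different edges are decided by different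
  independent uniform variables.\<close>

definition keys :: "lab set \<Rightarrow> (lab \<times> lab) set" where
  "keys V = {(l, l'). l \<in> V \<and> l' \<in> V \<and> to_nat l < to_nat l'}"

lemma keys_bij: "bij_betw (\<lambda>(l, l'). {l, l'}) (keys V) (pairs V)"
  unfolding bij_betw_def
proof
  show "inj_on (\<lambda>(l, l'). {l, l'}) (keys V)"
  proof (rule inj_onI)
    fix p q assume "p \<in> keys V" "q \<in> keys V" "(\<lambda>(l, l'). {l, l'}) p = (\<lambda>(l, l'). {l, l'}) q"
    then show "p = q" by (cases p; cases q) (auto simp: keys_def doubleton_eq_iff)
  qed
  show "(\<lambda>(l, l'). {l, l'}) ` keys V = pairs V"
  proof (intro equalityI subsetI)
    fix e assume "e \<in> (\<lambda>(l, l'). {l, l'}) ` keys V"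
    then obtain l l' where "(l, l') \<in> keys V" "e = {l, l'}" by auto
    then show "e \<in> pairs V" by (auto simp: keys_def)
  next
    fix e assume "e \<in> pairs V"
    then obtain i j where ij: "i \<in> V" "j \<in> V" "i \<noteq> j" "e = {i, j}" unfolding pairs_def by blast
    then have "to_nat i \<noteq> to_nat j" by simp
    then consider "(i, j) \<in> keys V" | "(j, i) \<in> keys V" using ij by (fastforce simp: keys_def)
    then show "e \<in> (\<lambda>(l, l'). {l, l'}) ` keys V"
    proof cases
      case 1 then show ?thesis using ij by (intro image_eqI[of _ _ "(i, j)"]) auto
    next
      case 2 then show ?thesis using ij by (intro image_eqI[of _ _ "(j, i)"]) (auto simp: insert_commute)
    qed
  qed
qed

lemma finite_keys: "finite V \<Longrightarrow> finite (keys V)"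
  by (rule finite_subset[of _ "V \<times> V"]) (auto simp: keys_def)

definition Umeas :: "(lab \<times> lab \<Rightarrow> real) measure" where
  "Umeas = PiM UNIV (\<lambda>_. uniform_measure lborel {0..1})"

lemma prob_unit: "prob_space (uniform_measure lborel {0..1::real})"
  by (intro prob_space_uniform_measure) auto

lemma unit_measure:
  assumes "0 \<le> t" "t \<le> (1::real)"
  shows "emeasure (uniform_measure lborel {0..1}) {..<t} = ennreal t"
    and "emeasure (uniform_measure lborel {0..1}) {t..} = ennreal (1 - t)"
proof -
  have "{0..1} \<inter> {..<t} = {0..<t}" "{0..1} \<inter> {t..} = {t..1}" using assms by auto
  then show "emeasure (uniform_measure lborel {0..1}) {..<t} = ennreal t"
    "emeasure (uniform_measure lborel {0..1}) {t..} = ennreal (1 - t)"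
    using assms by (auto simp: divide_ennreal_def)
qed

lemma edge_config_prob:
  fixes pos :: "lab \<Rightarrow> pt"
  assumes g: "profile g" and V: "finite V" and E: "E \<subseteq> pairs V"
  shows "emeasure Umeas {U \<in> space Umeas. \<forall>k\<in>keys V. (U k < g (dist (pos (fst k)) (pos (snd k)))) = ({fst k, snd k} \<in> E)} =
    ennreal ((\<Prod>e\<in>E. wt (\<lambda>x y. g (dist x y)) pos e) * (\<Prod>e\<in>pairs V - E. 1 - wt (\<lambda>x y. g (dist x y)) pos e))"
proof -
  interpret kernel "\<lambda>(x::pt) y. g (dist x y)" by (rule kernel_profile[OF g])
  interpret product_prob_space "\<lambda>_::lab \<times> lab. uniform_measure lborel {0..1::real}" UNIV
    using prob_unit by (intro product_prob_spaceI)
  let ?t = "\<lambda>k. g (dist (pos (fst k)) (pos (snd k)))"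
  let ?A = "\<lambda>k. if {fst k, snd k} \<in> E then {..<?t k} else {?t k..}"
  let ?w = "\<lambda>e. if e \<in> E then wt (\<lambda>x y. g (dist x y)) pos e else 1 - wt (\<lambda>x y. g (dist x y)) pos e"
  have t: "0 \<le> ?t k" "?t k \<le> 1" for k using g by (auto simp: profile_def)
  have "{U \<in> space Umeas. \<forall>k\<in>keys V. (U k < ?t k) = ({fst k, snd k} \<in> E)} =
    {U \<in> space (PiM UNIV (\<lambda>_::lab \<times> lab. uniform_measure lborel {0..1::real})). \<forall>k\<in>keys V. U k \<in> ?A k}"
    unfolding Umeas_def by (intro Collect_cong conj_cong refl ball_cong) auto
  then have "emeasure Umeas {U \<in> space Umeas. \<forall>k\<in>keys V. (U k < ?t k) = ({fst k, snd k} \<in> E)} =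
    (\<Prod>k\<in>keys V. emeasure (uniform_measure lborel {0..1}) (?A k))"
    unfolding Umeas_def using finite_keys[OF V] by (simp only:) (intro emeasure_PiM_Collect, auto)
  also have "\<dots> = (\<Prod>k\<in>keys V. ennreal (?w {fst k, snd k}))"
  proof (intro prod.cong refl)
    fix k
    have wtp: "wt (\<lambda>x y. g (dist x y)) pos {fst k, snd k} = ?t k" by (rule wt_pair)
    show "emeasure (uniform_measure lborel {0..1}) (?A k) = ennreal (?w {fst k, snd k})"
      by (cases "{fst k, snd k} \<in> E") (simp_all only: if_True if_False unit_measure[OF t] wtp)
  qed
  also have "\<dots> = (\<Prod>e\<in>pairs V. ennreal (?w e))"
    using prod.reindex_bij_betw[OF keys_bij[of V], of "\<lambda>e. ennreal (?w e)"] by (simp only: case_prod_beta)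
  also have "\<dots> = ennreal (\<Prod>e\<in>pairs V. ?w e)"
  proof (rule prod_ennreal)
    fix e assume "e \<in> pairs V"
    from wt_range[OF this, of pos] show "0 \<le> ?w e" by simp
  qed
  also have "(\<Prod>e\<in>pairs V. ?w e) = (\<Prod>e\<in>E. wt (\<lambda>x y. g (dist x y)) pos e) * (\<Prod>e\<in>pairs V - E. 1 - wt (\<lambda>x y. g (dist x y)) pos e)"
  proof -
    have "(\<Prod>e\<in>pairs V. ?w e) = (\<Prod>e\<in>pairs V - E. ?w e) * (\<Prod>e\<in>E. ?w e)"
      by (rule prod.subset_diff[OF E]) (simp add: V)
    moreover have "(\<Prod>e\<in>pairs V - E. ?w e) = (\<Prod>e\<in>pairs V - E. 1 - wt (\<lambda>x y. g (dist x y)) pos e)"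
      by (intro prod.cong) auto
    moreover have "(\<Prod>e\<in>E. ?w e) = (\<Prod>e\<in>E. wt (\<lambda>x y. g (dist x y)) pos e)" by (intro prod.cong) auto
    ultimately show ?thesis by (simp add: mult.commute)
  qed
  finally show ?thesis .
qed

lemma redges_config:
  assumes E: "E \<subseteq> pairs V"
  shows "redges g pos U \<inter> pairs V = E \<longleftrightarrow> (\<forall>k\<in>keys V. (U k < g (dist (pos (fst k)) (pos (snd k)))) = ({fst k, snd k} \<in> E))"
proof
  assume L: "redges g pos U \<inter> pairs V = E"
  show "\<forall>k\<in>keys V. (U k < g (dist (pos (fst k)) (pos (snd k)))) = ({fst k, snd k} \<in> E)"
  proof
    fix k assume k: "k \<in> keys V"
    obtain l l' where ll: "k = (l, l')" "l \<in> V" "l' \<in> V" "to_nat l < to_nat l'" using k by (auto simp: keys_def)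
    have "{l, l'} \<in> pairs V" using ll by auto
    then have "{l, l'} \<in> E \<longleftrightarrow> {l, l'} \<in> redges g pos U" unfolding L[symmetric] by blast
    then show "(U k < g (dist (pos (fst k)) (pos (snd k)))) = ({fst k, snd k} \<in> E)"
      using redges_iff[OF ll(4), of g pos U] ll(1) by simp
  qed
next
  assume R: "\<forall>k\<in>keys V. (U k < g (dist (pos (fst k)) (pos (snd k)))) = ({fst k, snd k} \<in> E)"
  have "e \<in> redges g pos U \<longleftrightarrow> e \<in> E" if "e \<in> pairs V" for e
  proof -
    have "e \<in> (\<lambda>(l, l'). {l, l'}) ` keys V" using that keys_bij[of V] by (simp add: bij_betw_def)
    then obtain k where k: "k \<in> keys V" "e = (\<lambda>(l, l'). {l, l'}) k" by (rule imageE)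
    obtain l l' where kl: "k = (l, l')" by (cases k)
    then have "to_nat l < to_nat l'" using k(1) by (simp add: keys_def)
    moreover have "(U k < g (dist (pos (fst k)) (pos (snd k)))) = ({fst k, snd k} \<in> E)" using R k(1) by (rule bspec)
    ultimately show ?thesis using k(2) kl redges_iff[of l l' g pos U] by simp
  qed
  then show "redges g pos U \<inter> pairs V = E" using E by blast
qed


lemma conn_redges:
  "conn V A B (redges g pos U) \<longleftrightarrow> conn V A B (redges g pos U \<inter> pairs V)"
proof -
  have "e \<in> pairs V" if e: "e \<in> redges g pos U" "e \<subseteq> V" for e
  proof -
    obtain l l' where "to_nat l < to_nat l'" "e = {l, l'}" using e(1) unfolding redges_def by blast
    then show ?thesis using e(2) by auto
  qed
  then have "redges g pos U \<inter> {e. e \<subseteq> V} = redges g pos U \<inter> pairs V \<inter> {e. e \<subseteq> V}" by blast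
  then show ?thesis
    using conn_restrict_edges[of V A B "redges g pos U"] conn_restrict_edges[of V A B "redges g pos U \<inter> pairs V"] by simp
qed

lemma U_integral_pred:
  assumes g: "profile g" and V: "finite V"
  shows "(\<integral>\<^sup>+U. ennreal (of_bool (P (redges g pos U \<inter> pairs V))) \<partial>Umeas) =
    ennreal (bsum (pairs V) (wt (\<lambda>x y. g (dist x y)) pos) (\<lambda>E. of_bool (P E)))"
proof -
  let ?C = "\<lambda>E. {U \<in> space Umeas. \<forall>k\<in>keys V. (U k < g (dist (pos (fst k)) (pos (snd k)))) = ({fst k, snd k} \<in> E)}"
  let ?W = "\<lambda>E. (\<Prod>e\<in>E. wt (\<lambda>x y. g (dist x y)) pos e) * (\<Prod>e\<in>pairs V - E. 1 - wt (\<lambda>x y. g (dist x y)) pos e)"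
  interpret kernel "\<lambda>(x::pt) y. g (dist x y)" by (rule kernel_profile[OF g])
  have fin: "finite (Pow (pairs V))" using V by simp
  have W0: "0 \<le> ?W E" if "E \<in> Pow (pairs V)" for E
    using that wt_range[of _ V pos] by (intro mult_nonneg_nonneg prod_nonneg) auto
  have C: "?C E \<in> sets Umeas" for E
  proof -
    have "Measurable.pred Umeas (\<lambda>U. U k < g (dist (pos (fst k)) (pos (snd k))))" for k
      unfolding Umeas_def by measurable
    then have "Measurable.pred Umeas (\<lambda>U. \<forall>k\<in>keys V. (U k < g (dist (pos (fst k)) (pos (snd k)))) = ({fst k, snd k} \<in> E))"
      using finite_keys[OF V] by (intro pred_intros_finite pred_intros_logic) auto
    then show ?thesis by (simp add: pred_def)
  qed
  have "(\<integral>\<^sup>+U. ennreal (of_bool (P (redges g pos U \<inter> pairs V))) \<partial>Umeas) =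
    (\<integral>\<^sup>+U. (\<Sum>E\<in>Pow (pairs V). ennreal (of_bool (P E)) * indicator (?C E) U) \<partial>Umeas)"
  proof (intro nn_integral_cong)
    fix U assume U: "U \<in> space Umeas"
    let ?E = "redges g pos U \<inter> pairs V"
    have "(\<Sum>E\<in>Pow (pairs V). ennreal (of_bool (P E)) * indicator (?C E) U) =
      (\<Sum>E\<in>Pow (pairs V). if ?E = E then ennreal (of_bool (P ?E)) else 0)"
    proof (intro sum.cong refl)
      fix E assume "E \<in> Pow (pairs V)"
      then have "E \<subseteq> pairs V" by simp
      from redges_config[OF this, of g pos U] U
      have c: "U \<in> ?C E \<longleftrightarrow> ?E = E" by blast
      have i: "indicator (?C E) U = (of_bool (?E = E) :: ennreal)" unfolding indicator_def c ..
      show "ennreal (of_bool (P E)) * indicator (?C E) U = (if ?E = E then ennreal (of_bool (P ?E)) else 0)"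
        unfolding i by (cases "?E = E") simp_all
    qed
    also have "\<dots> = ennreal (of_bool (P ?E))" using fin by (simp add: sum.delta')
    finally show "ennreal (of_bool (P (redges g pos U \<inter> pairs V))) = (\<Sum>E\<in>Pow (pairs V). ennreal (of_bool (P E)) * indicator (?C E) U)"
      by simp
  qed
  also have "\<dots> = (\<Sum>E\<in>Pow (pairs V). \<integral>\<^sup>+U. ennreal (of_bool (P E)) * indicator (?C E) U \<partial>Umeas)"
    by (intro nn_integral_sum borel_measurable_times_ennreal borel_measurable_const borel_measurable_indicator C)
  also have "\<dots> = (\<Sum>E\<in>Pow (pairs V). ennreal (?W E * of_bool (P E)))"
  proof (intro sum.cong refl)
    fix E assume E: "E \<in> Pow (pairs V)"
    have "(\<integral>\<^sup>+U. ennreal (of_bool (P E)) * indicator (?C E) U \<partial>Umeas) = ennreal (of_bool (P E)) * emeasure Umeas (?C E)"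
      by (rule nn_integral_cmult_indicator[OF C])
    also have "emeasure Umeas (?C E) = ennreal (?W E)" using E by (intro edge_config_prob[OF g V]) simp
    also have "ennreal (of_bool (P E)) * ennreal (?W E) = ennreal (?W E * of_bool (P E))"
      by (cases "P E") simp_all
    finally show "(\<integral>\<^sup>+U. ennreal (of_bool (P E)) * indicator (?C E) U \<partial>Umeas) = ennreal (?W E * of_bool (P E))" .
  qed
  also have "\<dots> = ennreal (\<Sum>E\<in>Pow (pairs V). ?W E * of_bool (P E))"
    by (rule sum_ennreal) (intro mult_nonneg_nonneg W0, auto)
  finally show ?thesis unfolding bsum_def .
qed

lemma U_integral:
  assumes g: "profile g" and V: "finite V"
  shows "(\<integral>\<^sup>+U. ennreal (of_bool (conn V A B (redges g pos U))) \<partial>Umeas) =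
    ennreal (bsum (pairs V) (wt (\<lambda>x y. g (dist x y)) pos) (\<lambda>E. of_bool (conn V A B E)))"
  using U_integral_pred[OF g V, where P="conn V A B"] by (simp only: conn_redges[symmetric])

text \<open>Transport of positions by \<open>\<phi>\<close>, needed for the dilation that carries
  unit cells to cells of another side.\<close>

lemma (in kernel) ex_distr:
  fixes \<phi> :: "'b::second_countable_topology \<Rightarrow> 'a" and D :: "'i \<Rightarrow> 'b measure"
  assumes V: "finite V" and ST: "S \<in> sets borel" "T \<in> sets borel"
    and D: "\<And>i. prob_space (D i)" "\<And>i. sets (D i) = sets borel" and \<phi>: "\<phi> \<in> borel_measurable borel"
  shows "ex V (\<lambda>i. distr (D i) borel \<phi>) w (ind_conn S T V) =
    ex V D (\<lambda>x y. w (\<phi> x) (\<phi> y)) (ind_conn (\<phi> -` S) (\<phi> -` T) V)"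
proof -
  let ?D = "\<lambda>i. distr (D i) borel \<phi>"
  have \<phi>D: "\<phi> \<in> D i \<rightarrow>\<^sub>M borel" for i using \<phi> measurable_cong_sets[OF D(2)[of i] refl] by blast
  have PD: "prob_space (?D i)" for i by (rule prob_space.prob_space_distr[OF D(1) \<phi>D])
  have k': "kernel (\<lambda>x y. w (\<phi> x) (\<phi> y))"
  proof
    have "(\<lambda>p. w (fst (\<phi> (fst p), \<phi> (snd p))) (snd (\<phi> (fst p), \<phi> (snd p)))) \<in> borel_measurable (borel \<Otimes>\<^sub>M borel)"
      by (rule measurable_compose[OF _ w_measurable])
        (intro measurable_Pair measurable_compose[OF measurable_fst \<phi>] measurable_compose[OF measurable_snd \<phi>])
    then show "(\<lambda>p. w (\<phi> (fst p)) (\<phi> (snd p))) \<in> borel_measurable (borel \<Otimes>\<^sub>M borel)" by simp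
  qed (auto intro: w_sym w_nonneg w_le1)
  interpret K: kernel "\<lambda>x y. w (\<phi> x) (\<phi> y)" by (rule k')
  have \<phi>D': "\<phi> \<in> D i \<rightarrow>\<^sub>M ?D i" for i using \<phi>D[of i] measurable_cong_sets[OF refl sets_distr[of "D i" borel \<phi>]] by blast
  have dd: "distr (D i) (?D i) \<phi> = ?D i" for i by (intro distr_cong) auto
  have eq: "PiM V ?D = distr (PiM V D) (PiM V ?D) (compose V \<phi>)"
    using distr_PiM_finite_prob_space'[OF V D(1) PD \<phi>D'] by (simp only: dd)
  have mc: "compose V \<phi> \<in> PiM V D \<rightarrow>\<^sub>M PiM V ?D"
    unfolding compose_def
  proof (intro measurable_restrict)
    fix i assume i: "i \<in> V"
    show "(\<lambda>x. \<phi> (x i)) \<in> PiM V D \<rightarrow>\<^sub>M ?D i"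
      by (rule measurable_compose[OF measurable_component_singleton[OF i] \<phi>D'])
  qed
  have sD: "sets (?D i) = sets borel" for i by simp
  have "ex V ?D w (ind_conn S T V) = (\<integral>\<^sup>+x. ennreal (bsum (pairs V) (wt w x) (ind_conn S T V x)) \<partial>distr (PiM V D) (PiM V ?D) (compose V \<phi>))"
    unfolding ex_def eq[symmetric] ..
  also have "\<dots> = (\<integral>\<^sup>+x. ennreal (bsum (pairs V) (wt w (compose V \<phi> x)) (ind_conn S T V (compose V \<phi> x))) \<partial>PiM V D)"
    using bsum_wt_measurable'[OF adm_ind_conn[OF V ST] V sD] by (intro nn_integral_distr mc) simp
  also have "\<dots> = ex V D (\<lambda>x y. w (\<phi> x) (\<phi> y)) (ind_conn (\<phi> -` S) (\<phi> -` T) V)"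
    unfolding ex_def
  proof (intro nn_integral_cong arg_cong[where f=ennreal] bsum_cong)
    fix x :: "'i \<Rightarrow> 'b" and e assume "e \<in> pairs V"
    then obtain i j where "i \<in> V" "j \<in> V" "e = {i, j}" unfolding pairs_def by blast
    then show "wt w (compose V \<phi> x) e = wt (\<lambda>x y. w (\<phi> x) (\<phi> y)) x e" by (simp add: compose_def)
  next
    fix x :: "'i \<Rightarrow> 'b" and E
    have "mk V (compose V \<phi> x) R = mk V x (\<phi> -` R)" for R by (auto simp: mk_def compose_def)
    then show "ind_conn S T V (compose V \<phi> x) E = ind_conn (\<phi> -` S) (\<phi> -` T) V x E" by (simp add: ind_conn_def)
  qed
  finally show ?thesis .
qed

lemma (in kernel) ex_PiM_UNIV:
  fixes D :: "'i \<Rightarrow> 'a measure"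
  assumes V: "finite V" and ST: "S \<in> sets borel" "T \<in> sets borel"
    and D: "\<And>i. prob_space (D i)" "\<And>i. sets (D i) = sets borel"
  shows "(\<integral>\<^sup>+x. ennreal (bsum (pairs V) (wt w x) (ind_conn S T V x)) \<partial>PiM UNIV D) = ex V D w (ind_conn S T V)"
proof -
  let ?H = "\<lambda>x. ennreal (bsum (pairs V) (wt w x) (ind_conn S T V x))"
  have 2: "?H x = ?H (\<lambda>i\<in>V. x i)" for x
  proof -
    have "mk V x R = mk V (\<lambda>i\<in>V. x i) R" for R by (auto simp: mk_def)
    then have "ind_conn S T V x = ind_conn S T V (\<lambda>i\<in>V. x i)" unfolding ind_conn_def by simp
    moreover have "bsum (pairs V) (wt w x) Y = bsum (pairs V) (wt w (\<lambda>i\<in>V. x i)) Y" for Y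
      by (intro bsum_cong refl, erule wt_cong) simp
    ultimately show ?thesis by simp
  qed
  have meas: "(\<lambda>x. \<lambda>i\<in>V. x i) \<in> PiM UNIV D \<rightarrow>\<^sub>M PiM V D"
    by (intro measurable_restrict measurable_component_singleton) auto
  have distr: "distr (PiM UNIV D) (PiM V D) (\<lambda>x. \<lambda>i\<in>V. x i) = PiM V D"
    using distr_PiM_reindex[of UNIV D "\<lambda>i. i" V, OF D(1)] by simp
  have "(\<integral>\<^sup>+x. ?H x \<partial>PiM UNIV D) = (\<integral>\<^sup>+x. ?H (\<lambda>i\<in>V. x i) \<partial>PiM UNIV D)" using 2 by simp
  also have "\<dots> = (\<integral>\<^sup>+x. ?H x \<partial>distr (PiM UNIV D) (PiM V D) (\<lambda>x. \<lambda>i\<in>V. x i))"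
    using bsum_wt_measurable'[OF adm_ind_conn[OF V ST] V, of D] D(2)
    by (intro nn_integral_distr[symmetric] meas) simp
  also have "\<dots> = ex V D w (ind_conn S T V)" unfolding distr ex_def ..
  finally show ?thesis .
qed

section \<open>Connection events of the random connection model and their probability\<close>

lemma measurable_PiM_counts:
  fixes p :: "'c \<Rightarrow> nat pmf" and \<Psi> :: "('c \<Rightarrow> nat) \<Rightarrow> ennreal"
  assumes "finite K" shows "\<Psi> \<in> borel_measurable (PiM K (\<lambda>c. measure_pmf (p c)))"
proof (rule measurableI)
  let ?M = "PiM K (\<lambda>c. measure_pmf (p c))"
  fix A :: "ennreal set"
  have sp: "space ?M = PiE K (\<lambda>_. UNIV)" by (simp add: space_PiM)
  show "\<Psi> -` A \<inter> space ?M \<in> sets ?M"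
  proof (rule sets.countable)
    have "countable (PiE K (\<lambda>_. UNIV :: nat set))" using assms by (intro countable_PiE) auto
    then show "countable (\<Psi> -` A \<inter> space ?M)" unfolding sp by (rule countable_subset[rotated]) auto
    fix N assume "N \<in> \<Psi> -` A \<inter> space ?M"
    then have "N \<in> extensional K" by (auto simp: sp PiE_iff)
    from PiE_singleton[OF this] have "{N} = PiE K (\<lambda>c. {N c})" by simp
    also have "\<dots> \<in> sets ?M" using assms by (intro sets_PiM_I_finite) auto
    finally show "{N} \<in> sets ?M" .
  qed
qed simp

text \<open>With the cells restricted to \<open>K\<close> and the counts given, the event depends on
  finitely many labels when \<open>K\<close> is finite; infinite volume is recovered by letting
  \<open>K\<close> grow.\<close>

definition Ev :: "(real \<Rightarrow> real) \<Rightarrow> (int \<times> int) set \<Rightarrow> pt set \<Rightarrow> pt set \<Rightarrow> rcm_sample set" where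
  "Ev g K S T = {\<omega>. conn (labs K (fst \<omega>)) {l. position \<omega> l \<in> S} {l. position \<omega> l \<in> T} (redges g (fst (snd \<omega>)) (snd (snd \<omega>)))}"

text \<open>The half-open ranges select the 4 L^2 unit cells that fill
  \<open>sq (real L)\<close>.\<close>

definition Kc :: "nat \<Rightarrow> (int \<times> int) set" where
  "Kc L = {- int L..<int L} \<times> {- int L..<int L}"

lemma finite_Kc[simp]: "finite (Kc L)" by (simp add: Kc_def)

lemma card_Kc: "card (Kc L) = 4 * L * L" by (simp add: Kc_def card_cartesian_product nat_mult_distrib)

lemma Kc_mono: "L \<le> L' \<Longrightarrow> Kc L \<subseteq> Kc L'" by (auto simp: Kc_def)

lemma space_RCM[simp]: "space (RCM_space lam) = UNIV"
  by (simp add: RCM_space_def space_pair_measure space_PiM)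

lemma cell_borel[simp, measurable]: "cell c \<in> sets borel" by (simp add: cell_def)

lemma emeasure_cell: "emeasure lborel (cell c) = 1"
  unfolding cell_def by (subst emeasure_cbox_prod) auto

lemma prob_cell: "prob_space (unif (cell c))"
  by (rule prob_space_unif[of _ 1]) (auto simp: emeasure_cell)

lemma prob_N: "prob_space (PiM UNIV (\<lambda>_::int \<times> int. measure_pmf (poisson_pmf lam)))"
  by (intro prob_space_PiM prob_space_measure_pmf)

lemma prob_pos: "prob_space (PiM UNIV (\<lambda>l::lab. unif (cell (fst l))))"
  by (intro prob_space_PiM prob_cell)

lemma prob_U: "prob_space Umeas" unfolding Umeas_def by (intro prob_space_PiM prob_unit)

lemma RCM_space_alt:
  "RCM_space lam = PiM UNIV (\<lambda>_. measure_pmf (poisson_pmf lam)) \<Otimes>\<^sub>M (PiM UNIV (\<lambda>l. unif (cell (fst l))) \<Otimes>\<^sub>M Umeas)"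
  by (simp add: RCM_space_def Umeas_def)

lemma prob_pair: "prob_space A \<Longrightarrow> prob_space B \<Longrightarrow> prob_space (A \<Otimes>\<^sub>M B)"
proof -
  assume "prob_space A" "prob_space B"
  then interpret pair_prob_space A B by (simp add: pair_prob_space_def pair_sigma_finite_def prob_space_imp_sigma_finite)
  show "prob_space (A \<Otimes>\<^sub>M B)" by unfold_locales
qed

lemma prob_RCM: "prob_space (RCM_space lam)"
  unfolding RCM_space_alt by (intro prob_pair prob_N prob_pos prob_U)

text \<open>For each of the countably many families of counts in \<open>K\<close>, the event is a
  finite Boolean combination of marks of positions and of edge indicators.\<close>

lemma Ev_sets:
  assumes g: "profile g" and K: "finite K" and ST[measurable]: "S \<in> sets borel" "T \<in> sets borel"
  shows "Ev g K S T \<in> sets (RCM_space lam)"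
proof -
  let ?M = "RCM_space lam"
  have gm[measurable]: "g \<in> borel_measurable borel" using g by (simp add: profile_def)
  have p1: "Measurable.pred ?M (\<lambda>\<omega>. fst \<omega> c = n)" for c n
    unfolding RCM_space_def by measurable
  have pm: "(\<lambda>\<omega>. fst (snd \<omega>) l) \<in> ?M \<rightarrow>\<^sub>M borel" for l
  proof -
    have "(\<lambda>\<omega>. fst (snd \<omega>) l) \<in> ?M \<rightarrow>\<^sub>M unif (cell (fst l))" unfolding RCM_space_def by measurable
    then show ?thesis by (simp add: measurable_def)
  qed
  have um: "(\<lambda>\<omega>. snd (snd \<omega>) k) \<in> ?M \<rightarrow>\<^sub>M borel" for k
  proof -
    have "(\<lambda>\<omega>. snd (snd \<omega>) k) \<in> ?M \<rightarrow>\<^sub>M uniform_measure lborel {0..1}" unfolding RCM_space_def by measurable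
    then show ?thesis by (simp add: measurable_def)
  qed
  have p2: "Measurable.pred ?M (\<lambda>\<omega>. fst (snd \<omega>) l \<in> R)" if "R \<in> sets borel" for l R
    using measurable_sets[OF pm[of l] that] by (simp add: pred_def vimage_def)
  have p3: "Measurable.pred ?M (\<lambda>\<omega>. snd (snd \<omega>) k < g (dist (fst (snd \<omega>) (fst k)) (fst (snd \<omega>) (snd k))))" for k
  proof -
    note [measurable] = pm um
    show ?thesis by measurable
  qed
  define Q where "Q N \<omega> \<longleftrightarrow> (\<forall>c\<in>K. fst \<omega> c = N c) \<and>
     (\<exists>A\<in>Pow (labs K N). \<exists>B\<in>Pow (labs K N). \<exists>E\<in>Pow (pairs (labs K N)).
       (\<forall>l\<in>labs K N. (fst (snd \<omega>) l \<in> S) = (l \<in> A)) \<and> (\<forall>l\<in>labs K N. (fst (snd \<omega>) l \<in> T) = (l \<in> B)) \<and>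
       (\<forall>k\<in>keys (labs K N). (snd (snd \<omega>) k < g (dist (fst (snd \<omega>) (fst k)) (fst (snd \<omega>) (snd k)))) = ({fst k, snd k} \<in> E)) \<and>
       conn (labs K N) A B E)" for N and \<omega> :: rcm_sample
  have fl: "finite (labs K N)" for N by (rule finite_labs[OF K])
  have cP: "countable (PiE K (\<lambda>_. UNIV :: nat set))" using K by (intro countable_PiE) auto
  have inner: "Measurable.pred ?M (Q N)" for N
    unfolding Q_def
    by (intro pred_intros_logic pred_intros_finite K fl finite_keys p1 p2 p3 ST
        finite_Pow_iff[THEN iffD2] finite_pairs) auto
  have "(\<Union>N\<in>PiE K (\<lambda>_. UNIV). {\<omega>\<in>space ?M. Q N \<omega>}) \<in> sets ?M"
    by (rule sets.countable_UN''[OF cP]) (use inner in \<open>simp add: pred_def\<close>)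
  moreover have "Ev g K S T = (\<Union>N\<in>PiE K (\<lambda>_. UNIV). {\<omega>\<in>space ?M. Q N \<omega>})"
  proof (intro equalityI subsetI)
    fix \<omega> assume w: "\<omega> \<in> Ev g K S T"
    define N where "N = restrict (fst \<omega>) K"
    have l: "labs K N = labs K (fst \<omega>)" by (auto simp: labs_def N_def)
    define V where "V = labs K (fst \<omega>)"
    define E where "E = redges g (fst (snd \<omega>)) (snd (snd \<omega>)) \<inter> pairs V"
    define A where "A = V \<inter> {l. fst (snd \<omega>) l \<in> S}"
    define B where "B = V \<inter> {l. fst (snd \<omega>) l \<in> T}"
    have "conn V {l. position \<omega> l \<in> S} {l. position \<omega> l \<in> T} E"
      using w conn_redges unfolding Ev_def mem_Collect_eq V_def E_def by (rule iffD1[rotated])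
    then have c: "conn V A B E" by (rule conn_mono_marks) (simp_all add: A_def B_def position_def)
    have EV: "E \<subseteq> pairs V" by (simp add: E_def)
    have e: "\<forall>k\<in>keys V. (snd (snd \<omega>) k < g (dist (fst (snd \<omega>) (fst k)) (fst (snd \<omega>) (snd k)))) = ({fst k, snd k} \<in> E)"
      by (rule redges_config[OF EV, THEN iffD1]) (simp add: E_def)
    have "Q N \<omega>" unfolding Q_def l V_def[symmetric]
    proof (rule conjI, simp add: N_def, rule bexI[of _ A], rule bexI[of _ B], rule bexI[of _ E], intro conjI)
      show "conn V A B E" by (rule c)
      show "\<forall>k\<in>keys V. (snd (snd \<omega>) k < g (dist (fst (snd \<omega>) (fst k)) (fst (snd \<omega>) (snd k)))) = ({fst k, snd k} \<in> E)" by (rule e)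
    qed (simp_all add: A_def B_def EV)
    moreover have "N \<in> PiE K (\<lambda>_. UNIV)" by (simp add: N_def)
    ultimately show "\<omega> \<in> (\<Union>N\<in>PiE K (\<lambda>_. UNIV). {\<omega>\<in>space ?M. Q N \<omega>})" unfolding space_RCM by blast
  next
    fix \<omega> assume "\<omega> \<in> (\<Union>N\<in>PiE K (\<lambda>_. UNIV). {\<omega>\<in>space ?M. Q N \<omega>})"
    then obtain N where "Q N \<omega>" by blast
    then obtain A B E where N: "\<forall>c\<in>K. fst \<omega> c = N c" "A \<in> Pow (labs K N)" "B \<in> Pow (labs K N)" "E \<in> Pow (pairs (labs K N))"
      "\<forall>l\<in>labs K N. (fst (snd \<omega>) l \<in> S) = (l \<in> A)" "\<forall>l\<in>labs K N. (fst (snd \<omega>) l \<in> T) = (l \<in> B)"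
      "\<forall>k\<in>keys (labs K N). (snd (snd \<omega>) k < g (dist (fst (snd \<omega>) (fst k)) (fst (snd \<omega>) (snd k)))) = ({fst k, snd k} \<in> E)"
      "conn (labs K N) A B E" unfolding Q_def by (elim conjE bexE) (rule that)
    have l: "labs K N = labs K (fst \<omega>)" using N(1) by (auto simp: labs_def)
    have "redges g (fst (snd \<omega>)) (snd (snd \<omega>)) \<inter> pairs (labs K N) = E"
      using N(4) by (intro redges_config[THEN iffD2] N(7)) simp
    then have "conn (labs K N) A B (redges g (fst (snd \<omega>)) (snd (snd \<omega>)))"
      using N(8) by (subst conn_redges) simp
    then have "conn (labs K N) {l. position \<omega> l \<in> S} {l. position \<omega> l \<in> T} (redges g (fst (snd \<omega>)) (snd (snd \<omega>)))"
      by (rule conn_mono_marks) (use N(5,6) in \<open>auto simp only: position_def\<close>)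
    then show "\<omega> \<in> Ev g K S T" by (simp add: Ev_def l)
  qed
  ultimately show ?thesis by simp
qed

text \<open>Integrating first the edge variables, then the positions, then the counts reproduces the
  layers of \<open>bsum\<close>, \<open>ex\<close> and the Poisson product.\<close>

lemma emeasure_Ev:
  assumes g: "profile g" and K: "finite K" and ST: "S \<in> sets borel" "T \<in> sets borel"
  shows "emeasure (RCM_space lam) (Ev g K S T) =
    (\<integral>\<^sup>+N. ex (labs K N) (\<lambda>l. unif (cell (fst l))) (\<lambda>x y. g (dist x y)) (ind_conn S T (labs K N))
      \<partial>PiM K (\<lambda>_. measure_pmf (poisson_pmf lam)))"
proof -
  interpret kernel "\<lambda>(x::pt) y. g (dist x y)" by (rule kernel_profile[OF g])
  let ?N = "PiM UNIV (\<lambda>_::int \<times> int. measure_pmf (poisson_pmf lam))" and ?P = "PiM UNIV (\<lambda>l::lab. unif (cell (fst l)))"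
  interpret N: prob_space ?N by (rule prob_N)
  interpret P: prob_space ?P by (rule prob_pos)
  interpret U: prob_space Umeas by (rule prob_U)
  interpret PU: prob_space "?P \<Otimes>\<^sub>M Umeas" by (intro prob_pair prob_pos prob_U)
  let ?\<Psi> = "\<lambda>N. ex (labs K N) (\<lambda>l. unif (cell (fst l))) (\<lambda>x y. g (dist x y)) (ind_conn S T (labs K N))"
  have ind: "(indicator (Ev g K S T) :: _ \<Rightarrow> ennreal) \<in> borel_measurable (?N \<Otimes>\<^sub>M (?P \<Otimes>\<^sub>M Umeas))"
    using Ev_sets[OF g K ST, of lam] unfolding RCM_space_alt by (rule borel_measurable_indicator)
  have "emeasure (RCM_space lam) (Ev g K S T) = (\<integral>\<^sup>+\<omega>. indicator (Ev g K S T) \<omega> \<partial>(?N \<Otimes>\<^sub>M (?P \<Otimes>\<^sub>M Umeas)))"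
    using Ev_sets[OF g K ST, of lam] unfolding RCM_space_alt by (rule nn_integral_indicator[symmetric])
  also have "\<dots> = (\<integral>\<^sup>+N. \<integral>\<^sup>+y. indicator (Ev g K S T) (N, y) \<partial>(?P \<Otimes>\<^sub>M Umeas) \<partial>?N)"
    by (rule PU.nn_integral_fst[OF ind, symmetric])
  also have "\<dots> = (\<integral>\<^sup>+N. ?\<Psi> N \<partial>?N)"
  proof (intro nn_integral_cong)
    fix N :: "int \<times> int \<Rightarrow> nat"
    have fV: "finite (labs K N)" by (rule finite_labs[OF K])
    have "(\<lambda>y. (N, y)) \<in> ?P \<Otimes>\<^sub>M Umeas \<rightarrow>\<^sub>M ?N \<Otimes>\<^sub>M (?P \<Otimes>\<^sub>M Umeas)"
      by (intro measurable_Pair1') (simp add: space_PiM)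
    from measurable_compose[OF this ind]
    have ind': "(\<lambda>y. indicator (Ev g K S T) (N, y) :: ennreal) \<in> borel_measurable (?P \<Otimes>\<^sub>M Umeas)" .
    have "(\<integral>\<^sup>+y. indicator (Ev g K S T) (N, y) \<partial>(?P \<Otimes>\<^sub>M Umeas)) = (\<integral>\<^sup>+x. \<integral>\<^sup>+u. indicator (Ev g K S T) (N, (x, u)) \<partial>Umeas \<partial>?P)"
      by (rule U.nn_integral_fst[OF ind', symmetric])
    also have "\<dots> = (\<integral>\<^sup>+x. ennreal (bsum (pairs (labs K N)) (wt (\<lambda>x y. g (dist x y)) x) (ind_conn S T (labs K N) x)) \<partial>?P)"
    proof (intro nn_integral_cong)
      fix x :: "lab \<Rightarrow> pt"
      let ?V = "labs K N"
      have m: "conn ?V {l. x l \<in> S} {l. x l \<in> T} E \<longleftrightarrow> conn ?V (mk ?V x S) (mk ?V x T) E" for E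
        by (rule conn_cong_marks) (auto simp: mk_def)
      have "(\<integral>\<^sup>+u. indicator (Ev g K S T) (N, (x, u)) \<partial>Umeas) = (\<integral>\<^sup>+u. ennreal (of_bool (conn ?V (mk ?V x S) (mk ?V x T) (redges g x u))) \<partial>Umeas)"
        by (intro nn_integral_cong) (simp add: Ev_def indicator_def position_def m)
      also have "\<dots> = ennreal (bsum (pairs ?V) (wt (\<lambda>x y. g (dist x y)) x) (ind_conn S T ?V x))"
        unfolding ind_conn_def by (rule U_integral[OF g fV])
      finally show "(\<integral>\<^sup>+u. indicator (Ev g K S T) (N, (x, u)) \<partial>Umeas) = ennreal (bsum (pairs ?V) (wt (\<lambda>x y. g (dist x y)) x) (ind_conn S T ?V x))" .
    qed
    also have "\<dots> = ?\<Psi> N" by (rule ex_PiM_UNIV[OF fV ST]) (auto simp: prob_cell)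
    finally show "(\<integral>\<^sup>+y. indicator (Ev g K S T) (N, y) \<partial>(?P \<Otimes>\<^sub>M Umeas)) = ?\<Psi> N" .
  qed
  also have "\<dots> = (\<integral>\<^sup>+N. ?\<Psi> (\<lambda>c\<in>K. N c) \<partial>?N)"
  proof (intro nn_integral_cong)
    fix N :: "int \<times> int \<Rightarrow> nat"
    have "labs K (\<lambda>c\<in>K. N c) = labs K N" by (auto simp: labs_def)
    then show "?\<Psi> N = ?\<Psi> (\<lambda>c\<in>K. N c)" by simp
  qed
  also have "\<dots> = (\<integral>\<^sup>+N. ?\<Psi> N \<partial>distr ?N (PiM K (\<lambda>_. measure_pmf (poisson_pmf lam))) (\<lambda>N. \<lambda>c\<in>K. N c))"
    by (intro nn_integral_distr[symmetric] measurable_restrict measurable_component_singleton)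
      (auto simp: measurable_PiM_counts[OF K])
  also have "distr ?N (PiM K (\<lambda>_. measure_pmf (poisson_pmf lam))) (\<lambda>N. \<lambda>c\<in>K. N c) = PiM K (\<lambda>_. measure_pmf (poisson_pmf lam))"
    using distr_PiM_reindex[of UNIV "\<lambda>_. measure_pmf (poisson_pmf lam)" "\<lambda>i. i" K] by (simp add: prob_space_measure_pmf)
  finally show ?thesis .
qed

lemma sq_covered:
  assumes "y \<in> sq (real L)" "0 < L" obtains c where "c \<in> Kc L" "y \<in> cell c"
proof -
  have 1: "\<exists>i\<in>{- int L..<int L}. real_of_int i \<le> r \<and> r \<le> real_of_int i + 1" if "- real L \<le> r" "r \<le> real L" for r
  proof (cases "r = real L")
    case True
    then show ?thesis using assms(2) by (intro bexI[of _ "int L - 1"]) auto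
  next
    case False
    then have "\<lfloor>r\<rfloor> \<in> {- int L..<int L}" using that by (auto simp: le_floor_iff floor_less_iff)
    then show ?thesis by (intro bexI[of _ "\<lfloor>r\<rfloor>"]) (auto intro: real_of_int_floor_add_one_ge)
  qed
  obtain i j where ij: "i \<in> {- int L..<int L}" "real_of_int i \<le> fst y" "fst y \<le> real_of_int i + 1"
      "j \<in> {- int L..<int L}" "real_of_int j \<le> snd y" "snd y \<le> real_of_int j + 1"
    using 1[of "fst y"] 1[of "snd y"] assms(1) by (auto simp: sq_def cbox_Pair_eq)
  show ?thesis by (rule that[of "(i, j)"]) (use ij in \<open>auto simp: Kc_def cell_def cbox_Pair_eq mem_Times_iff\<close>)
qed

text \<open>Closed cells overlap on their boundaries. The sum of their indicators dominates that of
  the square and has the same integral, hence equality almost everywhere.\<close>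

lemma AE_cells:
  assumes "0 < L"
  shows "AE y in lborel. (\<Sum>c\<in>Kc L. indicator (cell c) y) = (indicator (sq (real L)) y :: ennreal)"
proof -
  let ?f = "\<lambda>y. \<Sum>c\<in>Kc L. indicator (cell c) y :: ennreal" and ?g = "indicator (sq (real L)) :: pt \<Rightarrow> ennreal"
  have le: "?g y \<le> ?f y" for y
  proof (cases "y \<in> sq (real L)")
    case True
    then obtain c where c: "c \<in> Kc L" "y \<in> cell c" using sq_covered[OF _ assms] by blast
    have "indicator (cell c) y \<le> ?f y" using c(1) by (intro member_le_sum) auto
    then show ?thesis using True c by (simp add: indicator_def)
  qed simp
  have int_g: "(\<integral>\<^sup>+y. ?g y \<partial>lborel) = ennreal (4 * (real L)\<^sup>2)" by (simp add: emeasure_sq)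
  have "(\<integral>\<^sup>+y. ?f y \<partial>lborel) = (\<Sum>c\<in>Kc L. emeasure lborel (cell c))" by (subst nn_integral_sum) auto
  also have "\<dots> = ennreal (4 * (real L)\<^sup>2)"
    by (simp add: emeasure_cell card_Kc power2_eq_square ennreal_of_nat_eq_real_of_nat)
  finally have "(\<integral>\<^sup>+y. ?f y - ?g y \<partial>lborel) = 0"
    using le int_g by (subst nn_integral_diff) auto
  then have "AE y in lborel. ?f y - ?g y = 0" by (subst (asm) nn_integral_0_iff_AE) auto
  then show ?thesis
  proof (eventually_elim)
    case (elim y)
    then have "?f y \<le> ?g y" by (simp add: diff_eq_0_iff_ennreal)
    then show ?case using le[of y] by (rule antisym)
  qed
qed

lemma nn_integral_lborel_scale:
  fixes h :: "pt \<Rightarrow> ennreal"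
  assumes a: "0 < a" and h: "h \<in> borel_measurable borel"
  shows "(\<integral>\<^sup>+y. h y \<partial>lborel) = ennreal (a\<^sup>2) * (\<integral>\<^sup>+y. h (a *\<^sub>R y) \<partial>lborel)"
proof -
  have dim: "DIM(pt) = 2" by simp
  have m: "(\<lambda>x::pt. 0 + a *\<^sub>R x) \<in> borel_measurable borel" by measurable
  have "(\<integral>\<^sup>+y. h y \<partial>lborel) = (\<integral>\<^sup>+y. h y \<partial>density (distr lborel borel (\<lambda>x. 0 + a *\<^sub>R x)) (\<lambda>_. ennreal (\<bar>a\<bar> ^ DIM(pt))))"
    using lborel_affine[of a "0 :: pt"] a by simp
  also have "\<dots> = (\<integral>\<^sup>+y. ennreal (\<bar>a\<bar> ^ DIM(pt)) * h y \<partial>distr lborel borel (\<lambda>x. 0 + a *\<^sub>R x))"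
    using h by (intro nn_integral_density) auto
  also have "\<dots> = (\<integral>\<^sup>+y. ennreal (\<bar>a\<bar> ^ DIM(pt)) * h (0 + a *\<^sub>R y) \<partial>lborel)"
    using h m by (intro nn_integral_distr) auto
  also have "\<dots> = ennreal (a\<^sup>2) * (\<integral>\<^sup>+y. h (a *\<^sub>R y) \<partial>lborel)"
    using a h m by (subst nn_integral_cmult) (auto simp: dim power2_eq_square)
  finally show ?thesis .
qed

lemma unif_scaled_cells:
  fixes h :: "pt \<Rightarrow> ennreal"
  assumes a: "0 < a" and L: "0 < L" and h: "h \<in> borel_measurable borel"
  shows "(\<integral>\<^sup>+y. h y \<partial>unif (sq (a * real L))) =
    (\<Sum>c\<in>Kc L. ennreal (1 / real (card (Kc L))) * (\<integral>\<^sup>+y. h y \<partial>distr (unif (cell c)) borel (\<lambda>x. a *\<^sub>R x)))"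
proof -
  let ?v = "4 * (a * real L)\<^sup>2"
  have v: "0 < ?v" using a L by simp
  have e: "emeasure lborel (sq (a * real L)) = ennreal ?v" using a by (intro emeasure_sq) simp
  have hs[measurable]: "(\<lambda>y. h (a *\<^sub>R y)) \<in> borel_measurable borel"
    by (rule measurable_compose[OF _ h]) measurable
  have ind: "indicator (sq (a * real L)) (a *\<^sub>R y) = (indicator (sq (real L)) y :: ennreal)" for y :: pt
  proof -
    have "a *\<^sub>R y \<in> sq (a * real L) \<longleftrightarrow> y \<in> sq (real L)"
    proof -
      have "- (a * real L) \<le> a * r \<longleftrightarrow> - real L \<le> r" "a * r \<le> a * real L \<longleftrightarrow> r \<le> real L" for r
        using a mult_le_cancel_left_pos[of a "- real L" r] by auto
      then show ?thesis by (cases y) (simp add: sq_def cbox_Pair_eq)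
    qed
    then show ?thesis by (simp add: indicator_def)
  qed
  have ci: "(\<integral>\<^sup>+y. h y \<partial>distr (unif (cell c)) borel (\<lambda>x. a *\<^sub>R x)) = (\<integral>\<^sup>+y. h (a *\<^sub>R y) * indicator (cell c) y \<partial>lborel)" for c
  proof -
    have "(\<integral>\<^sup>+y. h y \<partial>distr (unif (cell c)) borel (\<lambda>x. a *\<^sub>R x)) = (\<integral>\<^sup>+y. h (a *\<^sub>R y) \<partial>unif (cell c))"
      using h by (intro nn_integral_distr) auto
    also have "\<dots> = ennreal (1 / 1) * (\<integral>\<^sup>+y. h (a *\<^sub>R y) * indicator (cell c) y \<partial>lborel)"
      by (rule nn_integral_unif) (auto simp: emeasure_cell)
    finally show ?thesis by simp
  qed
  have "(\<integral>\<^sup>+y. h y \<partial>unif (sq (a * real L))) = ennreal (1 / ?v) * (\<integral>\<^sup>+y. h y * indicator (sq (a * real L)) y \<partial>lborel)"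
    by (rule nn_integral_unif[OF sq_borel e v h])
  also have "\<dots> = ennreal (1 / ?v) * (ennreal (a\<^sup>2) * (\<integral>\<^sup>+y. h (a *\<^sub>R y) * indicator (sq (a * real L)) (a *\<^sub>R y) \<partial>lborel))"
    using h by (subst nn_integral_lborel_scale[OF a]) auto
  also have "\<dots> = ennreal (1 / ?v * a\<^sup>2) * (\<integral>\<^sup>+y. h (a *\<^sub>R y) * indicator (sq (real L)) y \<partial>lborel)"
    unfolding ind using v by (subst ennreal_mult) (auto simp: mult.assoc)
  also have "(\<integral>\<^sup>+y. h (a *\<^sub>R y) * indicator (sq (real L)) y \<partial>lborel) = (\<integral>\<^sup>+y. (\<Sum>c\<in>Kc L. h (a *\<^sub>R y) * indicator (cell c) y) \<partial>lborel)"
  proof (rule nn_integral_cong_AE)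
    show "AE y in lborel. h (a *\<^sub>R y) * indicator (sq (real L)) y = (\<Sum>c\<in>Kc L. h (a *\<^sub>R y) * indicator (cell c) y)"
      using AE_cells[OF L] by eventually_elim (simp add: sum_distrib_left[symmetric])
  qed
  also have "\<dots> = (\<Sum>c\<in>Kc L. \<integral>\<^sup>+y. h (a *\<^sub>R y) * indicator (cell c) y \<partial>lborel)" by (rule nn_integral_sum) auto
  also have "1 / ?v * a\<^sup>2 = 1 / real (card (Kc L))" using a L by (simp add: card_Kc power2_eq_square field_simps)
  finally show ?thesis unfolding ci sum_distrib_left .
qed

text \<open>The dilation by \<open>a\<close> turns unit cells into cells of side \<open>a\<close>,
  the intensity \<open>lam\<close> into \<open>lam / a\<^sup>2\<close>, and the profile k(a r) into
  k. With a = sqrt(s) it undoes the spatial part of \<open>scale_conn\<close>.\<close>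

theorem bridge:
  assumes k: "profile k" and a: "0 < a" and L: "0 < L" and lam: "0 < lam" and S: "S \<in> sets borel"
  shows "emeasure (RCM_space lam) (Ev (\<lambda>r. k (a * r)) (Kc L) ((\<lambda>x. a *\<^sub>R x) -` S) ((\<lambda>x. a *\<^sub>R x) -` (- sq t))) =
    PB (lam / a\<^sup>2) k (a * real L) S t"
proof -
  interpret kernel "\<lambda>(x::pt) y. k (dist x y)" by (rule kernel_profile[OF k])
  let ?\<phi> = "\<lambda>x::pt. a *\<^sub>R x"
  have \<phi>: "?\<phi> \<in> borel_measurable borel" by measurable
  have [measurable]: "k \<in> borel_measurable borel" using k by (simp add: profile_def)
  have k': "profile (\<lambda>r. k (a * r))" using k by (auto simp: profile_def)
  have T: "- sq t \<in> sets borel" by auto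
  have d: "(\<lambda>x y. k (a * dist x y)) = (\<lambda>x y. k (dist (?\<phi> x) (?\<phi> y)))"
    using a by (intro ext) (simp add: dist_norm scaleR_diff_right[symmetric])
  have vm: "?\<phi> -` R \<in> sets borel" if "R \<in> sets borel" for R using measurable_sets[OF \<phi> that] by simp
  have cK: "card (Kc L) = 4 * L * L" "0 < card (Kc L)" using L by (simp_all add: card_Kc)
  have Kne: "Kc L \<noteq> {}" using cK(2) by (metis card.empty less_irrefl)
  let ?m = "lam / a\<^sup>2 * (4 * (a * real L)\<^sup>2)"
  have m: "?m = lam * real (card (Kc L))" using a by (simp add: cK(1) power2_eq_square field_simps)
  have "PB (lam / a\<^sup>2) k (a * real L) S t = (\<integral>\<^sup>+N. ex (labs (Kc L) N) (\<lambda>l. distr (unif (cell (fst l))) borel ?\<phi>) (\<lambda>x y. k (dist x y)) (ind_conn S (- sq t) (labs (Kc L) N))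
     \<partial>PiM (Kc L) (\<lambda>c. measure_pmf (poisson_pmf (?m * (1 / real (card (Kc L)))))))"
    unfolding PB_def
  proof (rule PC_lump[OF finite_Kc S T])
    show "0 < ?m" using a L lam by simp
    show "prob_space (unif (sq (a * real L)))" using a L by (intro prob_space_sq) simp
    show "prob_space (distr (unif (cell c)) borel ?\<phi>)" for c
      by (rule prob_space.prob_space_distr[OF prob_cell]) simp
    show "(\<Sum>c\<in>Kc L. 1 / real (card (Kc L))) = 1" using Kne by simp
    fix h :: "pt \<Rightarrow> ennreal" assume "h \<in> borel_measurable borel"
    then show "(\<integral>\<^sup>+y. h y \<partial>unif (sq (a * real L))) =
      (\<Sum>c\<in>Kc L. ennreal (1 / real (card (Kc L))) * (\<integral>\<^sup>+y. h y \<partial>distr (unif (cell c)) borel ?\<phi>))"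
      by (rule unif_scaled_cells[OF a L])
  qed (use Kne in auto)
  also have "?m * (1 / real (card (Kc L))) = lam" unfolding m using Kne by simp
  also have "(\<integral>\<^sup>+N. ex (labs (Kc L) N) (\<lambda>l. distr (unif (cell (fst l))) borel ?\<phi>) (\<lambda>x y. k (dist x y)) (ind_conn S (- sq t) (labs (Kc L) N))
     \<partial>PiM (Kc L) (\<lambda>c. measure_pmf (poisson_pmf lam))) =
    (\<integral>\<^sup>+N. ex (labs (Kc L) N) (\<lambda>l. unif (cell (fst l))) (\<lambda>x y. k (dist (?\<phi> x) (?\<phi> y))) (ind_conn (?\<phi> -` S) (?\<phi> -` (- sq t)) (labs (Kc L) N))
     \<partial>PiM (Kc L) (\<lambda>c. measure_pmf (poisson_pmf lam)))"
    by (intro nn_integral_cong ex_distr finite_labs S T \<phi>) (auto simp: prob_cell)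
  also have "\<dots> = emeasure (RCM_space lam) (Ev (\<lambda>r. k (a * r)) (Kc L) (?\<phi> -` S) (?\<phi> -` (- sq t)))"
    unfolding d[symmetric] by (rule emeasure_Ev[OF k' finite_Kc vm[OF S] vm[OF T], symmetric])
  finally show ?thesis ..
qed


section \<open>Infinite components and connections to large distance\<close>

lemma rcm_adj_iff:
  "rcm_adj g \<omega> l l' \<longleftrightarrow> present \<omega> l \<and> present \<omega> l' \<and> {l, l'} \<in> redges g (fst (snd \<omega>)) (snd (snd \<omega>))"
proof (cases "l = l'")
  case True
  have "{l, l} \<notin> redges g (fst (snd \<omega>)) (snd (snd \<omega>))"
    by (auto simp: redges_def doubleton_eq_iff insert_eq_iff)
  then show ?thesis using True by (simp add: rcm_adj_def)
next
  case False
  then have "to_nat l \<noteq> to_nat l'" by simp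
  then consider "to_nat l < to_nat l'" | "to_nat l' < to_nat l" by linarith
  then show ?thesis
  proof cases
    case 1
    show ?thesis using False 1 redges_iff[OF 1, of g "fst (snd \<omega>)" "snd (snd \<omega>)"]
      by (simp add: rcm_adj_def edge_unif_def position_def)
  next
    case 2
    show ?thesis using False 2 redges_iff[OF 2, of g "fst (snd \<omega>)" "snd (snd \<omega>)"]
      by (simp add: rcm_adj_def edge_unif_def position_def insert_commute dist_commute)
  qed
qed

lemma labs_iff: "l \<in> labs K (fst \<omega>) \<longleftrightarrow> fst l \<in> K \<and> present \<omega> l"
  by (cases l) (simp add: labs_def present_def)

lemma step_in_labs:
  "step_in (labs K (fst \<omega>)) (redges g (fst (snd \<omega>)) (snd (snd \<omega>))) l l' \<longleftrightarrow> fst l \<in> K \<and> fst l' \<in> K \<and> rcm_adj g \<omega> l l'"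
  by (auto simp: step_in_def labs_iff rcm_adj_iff)

lemma Kc_exhaust: "\<exists>L. c \<in> Kc L"
proof -
  obtain i j where c: "c = (i, j)" by (cases c)
  have "c \<in> Kc (nat (\<bar>i\<bar> + \<bar>j\<bar> + 1))" unfolding c Kc_def by auto
  then show ?thesis ..
qed

text \<open>A path visits finitely many cells, so it lies in some block \<open>Kc L\<close>.\<close>

lemma rcm_path_bounded:
  assumes "(rcm_adj g \<omega>)\<^sup>*\<^sup>* l l'" "present \<omega> l"
  shows "\<exists>L. fst l \<in> Kc L \<and> fst l' \<in> Kc L \<and> present \<omega> l' \<and>
     (step_in (labs (Kc L) (fst \<omega>)) (redges g (fst (snd \<omega>)) (snd (snd \<omega>))))\<^sup>*\<^sup>* l l'"
  using assms
proof (induction)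
  case base
  then show ?case using Kc_exhaust[of "fst l"] by auto
next
  case (step y z)
  then obtain L where L: "fst l \<in> Kc L" "fst y \<in> Kc L" "present \<omega> y"
      "(step_in (labs (Kc L) (fst \<omega>)) (redges g (fst (snd \<omega>)) (snd (snd \<omega>))))\<^sup>*\<^sup>* l y" by blast
  obtain L' where L': "fst z \<in> Kc L'" using Kc_exhaust by blast
  define M where "M = max L L'"
  have M: "Kc L \<subseteq> Kc M" "Kc L' \<subseteq> Kc M" by (auto intro!: Kc_mono simp: M_def)
  have "step_in (labs (Kc L) (fst \<omega>)) (redges g (fst (snd \<omega>)) (snd (snd \<omega>))) \<le>
     step_in (labs (Kc M) (fst \<omega>)) (redges g (fst (snd \<omega>)) (snd (snd \<omega>)))"
    using M unfolding le_fun_def le_bool_def step_in_labs by blast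
  then have "(step_in (labs (Kc M) (fst \<omega>)) (redges g (fst (snd \<omega>)) (snd (snd \<omega>))))\<^sup>*\<^sup>* l y"
    using L(4) by (rule rtranclp_mono[THEN predicate2D])
  moreover have "step_in (labs (Kc M) (fst \<omega>)) (redges g (fst (snd \<omega>)) (snd (snd \<omega>))) y z"
    using step(2) L L' M by (auto simp: step_in_labs)
  moreover have "present \<omega> z" using step(2) by (simp add: rcm_adj_def)
  moreover have "fst l \<in> Kc M" "fst z \<in> Kc M" using L L' M by auto
  ultimately show ?case by (meson rtranclp.rtrancl_into_rtrancl)
qed

lemma step_in_rcm_path:
  assumes "(step_in (labs K (fst \<omega>)) (redges g (fst (snd \<omega>)) (snd (snd \<omega>))))\<^sup>*\<^sup>* l l'"
  shows "(rcm_adj g \<omega>)\<^sup>*\<^sup>* l l'"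
proof -
  have "step_in (labs K (fst \<omega>)) (redges g (fst (snd \<omega>)) (snd (snd \<omega>))) \<le> rcm_adj g \<omega>"
    unfolding le_fun_def le_bool_def step_in_labs by blast
  then show ?thesis using assms by (rule rtranclp_mono[THEN predicate2D])
qed

lemma Ev_iff:
  "\<omega> \<in> Ev g K S T \<longleftrightarrow> (\<exists>l l'. fst l \<in> K \<and> present \<omega> l \<and> position \<omega> l \<in> S \<and> fst l' \<in> K \<and> present \<omega> l' \<and> position \<omega> l' \<in> T \<and>
     (step_in (labs K (fst \<omega>)) (redges g (fst (snd \<omega>)) (snd (snd \<omega>))))\<^sup>*\<^sup>* l l')"
proof -
  have "\<omega> \<in> Ev g K S T \<longleftrightarrow> (\<exists>l\<in>labs K (fst \<omega>) \<inter> {l. position \<omega> l \<in> S}. \<exists>l'\<in>labs K (fst \<omega>) \<inter> {l. position \<omega> l \<in> T}.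
     (step_in (labs K (fst \<omega>)) (redges g (fst (snd \<omega>)) (snd (snd \<omega>))))\<^sup>*\<^sup>* l l')"
    unfolding Ev_def mem_Collect_eq conn_iff_rtranclp ..
  also have "\<dots> \<longleftrightarrow> (\<exists>l l'. fst l \<in> K \<and> present \<omega> l \<and> position \<omega> l \<in> S \<and> fst l' \<in> K \<and> present \<omega> l' \<and> position \<omega> l' \<in> T \<and>
     (step_in (labs K (fst \<omega>)) (redges g (fst (snd \<omega>)) (snd (snd \<omega>))))\<^sup>*\<^sup>* l l')"
    unfolding Bex_def Int_iff mem_Collect_eq labs_iff by metis
  finally show ?thesis .
qed

lemma Ev_mono: "K \<subseteq> K' \<Longrightarrow> T \<subseteq> T' \<Longrightarrow> Ev g K S T \<subseteq> Ev g K' S T'"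
proof
  fix \<omega> assume K: "K \<subseteq> K'" "T \<subseteq> T'" and w: "\<omega> \<in> Ev g K S T"
  then obtain l l' where l: "fst l \<in> K" "present \<omega> l" "position \<omega> l \<in> S" "fst l' \<in> K" "present \<omega> l'" "position \<omega> l' \<in> T"
     "(step_in (labs K (fst \<omega>)) (redges g (fst (snd \<omega>)) (snd (snd \<omega>))))\<^sup>*\<^sup>* l l'" unfolding Ev_iff by blast
  have "step_in (labs K (fst \<omega>)) (redges g (fst (snd \<omega>)) (snd (snd \<omega>))) \<le>
     step_in (labs K' (fst \<omega>)) (redges g (fst (snd \<omega>)) (snd (snd \<omega>)))"
    using K unfolding le_fun_def le_bool_def step_in_labs by blast
  then have "(step_in (labs K' (fst \<omega>)) (redges g (fst (snd \<omega>)) (snd (snd \<omega>))))\<^sup>*\<^sup>* l l'"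
    using l(7) by (rule rtranclp_mono[THEN predicate2D])
  then show "\<omega> \<in> Ev g K' S T'" unfolding Ev_iff using l K by blast
qed

text \<open>Holds almost surely. It excludes samples in which points labelled by distant cells lie
  close to the origin.\<close>

definition good :: "rcm_sample \<Rightarrow> bool" where
  "good \<omega> \<longleftrightarrow> (\<forall>l. position \<omega> l \<in> cell (fst l))"

lemma AE_good: "AE \<omega> in RCM_space lam. good \<omega>"
proof -
  let ?N = "PiM UNIV (\<lambda>_::int \<times> int. measure_pmf (poisson_pmf lam))" and ?P = "PiM UNIV (\<lambda>l::lab. unif (cell (fst l)))"
  interpret PU: pair_prob_space ?P Umeas
    using prob_pos prob_U by (simp add: pair_prob_space_def pair_sigma_finite_def prob_space_imp_sigma_finite)
  interpret NPU: pair_prob_space ?N "?P \<Otimes>\<^sub>M Umeas"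
    using prob_N prob_pair[OF prob_pos prob_U] by (simp add: pair_prob_space_def pair_sigma_finite_def prob_space_imp_sigma_finite)
  have "AE \<omega> in RCM_space lam. position \<omega> l \<in> cell (fst l)" for l
  proof -
    have c: "AE x in unif (cell (fst l)). x \<in> cell (fst l)"
      by (rule AE_uniform_measureI) auto
    have 1: "AE x in ?P. x l \<in> cell (fst l)"
      by (rule AE_PiM_component[where M="\<lambda>l. unif (cell (fst l))" and I=UNIV and i=l and P="\<lambda>y. y \<in> cell (fst l)"]) (auto simp: prob_cell c)
    have m1: "{y \<in> space (?P \<Otimes>\<^sub>M Umeas). fst y l \<in> cell (fst l)} \<in> sets (?P \<Otimes>\<^sub>M Umeas)"
    proof -
      have "(\<lambda>y. fst y l) \<in> ?P \<Otimes>\<^sub>M Umeas \<rightarrow>\<^sub>M unif (cell (fst l))" by measurable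
      from measurable_sets[OF this, of "cell (fst l)"] show ?thesis by (simp add: vimage_def Int_def conj_commute)
    qed
    have 2: "AE y in ?P \<Otimes>\<^sub>M Umeas. fst y l \<in> cell (fst l)"
      by (rule PU.AE_pair_measure[OF m1]) (use 1 in auto)
    have m2: "{y \<in> space (?N \<Otimes>\<^sub>M (?P \<Otimes>\<^sub>M Umeas)). fst (snd y) l \<in> cell (fst l)} \<in> sets (?N \<Otimes>\<^sub>M (?P \<Otimes>\<^sub>M Umeas))"
    proof -
      have "(\<lambda>y. fst (snd y) l) \<in> ?N \<Otimes>\<^sub>M (?P \<Otimes>\<^sub>M Umeas) \<rightarrow>\<^sub>M unif (cell (fst l))" by measurable
      from measurable_sets[OF this, of "cell (fst l)"] show ?thesis by (simp add: vimage_def Int_def conj_commute)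
    qed
    have "AE \<omega> in ?N \<Otimes>\<^sub>M (?P \<Otimes>\<^sub>M Umeas). fst (snd \<omega>) l \<in> cell (fst l)"
      by (rule NPU.AE_pair_measure[OF m2]) (use 2 in auto)
    then show ?thesis unfolding RCM_space_alt position_def .
  qed
  then show ?thesis unfolding good_def by (subst AE_all_countable) auto
qed

text \<open>Phrased as the failure of almost sure absence, to match the set whose supremum is
  \<open>crit_intensity\<close>.\<close>

definition percolates :: "real \<Rightarrow> (real \<Rightarrow> real) \<Rightarrow> bool" where
  "percolates lam g \<longleftrightarrow> \<not> (AE \<omega> in RCM_space lam. \<not> has_infinite_component g \<omega>)"

lemma outside_Kc:
  assumes "c \<notin> Kc (t + 2)" "y \<in> cell c" shows "y \<notin> sq (real t)"
  using assms by (cases c) (auto simp: Kc_def cell_def sq_def cbox_Pair_eq mem_Times_iff)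

lemma inside_Kc:
  assumes "y \<in> sq (real t)" "y \<in> cell c" shows "c \<in> Kc (t + 2)"
  using outside_Kc[of c t y] assms by blast

text \<open>The block of cells around \<open>sq (real t)\<close> contains finitely many present
  labels, so an infinite component leaves it.\<close>

lemma infinite_component_Ev:
  assumes w: "good \<omega>" and l: "present \<omega> l" "infinite {l'. (rcm_adj g \<omega>)\<^sup>*\<^sup>* l l'}" and S: "position \<omega> l \<in> S"
  shows "\<exists>L. \<omega> \<in> Ev g (Kc L) S (- sq (real t))"
proof -
  have "finite (labs (Kc (t + 2)) (fst \<omega>))" by (rule finite_labs) simp
  then obtain l' where l': "(rcm_adj g \<omega>)\<^sup>*\<^sup>* l l'" "l' \<notin> labs (Kc (t + 2)) (fst \<omega>)"
    using l(2) by (metis (mono_tags, lifting) mem_Collect_eq rev_finite_subset subsetI)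
  obtain L where L: "fst l \<in> Kc L" "fst l' \<in> Kc L" "present \<omega> l'"
     "(step_in (labs (Kc L) (fst \<omega>)) (redges g (fst (snd \<omega>)) (snd (snd \<omega>))))\<^sup>*\<^sup>* l l'"
    using rcm_path_bounded[OF l'(1) l(1)] by blast
  have "fst l' \<notin> Kc (t + 2)" using l'(2) L(3) by (simp add: labs_iff)
  then have "position \<omega> l' \<notin> sq (real t)" by (rule outside_Kc[OF _ w[unfolded good_def, THEN spec]])
  then have "\<omega> \<in> Ev g (Kc L) S (- sq (real t))" unfolding Ev_iff using L l(1) S by blast
  then show ?thesis ..
qed

text \<open>Only finitely many present labels have positions in \<open>S\<close>. By the pigeonhole
  principle one of them is connected beyond \<open>sq (real t)\<close> for infinitely many
  \<open>t\<close>, whereas a finite component would be bounded.\<close>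

lemma Ev_infinite_component:
  assumes w: "good \<omega>" and S: "S \<subseteq> sq (real r)" and E: "\<And>t. \<exists>L. \<omega> \<in> Ev g (Kc L) S (- sq (real t))"
  shows "has_infinite_component g \<omega>"
proof -
  have "\<exists>l l'. present \<omega> l \<and> position \<omega> l \<in> S \<and> position \<omega> l' \<notin> sq (real t) \<and> (rcm_adj g \<omega>)\<^sup>*\<^sup>* l l'" for t
    using E[of t] step_in_rcm_path unfolding Ev_iff by blast
  then obtain a b where ab: "\<And>t. present \<omega> (a t)" "\<And>t. position \<omega> (a t) \<in> S" "\<And>t. position \<omega> (b t) \<notin> sq (real t)" "\<And>t. (rcm_adj g \<omega>)\<^sup>*\<^sup>* (a t) (b t)"
    by metis
  have "a t \<in> labs (Kc (r + 2)) (fst \<omega>)" for t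
    unfolding labs_iff using ab(1)[of t] inside_Kc[OF subsetD[OF S ab(2)[of t]] w[unfolded good_def, THEN spec]] by (rule conjI[rotated])
  then have "finite (range a)" using finite_subset[of "range a" "labs (Kc (r + 2)) (fst \<omega>)"] finite_labs[of "Kc (r + 2)" "fst \<omega>"] by auto
  then obtain t0 where t0: "infinite {t. a t = a t0}" using pigeonhole_infinite[of UNIV a] by auto
  have "infinite {l'. (rcm_adj g \<omega>)\<^sup>*\<^sup>* (a t0) l'}"
  proof
    assume fin: "finite {l'. (rcm_adj g \<omega>)\<^sup>*\<^sup>* (a t0) l'}"
    let ?n = "\<lambda>l. nat \<lceil>\<bar>fst (position \<omega> l)\<bar> + \<bar>snd (position \<omega> l)\<bar>\<rceil>"
    define M where "M = Max (?n ` {l'. (rcm_adj g \<omega>)\<^sup>*\<^sup>* (a t0) l'})"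
    obtain t where t: "t \<ge> M" "a t = a t0" using t0 by (metis (mono_tags, lifting) infinite_nat_iff_unbounded_le mem_Collect_eq)
    have "b t \<in> {l'. (rcm_adj g \<omega>)\<^sup>*\<^sup>* (a t0) l'}" using ab(4)[of t] t by simp
    then have "?n (b t) \<le> M" unfolding M_def using fin by (intro Max_ge) auto
    then have "\<bar>fst (position \<omega> (b t))\<bar> + \<bar>snd (position \<omega> (b t))\<bar> \<le> real t" using t by linarith
    then have "position \<omega> (b t) \<in> sq (real t)" by (cases "position \<omega> (b t)") (auto simp: sq_def cbox_Pair_eq)
    then show False using ab(3)[of t] by simp
  qed
  then show ?thesis unfolding has_infinite_component_def using ab(1) by blast
qed

text \<open>Countably many squares of side \<open>\<epsilon>\<close> cover the plane, so one of them
  is connected to every distance with positive probability. Continuity from below in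
  \<open>L\<close> passes to finite blocks at the price of half of that probability. The side is
  free because the comparison needs a source set so small that room for planting a vertex remains
  outside it.\<close>

theorem percolates_imp_Ev:
  assumes g: "profile g" and \<epsilon>: "0 < \<epsilon>" and perc: "percolates lam g"
  shows "\<exists>z \<delta>. 0 < \<delta> \<and> (\<forall>t. \<exists>L. ennreal \<delta> \<le> emeasure (RCM_space lam) (Ev g (Kc L) (cbox z (z + (\<epsilon>, \<epsilon>))) (- sq (real t))))"
proof -
  interpret prob_space "RCM_space lam" by (rule prob_RCM)
  define Z where "Z j = (\<epsilon> * real_of_int (fst j), \<epsilon> * real_of_int (snd j))" for j :: "int \<times> int"
  define Sj where "Sj j = cbox (Z j) (Z j + (\<epsilon>, \<epsilon>))" for j
  let ?E = "\<lambda>j t L. Ev g (Kc L) (Sj j) (- sq (real t))"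
  define A where "A j t = (\<Union>L. ?E j t L)" for j t
  have Em: "?E j t L \<in> events" for j t L by (rule Ev_sets[OF g]) (auto simp: Sj_def)
  have Am: "A j t \<in> events" for j t unfolding A_def using Em by auto
  have cover: "\<exists>j. y \<in> Sj j" for y :: pt
  proof -
    have "\<epsilon> * real_of_int \<lfloor>r / \<epsilon>\<rfloor> \<le> r \<and> r \<le> \<epsilon> * real_of_int \<lfloor>r / \<epsilon>\<rfloor> + \<epsilon>" for r
    proof -
      have "real_of_int \<lfloor>r / \<epsilon>\<rfloor> \<le> r / \<epsilon>" "r / \<epsilon> \<le> real_of_int \<lfloor>r / \<epsilon>\<rfloor> + 1" by linarith+
      from mult_left_mono[OF this(1), of \<epsilon>] mult_left_mono[OF this(2), of \<epsilon>]
      show ?thesis using \<epsilon> by (simp add: distrib_left)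
    qed
    then have "y \<in> Sj (\<lfloor>fst y / \<epsilon>\<rfloor>, \<lfloor>snd y / \<epsilon>\<rfloor>)" by (auto simp: Sj_def Z_def cbox_Pair_eq mem_Times_iff)
    then show ?thesis ..
  qed
  have "\<exists>j. emeasure (RCM_space lam) (\<Inter>t. A j t) \<noteq> 0"
  proof (rule ccontr)
    assume "\<not> ?thesis"
    then have z: "emeasure (RCM_space lam) (\<Inter>t. A j t) = 0" for j by (metis (no_types))
    have "(\<Inter>t. A j t) \<in> events" for j using Am by (intro sets.countable_INT) blast+
    then have null: "(\<Inter>t. A j t) \<in> null_sets (RCM_space lam)" for j by (intro null_setsI z)
    have "AE \<omega> in RCM_space lam. \<forall>j. \<omega> \<notin> (\<Inter>t. A j t)"
      unfolding AE_all_countable by (intro allI AE_not_in null)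
    then have "AE \<omega> in RCM_space lam. \<not> has_infinite_component g \<omega>"
      using AE_good
    proof (eventually_elim)
      case (elim \<omega>)
      show ?case
      proof
        assume "has_infinite_component g \<omega>"
        then obtain l where l: "present \<omega> l" "infinite {l'. (rcm_adj g \<omega>)\<^sup>*\<^sup>* l l'}" by (auto simp: has_infinite_component_def)
        obtain j where j: "position \<omega> l \<in> Sj j" using cover by blast
        have "\<omega> \<in> (\<Inter>t. A j t)" unfolding A_def using infinite_component_Ev[OF elim(2) l j] by blast
        then show False using elim(1) by blast
      qed
    qed
    then show False using perc by (simp add: percolates_def)
  qed
  then obtain j where j: "emeasure (RCM_space lam) (\<Inter>t. A j t) \<noteq> 0" by blast
  define \<beta> where "\<beta> = prob (\<Inter>t. A j t)"
  have \<beta>: "0 < \<beta>" using j by (simp add: \<beta>_def emeasure_eq_measure zero_less_measure_iff)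
  have "\<exists>L. ennreal (\<beta> / 2) \<le> emeasure (RCM_space lam) (?E j t L)" for t
  proof -
    have "incseq (?E j t)" by (intro monoI Ev_mono Kc_mono) auto
    then have "(SUP L. emeasure (RCM_space lam) (?E j t L)) = emeasure (RCM_space lam) (A j t)"
      unfolding A_def by (rule SUP_emeasure_incseq[rotated]) (intro image_subsetI Em)
    moreover have "ennreal (\<beta> / 2) < emeasure (RCM_space lam) (A j t)"
    proof -
      have "ennreal (\<beta> / 2) < ennreal \<beta>" using \<beta> by (simp add: ennreal_less_iff)
      also have "ennreal \<beta> \<le> emeasure (RCM_space lam) (A j t)"
        unfolding \<beta>_def emeasure_eq_measure[symmetric] by (intro emeasure_mono Am) blast
      finally show ?thesis .
    qed
    ultimately have "ennreal (\<beta> / 2) < (SUP L. emeasure (RCM_space lam) (?E j t L))" by simp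
    then obtain L where "ennreal (\<beta> / 2) < emeasure (RCM_space lam) (?E j t L)" unfolding less_SUP_iff by blast
    then show ?thesis by (intro exI[of _ L] less_imp_le)
  qed
  then show ?thesis using \<beta> by (intro exI[of _ "Z j"] exI[of _ "\<beta> / 2"]) (auto simp: Sj_def)
qed

text \<open>The events decrease in \<open>t\<close> and keep probability at least
  \<open>\<delta>\<close>, so by continuity from above they occur together with positive
  probability.\<close>

theorem Ev_imp_percolates:
  assumes g: "profile g" and S: "S \<in> sets borel" "S \<subseteq> sq (real r)" and \<delta>: "0 < \<delta>"
    and E: "\<And>t. \<exists>L. ennreal \<delta> \<le> emeasure (RCM_space lam) (Ev g (Kc L) S (- sq (real t)))"
  shows "percolates lam g"
  unfolding percolates_def
proof
  interpret prob_space "RCM_space lam" by (rule prob_RCM)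
  assume ae: "AE \<omega> in RCM_space lam. \<not> has_infinite_component g \<omega>"
  define A where "A t = (\<Union>L. Ev g (Kc L) S (- sq (real t)))" for t :: nat
  have Em: "Ev g (Kc L) S (- sq (real t)) \<in> events" for t L by (rule Ev_sets[OF g]) (auto simp: S)
  have Am: "A t \<in> events" for t unfolding A_def using Em by auto
  have "decseq A"
  proof (rule decseq_SucI)
    fix t
    have "- sq (real (Suc t)) \<subseteq> - sq (real t)" by (auto simp: sq_def cbox_Pair_eq)
    then show "A (Suc t) \<subseteq> A t" unfolding A_def by (intro UN_mono Ev_mono order_refl)
  qed
  then have "(INF t. emeasure (RCM_space lam) (A t)) = emeasure (RCM_space lam) (\<Inter>t. A t)"
    by (rule INF_emeasure_decseq[rotated]) (auto intro: Am)
  moreover have "ennreal \<delta> \<le> (INF t. emeasure (RCM_space lam) (A t))"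
  proof (rule INF_greatest)
    fix t
    obtain L where "ennreal \<delta> \<le> emeasure (RCM_space lam) (Ev g (Kc L) S (- sq (real t)))" using E by blast
    also have "\<dots> \<le> emeasure (RCM_space lam) (A t)" by (intro emeasure_mono Am) (unfold A_def, blast)
    finally show "ennreal \<delta> \<le> emeasure (RCM_space lam) (A t)" .
  qed
  ultimately have "ennreal \<delta> \<le> emeasure (RCM_space lam) (\<Inter>t. A t)" by simp
  moreover have "AE \<omega> in RCM_space lam. \<omega> \<notin> (\<Inter>t. A t)"
    using ae AE_good
  proof (eventually_elim)
    case (elim \<omega>)
    show ?case
    proof
      assume "\<omega> \<in> (\<Inter>t. A t)"
      then have "\<And>t. \<exists>L. \<omega> \<in> Ev g (Kc L) S (- sq (real t))" by (auto simp: A_def)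
      from Ev_infinite_component[OF elim(2) S(2) this] show False using elim(1) by simp
    qed
  qed
  moreover have "(\<Inter>t. A t) \<in> events" using Am by (intro sets.countable_INT) blast+
  ultimately have "(\<Inter>t. A t) \<in> null_sets (RCM_space lam)" "ennreal \<delta> \<le> emeasure (RCM_space lam) (\<Inter>t. A t)"
    using AE_iff_null_sets by blast+
  then have "ennreal \<delta> \<le> 0" by (metis null_setsD1)
  then show False using \<delta> by simp
qed

section \<open>Spreading out the connection function\<close>

lemma dist_pt_le: "dist (x::pt) y \<le> \<bar>fst x - fst y\<bar> + \<bar>snd x - snd y\<bar>"
  by (cases x; cases y) (simp add: dist_Pair_Pair dist_real_def sqrt_sum_squares_le_sum_abs)

lemma fst_diff_le: "\<bar>fst x - fst y\<bar> \<le> dist (x::pt) y" and snd_diff_le: "\<bar>snd x - snd y\<bar> \<le> dist (x::pt) y"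
  using dist_fst_le[of x y] dist_snd_le[of x y] by (simp_all add: dist_real_def)

lemma unif_sq_le:
  assumes b: "0 < b" and B: "B \<in> sets borel" "emeasure lborel B \<le> ennreal v" "0 \<le> v"
  shows "emeasure (unif (sq b)) B \<le> ennreal (v / (4 * b\<^sup>2))"
proof -
  have "emeasure (unif (sq b)) B = emeasure lborel (sq b \<inter> B) / ennreal (4 * b\<^sup>2)"
    using b B by (simp add: emeasure_uniform_measure emeasure_sq)
  also have "\<dots> \<le> ennreal v / ennreal (4 * b\<^sup>2)"
    using B by (intro divide_right_mono_ennreal order_trans[OF emeasure_mono B(2)]) auto
  also have "\<dots> = ennreal (v / (4 * b\<^sup>2))" using b B(3) by (simp add: divide_ennreal)
  finally show ?thesis .
qed

lemma unif_sq_ge: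
  assumes b: "0 < b" and B: "B \<in> sets borel" "B \<subseteq> sq b" "ennreal v \<le> emeasure lborel B" "0 \<le> v"
  shows "ennreal (v / (4 * b\<^sup>2)) \<le> emeasure (unif (sq b)) B"
proof -
  have "ennreal (v / (4 * b\<^sup>2)) = ennreal v / ennreal (4 * b\<^sup>2)" using b B(4) by (simp add: divide_ennreal)
  also have "\<dots> \<le> emeasure lborel B / ennreal (4 * b\<^sup>2)" by (intro divide_right_mono_ennreal B)
  also have "\<dots> = emeasure (unif (sq b)) B"
    using b B by (simp add: emeasure_uniform_measure emeasure_sq Int_absorb1)
  finally show ?thesis .
qed

text \<open>Points at distance at most 2R have coordinates that differ by at most 8 in units of the
  cell side R/4; hence the offsets from -9 to 9.\<close>

lemma floor_diff_bound:
  assumes "\<bar>u - v\<bar> \<le> (8::real)" shows "\<lfloor>v\<rfloor> - \<lfloor>u\<rfloor> \<in> {-9..9}"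
proof -
  have "v - u \<le> 8" "u - v \<le> 8" using assms by (simp_all add: abs_le_iff)
  moreover have "of_int \<lfloor>v\<rfloor> \<le> v" "v < of_int \<lfloor>v\<rfloor> + 1" "of_int \<lfloor>u\<rfloor> \<le> u" "u < of_int \<lfloor>u\<rfloor> + 1" by linarith+
  ultimately have "real_of_int (\<lfloor>v\<rfloor> - \<lfloor>u\<rfloor>) \<le> of_int 9" "of_int (- 9) \<le> real_of_int (\<lfloor>v\<rfloor> - \<lfloor>u\<rfloor>)" by linarith+
  then show ?thesis by (simp only: of_int_le_iff atLeastAtMost_iff)
qed

lemma floor_eq_dist:
  assumes "\<lfloor>u / e\<rfloor> = \<lfloor>v / e\<rfloor>" "0 < e" shows "\<bar>u - v\<bar> \<le> (e::real)"
proof -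
  have "\<bar>u / e - v / e\<bar> \<le> 1" using assms(1) by linarith
  then have "\<bar>(u - v) / e\<bar> \<le> 1" by (simp add: diff_divide_distrib)
  then show ?thesis using assms(2) by (simp add: abs_divide)
qed

text \<open>A square of side \<open>h\<close> with corner \<open>c\<close>, extended towards the
  origin in each coordinate. So it stays inside every square around the origin that contains
  \<open>c\<close> and has half-side at least \<open>h\<close>.\<close>

definition subrect :: "real \<Rightarrow> pt \<Rightarrow> pt set" where
  "subrect h c = (let l = (\<lambda>u. if u \<le> 0 then u else u - h) in cbox (l (fst c), l (snd c)) (l (fst c) + h, l (snd c) + h))"

lemma subrect_borel[simp]: "subrect h c \<in> sets borel" by (simp add: subrect_def Let_def)

lemma emeasure_subrect: "0 \<le> h \<Longrightarrow> emeasure lborel (subrect h c) = ennreal (h\<^sup>2)"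
  unfolding subrect_def Let_def by (subst emeasure_cbox_prod) (auto simp: power2_eq_square)

lemma subrect_near: "y \<in> subrect h c \<Longrightarrow> 0 \<le> h \<Longrightarrow> dist c y \<le> 2 * h"
  using dist_pt_le[of c y] by (auto simp: subrect_def Let_def cbox_Pair_eq mem_Times_iff split: if_splits)

lemma subrect_sub: "c \<in> sq t \<Longrightarrow> 0 \<le> h \<Longrightarrow> h \<le> t \<Longrightarrow> subrect h c \<subseteq> sq t"
  by (auto simp: subrect_def Let_def sq_def cbox_Pair_eq mem_Times_iff split: if_splits)

lemma midpoint_sq: "a \<in> sq t \<Longrightarrow> b \<in> sq t \<Longrightarrow> midpoint a b \<in> sq t"
  by (auto simp: sq_def cbox_Pair_eq mem_Times_iff midpoint_def field_simps)

text \<open>The constants: points of one cell of side R/4 are at distance at most R/2, which gives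
  \<open>w0\<close>. A planted vertex lies within R/4 of the midpoint of an edge of length at most
  R, so within 3R/4 of both ends, which gives \<open>w1\<close>; what it can reach is within 7R/4 of
  both ends, so distance 2R serves as nearness. The planting square has area R^2/64, of which at
  most half is lost to \<open>S\<close>. The disc of near points fits into a square of side 4R,
  which gives \<open>\<kappa>\<close>.\<close>

lemma pivotal_box:
  assumes k: "profile k" and anti: "\<And>u v. u \<le> v \<Longrightarrow> k v \<le> k u" and R: "0 < R"
    and kpos: "\<And>r. r < R \<Longrightarrow> 0 < k r" and kzero: "\<And>r. R < r \<Longrightarrow> k r = 0"
    and p: "0 < p" "p \<le> s" "s \<le> q'" "q' < 1" and \<Lambda>: "0 < \<Lambda>lo" "\<Lambda>lo \<le> \<Lambda>" "\<Lambda> \<le> \<Lambda>hi"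
    and t: "R / 8 \<le> t" "t \<le> b" and S: "S \<in> sets borel" "emeasure lborel S \<le> ennreal (R\<^sup>2 / 128)"
  shows "pivotal (\<lambda>x y. s * k (dist x y)) (unif (sq b)) (\<Lambda> * (4 * b\<^sup>2)) S (- sq t) (\<lambda>x y. dist x y \<le> 2 * R)
    (\<lambda>x. (\<lfloor>fst x / (R / 4)\<rfloor>, \<lfloor>snd x / (R / 4)\<rfloor>)) ({-9..9} \<times> {-9..9}) (\<lambda>x y. subrect (R / 8) (midpoint x y) - S)
    (p * k (R / 2)) (p * k (3 * R / 4)) (1 - q') (\<Lambda>hi * (16 * R\<^sup>2)) (\<Lambda>lo * (R\<^sup>2 / 128))"
proof -
  have b: "0 < b" using R t by linarith
  have \<Lambda>p: "0 < \<Lambda>" using \<Lambda> by linarith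
  have s: "0 < s" "s < 1" using p by linarith+
  have k01: "0 \<le> k r" "k r \<le> 1" for r using k by (auto simp: profile_def)
  have ks: "profile (\<lambda>r. s * k r)" using k s k01 by (auto simp: profile_def mult_le_one)
  interpret kernel "\<lambda>(x::pt) y. s * k (dist x y)" by (rule kernel_profile[OF ks])
  have wR: "dist x y \<le> R" if "0 < s * k (dist x y)" for x y :: pt
    using that kzero[of "dist x y"] by (cases "R < dist x y") auto
  show ?thesis
  proof (rule pivotal.intro[OF kernel_axioms pivotal_axioms.intro])
    show "prob_space (unif (sq b))" using b by (rule prob_space_sq)
    show "sets (unif (sq b)) = sets borel" by simp
    show "0 < \<Lambda> * (4 * b\<^sup>2)" using \<Lambda>p b by simp
    show "S \<in> sets borel" by (rule S)
    show "- sq t \<in> sets borel" by auto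
    show "Measurable.pred (borel \<Otimes>\<^sub>M borel) (\<lambda>p. dist (fst p :: pt) (snd p) \<le> 2 * R)" by measurable
    have f: "(\<lambda>x::pt. fst x / (R / 4)) \<in> borel_measurable borel" "(\<lambda>x::pt. snd x / (R / 4)) \<in> borel_measurable borel"
      using R by (auto intro!: borel_measurable_continuous_onI continuous_intros)
    note [measurable] = measurable_compose[OF f(1) measurable_real_floor] measurable_compose[OF f(2) measurable_real_floor]
    show "Measurable.pred (borel \<Otimes>\<^sub>M borel) (\<lambda>p. (\<lfloor>fst (fst p :: pt) / (R / 4)\<rfloor>, \<lfloor>snd (fst p) / (R / 4)\<rfloor>) =
       (\<lfloor>fst (snd p :: pt) / (R / 4)\<rfloor>, \<lfloor>snd (snd p) / (R / 4)\<rfloor>))"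
      unfolding prod.inject by measurable
    show "finite ({-9..9::int} \<times> {-9..9::int})" by simp
    fix x y :: pt
    show "(\<lfloor>fst y / (R / 4)\<rfloor>, \<lfloor>snd y / (R / 4)\<rfloor>) - (\<lfloor>fst x / (R / 4)\<rfloor>, \<lfloor>snd x / (R / 4)\<rfloor>) \<in> {-9..9} \<times> {-9..9}"
      if d: "dist x y \<le> 2 * R"
    proof -
      have e: "\<bar>u / (R / 4) - v / (R / 4)\<bar> \<le> 8" if "\<bar>u - v\<bar> \<le> 2 * R" for u v
      proof -
        have "\<bar>u / (R / 4) - v / (R / 4)\<bar> = \<bar>u - v\<bar> / (R / 4)" using R by (simp only: diff_divide_distrib[symmetric] abs_divide)
        also have "\<dots> \<le> 2 * R / (R / 4)" using that R by (intro divide_right_mono) auto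
        finally show ?thesis using R by simp
      qed
      have "\<bar>fst x - fst y\<bar> \<le> 2 * R" "\<bar>snd x - snd y\<bar> \<le> 2 * R"
        using fst_diff_le[of x y] snd_diff_le[of x y] d by linarith+
      from floor_diff_bound[OF e[OF this(1)]] floor_diff_bound[OF e[OF this(2)]] show ?thesis
        by (simp only: minus_prod_def fst_conv snd_conv mem_Times_iff)
    qed
    show "p * k (R / 2) \<le> s * k (dist x y)"
      if c: "(\<lfloor>fst x / (R / 4)\<rfloor>, \<lfloor>snd x / (R / 4)\<rfloor>) = (\<lfloor>fst y / (R / 4)\<rfloor>, \<lfloor>snd y / (R / 4)\<rfloor>)"
    proof -
      have c1: "\<lfloor>fst x / (R / 4)\<rfloor> = \<lfloor>fst y / (R / 4)\<rfloor>" and c2: "\<lfloor>snd x / (R / 4)\<rfloor> = \<lfloor>snd y / (R / 4)\<rfloor>" using c by simp_all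
      have "0 < R / 4" using R by simp
      from floor_eq_dist[OF c1 this] floor_eq_dist[OF c2 this] have "dist x y \<le> R / 2"
        using dist_pt_le[of x y] by linarith
      then show ?thesis using p s k01 by (intro mult_mono anti) auto
    qed
    show "emeasure (unif (sq b)) {y. dist x y \<le> 2 * R} \<le> ennreal (\<Lambda>hi * (16 * R\<^sup>2) / (\<Lambda> * (4 * b\<^sup>2)))"
    proof -
      have eq: "{y. dist x y \<le> 2 * R} = cball x (2 * R)" by (auto simp: cball_def)
      have sub: "cball x (2 * R) \<subseteq> cbox (fst x - 2 * R, snd x - 2 * R) (fst x + 2 * R, snd x + 2 * R)"
      proof
        fix y assume "y \<in> cball x (2 * R)"
        then have "dist x y \<le> 2 * R" by simp
        then have "\<bar>fst x - fst y\<bar> \<le> 2 * R" "\<bar>snd x - snd y\<bar> \<le> 2 * R"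
          using fst_diff_le[of x y] snd_diff_le[of x y] by linarith+
        then show "y \<in> cbox (fst x - 2 * R, snd x - 2 * R) (fst x + 2 * R, snd x + 2 * R)"
          by (auto simp: cbox_Pair_eq mem_Times_iff)
      qed
      have "emeasure lborel (cball x (2 * R)) \<le> emeasure lborel (cbox (fst x - 2 * R, snd x - 2 * R) (fst x + 2 * R, snd x + 2 * R))"
        by (rule emeasure_mono[OF sub]) simp
      also have "\<dots> = ennreal (16 * R\<^sup>2)" using R by (subst emeasure_cbox_prod) (auto simp: power2_eq_square)
      finally have "emeasure (unif (sq b)) (cball x (2 * R)) \<le> ennreal (16 * R\<^sup>2 / (4 * b\<^sup>2))"
        by (intro unif_sq_le b) auto
      also have "\<dots> \<le> ennreal (\<Lambda>hi * (16 * R\<^sup>2) / (\<Lambda> * (4 * b\<^sup>2)))"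
      proof (rule ennreal_leI)
        have "16 * R\<^sup>2 / (4 * b\<^sup>2) = \<Lambda> * (16 * R\<^sup>2) / (\<Lambda> * (4 * b\<^sup>2))" using \<Lambda>p by simp
        also have "\<dots> \<le> \<Lambda>hi * (16 * R\<^sup>2) / (\<Lambda> * (4 * b\<^sup>2))" using \<Lambda> \<Lambda>p by (intro divide_right_mono mult_right_mono) auto
        finally show "16 * R\<^sup>2 / (4 * b\<^sup>2) \<le> \<Lambda>hi * (16 * R\<^sup>2) / (\<Lambda> * (4 * b\<^sup>2))" .
      qed
      finally show ?thesis unfolding eq .
    qed
    show "subrect (R / 8) (midpoint x y) - S \<in> sets borel \<and>
      ennreal (\<Lambda>lo * (R\<^sup>2 / 128) / (\<Lambda> * (4 * b\<^sup>2))) \<le> emeasure (unif (sq b)) (subrect (R / 8) (midpoint x y) - S) \<and>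
      (\<forall>z\<in>subrect (R / 8) (midpoint x y) - S. z \<notin> S \<union> - sq t \<and> p * k (3 * R / 4) \<le> s * k (dist x z) \<and> p * k (3 * R / 4) \<le> s * k (dist y z) \<and>
         (\<forall>u. 0 < s * k (dist u z) \<longrightarrow> dist x u \<le> 2 * R \<and> dist y u \<le> 2 * R))"
      if x: "x \<notin> S \<union> - sq t" and y: "y \<notin> S \<union> - sq t" and w: "0 < s * k (dist x y)"
    proof (intro conjI ballI allI impI)
      let ?Q = "subrect (R / 8) (midpoint x y)"
      have m: "midpoint x y \<in> sq t" using x y by (intro midpoint_sq) auto
      have Qt: "?Q \<subseteq> sq t" using R t by (intro subrect_sub m) auto
      have tb: "sq t \<subseteq> sq b" using t by (auto simp: sq_def cbox_Pair_eq)
      show Qb: "?Q - S \<in> sets borel" using S by auto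
      have "ennreal (R\<^sup>2 / 128) + ennreal (R\<^sup>2 / 128) = ennreal (R\<^sup>2 / 64)" by (simp flip: ennreal_plus)
      also have "\<dots> = emeasure lborel ?Q" using R by (subst emeasure_subrect) (auto simp: power_divide)
      also have "\<dots> \<le> emeasure lborel ((?Q - S) \<union> S)" using S by (intro emeasure_mono) auto
      also have "\<dots> \<le> emeasure lborel (?Q - S) + emeasure lborel S" using S by (intro emeasure_subadditive) auto
      also have "\<dots> \<le> emeasure lborel (?Q - S) + ennreal (R\<^sup>2 / 128)" by (rule add_left_mono[OF S(2)])
      finally have "ennreal (R\<^sup>2 / 128) + ennreal (R\<^sup>2 / 128) \<le> ennreal (R\<^sup>2 / 128) + emeasure lborel (?Q - S)"
        by (simp only: add.commute)
      then have v: "ennreal (R\<^sup>2 / 128) \<le> emeasure lborel (?Q - S)"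
        by (simp only: ennreal_add_left_cancel_le) simp
      have "\<Lambda>lo * (R\<^sup>2 / 128) / (\<Lambda> * (4 * b\<^sup>2)) \<le> \<Lambda> * (R\<^sup>2 / 128) / (\<Lambda> * (4 * b\<^sup>2))"
        using \<Lambda> \<Lambda>p by (intro divide_right_mono mult_right_mono) auto
      also have "\<dots> = R\<^sup>2 / 128 / (4 * b\<^sup>2)" using \<Lambda>p by simp
      finally have le: "ennreal (\<Lambda>lo * (R\<^sup>2 / 128) / (\<Lambda> * (4 * b\<^sup>2))) \<le> ennreal (R\<^sup>2 / 128 / (4 * b\<^sup>2))" by (rule ennreal_leI)
      have QS: "?Q - S \<subseteq> sq b" using Qt tb by blast
      have "0 \<le> R\<^sup>2 / 128" by simp
      from order_trans[OF le unif_sq_ge[OF b Qb QS v this]]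
      show "ennreal (\<Lambda>lo * (R\<^sup>2 / 128) / (\<Lambda> * (4 * b\<^sup>2))) \<le> emeasure (unif (sq b)) (?Q - S)" .
      fix z assume z: "z \<in> ?Q - S"
      show "z \<notin> S \<union> - sq t" using z Qt by auto
      have "dist x y \<le> R" by (rule wR[OF w])
      then have mx: "dist x (midpoint x y) \<le> R / 2" "dist y (midpoint x y) \<le> R / 2" by (simp_all add: dist_midpoint)
      have "dist (midpoint x y) z \<le> 2 * (R / 8)" using z R by (intro subrect_near) auto
      then have xz: "dist x z \<le> 3 * R / 4" "dist y z \<le> 3 * R / 4"
        using dist_triangle[of x z "midpoint x y"] dist_triangle[of y z "midpoint x y"] mx by linarith+
      show "p * k (3 * R / 4) \<le> s * k (dist x z)" by (rule mult_mono[OF p(2) anti[OF xz(1)]]) (use s k01 in auto)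
      show "p * k (3 * R / 4) \<le> s * k (dist y z)" by (rule mult_mono[OF p(2) anti[OF xz(2)]]) (use s k01 in auto)
      fix u assume "0 < s * k (dist u z)"
      then have "dist u z \<le> R" by (rule wR)
      then show "dist x u \<le> 2 * R" "dist y u \<le> 2 * R"
        using dist_triangle[of x u z] dist_triangle[of y u z] xz R by (simp_all add: dist_commute)
    qed
    have "s * k (dist x y) \<le> s * 1" using s k01 by (intro mult_left_mono) auto
    then show "s * k (dist x y) \<le> 1 - (1 - q')" using p by linarith
    show "0 < p * k (R / 2)" "0 < p * k (3 * R / 4)" using p kpos R by simp_all
    show "0 < 1 - q'" "1 - q' \<le> 1" using p by linarith+
    show "0 \<le> \<Lambda>hi * (16 * R\<^sup>2)" "0 < \<Lambda>lo * (R\<^sup>2 / 128)" using \<Lambda> R by simp_all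
  qed
qed

text \<open>One factor \<open>\<rho>\<close> serves all boxes, targets, small source sets and
  intensities of a compact range, because the constant of \<open>pivotal_bound\<close> depends on
  the intensity only through \<open>lo\<close> and \<open>hi\<close>.\<close>

theorem spread_out_comparison:
  assumes k: "profile k" and anti: "\<And>u v. u \<le> v \<Longrightarrow> k v \<le> k u" and R: "0 < R"
    and kpos: "\<And>r. r < R \<Longrightarrow> 0 < k r" and kzero: "\<And>r. R < r \<Longrightarrow> k r = 0"
    and p: "0 < p" "p < q" "q \<le> 1" and lo: "0 < lo" "lo \<le> hi"
  shows "\<exists>\<rho>>1. \<forall>lam b t S. lo \<le> lam \<longrightarrow> lam \<le> hi \<longrightarrow> R / 8 \<le> t \<longrightarrow> t \<le> b \<longrightarrow> S \<in> sets borel \<longrightarrow>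
    emeasure lborel S \<le> ennreal (R\<^sup>2 / 128) \<longrightarrow>
    PB (lam * \<rho> / q) (\<lambda>r. q * k r) b S t \<le> PB (lam / p) (\<lambda>r. p * k r) b S t"
proof -
  \<comment> \<open>Up to \<open>q'\<close> absent edges have probability bounded away from 0 and
    the gain \<open>\<eta>\<close> is available. From \<open>q'\<close> to \<open>q\<close>, which
    may be 1, monotonicity with exponent 0 is used.\<close>
  define q' where "q' = (p + q) / 2"
  have q': "p < q'" "q' < q" "q' < 1" "0 < q'" using p by (auto simp: q'_def)
  define w0 where "w0 = p * k (R / 2)"
  define w1 where "w1 = p * k (3 * R / 4)"
  \<comment> \<open>Along the curve the intensity stays between \<open>lo\<close> and
    \<open>hi / p\<^sup>2\<close>; the upper bound enters \<open>\<kappa>\<close> and the lower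
    bound \<open>c0\<close>.\<close>
  define \<kappa> where "\<kappa> = hi / p\<^sup>2 * (16 * R\<^sup>2)"
  define c0 where "c0 = lo * (R\<^sup>2 / 128)"
  define O' where "O' = ({-9..9} \<times> {-9..9} :: (int \<times> int) set)"
  obtain j :: nat where j: "2 * (\<kappa> + 3 * real (card O')) + 1 \<le> real j" using real_arch_simple by blast
  have \<kappa>0: "0 \<le> \<kappa>" using lo by (simp add: \<kappa>_def)
  have j0: "0 < j" using j \<kappa>0 by (intro gr0I) auto
  define C where "C = 2 * (3 + 1 / ((1 - q') ^ j * (c0 * w1\<^sup>2)) + 2 * real (card O') / (w0 * real j))"
  have w: "0 < w0" "0 < w1" "0 < c0" using p kpos R lo by (simp_all add: w0_def w1_def c0_def)
  have C: "1 \<le> C"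
  proof -
    have "0 \<le> 1 / ((1 - q') ^ j * (c0 * w1\<^sup>2))" "0 \<le> 2 * real (card O') / (w0 * real j)" using w q' by simp_all
    then show ?thesis unfolding C_def by simp
  qed
  define \<eta> where "\<eta> = 1 / C"
  have \<eta>: "0 < \<eta>" "\<eta> \<le> 1" "\<eta> * C = 1" using C by (simp_all add: \<eta>_def)
  \<comment> \<open>The factor by which \<lambda>, proportional to s^\<eta>, grows from p to
    q'.\<close>
  define \<rho> where "\<rho> = (q' / p) powr \<eta>"
  have \<rho>: "1 < \<rho>" unfolding \<rho>_def using q' p \<eta> by (intro gr_one_powr) auto
  have k01: "0 \<le> k r" "k r \<le> 1" for r using k by (auto simp: profile_def)
  have "PB (lam * \<rho> / q) (\<lambda>r. q * k r) b S t \<le> PB (lam / p) (\<lambda>r. p * k r) b S t"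
    if lam: "lo \<le> lam" "lam \<le> hi" and t: "R / 8 \<le> t" "t \<le> b" and S: "S \<in> sets borel" "emeasure lborel S \<le> ennreal (R\<^sup>2 / 128)"
    for lam b t S
  proof -
    have b: "0 < b" using R t by linarith
    have lam0: "0 < lam" using lam lo by linarith
    interpret kernel "\<lambda>(x::pt) y. k (dist x y)" by (rule kernel_profile[OF k])
    interpret curve "\<lambda>(x::pt) y. k (dist x y)" "unif (sq b)" S "- sq t"
    proof (rule curve.intro[OF kernel_axioms curve_axioms.intro])
      show "prob_space (unif (sq b))" by (rule prob_space_sq[OF b])
      show "S \<in> sets borel" by (rule S)
    qed auto
    have PBF: "PB \<Lambda> (\<lambda>r. s * k r) b S t = ennreal (F (\<Lambda> * (4 * b\<^sup>2)) s)" if "0 \<le> s" "s \<le> 1" "0 < \<Lambda>" for \<Lambda> s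
    proof -
      have cn_eq: "cn = (\<lambda>n. ind_conn S (- sq t) {..<n})" by (intro ext) (simp only: cn_def ind_conn_def)
      show ?thesis unfolding PB_def PC_def cn_eq[symmetric] by (rule pex_cn) (use that b in simp_all)
    qed
    \<comment> \<open>Normalised so that the curve starts at intensity \<open>lam / p\<close> when s
      = p.\<close>
    define c where "c = 4 * b\<^sup>2 * (lam * p powr (- \<eta>))"
    have c: "0 < c" using b lam0 p by (simp add: c_def)
    have A: "F (c * q' powr (\<eta> - 1)) q' \<le> F (c * p powr (\<eta> - 1)) p"
    proof (rule F_decreasing_along_curve)
      fix s assume s: "s \<in> {p..q'}"
      have s0: "0 < s" "s \<le> 1" "p \<le> s" "s \<le> q'" using s p q' by auto
      define \<Lambda> where "\<Lambda> = lam * p powr (- \<eta>) * s powr (\<eta> - 1)"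
      have \<Lambda>eq: "\<Lambda> = lam / s * (s / p) powr \<eta>"
      proof -
        have "(s / p) powr \<eta> = s powr \<eta> / p powr \<eta>" "s powr (\<eta> - 1) = s powr \<eta> / s" "p powr (- \<eta>) = 1 / p powr \<eta>"
          using s0 p by (simp_all add: powr_divide powr_diff powr_minus_divide)
        then show ?thesis by (simp add: \<Lambda>_def mult_ac)
      qed
      have r1: "1 \<le> (s / p) powr \<eta>" using s0 p \<eta> by (intro ge_one_powr_ge_zero) auto
      have "(s / p) powr \<eta> \<le> (s / p) powr 1" using s0 p \<eta> by (intro powr_mono) auto
      then have r2: "(s / p) powr \<eta> \<le> s / p" using s0 p by simp
      have l1: "lam \<le> lam / s" using s0 lam0 by (simp add: field_simps)
      have "lo \<le> lam / s * 1" using lam l1 by simp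
      also have "\<dots> \<le> \<Lambda>" unfolding \<Lambda>eq using r1 lam0 s0 by (intro mult_left_mono) auto
      finally have L1: "lo \<le> \<Lambda>" .
      have "\<Lambda> \<le> lam / s * (s / p)" unfolding \<Lambda>eq using r2 lam0 s0 by (intro mult_left_mono) auto
      also have "\<dots> = lam / p" using s0 by simp
      also have "\<dots> \<le> hi / p" using lam p by (intro divide_right_mono) auto
      also have "\<dots> \<le> hi / p\<^sup>2"
      proof (rule divide_left_mono)
        show "p\<^sup>2 \<le> p" using p mult_left_le[of p p] by (simp add: power2_eq_square)
      qed (use p lo in auto)
      finally have L2: "\<Lambda> \<le> hi / p\<^sup>2" .
      have m: "c * s powr (\<eta> - 1) = \<Lambda> * (4 * b\<^sup>2)" by (simp add: c_def \<Lambda>_def)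
      have piv: "pivotal (\<lambda>x y. s * k (dist x y)) (unif (sq b)) (\<Lambda> * (4 * b\<^sup>2)) S (- sq t) (\<lambda>x y. dist x y \<le> 2 * R)
          (\<lambda>x. (\<lfloor>fst x / (R / 4)\<rfloor>, \<lfloor>snd x / (R / 4)\<rfloor>)) O' (\<lambda>x y. subrect (R / 8) (midpoint x y) - S) w0 w1 (1 - q') \<kappa> c0"
        unfolding w0_def w1_def \<kappa>_def c0_def O'_def
        by (rule pivotal_box[OF k _ R _ _ p(1) s0(3,4) q'(3) lo(1) L1 L2 t S]) (rule anti kpos kzero; assumption)+
      have Dfe: "pivotal.Df S (- sq t) = (\<lambda>n x E. nV n x E - nE n x E)"
        by (intro ext) (simp only: pivotal.Df_def[OF piv] nV_def nE_def)
      have nVe: "nV = (\<lambda>n x E. real (card (PV {..<n} (mk {..<n} x S) (mk {..<n} x (- sq t)) E)))"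
        by (intro ext) (simp only: nV_def)
      have jj: "2 * (\<kappa> + 3 * real (card O')) \<le> real j" using j by linarith
      have bd: "pex (\<Lambda> * (4 * b\<^sup>2)) (unif (sq b)) (W s) nV \<le> ennreal C * pex (\<Lambda> * (4 * b\<^sup>2)) (unif (sq b)) (W s) (\<lambda>n x E. nV n x E - nE n x E)"
        using pivotal.pivotal_bound[OF piv j0 jj] unfolding Dfe nVe[symmetric] C_def[symmetric] .
      have "ennreal \<eta> * pex (\<Lambda> * (4 * b\<^sup>2)) (unif (sq b)) (W s) nV \<le>
        ennreal \<eta> * (ennreal C * pex (\<Lambda> * (4 * b\<^sup>2)) (unif (sq b)) (W s) (\<lambda>n x E. nV n x E - nE n x E))"
        by (rule mult_left_mono[OF bd]) simp
      also have "\<dots> = pex (\<Lambda> * (4 * b\<^sup>2)) (unif (sq b)) (W s) (\<lambda>n x E. nV n x E - nE n x E)"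
        using \<eta> C by (simp add: mult.assoc[symmetric] ennreal_mult[symmetric])
      finally show "ennreal \<eta> * pex (c * s powr (\<eta> - 1)) (unif (sq b)) (W s) nV \<le>
        pex (c * s powr (\<eta> - 1)) (unif (sq b)) (W s) (\<lambda>n x E. nV n x E - nE n x E)" unfolding m .
    qed (use p q' \<eta> c in auto)
    \<comment> \<open>With exponent 0 the product of intensity and s is constant; its value
      \<open>lam * \<rho>\<close> is the one reached by the first curve at
      \<open>q'\<close>.\<close>
    define c' where "c' = 4 * b\<^sup>2 * (lam * \<rho>)"
    have c': "0 < c'" using b lam0 \<rho> by (simp add: c'_def)
    have B: "F (c' * q powr (0 - 1)) q \<le> F (c' * q' powr (0 - 1)) q'"
      by (rule F_decreasing_along_curve) (use p q' c' in auto)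
    have "F (lam * \<rho> / q * (4 * b\<^sup>2)) q = F (c' * q powr (0 - 1)) q" using p by (simp add: c'_def powr_minus_divide mult_ac)
    also note B
    also have "c' * q' powr (0 - 1) = c * q' powr (\<eta> - 1)"
    proof -
      have "(q' / p) powr \<eta> = q' powr \<eta> / p powr \<eta>" "q' powr (\<eta> - 1) = q' powr \<eta> / q'" "p powr (- \<eta>) = 1 / p powr \<eta>" "q' powr (0 - 1) = 1 / q'"
        using q' p by (simp_all add: powr_divide powr_diff powr_minus_divide)
      then show ?thesis by (simp add: c'_def c_def \<rho>_def mult_ac)
    qed
    also note A
    also have "c * p powr (\<eta> - 1) = lam / p * (4 * b\<^sup>2)"
    proof -
      have "p powr (\<eta> - 1) = p powr \<eta> / p" "p powr (- \<eta>) = 1 / p powr \<eta>" "p powr \<eta> \<noteq> 0"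
        using p by (simp_all add: powr_diff powr_minus_divide)
      then show ?thesis by (simp add: c_def mult_ac)
    qed
    finally have "F (lam * \<rho> / q * (4 * b\<^sup>2)) q \<le> F (lam / p * (4 * b\<^sup>2)) p" .
    then show ?thesis using p \<rho> lam0 by (subst (1 2) PBF) (auto intro!: ennreal_leI)
  qed
  with \<rho> show ?thesis by blast
qed

section \<open>Path counting\<close>

lemma bsum_subset:
  assumes "finite Q" "A \<subseteq> Q"
  shows "bsum Q q (\<lambda>E. of_bool (A \<subseteq> E)) = (\<Prod>e\<in>A. q e)"
  using assms
proof (induction Q arbitrary: A rule: finite_induct)
  case (insert a Q)
  show ?case
  proof (cases "a \<in> A")
    case True
    have 1: "bsum Q q (\<lambda>E. of_bool (A \<subseteq> insert a E)) = bsum Q q (\<lambda>E. of_bool (A - {a} \<subseteq> E))"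
      by (simp only: subset_insert_iff[of A a] True if_True)
    have 2: "bsum Q q (\<lambda>E. of_bool (A \<subseteq> E)) = bsum Q q (\<lambda>E. 0)"
    proof (rule bsum_cong[OF refl])
      fix E assume "E \<subseteq> Q"
      then have "\<not> A \<subseteq> E" using True insert(2) by blast
      then show "of_bool (A \<subseteq> E) = (0::real)" by simp
    qed
    have A: "A - {a} \<subseteq> Q" "finite A" using insert(1,4) finite_subset[of A "insert a Q"] by auto
    show ?thesis
      unfolding bsum_insert[OF insert(1,2)] 1 2 bsum_const[OF insert(1)] insert.IH[OF A(1)] prod.remove[OF A(2) True] by simp
  next
    case False
    then have A: "A \<subseteq> Q" using insert(4) by blast
    have 1: "bsum Q q (\<lambda>E. of_bool (A \<subseteq> insert a E)) = bsum Q q (\<lambda>E. of_bool (A \<subseteq> E))"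
      by (simp only: subset_insert[OF False])
    show ?thesis unfolding bsum_insert[OF insert(1,2)] 1 insert.IH[OF A] by (simp add: algebra_simps)
  qed
qed simp

definition path_edges :: "'i list \<Rightarrow> 'i set set" where
  "path_edges xs = (\<lambda>i. {xs ! i, xs ! Suc i}) ` {..<length xs - 1}"

lemma inj_on_path_edges:
  assumes "distinct xs" shows "inj_on (\<lambda>i. {xs ! i, xs ! Suc i}) {..<length xs - 1}"
proof (rule inj_onI)
  fix i j assume ij: "i \<in> {..<length xs - 1}" "j \<in> {..<length xs - 1}" and e: "{xs ! i, xs ! Suc i} = {xs ! j, xs ! Suc j}"
  have b: "i < length xs" "Suc i < length xs" "j < length xs" "Suc j < length xs" using ij by auto
  from e have "xs ! i = xs ! j \<and> xs ! Suc i = xs ! Suc j \<or> xs ! i = xs ! Suc j \<and> xs ! Suc i = xs ! j"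
    by (simp only: doubleton_eq_iff)
  then show "i = j" using b by (simp only: nth_eq_iff_index_eq[OF assms]) linarith
qed

lemma path_edges_pairs:
  assumes "distinct xs" "set xs \<subseteq> V" shows "path_edges xs \<subseteq> pairs V"
  unfolding path_edges_def
proof (rule image_subsetI)
  fix i assume "i \<in> {..<length xs - 1}"
  then have b: "i < length xs" "Suc i < length xs" by auto
  have "xs ! i \<noteq> xs ! Suc i" using b by (simp only: nth_eq_iff_index_eq[OF assms(1)])
  moreover have "xs ! i \<in> V" "xs ! Suc i \<in> V" using b assms(2) nth_mem by blast+
  ultimately show "{xs ! i, xs ! Suc i} \<in> pairs V" by simp
qed

definition path_weight :: "('a \<Rightarrow> 'a \<Rightarrow> real) \<Rightarrow> 'a set \<Rightarrow> 'i list \<Rightarrow> ('i \<Rightarrow> 'a) \<Rightarrow> real" where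
  "path_weight w S xs x = of_bool (x (hd xs) \<in> S) * (\<Prod>i<length xs - 1. w (x (xs ! i)) (x (xs ! Suc i)))"

lemma path_weight_snoc:
  assumes "xs \<noteq> []"
  shows "path_weight w S (xs @ [v]) x = path_weight w S xs x * w (x (last xs)) (x v)"
proof -
  obtain n where n: "length xs = Suc n" using assms by (cases xs) auto
  have "(\<Prod>i<n. w (x ((xs @ [v]) ! i)) (x ((xs @ [v]) ! Suc i))) = (\<Prod>i<n. w (x (xs ! i)) (x (xs ! Suc i)))"
    using n by (intro prod.cong refl) (simp add: nth_append)
  then show ?thesis using assms n by (simp add: path_weight_def nth_append last_conv_nth)
qed

lemma path_weight_upd:
  assumes "v \<notin> set xs" "xs \<noteq> []" shows "path_weight w S xs (x(v := y)) = path_weight w S xs x"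
proof -
  have nv: "xs ! i \<noteq> v" if "i < length xs" for i using that assms(1) nth_mem by blast
  have "hd xs \<noteq> v" using assms by auto
  moreover have "(\<Prod>i<length xs - 1. w ((x(v := y)) (xs ! i)) ((x(v := y)) (xs ! Suc i))) = (\<Prod>i<length xs - 1. w (x (xs ! i)) (x (xs ! Suc i)))"
    using nv by (intro prod.cong refl) simp
  ultimately show ?thesis by (simp add: path_weight_def)
qed

context kernel begin

lemma path_weight_nonneg: "0 \<le> path_weight w S xs x"
  unfolding path_weight_def by (intro mult_nonneg_nonneg prod_nonneg) (auto simp: w_nonneg)

lemma path_weight_measurable:
  assumes S[measurable]: "S \<in> sets borel" and xs: "xs \<noteq> []" "set xs \<subseteq> V" and D: "\<And>i. sets (D i) = sets borel"
  shows "path_weight w S xs \<in> borel_measurable (PiM V D)"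
proof -
  have c: "(\<lambda>x. x v) \<in> PiM V D \<rightarrow>\<^sub>M borel" if "v \<in> set xs" for v
  proof -
    have "(\<lambda>x. x v) \<in> PiM V D \<rightarrow>\<^sub>M D v" using that xs by (intro measurable_component_singleton) auto
    then show ?thesis using measurable_cong_sets[OF refl D[of v]] by blast
  qed
  have h: "(\<lambda>x. of_bool (x (hd xs) \<in> S) :: real) \<in> borel_measurable (PiM V D)"
  proof -
    have "(\<lambda>x. indicator S (x (hd xs)) :: real) \<in> borel_measurable (PiM V D)"
      by (rule measurable_compose[OF c]) (use xs in auto)
    then show ?thesis by (simp add: indicator_def)
  qed
  have "(\<lambda>x. w (x (xs ! i)) (x (xs ! Suc i))) \<in> borel_measurable (PiM V D)" if "i \<in> {..<length xs - 1}" for i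
  proof -
    have "(\<lambda>x. (x (xs ! i), x (xs ! Suc i))) \<in> PiM V D \<rightarrow>\<^sub>M borel \<Otimes>\<^sub>M borel"
      using that by (intro measurable_Pair c) auto
    from measurable_compose[OF this w_measurable] show ?thesis by simp
  qed
  then show ?thesis unfolding path_weight_def[abs_def] by (intro borel_measurable_times h borel_measurable_prod)
qed

text \<open>Vertices are integrated out from the end of the path: every step costs at most
  \<open>\<kappa>\<close>, and the first vertex costs the measure of \<open>S\<close>.\<close>

lemma path_weight_integral:
  assumes D: "prob_space D" "sets D = sets borel" and S: "S \<in> sets borel"
    and \<kappa>: "\<And>a. (\<integral>\<^sup>+y. ennreal (w a y) \<partial>D) \<le> \<kappa>"
  shows "xs \<noteq> [] \<Longrightarrow> distinct xs \<Longrightarrow> finite V \<Longrightarrow> set xs \<subseteq> V \<Longrightarrow>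
    (\<integral>\<^sup>+x. ennreal (path_weight w S xs x) \<partial>PiM V (\<lambda>_. D)) \<le> emeasure D S * \<kappa> ^ (length xs - 1)"
proof (induction xs arbitrary: V rule: rev_nonempty_induct)
  case (single v)
  interpret product_sigma_finite "\<lambda>_. D" using D(1) by (simp add: product_sigma_finite_def prob_space_imp_sigma_finite)
  interpret P: prob_space "PiM (V - {v}) (\<lambda>_. D)" by (intro prob_space_PiM D)
  have V: "insert v (V - {v}) = V" using single by auto
  have m: "(\<lambda>x. ennreal (path_weight w S [v] x)) \<in> borel_measurable (PiM (insert v (V - {v})) (\<lambda>_. D))"
    by (intro measurable_compose[OF path_weight_measurable measurable_ennreal] S) (auto simp: D)
  have "(\<integral>\<^sup>+x. ennreal (path_weight w S [v] x) \<partial>PiM V (\<lambda>_. D)) = (\<integral>\<^sup>+x. (\<integral>\<^sup>+y. ennreal (path_weight w S [v] (x(v := y))) \<partial>D) \<partial>PiM (V - {v}) (\<lambda>_. D))"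
    using product_nn_integral_insert[OF _ _ m] single unfolding V by simp
  also have "\<dots> = (\<integral>\<^sup>+x. (\<integral>\<^sup>+y. indicator S y \<partial>D) \<partial>PiM (V - {v}) (\<lambda>_. D))"
    by (intro nn_integral_cong) (simp add: path_weight_def indicator_def)
  also have "\<dots> = emeasure D S" using S D(2) by (simp add: P.emeasure_space_1)
  finally show ?case by simp
next
  case (snoc v xs)
  interpret product_sigma_finite "\<lambda>_. D" using D(1) by (simp add: product_sigma_finite_def prob_space_imp_sigma_finite)
  let ?V = "V - {v}"
  have V: "insert v ?V = V" "set xs \<subseteq> ?V" "v \<notin> set xs" "finite ?V" "distinct xs" using snoc.prems by auto
  have m: "(\<lambda>x. ennreal (path_weight w S (xs @ [v]) x)) \<in> borel_measurable (PiM (insert v ?V) (\<lambda>_. D))"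
    by (intro measurable_compose[OF path_weight_measurable measurable_ennreal] S) (use V in \<open>auto simp: D\<close>)
  have m': "(\<lambda>x. ennreal (path_weight w S xs x)) \<in> borel_measurable (PiM ?V (\<lambda>_. D))"
    by (intro measurable_compose[OF path_weight_measurable measurable_ennreal] S V snoc.hyps) (auto simp: D)
  have "(\<integral>\<^sup>+x. ennreal (path_weight w S (xs @ [v]) x) \<partial>PiM V (\<lambda>_. D)) =
    (\<integral>\<^sup>+x. (\<integral>\<^sup>+y. ennreal (path_weight w S (xs @ [v]) (x(v := y))) \<partial>D) \<partial>PiM ?V (\<lambda>_. D))"
    using product_nn_integral_insert[OF V(4) _ m] unfolding V(1) by simp
  also have "\<dots> \<le> (\<integral>\<^sup>+x. ennreal (path_weight w S xs x) * \<kappa> \<partial>PiM ?V (\<lambda>_. D))"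
  proof (rule nn_integral_mono)
    fix x
    have lv: "last xs \<noteq> v" using V(3) snoc.hyps by auto
    have wm: "(\<lambda>y. ennreal (w a y)) \<in> borel_measurable D" for a
    proof -
      have "(\<lambda>y. (a, y)) \<in> borel \<rightarrow>\<^sub>M borel \<Otimes>\<^sub>M borel" by simp
      from measurable_compose[OF measurable_compose[OF this w_measurable] measurable_ennreal]
      show ?thesis unfolding measurable_cong_sets[OF D(2) refl] by simp
    qed
    have "(\<integral>\<^sup>+y. ennreal (path_weight w S (xs @ [v]) (x(v := y))) \<partial>D) = (\<integral>\<^sup>+y. ennreal (path_weight w S xs x) * ennreal (w (x (last xs)) y) \<partial>D)"
      using lv by (intro nn_integral_cong) (simp add: path_weight_snoc snoc.hyps path_weight_upd V(3) ennreal_mult path_weight_nonneg w_nonneg)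
    also have "\<dots> = ennreal (path_weight w S xs x) * (\<integral>\<^sup>+y. ennreal (w (x (last xs)) y) \<partial>D)"
      by (rule nn_integral_cmult[OF wm])
    also have "\<dots> \<le> ennreal (path_weight w S xs x) * \<kappa>" by (rule mult_left_mono[OF \<kappa>]) simp
    finally show "(\<integral>\<^sup>+y. ennreal (path_weight w S (xs @ [v]) (x(v := y))) \<partial>D) \<le> ennreal (path_weight w S xs x) * \<kappa>" .
  qed
  also have "\<dots> = (\<integral>\<^sup>+x. ennreal (path_weight w S xs x) \<partial>PiM ?V (\<lambda>_. D)) * \<kappa>" by (rule nn_integral_multc[OF m'])
  also have "\<dots> \<le> emeasure D S * \<kappa> ^ (length xs - 1) * \<kappa>" by (rule mult_right_mono[OF snoc.IH[OF V(5,4,2)]]) simp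
  also have "\<dots> = emeasure D S * \<kappa> ^ (length (xs @ [v]) - 1)"
    using snoc.hyps by (cases xs) (simp_all add: mult_ac)
  finally show ?case .
qed

lemma ex_path:
  assumes D: "prob_space D" "sets D = sets borel" and S: "S \<in> sets borel"
    and \<kappa>: "\<And>a. (\<integral>\<^sup>+y. ennreal (w a y) \<partial>D) \<le> \<kappa>"
    and xs: "xs \<noteq> []" "distinct xs" "finite V" "set xs \<subseteq> V"
  shows "ex V (\<lambda>_. D) w (\<lambda>x E. of_bool (x (hd xs) \<in> S \<and> path_edges xs \<subseteq> E)) \<le> emeasure D S * \<kappa> ^ (length xs - 1)"
proof -
  have "bsum (pairs V) (wt w x) (\<lambda>E. of_bool (x (hd xs) \<in> S \<and> path_edges xs \<subseteq> E)) = path_weight w S xs x" for x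
  proof -
    have "bsum (pairs V) (wt w x) (\<lambda>E. of_bool (x (hd xs) \<in> S \<and> path_edges xs \<subseteq> E)) =
      of_bool (x (hd xs) \<in> S) * bsum (pairs V) (wt w x) (\<lambda>E. of_bool (path_edges xs \<subseteq> E))"
      unfolding bsum_cmult[symmetric] by (rule bsum_cong) simp_all
    also have "bsum (pairs V) (wt w x) (\<lambda>E. of_bool (path_edges xs \<subseteq> E)) = (\<Prod>e\<in>path_edges xs. wt w x e)"
      by (rule bsum_subset[OF finite_pairs[OF xs(3)] path_edges_pairs[OF xs(2,4)]])
    also have "\<dots> = (\<Prod>i<length xs - 1. wt w x {xs ! i, xs ! Suc i})"
      unfolding path_edges_def by (rule prod.reindex_cong[OF inj_on_path_edges[OF xs(2)] refl]) simp
    finally show ?thesis by (simp add: path_weight_def)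
  qed
  then show ?thesis unfolding ex_def using path_weight_integral[OF D S \<kappa> xs] by simp
qed

end

text \<open>Factorial moments: the mean number of ordered k-tuples of distinct points is m^k.
  Truncated subtraction makes the product vanish for n < k.\<close>

lemma poisson_falling_moment:
  assumes "0 < m"
  shows "(\<integral>\<^sup>+n. ennreal (real (\<Prod>i<k. n - i)) \<partial>measure_pmf (poisson_pmf m)) = ennreal (m ^ k)"
proof (induction k)
  case (Suc k)
  have s: "(\<Prod>i<Suc k. Suc n - i) = Suc n * (\<Prod>i<k. n - i)" for n
    unfolding prod.lessThan_Suc_shift by simp
  have z: "ennreal (real (\<Prod>i<Suc k. 0 - i)) = 0" unfolding prod.lessThan_Suc_shift by simp
  have "(\<integral>\<^sup>+n. ennreal (real (\<Prod>i<Suc k. n - i)) \<partial>measure_pmf (poisson_pmf m)) =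
    ennreal m * (\<integral>\<^sup>+n. ennreal (1 / real (Suc n)) * ennreal (real (\<Prod>i<Suc k. Suc n - i)) \<partial>measure_pmf (poisson_pmf m))"
    by (rule nn_integral_poisson_Suc[where F="\<lambda>n. ennreal (real (\<Prod>i<Suc k. n - i))", OF assms z])
  also have "(\<integral>\<^sup>+n. ennreal (1 / real (Suc n)) * ennreal (real (\<Prod>i<Suc k. Suc n - i)) \<partial>measure_pmf (poisson_pmf m)) =
    (\<integral>\<^sup>+n. ennreal (real (\<Prod>i<k. n - i)) \<partial>measure_pmf (poisson_pmf m))"
  proof (rule nn_integral_cong)
    fix n
    have "ennreal (1 / real (Suc n)) * ennreal (real (\<Prod>i<Suc k. Suc n - i)) = ennreal (1 / real (Suc n) * real (\<Prod>i<Suc k. Suc n - i))"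
      by (rule ennreal_mult[symmetric]) (simp, rule of_nat_0_le_iff)
    also have "1 / real (Suc n) * real (\<Prod>i<Suc k. Suc n - i) = real (\<Prod>i<k. n - i)"
      unfolding s of_nat_mult by (simp del: of_nat_Suc)
    finally show "ennreal (1 / real (Suc n)) * ennreal (real (\<Prod>i<Suc k. Suc n - i)) = ennreal (real (\<Prod>i<k. n - i))" .
  qed
  finally show ?case unfolding Suc.IH using assms by (simp add: ennreal_mult)
qed simp

definition dlists :: "nat \<Rightarrow> nat \<Rightarrow> nat list set" where
  "dlists k n = {xs. length xs = k \<and> distinct xs \<and> set xs \<subseteq> {..<n}}"

lemma finite_dlists: "finite (dlists k n)"
  by (rule finite_subset[OF _ finite_lists_length_eq[of "{..<n}" k]]) (auto simp: dlists_def)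

lemma card_dlists: "card (dlists k n) \<le> (\<Prod>i<k. n - i)"
proof (cases "k \<le> n")
  case True
  have "card (dlists k n) = \<Prod>{n - k + 1..n}"
    unfolding dlists_def using card_lists_distinct_length_eq[of "{..<n}" k] True by simp
  also have "\<dots> = (\<Prod>i<k. n - i)"
    using True by (intro prod.reindex_bij_witness[where i="\<lambda>i. n - i" and j="\<lambda>i. n - i"]) auto
  finally show ?thesis by simp
next
  case False
  have "dlists k n = {}"
  proof (rule equals0I)
    fix xs assume "xs \<in> dlists k n"
    then have "card (set xs) = k" "set xs \<subseteq> {..<n}" by (simp_all add: dlists_def distinct_card)
    with card_mono[of "{..<n}" "set xs"] False show False by simp
  qed
  then show ?thesis by simp
qed

text \<open>Along an edge \<open>\<phi>\<close> grows by at most \<open>R\<close>, so a connection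
  from \<open>S\<close> to \<open>T\<close> takes more than \<open>N\<close> steps and starts with a
  self-avoiding path of \<open>N + 1\<close> vertices. The mean number of such paths is a factorial
  moment times the weight of a single path.\<close>

lemma (in kernel) PC_path_bound:
  assumes D: "prob_space D" "sets D = sets borel" and S: "S \<in> sets borel" and T: "T \<in> sets borel" and m: "0 < m"
    and \<kappa>: "\<And>a. (\<integral>\<^sup>+y. ennreal (w a y) \<partial>D) \<le> \<kappa>"
    and \<phi>: "\<And>a b. 0 < w a b \<Longrightarrow> \<phi> b \<le> \<phi> a + (R::real)" and R: "0 < R"
    and \<phi>S: "\<And>a. a \<in> S \<Longrightarrow> \<phi> a \<le> r" and \<phi>T: "\<And>a. a \<in> T \<Longrightarrow> r + real N * R < \<phi> a"
  shows "PC m D w S T \<le> ennreal (m ^ Suc N) * (emeasure D S * \<kappa> ^ N)"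
proof -
  let ?c = "emeasure D S * \<kappa> ^ N"
  let ?Y = "\<lambda>(xs::nat list) x E. of_bool (x (hd xs) \<in> S \<and> path_edges xs \<subseteq> E) :: real"
  have "ex {..<n} (\<lambda>_. D) w (ind_conn S T {..<n}) \<le> ennreal (real (\<Prod>i<Suc N. n - i)) * ?c" for n
  proof -
    let ?L = "dlists (Suc N) n" and ?V = "{..<n}"
    have "ex ?V (\<lambda>_. D) w (ind_conn S T ?V) \<le> ex ?V (\<lambda>_. D) w (\<lambda>x E. \<Sum>xs\<in>?L. ?Y xs x E)"
      unfolding ex_def
    proof (intro nn_integral_mono ennreal_leI bsum_mono_pos)
      show "0 \<le> wt w x e \<and> wt w x e \<le> 1" if "e \<in> pairs ?V" for x e using wt_range[OF that] .
      show "finite (pairs ?V)" by (simp add: finite_pairs)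
      fix x E assume E: "E \<subseteq> pairs ?V" "\<And>e. e \<in> E \<Longrightarrow> 0 < wt w x e"
      have s0: "0 \<le> (\<Sum>xs\<in>?L. ?Y xs x E)" by (intro sum_nonneg) simp
      show "ind_conn S T ?V x E \<le> (\<Sum>xs\<in>?L. ?Y xs x E)"
      proof (cases "conn ?V (mk ?V x S) (mk ?V x T) E")
        case False
        then show ?thesis using s0 by (simp add: ind_conn_def)
      next
        case True
        then obtain xs where g: "geodesic ?V (mk ?V x S) (mk ?V x T) E xs" using geodesic_exists by blast
        have d: "distinct xs" by (rule geodesic_distinct[OF g])
        have p: "xs \<noteq> []" "set xs \<subseteq> ?V" "successively (\<lambda>i j. {i, j} \<in> E) xs" "hd xs \<in> mk ?V x S" "last xs \<in> mk ?V x T"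
          using g by (auto simp: geodesic_def path_between_def)
        have e: "{xs ! i, xs ! Suc i} \<in> E" if "Suc i < length xs" for i
          using p(3) that by (simp add: successively_conv_nth)
        have h: "\<phi> (x (xs ! i)) \<le> r + real i * R" if "i < length xs" for i
          using that
        proof (induction i)
          case 0
          then show ?case using p(1,4) \<phi>S by (simp add: hd_conv_nth mk_def)
        next
          case (Suc i)
          have "0 < w (x (xs ! i)) (x (xs ! Suc i))" using E(2)[OF e[OF Suc.prems]] by simp
          from \<phi>[OF this] Suc show ?case by (simp add: algebra_simps)
        qed
        have "r + real N * R < \<phi> (x (last xs))" using p(5) by (intro \<phi>T) (simp add: mk_def)
        also have "\<dots> \<le> r + real (length xs - 1) * R" using h[of "length xs - 1"] p(1) by (simp add: last_conv_nth)
        finally have "N < length xs - 1" using R by simp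
        then have len: "Suc N < length xs" by simp
        \<comment> \<open>Only the first \<open>N + 1\<close> vertices of the geodesic are kept;
          that it continues to \<open>T\<close> is forgotten.\<close>
        define ys where "ys = take (Suc N) xs"
        have yl: "length ys = Suc N" using len by (simp add: ys_def)
        have ys: "ys \<in> ?L" unfolding dlists_def using yl d p(2) set_take_subset[of "Suc N" xs] by (auto simp: ys_def distinct_take)
        have "hd ys = hd xs" using p(1) by (simp add: ys_def)
        then have 1: "x (hd ys) \<in> S" using p(4) by (simp add: mk_def)
        have 2: "path_edges ys \<subseteq> E" unfolding path_edges_def
        proof (rule image_subsetI)
          fix i assume "i \<in> {..<length ys - 1}"
          then have i: "i < N" by (simp add: yl)
          then have "ys ! i = xs ! i" "ys ! Suc i = xs ! Suc i" by (simp_all add: ys_def)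
          then show "{ys ! i, ys ! Suc i} \<in> E" using e[of i] i len by simp
        qed
        have "ind_conn S T ?V x E \<le> ?Y ys x E" using 1 2 by (simp add: ind_conn_def)
        also have "\<dots> \<le> (\<Sum>xs\<in>?L. ?Y xs x E)" by (rule member_le_sum[OF ys _ finite_dlists]) simp
        finally show ?thesis .
      qed
    qed
    also have "\<dots> = (\<Sum>xs\<in>?L. ex ?V (\<lambda>_. D) w (?Y xs))"
    proof (rule ex_sum[OF _ finite_dlists])
      fix xs assume xs: "xs \<in> ?L"
      then have "hd xs \<in> ?V" by (cases xs) (auto simp: dlists_def)
      then have eq: "(x (hd xs) \<in> S) = (hd xs \<in> mk ?V x S)" for x by (simp add: mk_def)
      show "adm ?V (?Y xs)" unfolding eq
        by (rule adm_mark[where \<Phi>="\<lambda>A B E. of_bool (hd xs \<in> A \<and> path_edges xs \<subseteq> E)", OF _ S S]) auto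
    qed (auto simp: D)
    also have "\<dots> \<le> (\<Sum>xs\<in>?L. ?c)"
    proof (rule sum_mono)
      fix xs assume xs: "xs \<in> ?L"
      then have "xs \<noteq> []" "distinct xs" "set xs \<subseteq> ?V" "length xs - 1 = N" by (auto simp: dlists_def)
      then show "ex ?V (\<lambda>_. D) w (?Y xs) \<le> ?c" using ex_path[OF D S \<kappa>, of xs ?V] by simp
    qed
    also have "\<dots> = of_nat (card ?L) * ?c" by simp
    also have "\<dots> \<le> ennreal (real (\<Prod>i<Suc N. n - i)) * ?c"
      unfolding ennreal_of_nat_eq_real_of_nat
      by (rule mult_right_mono[OF ennreal_leI[OF of_nat_mono[OF card_dlists]]]) simp
    finally show ?thesis .
  qed
  then have "PC m D w S T \<le> (\<integral>\<^sup>+n. ennreal (real (\<Prod>i<Suc N. n - i)) * ?c \<partial>measure_pmf (poisson_pmf m))"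
    unfolding PC_def pex_def by (intro nn_integral_mono)
  also have "\<dots> = ennreal (m ^ Suc N) * ?c" by (subst nn_integral_multc) (simp_all only: poisson_falling_moment[OF m], simp)
  finally show ?thesis .
qed

text \<open>A level set of a nonincreasing radial function is a disc, with or without points of its
  boundary circle, and its area pi \<rho>^2 is the integral of 2 pi r up to the radius
  \<rho>.\<close>

lemma radial_level_set:
  assumes anti: "\<And>u v. u \<le> v \<Longrightarrow> k v \<le> (k u :: real)" and kzero: "\<And>r. R < r \<Longrightarrow> k r = 0" and u: "0 \<le> u"
  shows "emeasure lborel {y::pt. u < k (norm y)} = (\<integral>\<^sup>+r. ennreal (2 * pi * r) * indicator {r. 0 \<le> r \<and> u < k r} r \<partial>lborel)"
proof (cases "{r. 0 \<le> r \<and> u < k r} = {}")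
  case True
  then have "{y::pt. u < k (norm y)} = {}" by (metis (mono_tags, lifting) empty_Collect_eq norm_ge_zero)
  then show ?thesis using True by simp
next
  case False
  let ?I = "{r. 0 \<le> r \<and> u < k r}"
  define \<rho> where "\<rho> = Sup ?I"
  have bd: "bdd_above ?I"
  proof (rule bdd_aboveI[of _ R])
    fix r assume "r \<in> ?I"
    then show "r \<le> R" using kzero[of r] u by (cases "R < r") auto
  qed
  have up: "r \<le> \<rho>" if "r \<in> ?I" for r unfolding \<rho>_def by (rule cSup_upper[OF that bd])
  have lowr: "r \<in> ?I" if r: "0 \<le> r" "r < \<rho>" for r
  proof -
    obtain s where "s \<in> ?I" "r < s" using less_cSup_iff[OF False bd] r(2) unfolding \<rho>_def by blast
    then show ?thesis using anti[of r s] r(1) by auto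
  qed
  have \<rho>0: "0 \<le> \<rho>" using False up by force
  have "ball 0 \<rho> \<subseteq> {y::pt. u < k (norm y)}" using lowr by auto
  moreover have cb: "{y::pt. u < k (norm y)} \<subseteq> cball 0 \<rho>" using up by auto
  moreover have "emeasure lborel (ball (0::pt) \<rho>) = ennreal (pi * \<rho>\<^sup>2)" "emeasure lborel (cball (0::pt) \<rho>) = ennreal (pi * \<rho>\<^sup>2)"
    using \<rho>0 by (simp_all add: emeasure_ball emeasure_cball unit_ball_vol_2 power2_eq_square)
  moreover have m: "{y::pt. u < k (norm y)} \<in> sets borel"
  proof -
    have "mono (\<lambda>r. - k r)" using anti by (intro monoI) simp
    then have "(\<lambda>r. - (- k r)) \<in> borel_measurable borel" by (intro borel_measurable_uminus borel_measurable_mono)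
    then have [measurable]: "k \<in> borel_measurable borel" by simp
    show ?thesis by measurable
  qed
  ultimately have L: "emeasure lborel {y::pt. u < k (norm y)} = ennreal (pi * \<rho>\<^sup>2)"
    using emeasure_mono[of "ball 0 \<rho>" "{y::pt. u < k (norm y)}" lborel] emeasure_mono[of "{y::pt. u < k (norm y)}" "cball 0 \<rho>" lborel]
    by (intro antisym) simp_all
  have "(\<integral>\<^sup>+r. ennreal (2 * pi * r) * indicator ?I r \<partial>lborel) = (\<integral>\<^sup>+r. ennreal (2 * pi * r) * indicator {0..\<rho>} r \<partial>lborel)"
  proof (rule nn_integral_cong_AE)
    show "AE r in lborel. ennreal (2 * pi * r) * indicator ?I r = ennreal (2 * pi * r) * indicator {0..\<rho>} r"
      using AE_lborel_singleton[of \<rho>]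
    proof (eventually_elim)
      case (elim r)
      have "r \<in> ?I \<longleftrightarrow> r \<in> {0..\<rho>}" using up[of r] lowr[of r] elim by auto
      then show ?case by (simp only: indicator_def)
    qed
  qed
  also have "\<dots> = ennreal (pi * \<rho>\<^sup>2 - pi * 0\<^sup>2)"
    using \<rho>0 by (intro nn_integral_FTC_Icc) (auto intro!: derivative_eq_intros)
  finally show ?thesis using L by simp
qed

text \<open>The layer-cake formula and Fubini reduce a radial integral to the areas of the level
  sets.\<close>

lemma nn_integral_radial:
  assumes anti: "\<And>u v. u \<le> v \<Longrightarrow> k v \<le> (k u :: real)" and kzero: "\<And>r. R < r \<Longrightarrow> k r = 0"
  shows "(\<integral>\<^sup>+y. ennreal (k (norm (y::pt))) \<partial>lborel) = (\<integral>\<^sup>+r. ennreal (2 * pi * r) * (ennreal (k r) * indicator {0..} r) \<partial>lborel)"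
proof -
  have "mono (\<lambda>r. - k r)" using anti by (intro monoI) simp
  then have "(\<lambda>r. - (- k r)) \<in> borel_measurable borel" by (intro borel_measurable_uminus borel_measurable_mono)
  then have [measurable]: "k \<in> borel_measurable borel" by simp
  have lc: "ennreal v = (\<integral>\<^sup>+u. indicator {u. 0 \<le> u \<and> u < v} u \<partial>lborel)" for v :: real
  proof -
    have "{u. 0 \<le> u \<and> u < v} = {0..<v}" by auto
    then show ?thesis by (cases "0 \<le> v") (auto simp: ennreal_neg)
  qed
  have "(\<integral>\<^sup>+y. ennreal (k (norm (y::pt))) \<partial>lborel) = (\<integral>\<^sup>+y. (\<integral>\<^sup>+u. indicator {u. 0 \<le> u \<and> u < k (norm (y::pt))} u \<partial>lborel) \<partial>lborel)"
    by (subst lc) rule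
  also have "\<dots> = (\<integral>\<^sup>+u. (\<integral>\<^sup>+y. indicator {u. 0 \<le> u \<and> u < k (norm (y::pt))} u \<partial>lborel) \<partial>lborel)"
    by (rule lborel_pair.Fubini'[symmetric]) (simp add: indicator_def case_prod_beta)
  also have "\<dots> = (\<integral>\<^sup>+u. (\<integral>\<^sup>+r. ennreal (2 * pi * r) * (indicator {u. 0 \<le> u \<and> u < k r} u * indicator {0..} r) \<partial>lborel) \<partial>lborel)"
  proof (rule nn_integral_cong)
    fix u :: real
    show "(\<integral>\<^sup>+y. indicator {u. 0 \<le> u \<and> u < k (norm (y::pt))} u \<partial>lborel) =
      (\<integral>\<^sup>+r. ennreal (2 * pi * r) * (indicator {u. 0 \<le> u \<and> u < k r} u * indicator {0..} r) \<partial>lborel)"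
    proof (cases "0 \<le> u")
      case True
      have "(\<integral>\<^sup>+y. indicator {u. 0 \<le> u \<and> u < k (norm (y::pt))} u \<partial>lborel) = (\<integral>\<^sup>+y. indicator {y::pt. u < k (norm y)} y \<partial>lborel)"
        using True by (intro nn_integral_cong) (simp add: indicator_def)
      also have "\<dots> = emeasure lborel {y::pt. u < k (norm y)}" by (rule nn_integral_indicator) measurable
      also have "\<dots> = (\<integral>\<^sup>+r. ennreal (2 * pi * r) * indicator {r. 0 \<le> r \<and> u < k r} r \<partial>lborel)"
        by (rule radial_level_set[OF _ _ True, where R=R]) (rule anti kzero; assumption)+
      also have "\<dots> = (\<integral>\<^sup>+r. ennreal (2 * pi * r) * (indicator {u. 0 \<le> u \<and> u < k r} u * indicator {0..} r) \<partial>lborel)"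
        using True by (intro nn_integral_cong) (auto simp: indicator_def)
      finally show ?thesis .
    qed simp
  qed
  also have "\<dots> = (\<integral>\<^sup>+r. (\<integral>\<^sup>+u. ennreal (2 * pi * r) * (indicator {u. 0 \<le> u \<and> u < k r} u * indicator {0..} r) \<partial>lborel) \<partial>lborel)"
    by (rule lborel_pair.Fubini') (simp add: indicator_def case_prod_beta)
  also have "\<dots> = (\<integral>\<^sup>+r. ennreal (2 * pi * r) * (ennreal (k r) * indicator {0..} r) \<partial>lborel)"
  proof (rule nn_integral_cong)
    fix r :: real
    have [measurable]: "{u. 0 \<le> u \<and> u < k r} \<in> sets borel" by measurable
    show "(\<integral>\<^sup>+u. ennreal (2 * pi * r) * (indicator {u. 0 \<le> u \<and> u < k r} u * indicator {0..} r) \<partial>lborel) = ennreal (2 * pi * r) * (ennreal (k r) * indicator {0..} r)"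
      by (subst nn_integral_cmult, simp, subst nn_integral_multc, simp, subst lc[of "k r"], rule refl)
  qed
  finally show ?thesis .
qed

lemma nn_integral_shift: "h \<in> borel_measurable borel \<Longrightarrow> (\<integral>\<^sup>+y. h (dist a (y::pt)) \<partial>lborel) = (\<integral>\<^sup>+y. h (norm (y::pt)) \<partial>lborel)"
proof -
  assume [measurable]: "h \<in> borel_measurable borel"
  have "(\<integral>\<^sup>+y. h (dist a y) \<partial>lborel) = (\<integral>\<^sup>+y. h (dist a y) \<partial>distr lborel borel ((+) a))"
    by (subst lborel_distr_plus) rule
  also have "\<dots> = (\<integral>\<^sup>+y. h (dist a (a + y)) \<partial>lborel)" by (rule nn_integral_distr) measurable
  finally show ?thesis by (simp add: dist_norm)
qed

text \<open>A connection over \<open>N\<close> steps has probability at most lam (lam c)^N: the area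
  of the box cancels between the factorial moment and the densities of the uniform law. This tends
  to 0, while percolation would keep it above some \<open>\<delta>\<close>.\<close>

theorem no_percolation:
  assumes k: "profile k" and R: "0 < R" and kzero: "\<And>r. R < r \<Longrightarrow> k r = 0" and lam: "0 < lam"
    and c: "(\<integral>\<^sup>+y. ennreal (k (norm (y::pt))) \<partial>lborel) = ennreal c" "0 \<le> c" "lam * c < 1"
  shows "\<not> percolates lam k"
proof
  assume "percolates lam k"
  from percolates_imp_Ev[OF k zero_less_one this]
  obtain z \<delta> where \<delta>: "0 < \<delta>" and E: "\<And>t. \<exists>L. ennreal \<delta> \<le> emeasure (RCM_space lam) (Ev k (Kc L) (cbox z (z + (1, 1))) (- sq (real t)))"
    by blast
  define S where "S = cbox z (z + (1, 1))"
  have S: "S \<in> sets borel" by (simp add: S_def)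
  have Svol: "emeasure lborel S = ennreal 1" unfolding S_def
    using emeasure_cbox_prod[of "fst z" "fst z + 1" "snd z" "snd z + 1"] by (cases z) simp
  define \<phi> where "\<phi> x = max \<bar>fst x\<bar> \<bar>snd x\<bar>" for x :: pt
  define r where "r = \<bar>fst z\<bar> + \<bar>snd z\<bar> + 1"
  have [measurable]: "k \<in> borel_measurable borel" and k01: "\<And>r. 0 \<le> k r" using k by (auto simp: profile_def)
  interpret kernel "\<lambda>(x::pt) y. k (dist x y)" by (rule kernel_profile[OF k])
  have "(\<lambda>N. lam * (lam * c) ^ N) \<longlonglongrightarrow> lam * 0"
    using lam c by (intro tendsto_mult tendsto_const LIMSEQ_power_zero) auto
  then have "\<forall>\<^sub>F N in sequentially. lam * (lam * c) ^ N < \<delta>" using \<delta> by (intro order_tendstoD) auto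
  then obtain N where N: "lam * (lam * c) ^ N < \<delta>" by (auto simp: eventually_sequentially)
  obtain t :: nat where t: "r + real N * R \<le> real t" using real_arch_simple by blast
  obtain L where L: "ennreal \<delta> \<le> emeasure (RCM_space lam) (Ev k (Kc L) S (- sq (real t)))" using E[of t] unfolding S_def by blast
  \<comment> \<open>\<open>Suc L\<close> keeps the side of the box positive even for
    \<open>L = 0\<close>.\<close>
  define b where "b = real (Suc L)"
  have b: "0 < b" by (simp add: b_def)
  have "Ev k (Kc L) S (- sq (real t)) \<subseteq> Ev k (Kc (Suc L)) S (- sq (real t))" by (intro Ev_mono Kc_mono) auto
  then have "emeasure (RCM_space lam) (Ev k (Kc L) S (- sq (real t))) \<le> emeasure (RCM_space lam) (Ev k (Kc (Suc L)) S (- sq (real t)))"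
    by (intro emeasure_mono Ev_sets[OF k] S) auto
  also have "\<dots> = PB lam k b S (real t)" using bridge[OF k zero_less_one zero_less_Suc lam S, of L "real t"] by (simp add: b_def)
  also have "\<dots> \<le> ennreal ((lam * (4 * b\<^sup>2)) ^ Suc N) * (emeasure (unif (sq b)) S * ennreal (c / (4 * b\<^sup>2)) ^ N)"
    unfolding PB_def
  proof (rule PC_path_bound[where \<phi>=\<phi> and R=R and r=r])
    show "prob_space (unif (sq b))" by (rule prob_space_sq[OF b])
    show "0 < lam * (4 * b\<^sup>2)" using lam b by simp
    fix a :: pt
    have v: "0 < 4 * b\<^sup>2" using b by simp
    have "(\<integral>\<^sup>+y. ennreal (k (dist a y)) \<partial>unif (sq b)) = ennreal (1 / (4 * b\<^sup>2)) * (\<integral>\<^sup>+y. ennreal (k (dist a y)) * indicator (sq b) y \<partial>lborel)"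
      using b by (intro nn_integral_unif[OF sq_borel emeasure_sq v]) auto
    also have "\<dots> \<le> ennreal (1 / (4 * b\<^sup>2)) * (\<integral>\<^sup>+y. ennreal (k (dist a y)) \<partial>lborel)"
      by (intro mult_left_mono nn_integral_mono) (auto simp: indicator_def)
    also have "(\<integral>\<^sup>+y. ennreal (k (dist a y)) \<partial>lborel) = ennreal c"
      using nn_integral_shift[of "\<lambda>r. ennreal (k r)" a] c(1) by simp
    also have "ennreal (1 / (4 * b\<^sup>2)) * ennreal c = ennreal (c / (4 * b\<^sup>2))" using c(2) by (simp add: ennreal_mult[symmetric])
    finally show "(\<integral>\<^sup>+y. ennreal (k (dist a y)) \<partial>unif (sq b)) \<le> ennreal (c / (4 * b\<^sup>2))" .
    show "\<phi> y \<le> \<phi> a + R" if "0 < k (dist a y)" for y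
    proof -
      have "dist a y \<le> R" using that kzero[of "dist a y"] by (cases "R < dist a y") auto
      then show ?thesis using fst_diff_le[of a y] snd_diff_le[of a y] by (simp add: \<phi>_def) linarith
    qed
    show "\<phi> a \<le> r" if "a \<in> S"
      using that unfolding S_def r_def \<phi>_def by (cases z; cases a) (simp add: cbox_Pair_eq, linarith)
    show "r + real N * R < \<phi> a" if "a \<in> - sq (real t)"
    proof -
      have "real t < \<phi> a" using that unfolding \<phi>_def sq_def by (cases a) (simp add: cbox_Pair_eq, linarith)
      then show ?thesis using t by linarith
    qed
  qed (auto simp: S R)
  also have "\<dots> \<le> ennreal ((lam * (4 * b\<^sup>2)) ^ Suc N) * (ennreal (1 / (4 * b\<^sup>2)) * ennreal (c / (4 * b\<^sup>2)) ^ N)"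
    using Svol by (intro mult_left_mono mult_right_mono unif_sq_le[OF b S]) auto
  also have "\<dots> = ennreal ((lam * (4 * b\<^sup>2)) ^ Suc N * (1 / (4 * b\<^sup>2) * (c / (4 * b\<^sup>2)) ^ N))"
    using lam c by (simp only: ennreal_power ennreal_mult[symmetric] mult_nonneg_nonneg zero_le_power divide_nonneg_nonneg less_imp_le zero_le_numeral zero_le_one zero_le_power2)
  also have "(lam * (4 * b\<^sup>2)) ^ Suc N * (1 / (4 * b\<^sup>2) * (c / (4 * b\<^sup>2)) ^ N) = lam * (lam * c) ^ N"
  proof -
    have "(lam * v) ^ Suc N * (1 / v * (c / v) ^ N) = lam * (lam * c) ^ N" if "v \<noteq> 0" for v
      using that by (simp add: power_mult_distrib power_divide)
    then show ?thesis using b by simp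
  qed
  also have "ennreal (lam * (lam * c) ^ N) < ennreal \<delta>" using N \<delta> by (simp add: ennreal_lessI)
  finally show False using L by simp
qed

section \<open>Percolation at high intensity\<close>

definition dirs :: "(int \<times> int) set" where "dirs = {(0, 1), (1, -1), (-1, -1)}"

text \<open>Steps upwards must end in \<open>B\<close>, the set of bad sites; the two diagonal steps
  downwards are free. The upper boundary of what is reachable from height 0 is then a Lipschitz
  graph that avoids \<open>B\<close>.\<close>

definition lstep :: "(int \<times> int) set \<Rightarrow> int \<times> int \<Rightarrow> int \<times> int \<Rightarrow> bool" where
  "lstep B z z' \<longleftrightarrow> z' - z \<in> dirs \<and> (z' - z = (0, 1) \<longrightarrow> z' \<in> B)"

definition reach :: "(int \<times> int) set \<Rightarrow> int \<times> int \<Rightarrow> bool" where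
  "reach B z \<longleftrightarrow> (\<exists>x n. (lstep B ^^ n) (x, 0) z)"

lemma reach_step: "reach B z \<Longrightarrow> lstep B z z' \<Longrightarrow> reach B z'"
  unfolding reach_def by (meson relpowp_Suc_I)

lemma reach_base: "reach B (x, 0)"
  unfolding reach_def by (intro exI[of _ x] exI[of _ 0]) simp

text \<open>The graph runs one above the highest reachable site: a bad site there would itself be
  reachable, and the free diagonal steps keep neighbouring heights within 1.\<close>

lemma lipschitz_open_ray:
  assumes bd: "\<And>x. bdd_above {y. reach B (x, y)}"
  shows "\<exists>F. \<forall>x. (x, F x) \<notin> B \<and> F (x + 1) - F x \<in> {-1, 0, 1}"
proof -
  \<comment> \<open>The cut at height 0 makes the set finite, and 0 always belongs to it.\<close>
  define G where "G x = {y. 0 \<le> y \<and> reach B (x, y)}" for x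
  have fin: "finite (G x)" for x
  proof -
    obtain h where "\<And>y. reach B (x, y) \<Longrightarrow> y \<le> h" using bd[of x] by (auto simp: bdd_above_def)
    then have "G x \<subseteq> {0..h}" by (auto simp: G_def)
    then show ?thesis by (rule finite_subset) simp
  qed
  have ne: "0 \<in> G x" for x by (simp add: G_def reach_base)
  define M where "M x = Max (G x)" for x
  have M: "M x \<in> G x" for x unfolding M_def using fin ne by (intro Max_in) auto
  have up: "y \<le> M x" if "y \<in> G x" for x y unfolding M_def by (rule Max_ge[OF fin that])
  have open': "(x, M x + 1) \<notin> B" for x
  proof
    assume "(x, M x + 1) \<in> B"
    then have "lstep B (x, M x) (x, M x + 1)" by (simp add: lstep_def dirs_def)
    then have "reach B (x, M x + 1)" using M[of x] reach_step by (auto simp: G_def)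
    then have "M x + 1 \<in> G x" using M[of x] by (simp add: G_def)
    from up[OF this] show False by simp
  qed
  have lip: "M x - 1 \<le> M x'" if "x' = x + 1 \<or> x' = x - 1" for x x'
  proof (cases "M x \<ge> 1")
    case True
    have "lstep B (x, M x) (x', M x - 1)" using that by (auto simp: lstep_def dirs_def)
    then have "reach B (x', M x - 1)" using M[of x] reach_step by (auto simp: G_def)
    then have "M x - 1 \<in> G x'" using True by (simp add: G_def)
    then show ?thesis by (rule up)
  next
    case False
    then show ?thesis using M[of x'] by (simp add: G_def)
  qed
  have "M (x + 1) + 1 - (M x + 1) \<in> {-1, 0, 1}" for x
    using lip[of "x + 1" x] lip[of x "x + 1"] by (simp; presburger)
  then show ?thesis using open' by (intro exI[of _ "\<lambda>x. M x + 1"]) blast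
qed

text \<open>A path is described by its final abscissa \<open>x\<close> and its steps; the start at
  height 0 is recovered by subtracting the total horizontal displacement. In this way all paths that
  end above \<open>x\<close> are counted together.\<close>

definition site_at :: "int \<Rightarrow> nat \<Rightarrow> (nat \<Rightarrow> int \<times> int) \<Rightarrow> nat \<Rightarrow> int \<times> int" where
  "site_at x l d i = (x - (\<Sum>j<l. fst (d j)) + (\<Sum>j<i. fst (d j)), \<Sum>j<i. snd (d j))"

definition ups :: "nat \<Rightarrow> (nat \<Rightarrow> int \<times> int) \<Rightarrow> nat set" where
  "ups l d = {..<l} \<inter> {i. d i = (0, 1)}"

text \<open>The last condition expresses a nonnegative final height, which is the number of steps up
  minus the number of steps down.\<close>

definition shapes :: "int \<Rightarrow> nat \<Rightarrow> (nat \<Rightarrow> int \<times> int) set" where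
  "shapes x l = {d \<in> PiE {..<l} (\<lambda>_. dirs). inj_on (site_at x l d) {..l} \<and> l \<le> 2 * card (ups l d)}"

lemma card_dirs: "card dirs = 3" "finite dirs" by (simp_all add: dirs_def)

lemma finite_shapes: "finite (shapes x l)"
  by (rule finite_subset[of _ "PiE {..<l} (\<lambda>_. dirs)"]) (auto simp: shapes_def card_dirs intro!: finite_PiE)

lemma card_shapes: "card (shapes x l) \<le> 3 ^ l"
proof -
  have "card (shapes x l) \<le> card (PiE {..<l} (\<lambda>_. dirs))"
    by (rule card_mono) (auto simp: shapes_def card_dirs intro!: finite_PiE)
  then show ?thesis by (simp add: card_PiE card_dirs)
qed

text \<open>A shortest path to a reachable site is self-avoiding, and at least half of its steps go up.\<close>

lemma reach_shape:
  assumes r: "reach B (x, h)" and h: "0 \<le> h"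
  shows "\<exists>l. h \<le> int l \<and> (\<exists>d\<in>shapes x l. \<forall>i\<in>ups l d. site_at x l d (Suc i) \<in> B)"
proof -
  let ?P = "\<lambda>n. \<exists>x0. (lstep B ^^ n) (x0, 0) (x, h)"
  have "\<exists>n. ?P n" using r by (auto simp: reach_def)
  then obtain n where n: "?P n" "\<And>k. k < n \<Longrightarrow> \<not> ?P k" using exists_least_iff[of ?P] by blast
  obtain x0 where x0: "(lstep B ^^ n) (x0, 0) (x, h)" using n(1) by blast
  obtain f where f: "f 0 = (x0, 0)" "f n = (x, h)" "\<And>i. i < n \<Longrightarrow> lstep B (f i) (f (Suc i))"
    using x0 unfolding relpowp_fun_conv by blast
  have inj: "f i \<noteq> f j" if ij: "i < j" "j \<le> n" for i j
  proof
    assume e: "f i = f j"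
    have "(lstep B ^^ i) (f 0) (f i)" unfolding relpowp_fun_conv using f(3) ij by (intro exI[of _ f]) auto
    moreover have "(lstep B ^^ (n - j)) (f j) (f n)" unfolding relpowp_fun_conv
      using f(3) ij by (intro exI[of _ "\<lambda>k. f (j + k)"]) auto
    ultimately have "(lstep B ^^ (i + (n - j))) (f 0) (f n)" unfolding relpowp_add using e by auto
    then have "?P (i + (n - j))" using f by auto
    moreover have "i + (n - j) < n" using ij by linarith
    ultimately show False using n(2) by blast
  qed
  define d where "d = restrict (\<lambda>i. f (Suc i) - f i) {..<n}"
  have di: "d i = f (Suc i) - f i" if "i < n" for i using that by (simp add: d_def)
  have s1: "(\<Sum>j<i. fst (d j)) = fst (f i) - x0" and s2: "(\<Sum>j<i. snd (d j)) = snd (f i)" if "i \<le> n" for i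
  proof -
    have "(\<Sum>j<i. fst (d j)) = (\<Sum>j<i. fst (f (Suc j)) - fst (f j))" using that di by (intro sum.cong) auto
    then show "(\<Sum>j<i. fst (d j)) = fst (f i) - x0" using sum_lessThan_telescope[of "\<lambda>j. fst (f j)" i] f(1) by simp
    have "(\<Sum>j<i. snd (d j)) = (\<Sum>j<i. snd (f (Suc j)) - snd (f j))" using that di by (intro sum.cong) auto
    then show "(\<Sum>j<i. snd (d j)) = snd (f i)" using sum_lessThan_telescope[of "\<lambda>j. snd (f j)" i] f(1) by simp
  qed
  have pos: "site_at x n d i = f i" if "i \<le> n" for i
    unfolding site_at_def s1[OF order_refl] s1[OF that] s2[OF that] by (simp add: f(2) prod_eq_iff)
  have "inj_on (site_at x n d) {..n}"
  proof (rule inj_onI)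
    fix i j assume "i \<in> {..n}" "j \<in> {..n}" "site_at x n d i = site_at x n d j"
    then show "i = j" using pos inj[of i j] inj[of j i] by (cases i j rule: linorder_cases) auto
  qed
  moreover have dd: "d i \<in> dirs" if "i < n" for i using f(3)[OF that] di[OF that] by (simp add: lstep_def)
  then have "d \<in> PiE {..<n} (\<lambda>_. dirs)" by (auto simp: d_def)
  \<comment> \<open>A step upwards changes the height by 1, every other step by -1.\<close>
  moreover have hn: "h = 2 * int (card (ups n d)) - int n"
  proof -
    have "h = (\<Sum>j<n. snd (d j))" using s2[OF order_refl] f(2) by simp
    also have "\<dots> = (\<Sum>j<n. 2 * of_bool (d j = (0, 1)) - 1)"
    proof (rule sum.cong[OF refl])
      fix j assume "j \<in> {..<n}"
      then show "snd (d j) = 2 * of_bool (d j = (0, 1)) - 1" using dd[of j] by (auto simp: dirs_def)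
    qed
    also have "\<dots> = 2 * (\<Sum>j<n. of_bool (d j = (0, 1))) - int n" by (simp add: sum_subtractf sum_distrib_left)
    also have "(\<Sum>j<n. of_bool (d j = (0, 1))) = int (card (ups n d))" by (simp add: sum_of_bool_eq ups_def)
    finally show ?thesis .
  qed
  moreover have "card (ups n d) \<le> n"
    using card_mono[of "{..<n}" "ups n d"] by (simp add: ups_def)
  moreover have "site_at x n d (Suc i) \<in> B" if "i \<in> ups n d" for i
  proof -
    have i: "i < n" "d i = (0, 1)" using that by (auto simp: ups_def)
    then show ?thesis using f(3)[OF i(1)] di[OF i(1)] pos[of "Suc i"] by (simp add: lstep_def)
  qed
  ultimately show ?thesis using h by (intro exI[of _ n]) (auto simp: shapes_def)
qed

text \<open>There are at most 3^l shapes of length l. In a self-avoiding one the targets of the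
  steps up are at least l/2 distinct bad sites, which has probability at most (1/36)^(l/2) = 6^(-l).
  The sum 2^(-l) is summable, so by Borel-Cantelli only finitely many lengths occur, and reaching
  height y needs length at least y.\<close>

lemma AE_reach_bounded:
  assumes M: "prob_space M" and Bd: "\<And>z. Bd z \<in> sets M"
    and prod: "\<And>Z. finite Z \<Longrightarrow> measure M {\<omega>\<in>space M. \<forall>z\<in>Z. \<omega> \<in> Bd z} \<le> (1 / 36) ^ card Z"
  shows "AE \<omega> in M. \<forall>x. bdd_above {y. reach {z. \<omega> \<in> Bd z} (x, y)}"
proof -
  interpret prob_space M by (rule M)
  define W where "W x l d = {\<omega>\<in>space M. \<forall>z\<in>(\<lambda>i. site_at x l d (Suc i)) ` ups l d. \<omega> \<in> Bd z}" for x l d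
  define A where "A x l = (\<Union>d\<in>shapes x l. W x l d)" for x l
  have Wm: "W x l d \<in> events" for x l d
    unfolding W_def using Bd by (intro sets.sets_Collect_finite_All) (auto simp: ups_def)
  have Am: "A x l \<in> events" for x l unfolding A_def by (intro sets.finite_UN finite_shapes Wm)
  have le: "prob (A x l) \<le> (1 / 2) ^ l" for x l
  proof -
    have "prob (A x l) \<le> (\<Sum>d\<in>shapes x l. prob (W x l d))"
      unfolding A_def by (rule finite_measure_subadditive_finite[OF finite_shapes]) (auto intro: Wm)
    also have "\<dots> \<le> (\<Sum>d\<in>shapes x l. (1 / 6) ^ l)"
    proof (rule sum_mono)
      fix d assume d: "d \<in> shapes x l"
      have inj: "inj_on (\<lambda>i. site_at x l d (Suc i)) (ups l d)"
      proof (rule inj_onI)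
        fix i j assume ij: "i \<in> ups l d" "j \<in> ups l d" and e: "site_at x l d (Suc i) = site_at x l d (Suc j)"
        have "inj_on (site_at x l d) {..l}" using d by (simp add: shapes_def)
        from inj_onD[OF this e] ij show "i = j" by (simp add: ups_def)
      qed
      have "prob (W x l d) \<le> (1 / 36) ^ card ((\<lambda>i. site_at x l d (Suc i)) ` ups l d)"
        unfolding W_def by (rule prod) (simp add: ups_def)
      also have "\<dots> = (1 / 6) ^ (2 * card (ups l d))"
        unfolding card_image[OF inj] power_mult by (simp add: power2_eq_square)
      also have "\<dots> \<le> (1 / 6) ^ l" using d by (intro power_decreasing) (auto simp: shapes_def)
      finally show "prob (W x l d) \<le> (1 / 6) ^ l" .
    qed
    also have "\<dots> = real (card (shapes x l)) * (1 / 6) ^ l" by simp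
    also have "\<dots> \<le> 3 ^ l * (1 / 6) ^ l"
    proof (rule mult_right_mono)
      have "real (card (shapes x l)) \<le> real (3 ^ l)" using card_shapes by (simp only: of_nat_le_iff)
      then show "real (card (shapes x l)) \<le> 3 ^ l" by simp
    qed simp
    also have "\<dots> = (1 / 2) ^ l" by (simp add: power_mult_distrib[symmetric])
    finally show ?thesis .
  qed
  have "AE \<omega> in M. eventually (\<lambda>l. \<omega> \<in> space M - A x l) sequentially" for x
  proof (rule borel_cantelli_AE1[OF Am])
    show "emeasure M (A x n) < \<infinity>" for n by (simp add: emeasure_eq_measure)
    show "summable (\<lambda>n. measure M (A x n))"
      by (rule summable_comparison_test'[of "\<lambda>l. (1 / 2) ^ l" 0]) (use le in \<open>auto intro!: summable_geometric\<close>)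
  qed
  then have "AE \<omega> in M. \<forall>x. eventually (\<lambda>l. \<omega> \<in> space M - A x l) sequentially"
    by (simp only: AE_all_countable) blast
  then show ?thesis
  proof (eventually_elim)
    case (elim \<omega>)
    show ?case
    proof
      fix x
      obtain l0 where l0: "\<And>l. l \<ge> l0 \<Longrightarrow> \<omega> \<in> space M - A x l" using elim[rule_format, of x] unfolding eventually_sequentially by blast
      show "bdd_above {y. reach {z. \<omega> \<in> Bd z} (x, y)}"
      proof (rule bdd_aboveI[of _ "int l0"])
        fix y assume "y \<in> {y. reach {z. \<omega> \<in> Bd z} (x, y)}"
        then have r: "reach {z. \<omega> \<in> Bd z} (x, y)" by simp
        show "y \<le> int l0"
        proof (rule ccontr)
          assume c: "\<not> y \<le> int l0"
          then obtain l d where l: "y \<le> int l" "d \<in> shapes x l" "\<forall>i\<in>ups l d. site_at x l d (Suc i) \<in> {z. \<omega> \<in> Bd z}"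
            using reach_shape[OF r] by auto
          then have "l0 \<le> l" using c by linarith
          from l0[OF this] have o: "\<omega> \<in> space M" "\<omega> \<notin> A x l" by auto
          have "\<omega> \<in> W x l d" unfolding W_def using l(3) o(1) by blast
          then show False using o(2) l(2) unfolding A_def by blast
        qed
      qed
    qed
  qed
qed

section \<open>Good cells: hubs joined through relay points\<close>

lemma bsum_avoid_pairs:
  assumes "finite I" "finite Q" "\<alpha> ` I \<subseteq> Q" "\<beta> ` I \<subseteq> Q" "inj_on \<alpha> I" "inj_on \<beta> I" "\<alpha> ` I \<inter> \<beta> ` I = {}"
  shows "bsum Q (\<lambda>_. c) (\<lambda>E. of_bool (\<forall>j\<in>I. \<not> (\<alpha> j \<in> E \<and> \<beta> j \<in> E))) = (1 - c\<^sup>2) ^ card I"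
  using assms
proof (induction I arbitrary: Q rule: finite_induct)
  case empty
  then show ?case by (simp add: bsum_const)
next
  case (insert j I)
  define a where "a = \<alpha> j" define b where "b = \<beta> j"
  define Q' where "Q' = Q - {a, b}"
  have ab: "a \<noteq> b" "a \<in> Q" "b \<in> Q" using insert.prems by (auto simp: a_def b_def)
  have Q: "Q = insert a (insert b Q')" "finite Q'" "b \<notin> Q'" "a \<notin> insert b Q'" "finite (insert b Q')"
    using ab insert.prems(1) by (auto simp: Q'_def)
  have nab: "\<alpha> k \<noteq> a" "\<alpha> k \<noteq> b" "\<beta> k \<noteq> a" "\<beta> k \<noteq> b" if "k \<in> I" for k
    using that insert.prems(4-6) insert.hyps(2) unfolding a_def b_def inj_on_def by blast+
  define X where "X E = (of_bool (\<forall>k\<in>I. \<not> (\<alpha> k \<in> E \<and> \<beta> k \<in> E)) :: real)" for E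
  define Y where "Y E = (of_bool (\<forall>k\<in>insert j I. \<not> (\<alpha> k \<in> E \<and> \<beta> k \<in> E)) :: real)" for E
  have Y: "Y E = of_bool (\<not> (a \<in> E \<and> b \<in> E)) * X E" for E by (simp add: Y_def X_def a_def b_def)
  have X: "X (insert a E) = X E" "X (insert b E) = X E" for E
  proof -
    have "\<alpha> k \<in> insert a E \<longleftrightarrow> \<alpha> k \<in> E" "\<beta> k \<in> insert a E \<longleftrightarrow> \<beta> k \<in> E" "\<alpha> k \<in> insert b E \<longleftrightarrow> \<alpha> k \<in> E" "\<beta> k \<in> insert b E \<longleftrightarrow> \<beta> k \<in> E"
      if "k \<in> I" for k using nab[OF that] by blast+
    then show "X (insert a E) = X E" "X (insert b E) = X E" unfolding X_def by simp_all
  qed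
  have IH: "bsum Q' (\<lambda>_. c) X = (1 - c\<^sup>2) ^ card I"
    unfolding X_def
  proof (rule insert.IH)
    show "\<alpha> ` I \<subseteq> Q'" "\<beta> ` I \<subseteq> Q'" using insert.prems(2,3) nab by (auto simp: Q'_def)
    show "inj_on \<alpha> I" "inj_on \<beta> I" using insert.prems(4,5) by (auto simp: inj_on_def)
    show "\<alpha> ` I \<inter> \<beta> ` I = {}" using insert.prems(6) by blast
  qed (rule Q)
  have 1: "bsum Q' (\<lambda>_. c) (\<lambda>E. Y (insert a (insert b E))) = bsum Q' (\<lambda>_. c) (\<lambda>E. 0)"
    by (rule bsum_cong) (simp_all add: Y)
  have 2: "bsum Q' (\<lambda>_. c) (\<lambda>E. Y (insert a E)) = bsum Q' (\<lambda>_. c) X"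
  proof (rule bsum_cong[OF refl])
    fix E assume "E \<subseteq> Q'"
    then have "b \<notin> insert a E" using Q(3) ab by auto
    then show "Y (insert a E) = X E" by (simp add: Y X)
  qed
  have 3: "bsum Q' (\<lambda>_. c) (\<lambda>E. Y (insert b E)) = bsum Q' (\<lambda>_. c) X"
  proof (rule bsum_cong[OF refl])
    fix E assume "E \<subseteq> Q'"
    then have "a \<notin> insert b E" using Q(4) ab by auto
    then show "Y (insert b E) = X E" by (simp add: Y X)
  qed
  have 4: "bsum Q' (\<lambda>_. c) Y = bsum Q' (\<lambda>_. c) X"
  proof (rule bsum_cong[OF refl])
    fix E assume "E \<subseteq> Q'"
    then have "a \<notin> E" using Q(4) by auto
    then show "Y E = X E" by (simp add: Y)
  qed
  have "bsum Q (\<lambda>_. c) Y = c * (c * 0 + (1 - c) * (1 - c\<^sup>2) ^ card I) + (1 - c) * (c * (1 - c\<^sup>2) ^ card I + (1 - c) * (1 - c\<^sup>2) ^ card I)"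
    unfolding Q(1) bsum_insert[OF Q(5,4)] bsum_insert[OF Q(2,3)] 1 2 3 4 IH bsum_const[OF Q(2)] ..
  also have "\<dots> = (1 - c\<^sup>2) * (1 - c\<^sup>2) ^ card I" by (simp add: power2_eq_square algebra_simps)
  finally show ?case using insert.hyps unfolding Y_def by simp
qed

text \<open>Label \<open>(z, 0)\<close> is the hub of the cell \<open>z\<close>; its labels 1 to
  \<open>J\<close> are relays to the hubs of three cells in the next column. A single edge is open
  only with some small probability \<open>c\<close>, but one of many relays is likely to work.
  Relays are not shared between cells, so different \<open>z\<close> involve different
  edges.\<close>

definition isolated_hub :: "nat \<Rightarrow> lab set set \<Rightarrow> int \<times> int \<Rightarrow> bool" where
  "isolated_hub J E z \<longleftrightarrow> (\<exists>s\<in>{-1, 0, 1}. \<forall>i<J. \<not> ({(z, 0), (z, Suc i)} \<in> E \<and> {(z, Suc i), (z + (1, s), 0)} \<in> E))"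

text \<open>A constant threshold makes these edges independent of the positions. Where the
  connection function is at least \<open>c\<close>, they are also edges of the model, provided their
  ends are present.\<close>

definition const_edges :: "real \<Rightarrow> (lab \<times> lab \<Rightarrow> real) \<Rightarrow> lab set set" where
  "const_edges c U = redges (\<lambda>_. c) (\<lambda>_. 0) U"

lemma profile_const: "0 \<le> c \<Longrightarrow> c \<le> 1 \<Longrightarrow> profile (\<lambda>_. c)" by (simp add: profile_def)

lemma isolated_hub_measurable:
  shows "{U \<in> space Umeas. isolated_hub J (const_edges c U) z} \<in> sets Umeas"
proof -
  have e: "{U \<in> space Umeas. {l, l'} \<in> const_edges c U} \<in> sets Umeas" if ll: "l \<noteq> l'" for l l'
  proof -
    have m: "{U \<in> space Umeas. U k < c} \<in> sets Umeas" for k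
    proof -
      have "Measurable.pred Umeas (\<lambda>U. U k < c)" unfolding Umeas_def by measurable
      then show ?thesis by (simp add: pred_def)
    qed
    have "to_nat l \<noteq> to_nat l'" using ll by simp
    then consider "to_nat l < to_nat l'" | "to_nat l' < to_nat l" by linarith
    then show ?thesis
    proof cases
      case 1
      show ?thesis unfolding const_edges_def redges_iff[OF 1] by (rule m)
    next
      case 2
      show ?thesis unfolding const_edges_def insert_commute[of l l' "{}"] redges_iff[OF 2] by (rule m)
    qed
  qed
  show ?thesis unfolding isolated_hub_def
    by (intro sets.sets_Collect_finite_Ex sets.sets_Collect_countable_All sets.sets_Collect_imp sets.sets_Collect_neg sets.sets_Collect_conj sets.sets_Collect_const e) auto
qed

text \<open>For every \<open>z\<close> a direction of failure is selected, with 3 choices each. For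
  a fixed selection the pairs of edges hub-relay and relay-hub are disjoint, so
  \<open>bsum_avoid_pairs\<close> applies.\<close>

lemma isolated_hubs_prob:
  assumes c: "0 \<le> c" "c \<le> 1" and Z: "finite Z"
  shows "emeasure Umeas {U \<in> space Umeas. \<forall>z\<in>Z. isolated_hub J (const_edges c U) z} \<le> ennreal ((3 * (1 - c\<^sup>2) ^ J) ^ card Z)"
proof -
  have g: "profile (\<lambda>_. c)" by (rule profile_const[OF c])
  interpret kernel "\<lambda>(x::pt) y. c" by (rule kernel_profile[OF g])
  define T where "T = {-1, 0, 1::int}"
  define V where "V = (Z \<union> (\<lambda>(z, s). z + (1, s)) ` (Z \<times> T)) \<times> {..J}"
  have V: "finite V" using Z by (simp add: V_def T_def)
  have inV: "(z, 0) \<in> V" "i < J \<Longrightarrow> (z, Suc i) \<in> V" "s \<in> T \<Longrightarrow> (z + (1, s), 0) \<in> V" if "z \<in> Z" for z i s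
    using that unfolding V_def by force+
  define P where "P E \<longleftrightarrow> (\<forall>z\<in>Z. isolated_hub J E z)" for E
  have P: "P (const_edges c U \<inter> pairs V) \<longleftrightarrow> P (const_edges c U)" for U
  proof -
    have "isolated_hub J (const_edges c U \<inter> pairs V) z \<longleftrightarrow> isolated_hub J (const_edges c U) z" if "z \<in> Z" for z
    proof -
      have "{(z, 0), (z, Suc i)} \<in> pairs V" "{(z, Suc i), (z + (1, s), 0)} \<in> pairs V" if "i < J" "s \<in> T" for i s
        using inV[OF \<open>z \<in> Z\<close>] that by simp_all
      then show ?thesis unfolding isolated_hub_def T_def[symmetric] by (simp only: Int_iff) (metis (no_types))
    qed
    then show ?thesis by (simp add: P_def)
  qed
  have m: "{U \<in> space Umeas. P (const_edges c U)} \<in> sets Umeas"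
    unfolding P_def by (intro sets.sets_Collect_finite_All Z isolated_hub_measurable)
  have "emeasure Umeas {U \<in> space Umeas. P (const_edges c U)} = (\<integral>\<^sup>+U. indicator {U \<in> space Umeas. P (const_edges c U)} U \<partial>Umeas)"
    by (rule nn_integral_indicator[OF m, symmetric])
  also have "\<dots> = (\<integral>\<^sup>+U. ennreal (of_bool (P (const_edges c U \<inter> pairs V))) \<partial>Umeas)"
    by (intro nn_integral_cong) (simp add: P indicator_def)
  also have "\<dots> = ennreal (bsum (pairs V) (wt (\<lambda>x y. c) (\<lambda>_. 0::pt)) (\<lambda>E. of_bool (P E)))"
    unfolding const_edges_def by (rule U_integral_pred[OF g V])
  finally have e: "emeasure Umeas {U \<in> space Umeas. P (const_edges c U)} =
    ennreal (bsum (pairs V) (wt (\<lambda>x y. c) (\<lambda>_. 0::pt)) (\<lambda>E. of_bool (P E)))" .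
  have "bsum (pairs V) (wt (\<lambda>x y. c) (\<lambda>_. 0::pt)) (\<lambda>E. of_bool (P E)) = bsum (pairs V) (\<lambda>_. c) (\<lambda>E. of_bool (P E))"
    by (rule bsum_cong) (auto simp: pairs_def)
  also have "\<dots> \<le> bsum (pairs V) (\<lambda>_. c) (\<lambda>E. \<Sum>\<sigma>\<in>PiE Z (\<lambda>_. T).
      of_bool (\<forall>j\<in>Z \<times> {..<J}. \<not> ({(fst j, 0), (fst j, Suc (snd j))} \<in> E \<and> {(fst j, Suc (snd j)), (fst j + (1, \<sigma> (fst j)), 0)} \<in> E)))"
    (is "_ \<le> bsum _ _ (\<lambda>E. \<Sum>\<sigma>\<in>?S. ?f \<sigma> E)")
  proof (rule bsum_mono)
    fix E
    have fS: "finite ?S" using Z by (intro finite_PiE) (auto simp: T_def)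
    show "of_bool (P E) \<le> (\<Sum>\<sigma>\<in>?S. ?f \<sigma> E)"
    proof (cases "P E")
      case True
      then have "\<forall>z\<in>Z. \<exists>s. s \<in> T \<and> (\<forall>i<J. \<not> ({(z, 0), (z, Suc i)} \<in> E \<and> {(z, Suc i), (z + (1, s), 0)} \<in> E))"
        unfolding P_def isolated_hub_def T_def[symmetric] by blast
      from bchoice[OF this] obtain s where s: "\<forall>z\<in>Z. s z \<in> T \<and> (\<forall>i<J. \<not> ({(z, 0), (z, Suc i)} \<in> E \<and> {(z, Suc i), (z + (1, s z), 0)} \<in> E))" by blast
      have r: "restrict s Z \<in> ?S" using s by auto
      have "?f (restrict s Z) E = 1" using s by (auto simp del: plus_prod_def)
      then have "of_bool (P E) \<le> ?f (restrict s Z) E" by simp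
      also have "\<dots> \<le> (\<Sum>\<sigma>\<in>?S. ?f \<sigma> E)" by (rule member_le_sum[OF r _ fS]) simp
      finally show ?thesis .
    next
      case False
      have "0 \<le> (\<Sum>\<sigma>\<in>?S. ?f \<sigma> E)" by (intro sum_nonneg) simp
      then show ?thesis using False by simp
    qed
  qed (use c in simp)
  also have "\<dots> = (\<Sum>\<sigma>\<in>?S. bsum (pairs V) (\<lambda>_. c) (?f \<sigma>))" by (rule bsum_sum)
  also have "\<dots> = (\<Sum>\<sigma>\<in>?S. (1 - c\<^sup>2) ^ (card Z * J))"
  proof (rule sum.cong[OF refl])
    fix \<sigma> assume \<sigma>: "\<sigma> \<in> ?S"
    define \<alpha> where "\<alpha> j = {(fst j, 0), (fst j, Suc (snd j))}" for j :: "(int \<times> int) \<times> nat"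
    define \<beta> where "\<beta> j = {(fst j, Suc (snd j)), (fst j + (1, \<sigma> (fst j)), 0)}" for j :: "(int \<times> int) \<times> nat"
    have mem: "\<alpha> j \<in> pairs V" "\<beta> j \<in> pairs V" if "j \<in> Z \<times> {..<J}" for j
    proof -
      have j: "fst j \<in> Z" "snd j < J" using that by auto
      have "\<sigma> (fst j) \<in> T" using \<sigma> j by auto
      from inV(1)[OF j(1)] inV(2)[OF j] inV(3)[OF j(1) this]
      show "\<alpha> j \<in> pairs V" "\<beta> j \<in> pairs V" unfolding \<alpha>_def \<beta>_def by simp_all
    qed
    have key: "j = j'" if "(fst j, Suc (snd j)) = (fst j', Suc (snd j'))" for j j' :: "(int \<times> int) \<times> nat"
      using that by (simp add: prod_eq_iff)
    have "bsum (pairs V) (\<lambda>_. c) (\<lambda>E. of_bool (\<forall>j\<in>Z \<times> {..<J}. \<not> (\<alpha> j \<in> E \<and> \<beta> j \<in> E))) = (1 - c\<^sup>2) ^ card (Z \<times> {..<J})"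
    proof (rule bsum_avoid_pairs)
      show "finite (Z \<times> {..<J})" using Z by simp
      show "finite (pairs V)" by (rule finite_pairs[OF V])
      show "\<alpha> ` (Z \<times> {..<J}) \<subseteq> pairs V" "\<beta> ` (Z \<times> {..<J}) \<subseteq> pairs V" using mem by blast+
      show "inj_on \<alpha> (Z \<times> {..<J})"
        by (rule inj_onI, rule key) (simp only: \<alpha>_def doubleton_eq_iff, simp)
      show "inj_on \<beta> (Z \<times> {..<J})"
        by (rule inj_onI, rule key) (simp only: \<beta>_def doubleton_eq_iff, simp)
      show "\<alpha> ` (Z \<times> {..<J}) \<inter> \<beta> ` (Z \<times> {..<J}) = {}"
      proof (rule equals0I)
        fix e assume "e \<in> \<alpha> ` (Z \<times> {..<J}) \<inter> \<beta> ` (Z \<times> {..<J})"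
        then obtain j j' where "\<alpha> j = \<beta> j'" by (metis IntE imageE)
        then have "fst j = fst j' + (1, \<sigma> (fst j')) \<and> fst j = fst j'"
          unfolding \<alpha>_def \<beta>_def doubleton_eq_iff prod.inject by (elim disjE conjE) (simp, (intro conjI; assumption))
        then have "fst (fst j') = fst (fst j' + (1, \<sigma> (fst j')))" by argo
        then show False by simp
      qed
    qed
    then show "bsum (pairs V) (\<lambda>_. c) (?f \<sigma>) = (1 - c\<^sup>2) ^ (card Z * J)"
      unfolding \<alpha>_def \<beta>_def by (simp only: card_cartesian_product card_lessThan)
  qed
  also have "\<dots> = (3 * (1 - c\<^sup>2) ^ J) ^ card Z"
    using Z by (simp add: card_PiE T_def power_mult_distrib power_mult[symmetric] mult.commute)
  finally have "bsum (pairs V) (wt (\<lambda>x y. c) (\<lambda>_. 0::pt)) (\<lambda>E. of_bool (P E)) \<le> (3 * (1 - c\<^sup>2) ^ J) ^ card Z" .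
  from ennreal_leI[OF this] show ?thesis unfolding e[symmetric] unfolding P_def .
qed

text \<open>A count above \<open>J\<close> ensures that the hub and all \<open>J\<close> relays are
  present.\<close>

definition bad_site :: "nat \<Rightarrow> real \<Rightarrow> int \<times> int \<Rightarrow> rcm_sample set" where
  "bad_site J c z = {\<omega>. fst \<omega> z \<le> J \<or> isolated_hub J (const_edges c (snd (snd \<omega>))) z}"

text \<open>Counts and edge variables are independent. Splitting \<open>Z\<close> into the sites
  with too few points and the rest gives 2^|Z| cases of probability at most (1/72)^|Z| each, hence
  1/36 per site.\<close>

lemma bad_sites_prob:
  assumes c: "0 \<le> c" "c \<le> 1" and J: "3 * (1 - c\<^sup>2) ^ J \<le> 1 / 72"
    and \<nu>: "measure (measure_pmf (poisson_pmf lam)) {..J} \<le> 1 / 72"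
  shows "bad_site J c z \<in> sets (RCM_space lam)"
    and "finite Z \<Longrightarrow> measure (RCM_space lam) {\<omega>\<in>space (RCM_space lam). \<forall>z\<in>Z. \<omega> \<in> bad_site J c z} \<le> (1 / 36) ^ card Z"
proof -
  let ?N = "PiM UNIV (\<lambda>_::int \<times> int. measure_pmf (poisson_pmf lam))" and ?P = "PiM UNIV (\<lambda>l::lab. unif (cell (fst l)))"
  interpret N: prob_space ?N by (rule prob_N)
  interpret P: prob_space ?P by (rule prob_pos)
  interpret U: prob_space Umeas by (rule prob_U)
  interpret PU: prob_space "?P \<Otimes>\<^sub>M Umeas" by (intro prob_pair prob_pos prob_U)
  interpret R: prob_space "RCM_space lam" by (rule prob_RCM)
  interpret pN: product_prob_space "\<lambda>_::int \<times> int. measure_pmf (poisson_pmf lam)" UNIV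
    by (intro product_prob_spaceI prob_space_measure_pmf)
  define A where "A Z = {N \<in> space ?N. \<forall>z\<in>Z. N z \<in> {..J}}" for Z
  define C where "C Z = {U \<in> space Umeas. \<forall>z\<in>Z. isolated_hub J (const_edges c U) z}" for Z
  have sU: "space Umeas = UNIV" by (simp add: Umeas_def space_PiM)
  have Am: "A Z \<in> sets ?N" if "finite Z" for Z
    unfolding A_def using that by (intro sets.sets_Collect_finite_All) auto
  have Cm: "C Z \<in> sets Umeas" if "finite Z" for Z
    unfolding C_def by (intro sets.sets_Collect_finite_All that isolated_hub_measurable)
  define Q where "Q Z Z' = A Z \<times> (space ?P \<times> C Z')" for Z Z'
  have Qm: "Q Z Z' \<in> sets (RCM_space lam)" if "finite Z" "finite Z'" for Z Z'
    unfolding Q_def RCM_space_alt by (intro pair_measureI Am Cm that sets.top)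
  have bs: "bad_site J c z = Q {z} {} \<union> Q {} {z}" for z
    unfolding bad_site_def Q_def A_def C_def by (auto simp: space_PiM sU)
  show "bad_site J c z \<in> sets (RCM_space lam)" unfolding bs by (intro sets.Un Qm) auto
  assume Z: "finite Z"
  have Qp: "measure (RCM_space lam) (Q Z1 Z2) \<le> (1 / 72) ^ (card Z1 + card Z2)" if "finite Z1" "finite Z2" for Z1 Z2
  proof -
    have "emeasure (RCM_space lam) (Q Z1 Z2) = emeasure ?N (A Z1) * (emeasure ?P (space ?P) * emeasure Umeas (C Z2))"
      unfolding Q_def RCM_space_alt using Am[OF that(1)] Cm[OF that(2)]
      by (simp add: PU.emeasure_pair_measure_Times U.emeasure_pair_measure_Times)
    also have "\<dots> = emeasure ?N (A Z1) * emeasure Umeas (C Z2)" by (simp add: P.emeasure_space_1)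
    also have "emeasure ?N (A Z1) = (\<Prod>z\<in>Z1. emeasure (measure_pmf (poisson_pmf lam)) {..J})"
      unfolding A_def by (rule pN.emeasure_PiM_Collect) (use that in auto)
    also have "\<dots> \<le> ennreal ((1 / 72) ^ card Z1)"
      using \<nu> by (simp add: measure_pmf.emeasure_eq_measure ennreal_power power_mono ennreal_leI)
    also have "emeasure Umeas (C Z2) \<le> ennreal ((3 * (1 - c\<^sup>2) ^ J) ^ card Z2)"
      unfolding C_def by (rule isolated_hubs_prob[OF c that(2)])
    also have "\<dots> \<le> ennreal ((1 / 72) ^ card Z2)"
      using J c by (intro ennreal_leI power_mono) (auto simp: power_le_one)
    finally have "emeasure (RCM_space lam) (Q Z1 Z2) \<le> ennreal ((1 / 72) ^ card Z1) * ennreal ((1 / 72) ^ card Z2)"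
      by (simp add: mult_left_mono mult_right_mono)
    also have "\<dots> = ennreal ((1 / 72) ^ (card Z1 + card Z2))" by (simp add: ennreal_mult[symmetric] power_add)
    finally show ?thesis by (simp add: R.emeasure_eq_measure)
  qed
  have sub: "{\<omega>\<in>space (RCM_space lam). \<forall>z\<in>Z. \<omega> \<in> bad_site J c z} \<subseteq> (\<Union>Z1\<in>Pow Z. Q Z1 (Z - Z1))"
  proof
    fix \<omega> assume w: "\<omega> \<in> {\<omega>\<in>space (RCM_space lam). \<forall>z\<in>Z. \<omega> \<in> bad_site J c z}"
    define Z1 where "Z1 = {z\<in>Z. fst \<omega> z \<le> J}"
    have "\<omega> \<in> Q Z1 (Z - Z1)" using w
      by (cases \<omega>) (auto simp: Q_def A_def C_def Z1_def bad_site_def space_PiM sU)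
    then show "\<omega> \<in> (\<Union>Z1\<in>Pow Z. Q Z1 (Z - Z1))" by (auto simp: Z1_def)
  qed
  have "measure (RCM_space lam) {\<omega>\<in>space (RCM_space lam). \<forall>z\<in>Z. \<omega> \<in> bad_site J c z} \<le> measure (RCM_space lam) (\<Union>Z1\<in>Pow Z. Q Z1 (Z - Z1))"
    using Z by (intro R.finite_measure_mono sub sets.finite_UN Qm) (auto intro: finite_subset)
  also have "\<dots> \<le> (\<Sum>Z1\<in>Pow Z. measure (RCM_space lam) (Q Z1 (Z - Z1)))"
    using Z by (intro R.finite_measure_subadditive_finite) (auto intro!: Qm intro: finite_subset)
  also have "\<dots> \<le> (\<Sum>Z1\<in>Pow Z. (1 / 72) ^ card Z)"
  proof (rule sum_mono)
    fix Z1 assume Z1: "Z1 \<in> Pow Z"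
    then have f: "finite Z1" "finite (Z - Z1)" using Z finite_subset[of Z1 Z] by auto
    have "card Z1 + card (Z - Z1) = card Z" using Z1 f Z by (simp add: card_Diff_subset card_mono)
    then show "measure (RCM_space lam) (Q Z1 (Z - Z1)) \<le> (1 / 72) ^ card Z" using Qp[OF f] by simp
  qed
  also have "\<dots> = (1 / 36) ^ card Z" using Z by (simp add: card_Pow power_mult_distrib[symmetric])
  finally show "measure (RCM_space lam) {\<omega>\<in>space (RCM_space lam). \<forall>z\<in>Z. \<omega> \<in> bad_site J c z} \<le> (1 / 36) ^ card Z" .
qed

lemma cell_dist:
  assumes "x \<in> cell z" "y \<in> cell z'" "z' = z \<or> (\<exists>s\<in>{-1, 0, 1}. z' = z + (1, s))"
  shows "dist x y \<le> 4"
proof -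
  have "\<bar>fst x - fst y\<bar> \<le> 2 \<and> \<bar>snd x - snd y\<bar> \<le> 2"
    using assms by (cases z; cases x; cases y) (auto simp: cell_def cbox_Pair_eq)
  then show ?thesis using dist_pt_le[of x y] by linarith
qed

text \<open>On an open Lipschitz graph each hub reaches the next one through a relay, because all
  distances within a cell and between the cells concerned are at most 4.\<close>

lemma infinite_component_of_open_ray:
  assumes gw: "good \<omega>" and g: "\<And>r. 0 \<le> r \<Longrightarrow> r \<le> 4 \<Longrightarrow> c \<le> g r"
    and F: "\<And>x. (x, F x) \<notin> {z. \<omega> \<in> bad_site J c z}" "\<And>x. F (x + 1) - F x \<in> {-1, 0, 1}"
  shows "has_infinite_component g \<omega>"
proof -
  have adj: "rcm_adj g \<omega> l l'" if "{l, l'} \<in> const_edges c (snd (snd \<omega>))" "present \<omega> l" "present \<omega> l'" "l \<noteq> l'"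
     "dist (position \<omega> l) (position \<omega> l') \<le> 4" for l l'
  proof -
    have "{l, l'} \<in> redges (\<lambda>_. c) (fst (snd \<omega>)) (snd (snd \<omega>))" using that(1) by (simp add: const_edges_def redges_def)
    then have "rcm_adj (\<lambda>_. c) \<omega> l l'" unfolding rcm_adj_iff using that by blast
    moreover have "c \<le> g (dist (position \<omega> l) (position \<omega> l'))" using that by (intro g) auto
    ultimately show ?thesis unfolding rcm_adj_def by (elim conjE) (intro conjI, assumption+, linarith)
  qed
  define hub where "hub n = ((int n, F (int n)), 0::nat)" for n :: nat
  have pres: "i \<le> J \<Longrightarrow> present \<omega> ((x, F x), i)" for x i
    using F(1)[of x] by (simp add: present_def bad_site_def)
  have step: "(rcm_adj g \<omega>)\<^sup>*\<^sup>* (hub n) (hub (Suc n))" for n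
  proof -
    let ?z = "(int n, F (int n))"
    define s where "s = F (int n + 1) - F (int n)"
    have s: "s \<in> {-1, 0, 1}" unfolding s_def by (rule F(2))
    have zs: "?z + (1, s) = (int n + 1, F (int n + 1))" by (simp add: s_def)
    have "\<not> isolated_hub J (const_edges c (snd (snd \<omega>))) ?z" using F(1)[of "int n"] by (simp add: bad_site_def)
    then obtain i where i: "i < J" "{(?z, 0), (?z, Suc i)} \<in> const_edges c (snd (snd \<omega>))"
        "{(?z, Suc i), (?z + (1, s), 0)} \<in> const_edges c (snd (snd \<omega>))"
      unfolding isolated_hub_def using s by blast
    have gd: "position \<omega> (z, j) \<in> cell z" for z j using gw[unfolded good_def, THEN spec, of "(z, j)"] by simp
    have "rcm_adj g \<omega> (?z, 0) (?z, Suc i)"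
      by (rule adj[OF i(2)]) (use i(1) in \<open>auto intro!: pres cell_dist[OF gd gd]\<close>)
    moreover have "rcm_adj g \<omega> (?z, Suc i) (?z + (1, s), 0)"
    proof (rule adj[OF i(3)])
      show "present \<omega> (?z, Suc i)" using i(1) by (intro pres) simp
      show "present \<omega> (?z + (1, s), 0)" unfolding zs by (rule pres) simp
      show "dist (position \<omega> (?z, Suc i)) (position \<omega> (?z + (1, s), 0)) \<le> 4" by (rule cell_dist[OF gd gd]) (use s in blast)
    qed simp
    ultimately show ?thesis unfolding zs hub_def by (simp add: add.commute)
  qed
  have path: "(rcm_adj g \<omega>)\<^sup>*\<^sup>* (hub 0) (hub n)" for n
    by (induction n) (auto intro: rtranclp_trans step)
  have "inj hub" by (auto simp: inj_def hub_def)
  then have "infinite (range hub)" by (simp add: finite_image_iff)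
  moreover have "range hub \<subseteq> {l'. (rcm_adj g \<omega>)\<^sup>*\<^sup>* (hub 0) l'}" using path by blast
  ultimately have "infinite {l'. (rcm_adj g \<omega>)\<^sup>*\<^sup>* (hub 0) l'}" using infinite_super by blast
  moreover have "present \<omega> (hub 0)" unfolding hub_def by (rule pres) simp
  ultimately show ?thesis unfolding has_infinite_component_def by blast
qed

lemma poisson_lower_tail: "((\<lambda>lam. measure (measure_pmf (poisson_pmf lam)) {..J}) \<longlongrightarrow> 0) at_top"
proof -
  have "((\<lambda>lam::real. \<Sum>k\<le>J. (lam ^ k / exp lam) / fact k) \<longlongrightarrow> (\<Sum>k\<le>J. 0 / fact k)) at_top"
    by (rule tendsto_sum, rule tendsto_divide[OF tendsto_power_div_exp_0 tendsto_const]) simp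
  moreover have "\<forall>\<^sub>F lam in at_top. (\<Sum>k\<le>J. (lam ^ k / exp lam) / fact k) = measure (measure_pmf (poisson_pmf lam)) {..J}"
    using eventually_gt_at_top[of 0]
  proof (eventually_elim)
    case (elim lam)
    then show ?case by (simp add: measure_measure_pmf_finite exp_minus field_simps)
  qed
  ultimately have "((\<lambda>lam. measure (measure_pmf (poisson_pmf lam)) {..J}) \<longlongrightarrow> (\<Sum>k\<le>J. 0 / fact k)) at_top"
    by (rule Lim_transform_eventually)
  then show ?thesis by simp
qed

text \<open>First \<open>J\<close> is chosen from \<open>c\<close>, so that relays rarely fail all
  together; then the intensity is chosen so large that cells with at most \<open>J\<close> points
  are rare.\<close>

theorem percolates_high_intensity:
  assumes c: "0 < c" "c \<le> 1" and g: "\<And>r. 0 \<le> r \<Longrightarrow> r \<le> 4 \<Longrightarrow> c \<le> g r"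
  shows "\<exists>lam0>0. \<forall>lam\<ge>lam0. percolates lam g"
proof -
  have "(\<lambda>J. 3 * (1 - c\<^sup>2) ^ J) \<longlonglongrightarrow> 3 * 0"
  proof (intro tendsto_mult tendsto_const LIMSEQ_power_zero)
    have "0 < c\<^sup>2" "c\<^sup>2 \<le> 1" using c by (simp_all add: power_le_one)
    then show "norm (1 - c\<^sup>2) < 1" by simp
  qed
  then have "\<forall>\<^sub>F J in sequentially. 3 * (1 - c\<^sup>2) ^ J < 1 / 72" by (rule order_tendstoD(2)) simp
  then obtain J where J: "3 * (1 - c\<^sup>2) ^ J < 1 / 72" by (auto simp: eventually_sequentially)
  have "\<forall>\<^sub>F lam in at_top. measure (measure_pmf (poisson_pmf lam)) {..J} < 1 / 72"
    by (rule order_tendstoD(2)[OF poisson_lower_tail]) simp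
  then obtain lam0 where lam0: "\<And>lam. lam \<ge> lam0 \<Longrightarrow> measure (measure_pmf (poisson_pmf lam)) {..J} < 1 / 72"
    by (auto simp: eventually_at_top_linorder)
  have "percolates lam g" if "lam \<ge> max lam0 1" for lam
    unfolding percolates_def
  proof
    interpret prob_space "RCM_space lam" by (rule prob_RCM)
    assume no: "AE \<omega> in RCM_space lam. \<not> has_infinite_component g \<omega>"
    have \<nu>: "measure (measure_pmf (poisson_pmf lam)) {..J} \<le> 1 / 72" using lam0[of lam] that by simp
    note bp = bad_sites_prob[OF less_imp_le[OF c(1)] c(2) less_imp_le[OF J] \<nu>]
    have bd: "AE \<omega> in RCM_space lam. \<forall>x. bdd_above {y. reach {z. \<omega> \<in> bad_site J c z} (x, y)}"
      by (rule AE_reach_bounded[OF prob_RCM bp(1)]) (rule bp(2))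
    have "AE \<omega> in RCM_space lam. False"
      using no AE_good bd
    proof (eventually_elim)
      case (elim \<omega>)
      obtain F where "\<forall>x. (x, F x) \<notin> {z. \<omega> \<in> bad_site J c z} \<and> F (x + 1) - F x \<in> {-1, 0, 1}"
        using lipschitz_open_ray[of "{z. \<omega> \<in> bad_site J c z}"] elim(3) by blast
      then have "has_infinite_component g \<omega>"
        by (intro infinite_component_of_open_ray[OF elim(2), where c=c and J=J and F=F]) (auto intro: g)
      then show ?case using elim(1) by simp
    qed
    then show False using AE_False by simp
  qed
  then show ?thesis by (intro exI[of _ "max lam0 1"]) auto
qed

section \<open>Critical intensities\<close>

lemma vimage_sq: "0 < a \<Longrightarrow> (\<lambda>x. a *\<^sub>R x) -` (- sq t) = - sq (t / a)"
proof -
  assume a: "0 < a"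
  have "a * u \<le> t \<longleftrightarrow> u \<le> t / a" "- t \<le> a * u \<longleftrightarrow> - (t / a) \<le> u" for u
    using a by (simp_all add: field_simps)
  then show ?thesis by (auto simp: sq_def cbox_Pair_eq mem_Times_iff)
qed

lemma vimage_square_cbox:
  assumes "0 < a"
  shows "(\<lambda>x. a *\<^sub>R x) -` cbox (a *\<^sub>R z) (a *\<^sub>R z + (a * \<epsilon>, a * \<epsilon>)) = cbox z (z + (\<epsilon>, \<epsilon>))"
proof -
  have "a * v \<le> a * u \<longleftrightarrow> v \<le> u" "a * u \<le> a * v + a * \<epsilon> \<longleftrightarrow> u \<le> v + \<epsilon>" for u v
    using assms by (simp_all add: distrib_left[symmetric])
  then show ?thesis by (cases z) (auto simp: cbox_Pair_eq mem_Times_iff)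
qed

lemma percolates_imp_PB:
  assumes k: "profile k" and a: "0 < a" and lam: "0 < lam" and v: "0 < v" and perc: "percolates lam (\<lambda>r. k (a * r))"
  obtains S \<delta> r where "S \<in> sets borel" "S \<subseteq> sq (real r)" "emeasure lborel S \<le> ennreal v" "0 < \<delta>"
    "\<forall>t. \<exists>b. 0 < b \<and> t \<le> b \<and> ennreal \<delta> \<le> PB (lam / a\<^sup>2) k b S t"
proof -
  \<comment> \<open>The source square has area \<open>v\<close> after the dilation by
    \<open>a\<close>.\<close>
  define \<epsilon> where "\<epsilon> = sqrt v / a"
  have \<epsilon>: "0 < \<epsilon>" "a * \<epsilon> = sqrt v" using a v by (simp_all add: \<epsilon>_def)
  have [measurable]: "k \<in> borel_measurable borel" using k by (simp add: profile_def)
  have k': "profile (\<lambda>r. k (a * r))" using k by (auto simp: profile_def)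
  obtain z \<delta> where \<delta>: "0 < \<delta>" and
    E: "\<And>t. \<exists>L. ennreal \<delta> \<le> emeasure (RCM_space lam) (Ev (\<lambda>r. k (a * r)) (Kc L) (cbox z (z + (\<epsilon>, \<epsilon>))) (- sq (real t)))"
    using percolates_imp_Ev[OF k' \<epsilon>(1) perc] by blast
  define S where "S = cbox (a *\<^sub>R z) (a *\<^sub>R z + (a * \<epsilon>, a * \<epsilon>))"
  have S: "S \<in> sets borel" by (simp add: S_def)
  have Sv: "(\<lambda>x. a *\<^sub>R x) -` S = cbox z (z + (\<epsilon>, \<epsilon>))" unfolding S_def by (rule vimage_square_cbox[OF a])
  have vol: "emeasure lborel S \<le> ennreal v"
    unfolding S_def \<epsilon>(2) using emeasure_cbox_prod[of "a * fst z" "a * fst z + sqrt v" "a * snd z" "a * snd z + sqrt v"] v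
    by (cases z) simp
  obtain r :: nat where r: "\<bar>a * fst z\<bar> + \<bar>a * snd z\<bar> + sqrt v \<le> real r" using real_arch_simple by blast
  have "0 \<le> sqrt v" using v by simp
  then have Ssub: "S \<subseteq> sq (real r)"
    using r unfolding S_def \<epsilon>(2) sq_def by (cases z) (auto simp: cbox_Pair_eq)
  have "\<exists>b. 0 < b \<and> t \<le> b \<and> ennreal \<delta> \<le> PB (lam / a\<^sup>2) k b S t" for t
  proof -
    obtain t' :: nat where t': "t / a \<le> real t'" using real_arch_simple by blast
    obtain L where L: "ennreal \<delta> \<le> emeasure (RCM_space lam) (Ev (\<lambda>r. k (a * r)) (Kc L) (cbox z (z + (\<epsilon>, \<epsilon>))) (- sq (real t')))"
      using E by blast
    define M where "M = Suc (max L t')"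
    have "- sq (real t') \<subseteq> - sq (t / a)" using t' by (auto simp: sq_def cbox_Pair_eq)
    then have "Ev (\<lambda>r. k (a * r)) (Kc L) (cbox z (z + (\<epsilon>, \<epsilon>))) (- sq (real t')) \<subseteq> Ev (\<lambda>r. k (a * r)) (Kc M) (cbox z (z + (\<epsilon>, \<epsilon>))) (- sq (t / a))"
      by (intro Ev_mono Kc_mono) (simp_all add: M_def)
    then have "ennreal \<delta> \<le> emeasure (RCM_space lam) (Ev (\<lambda>r. k (a * r)) (Kc M) (cbox z (z + (\<epsilon>, \<epsilon>))) (- sq (t / a)))"
      by (intro order_trans[OF L] emeasure_mono Ev_sets[OF k']) auto
    also have "\<dots> = PB (lam / a\<^sup>2) k (a * real M) S t"
      using bridge[OF k a _ lam S, of M t] unfolding Sv vimage_sq[OF a] by (simp add: M_def)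
    finally have 1: "ennreal \<delta> \<le> PB (lam / a\<^sup>2) k (a * real M) S t" .
    have "t \<le> real t' * a" using t' a by (simp add: pos_divide_le_eq)
    also have "\<dots> \<le> real M * a" using a by (intro mult_right_mono) (auto simp: M_def)
    finally have "t \<le> a * real M" by (simp add: mult.commute)
    moreover have "0 < a * real M" using a by (simp add: M_def)
    ultimately show ?thesis using 1 by blast
  qed
  then show ?thesis by (intro that[OF S Ssub vol \<delta>] allI)
qed

lemma PB_imp_percolates:
  assumes k: "profile k" and a: "0 < a" and lam: "0 < lam" and S: "S \<in> sets borel" "S \<subseteq> sq (real r)" and \<delta>: "0 < \<delta>"
    and H: "\<And>t. \<exists>b>0. ennreal \<delta> \<le> PB (lam / a\<^sup>2) k b S t"
  shows "percolates lam (\<lambda>r. k (a * r))"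
proof -
  have [measurable]: "k \<in> borel_measurable borel" using k by (simp add: profile_def)
  have k': "profile (\<lambda>r. k (a * r))" using k by (auto simp: profile_def)
  obtain r' :: nat where r': "real r / a \<le> real r'" using real_arch_simple by blast
  have Sm: "(\<lambda>x. a *\<^sub>R x) -` S \<in> sets borel"
  proof -
    have "(\<lambda>x::pt. a *\<^sub>R x) \<in> borel_measurable borel" by measurable
    from measurable_sets[OF this S(1)] show ?thesis by simp
  qed
  have "(\<lambda>x. a *\<^sub>R x) -` S \<subseteq> sq (real r')"
  proof -
    have "- sq (real r') \<subseteq> - sq (real r / a)" using r' by (auto simp: sq_def cbox_Pair_eq)
    also have "\<dots> = (\<lambda>x. a *\<^sub>R x) -` (- sq (real r))" by (rule vimage_sq[OF a, symmetric])
    also have "\<dots> \<subseteq> (\<lambda>x. a *\<^sub>R x) -` (- S)" using S(2) by blast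
    finally show ?thesis by blast
  qed
  moreover have "\<exists>L. ennreal \<delta> \<le> emeasure (RCM_space lam) (Ev (\<lambda>r. k (a * r)) (Kc L) ((\<lambda>x. a *\<^sub>R x) -` S) (- sq (real t)))" for t
  proof -
    obtain b where b: "0 < b" "ennreal \<delta> \<le> PB (lam / a\<^sup>2) k b S (a * real t)" using H by blast
    obtain L :: nat where L: "b / a \<le> real L" using real_arch_simple by blast
    have bL: "b \<le> a * real L" using L a by (simp add: pos_divide_le_eq mult.commute)
    have L0: "0 < L" using b(1) bL by (intro gr0I) simp
    have "0 < lam / a\<^sup>2" using lam a by simp
    \<comment> \<open>The box is enlarged to half-side \<open>a * real L\<close>, the size at which
      \<open>bridge\<close> applies.\<close>
    from PB_mono_box[OF k S(1) this b(1) bL, of "a * real t"] b(2)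
    have "ennreal \<delta> \<le> PB (lam / a\<^sup>2) k (a * real L) S (a * real t)" by (rule order_trans[rotated])
    also have "\<dots> = emeasure (RCM_space lam) (Ev (\<lambda>r. k (a * r)) (Kc L) ((\<lambda>x. a *\<^sub>R x) -` S) (- sq (real t)))"
      using bridge[OF k a L0 lam S(1), of "a * real t"] a unfolding vimage_sq[OF a] by simp
    finally show ?thesis by blast
  qed
  ultimately show ?thesis by (intro Ev_imp_percolates[OF k' Sm _ \<delta>]) auto
qed

text \<open>The connection function is taken on the whole line, where it is monotone throughout. Its
  value at the end \<open>R\<close> of the range is left open.\<close>

locale finite_range =
  fixes k :: "real \<Rightarrow> real" and R :: real
  assumes k: "profile k" and anti: "\<And>u v. u \<le> v \<Longrightarrow> k v \<le> k u" and R: "0 < R"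
    and kpos: "\<And>r. r < R \<Longrightarrow> 0 < k r" and kzero: "\<And>r. R < r \<Longrightarrow> k r = 0"
begin

definition subcritical :: "real \<Rightarrow> real set" where
  "subcritical s = {lam. 0 < lam \<and> \<not> percolates lam (\<lambda>r. s * k (sqrt s * r))}"

lemma k01: "0 \<le> k r" "k r \<le> 1" using k by (auto simp: profile_def)

lemma profile_mult: "0 \<le> s \<Longrightarrow> s \<le> 1 \<Longrightarrow> profile (\<lambda>r. s * k r)"
  using k k01 by (auto simp: profile_def mult_le_one)

text \<open>The box model \<open>PB\<close> carries percolation from one spatial scale to another,
  with intensities proportional to the squares of the scales. So it is enough to percolate at a
  scale for which \<open>percolates_high_intensity\<close> applies.\<close>

lemma subcritical_bounded:
  assumes s: "0 < s" "s \<le> 1"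
  shows "bdd_above (subcritical s)"
proof -
  \<comment> \<open>Distances up to 4 become at most R/2, where the profile is at least its positive
    value at R/2.\<close>
  define a where "a = R / 8"
  have a: "0 < a" using R by (simp add: a_def)
  have c: "0 < s * k (R / 2)" "s * k (R / 2) \<le> 1" using s kpos[of "R / 2"] R k01 by (auto simp: mult_le_one)
  have "s * k (R / 2) \<le> s * k (a * r)" if "0 \<le> r" "r \<le> 4" for r
  proof -
    have "a * r \<le> a * 4" using that a by (intro mult_left_mono) auto
    then show ?thesis using s by (intro mult_left_mono anti) (auto simp: a_def)
  qed
  then obtain lam0 where lam0: "0 < lam0" "\<And>lam. lam0 \<le> lam \<Longrightarrow> percolates lam (\<lambda>r. s * k (a * r))"
    using percolates_high_intensity[OF c, of "\<lambda>r. s * k (a * r)"] by blast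
  have ks: "profile (\<lambda>r. s * k r)" using s by (intro profile_mult) auto
  have "percolates \<mu> (\<lambda>r. s * k (sqrt s * r))" if \<mu>: "lam0 / a\<^sup>2 * s \<le> \<mu>" for \<mu>
  proof -
    define lam where "lam = \<mu> / s * a\<^sup>2"
    have "lam0 / a\<^sup>2 \<le> \<mu> / s" using \<mu> s by (simp only: pos_le_divide_eq)
    then have l: "lam0 \<le> lam" using a unfolding lam_def by (simp add: pos_divide_le_eq)
    then have lp: "0 < lam" using lam0 by linarith
    have eq: "lam / a\<^sup>2 = \<mu> / (sqrt s)\<^sup>2" using a s by (simp add: lam_def)
    have "0 < lam0 / a\<^sup>2 * s" using lam0 a s by simp
    then have \<mu>p: "0 < \<mu>" using \<mu> by linarith
    have ls: "percolates lam (\<lambda>r. (\<lambda>r. s * k r) (a * r))" using lam0(2)[OF l] .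
    obtain S \<delta> r where S: "S \<in> sets borel" "S \<subseteq> sq (real r)" "0 < \<delta>" "\<forall>t. \<exists>b. 0 < b \<and> t \<le> b \<and> ennreal \<delta> \<le> PB (lam / a\<^sup>2) (\<lambda>r. s * k r) b S t"
      by (rule percolates_imp_PB[OF ks a lp zero_less_one ls]) (rule that; assumption)
    show ?thesis
    proof (rule PB_imp_percolates[OF ks _ \<mu>p S(1,2,3)])
      show "0 < sqrt s" using s by simp
      show "\<exists>b>0. ennreal \<delta> \<le> PB (\<mu> / (sqrt s)\<^sup>2) (\<lambda>r. s * k r) b S t" for t using S(4)[rule_format, of t] unfolding eq by blast
    qed
  qed
  moreover have "x \<le> lam0 / a\<^sup>2 * s" if "\<not> lam0 / a\<^sup>2 * s \<le> x" for x using that by linarith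
  ultimately show ?thesis by (intro bdd_aboveI[of _ "lam0 / a\<^sup>2 * s"]) (unfold subcritical_def mem_Collect_eq, blast)
qed

text \<open>The integral of s k(sqrt(s) |y|) over the plane does not depend on \<open>s\<close>, so
  path counting gives the same bound for every \<open>s\<close>.\<close>

lemma subcritical_contains:
  assumes s: "0 < s" "s \<le> 1" and c: "(\<integral>\<^sup>+r. ennreal (2 * pi * r) * (ennreal (k r) * indicator {0..} r) \<partial>lborel) = ennreal c" "0 \<le> c"
    and lam: "0 < lam" "lam * c < 1"
  shows "lam \<in> subcritical s"
proof -
  have [measurable]: "k \<in> borel_measurable borel" using k by (simp add: profile_def)
  have ks: "profile (\<lambda>r. s * k (sqrt s * r))" using s k01 by (auto simp: profile_def mult_le_one)
  have sq: "0 < sqrt s" using s by simp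
  have zero: "s * k (sqrt s * r) = 0" if "R / sqrt s < r" for r
    using that sq by (simp add: kzero pos_divide_less_eq mult.commute)
  have anti': "s * k (sqrt s * v) \<le> s * k (sqrt s * u)" if "u \<le> v" for u v
    using s that by (intro mult_left_mono anti) auto
  have "(\<integral>\<^sup>+y. ennreal (s * k (sqrt s * norm (y::pt))) \<partial>lborel) = (\<integral>\<^sup>+r. ennreal (2 * pi * r) * (ennreal (s * k (sqrt s * r)) * indicator {0..} r) \<partial>lborel)"
    by (rule nn_integral_radial[where k="\<lambda>r. s * k (sqrt s * r)" and R="R / sqrt s"]) (rule anti' zero; assumption)+
  also have "\<dots> = (\<integral>\<^sup>+r. ennreal (sqrt s) * (ennreal (2 * pi * (0 + sqrt s * r)) * (ennreal (k (0 + sqrt s * r)) * indicator {0..} (0 + sqrt s * r))) \<partial>lborel)"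
  proof (rule nn_integral_cong)
    fix r :: real
    show "ennreal (2 * pi * r) * (ennreal (s * k (sqrt s * r)) * indicator {0..} r) =
      ennreal (sqrt s) * (ennreal (2 * pi * (0 + sqrt s * r)) * (ennreal (k (0 + sqrt s * r)) * indicator {0..} (0 + sqrt s * r)))"
    proof (cases "0 \<le> r")
      case True
      have "2 * pi * r * (s * k (sqrt s * r)) = sqrt s * (2 * pi * (sqrt s * r) * k (sqrt s * r))"
        using s by (simp add: mult_ac)
      then show ?thesis using True s k01 by (simp add: ennreal_mult[symmetric])
    next
      case False
      then have "\<not> 0 \<le> sqrt s * r" using sq by (simp add: zero_le_mult_iff)
      then show ?thesis using False by simp
    qed
  qed
  also have "\<dots> = ennreal (sqrt s) * (\<integral>\<^sup>+r. ennreal (2 * pi * (0 + sqrt s * r)) * (ennreal (k (0 + sqrt s * r)) * indicator {0..} (0 + sqrt s * r)) \<partial>lborel)"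
    by (rule nn_integral_cmult) measurable
  also have "\<dots> = (\<integral>\<^sup>+r. ennreal (2 * pi * r) * (ennreal (k r) * indicator {0..} r) \<partial>lborel)"
    using sq nn_integral_real_affine[of "\<lambda>r. ennreal (2 * pi * r) * (ennreal (k r) * indicator {0..} r)" "sqrt s" 0] by simp
  also note c(1)
  finally have "(\<integral>\<^sup>+y. ennreal (s * k (sqrt s * norm (y::pt))) \<partial>lborel) = ennreal c" .
  moreover have "0 < R / sqrt s" using R sq by simp
  ultimately have "\<not> percolates lam (\<lambda>r. s * k (sqrt s * r))"
    using no_percolation[OF ks _ _ lam(1) _ c(2) lam(2), of "R / sqrt s"] zero by blast
  then show ?thesis using lam by (simp add: subcritical_def)
qed

text \<open>Both models are compared in coordinates where the range is \<open>R\<close>, at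
  intensities \<open>lam * \<rho> / q\<close> and \<open>lam / p\<close>. The estimate is uniform in
  boxes and targets, so it passes to infinite components.\<close>

lemma percolates_spread_out:
  assumes p: "0 < p" "p < q" "q \<le> 1" and lo: "0 < lo" "lo \<le> hi"
  shows "\<exists>\<rho>>1. \<forall>lam. lo \<le> lam \<longrightarrow> lam \<le> hi \<longrightarrow> percolates (lam * \<rho>) (\<lambda>r. q * k (sqrt q * r)) \<longrightarrow> percolates lam (\<lambda>r. p * k (sqrt p * r))"
proof -
  have "\<exists>\<rho>>1. \<forall>lam b t S. lo \<le> lam \<longrightarrow> lam \<le> hi \<longrightarrow> R / 8 \<le> t \<longrightarrow> t \<le> b \<longrightarrow> S \<in> sets borel \<longrightarrow>
    emeasure lborel S \<le> ennreal (R\<^sup>2 / 128) \<longrightarrow>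
    PB (lam * \<rho> / q) (\<lambda>r. q * k r) b S t \<le> PB (lam / p) (\<lambda>r. p * k r) b S t"
    by (rule spread_out_comparison[OF k _ R _ _ p lo]) (rule anti kpos kzero; assumption)+
  then obtain \<rho> where \<rho>: "1 < \<rho>" and cmp: "\<forall>lam b t S. lo \<le> lam \<longrightarrow> lam \<le> hi \<longrightarrow> R / 8 \<le> t \<longrightarrow> t \<le> b \<longrightarrow> S \<in> sets borel \<longrightarrow>
    emeasure lborel S \<le> ennreal (R\<^sup>2 / 128) \<longrightarrow>
    PB (lam * \<rho> / q) (\<lambda>r. q * k r) b S t \<le> PB (lam / p) (\<lambda>r. p * k r) b S t"
    by (elim exE conjE) (rule that; assumption)
  have "percolates lam (\<lambda>r. p * k (sqrt p * r))"
    if lam: "lo \<le> lam" "lam \<le> hi" and perc: "percolates (lam * \<rho>) (\<lambda>r. q * k (sqrt q * r))" for lam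
  proof -
    have kq: "profile (\<lambda>r. q * k r)" and kp: "profile (\<lambda>r. p * k r)" using p by (auto intro!: profile_mult)
    have l0: "0 < lam" "0 < lam * \<rho>" using lo lam \<rho> by auto
    have sq: "0 < sqrt q" "(sqrt q)\<^sup>2 = q" "0 < sqrt p" "(sqrt p)\<^sup>2 = p" using p by auto
    have v: "0 < R\<^sup>2 / 128" using R by simp
    have perc': "percolates (lam * \<rho>) (\<lambda>r. (\<lambda>r. q * k r) (sqrt q * r))" using perc .
    obtain S \<delta> r where S: "S \<in> sets borel" "S \<subseteq> sq (real r)" "emeasure lborel S \<le> ennreal (R\<^sup>2 / 128)" "0 < \<delta>"
        "\<forall>t. \<exists>b. 0 < b \<and> t \<le> b \<and> ennreal \<delta> \<le> PB (lam * \<rho> / q) (\<lambda>r. q * k r) b S t"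
      by (rule percolates_imp_PB[OF kq sq(1) l0(2) v perc', unfolded sq(2)]) (rule that; assumption)
    show ?thesis
    proof (rule PB_imp_percolates[OF kp sq(3) l0(1) S(1,2,4)], unfold sq(4))
      fix t
      \<comment> \<open>The comparison asks for target squares of half-side at least R/8; enlarging
        the target square only lowers the probability.\<close>
      define t' where "t' = max t (R / 8)"
      obtain b where b: "0 < b" "t' \<le> b" "ennreal \<delta> \<le> PB (lam * \<rho> / q) (\<lambda>r. q * k r) b S t'" using S(5)[rule_format, of t'] by blast
      note b(3)
      also have "PB (lam * \<rho> / q) (\<lambda>r. q * k r) b S t' \<le> PB (lam / p) (\<lambda>r. p * k r) b S t'"
        by (rule cmp[rule_format, OF lam _ b(2) S(1,3)]) (simp add: t'_def)
      also have "\<dots> \<le> PB (lam / p) (\<lambda>r. p * k r) b S t" by (rule PB_mono_target[OF kp]) (simp add: t'_def)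
      finally show "\<exists>b>0. ennreal \<delta> \<le> PB (lam / p) (\<lambda>r. p * k r) b S t" using b(1) by blast
    qed
  qed
  then show ?thesis using \<rho> by blast
qed

text \<open>The factor \<open>\<rho>\<close> is uniform on the window from \<open>lam1 / 2\<close>
  to the supremum for \<open>p\<close>. A subcritical intensity in this window that exceeds the
  supremum divided by \<open>\<rho>\<close> is, after multiplication by \<open>\<rho>\<close>,
  subcritical for \<open>q\<close> and larger than the supremum for \<open>p\<close>.\<close>

lemma Sup_subcritical_less:
  assumes p: "0 < p" "p < q" "q \<le> 1"
    and c: "(\<integral>\<^sup>+r. ennreal (2 * pi * r) * (ennreal (k r) * indicator {0..} r) \<partial>lborel) = ennreal c" "0 \<le> c"
  shows "Sup (subcritical p) < Sup (subcritical q)"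
proof -
  \<comment> \<open>A subcritical intensity, which keeps the window away from 0; the summand 1
    covers \<open>c = 0\<close>.\<close>
  define lam1 where "lam1 = 1 / (c + 1)"
  have lam1: "0 < lam1" "lam1 * c < 1" using c(2) by (simp_all add: lam1_def)
  have in1: "lam1 \<in> subcritical p" using p by (intro subcritical_contains[OF _ _ c lam1]) auto
  have bp: "bdd_above (subcritical p)" and bq: "bdd_above (subcritical q)" using p by (auto intro!: subcritical_bounded)
  have S1: "lam1 \<le> Sup (subcritical p)" by (rule cSup_upper[OF in1 bp])
  have half: "0 < lam1 / 2" "lam1 / 2 \<le> Sup (subcritical p)" using lam1 S1 by linarith+
  obtain \<rho> where \<rho>: "1 < \<rho>" and cmp: "\<And>lam. lam1 / 2 \<le> lam \<Longrightarrow> lam \<le> Sup (subcritical p) \<Longrightarrow>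
      percolates (lam * \<rho>) (\<lambda>r. q * k (sqrt q * r)) \<Longrightarrow> percolates lam (\<lambda>r. p * k (sqrt p * r))"
    using percolates_spread_out[OF p half] by blast
  have "Sup (subcritical p) / \<rho> < Sup (subcritical p)" using S1 lam1 \<rho> by (simp add: pos_divide_less_eq)
  moreover have "lam1 / 2 < Sup (subcritical p)" using S1 lam1 by linarith
  ultimately have "max (Sup (subcritical p) / \<rho>) (lam1 / 2) < Sup (subcritical p)" by simp
  then obtain lam where lam: "lam \<in> subcritical p" "Sup (subcritical p) / \<rho> < lam" "lam1 / 2 < lam"
    using less_cSup_iff[OF _ bp] in1 by (metis empty_iff max_less_iff_conj)
  have "lam * \<rho> \<in> subcritical q"
  proof -
    have "\<not> percolates (lam * \<rho>) (\<lambda>r. q * k (sqrt q * r))"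
      using cmp[of lam] cSup_upper[OF lam(1) bp] lam by (auto simp: subcritical_def)
    then show ?thesis using lam lam1 \<rho> by (simp add: subcritical_def)
  qed
  from cSup_upper[OF this bq] have "lam * \<rho> \<le> Sup (subcritical q)" .
  moreover have "Sup (subcritical p) < lam * \<rho>" using lam(2) \<rho> by (simp add: pos_divide_less_eq)
  ultimately show ?thesis by linarith
qed

lemma Sup_subcritical_ge:
  assumes s: "0 < s" "s \<le> 1"
    and c: "(\<integral>\<^sup>+r. ennreal (2 * pi * r) * (ennreal (k r) * indicator {0..} r) \<partial>lborel) = ennreal c" "0 \<le> c"
  shows "1 / c \<le> Sup (subcritical s)"
proof (cases "c = 0")
  case True
  \<comment> \<open>Here \<open>1 / c\<close> is 0, so any positive subcritical intensity proves the
    bound.\<close>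
  have "1 \<in> subcritical s" by (rule subcritical_contains[OF s c]) (simp_all add: True)
  from cSup_upper[OF this subcritical_bounded[OF s]] show ?thesis using True by simp
next
  case False
  then have cp: "0 < c" using c by simp
  show ?thesis
  proof (rule dense_le_bounded[of 0])
    show "0 < 1 / c" using cp by simp
    fix lam assume "0 < lam" "lam < 1 / c"
    then have "lam \<in> subcritical s" using cp by (intro subcritical_contains[OF s c]) (auto simp: pos_less_divide_eq)
    then show "lam \<le> Sup (subcritical s)" by (rule cSup_upper[OF _ subcritical_bounded[OF s]])
  qed
qed

end

text \<open>Distances are nonnegative, which permits \<open>f\<close> to be replaced by its monotone
  extension to the whole line.\<close>

lemma crit_intensity_cong:
  assumes "\<And>r. 0 \<le> r \<Longrightarrow> g r = h r"
  shows "crit_intensity g = crit_intensity h"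
proof -
  have "rcm_adj g = rcm_adj h" by (intro ext) (simp add: rcm_adj_def assms)
  then have "has_infinite_component g = has_infinite_component h" by (intro ext) (simp only: has_infinite_component_def)
  then show ?thesis by (simp only: crit_intensity_def)
qed

theorem theorem4:
  fixes f :: "real \<Rightarrow> real" and p q :: real
  assumes "0 < p" and "p < q" and "q \<le> 1"
    and "\<And>r. 0 \<le> r \<Longrightarrow> 0 \<le> f r \<and> f r \<le> 1"
    and "\<And>a b. 0 \<le> a \<Longrightarrow> a \<le> b \<Longrightarrow> f b \<le> f a"
    and "{a. 0 \<le> a \<and> f a > 0} \<noteq> {}"
    and "bdd_above {a. 0 \<le> a \<and> f a > 0}"
    and "0 < Sup {a. 0 \<le> a \<and> f a > 0}"
  shows "crit_intensity (scale_conn p f) < crit_intensity (scale_conn q f) \<and>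
         crit_intensity f > 1 / (2 * pi * (LBINT r:{0..}. r * f r))"
proof -
  \<comment> \<open>The constant extension to negative arguments makes the monotonicity of
    \<open>f\<close> global, and measurability follows from it.\<close>
  define k where "k r = f (max 0 r)" for r
  define R where "R = Sup {a. 0 \<le> a \<and> f a > 0}"
  have R: "0 < R" using assms(8) by (simp add: R_def)
  have anti: "k v \<le> k u" if "u \<le> v" for u v unfolding k_def using that by (intro assms(5)) auto
  have k01: "0 \<le> k r" "k r \<le> 1" for r using assms(4)[of "max 0 r"] by (auto simp: k_def)
  have "mono (\<lambda>r. - k r)" using anti by (intro monoI) simp
  then have "(\<lambda>r. - (- k r)) \<in> borel_measurable borel" by (intro borel_measurable_uminus borel_measurable_mono)
  then have km[measurable]: "k \<in> borel_measurable borel" by simp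
  have kpos: "0 < k r" if "r < R" for r
  proof -
    have "max 0 r < R" using that R by simp
    then obtain a where "0 \<le> a" "f a > 0" "max 0 r < a" using less_cSup_iff[OF assms(6,7)] unfolding R_def by blast
    then show ?thesis using assms(5)[of "max 0 r" a] by (simp add: k_def)
  qed
  have kzero: "k r = 0" if "R < r" for r
  proof (rule ccontr)
    assume "k r \<noteq> 0"
    then have "0 < k r" using k01[of r] by linarith
    then have "r \<in> {a. 0 \<le> a \<and> f a > 0}" using that R by (simp add: k_def)
    from cSup_upper[OF this assms(7)] that show False by (simp add: R_def)
  qed
  interpret finite_range k R
  proof (rule finite_range.intro)
    show "profile k" using km k01 by (simp add: profile_def)
  qed (rule R | (rule anti kpos kzero; assumption))+
  have crit: "crit_intensity (scale_conn s f) = Sup (subcritical s)" if "0 < s" for s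
  proof -
    have "crit_intensity (scale_conn s f) = crit_intensity (\<lambda>r. s * k (sqrt s * r))"
      using that by (intro crit_intensity_cong) (simp add: scale_conn_def k_def)
    then show ?thesis by (simp add: crit_intensity_def subcritical_def percolates_def)
  qed
  define I where "I = (LBINT r:{0..}. r * f r)"
  let ?h = "\<lambda>r. r * k r * indicator {0..} r"
  have I: "I = (\<integral>r. ?h r \<partial>lborel)"
    unfolding I_def set_lebesgue_integral_def by (intro Bochner_Integration.integral_cong refl) (auto simp: k_def indicator_def)
  have h0: "0 \<le> ?h r" for r using k01[of r] by (auto simp: indicator_def)
  have "integrable lborel ?h"
  proof (rule integrableI_bounded)
    have "(\<integral>\<^sup>+r. ennreal (norm (?h r)) \<partial>lborel) \<le> (\<integral>\<^sup>+r. ennreal R * indicator {0..R} r \<partial>lborel)"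
    proof (rule nn_integral_mono)
      fix r :: real
      show "ennreal (norm (?h r)) \<le> ennreal R * indicator {0..R} r"
      proof (cases "0 \<le> r \<and> r \<le> R")
        case True
        then have "r * k r \<le> R * 1" using k01[of r] by (intro mult_mono) auto
        then show ?thesis using True k01[of r] by (simp add: ennreal_leI abs_mult)
      next
        case False
        then have "?h r = 0" using kzero[of r] by (auto simp: indicator_def)
        then have "norm (?h r) = 0" by (simp only: norm_zero)
        then show ?thesis by (simp only: ennreal_0 zero_le)
      qed
    qed
    also have "\<dots> < \<infinity>" using R by (simp add: nn_integral_cmult_indicator ennreal_mult[symmetric])
    finally show "(\<integral>\<^sup>+r. ennreal (norm (?h r)) \<partial>lborel) < \<infinity>" .
  qed simp
  then have nI: "(\<integral>\<^sup>+r. ennreal (?h r) \<partial>lborel) = ennreal I"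
    unfolding I by (rule nn_integral_eq_integral) (simp add: h0)
  have I0: "0 \<le> I" unfolding I by (rule integral_nonneg_AE) (use h0 in simp)
  have "(\<integral>\<^sup>+r. ennreal (2 * pi * r) * (ennreal (k r) * indicator {0..} r) \<partial>lborel) = (\<integral>\<^sup>+r. ennreal (2 * pi) * ennreal (?h r) \<partial>lborel)"
    by (intro nn_integral_cong) (use k01 in \<open>auto simp: indicator_def ennreal_mult[symmetric] mult_ac\<close>)
  also have "\<dots> = ennreal (2 * pi) * ennreal I" unfolding nI[symmetric] by (rule nn_integral_cmult) simp
  also have "\<dots> = ennreal (2 * pi * I)" using I0 by (simp add: ennreal_mult[symmetric])
  finally have c: "(\<integral>\<^sup>+r. ennreal (2 * pi * r) * (ennreal (k r) * indicator {0..} r) \<partial>lborel) = ennreal (2 * pi * I)" .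
  have c0: "0 \<le> 2 * pi * I" using I0 by simp
  \<comment> \<open>The weak bound at s = 1/2 involves the same integral \<open>I\<close>; the
    strict step from 1/2 to 1 then separates it from the critical intensity of
    \<open>f\<close>.\<close>
  have "1 / (2 * pi * I) \<le> Sup (subcritical (1 / 2))" by (rule Sup_subcritical_ge[OF _ _ c c0]) auto
  also have "\<dots> < Sup (subcritical 1)" by (rule Sup_subcritical_less[OF _ _ _ c c0]) auto
  also have "\<dots> = crit_intensity f" using crit[of 1] by (simp add: scale_conn_def[abs_def])
  finally have "1 / (2 * pi * I) < crit_intensity f" .
  moreover have "crit_intensity (scale_conn p f) < crit_intensity (scale_conn q f)"
    using Sup_subcritical_less[OF assms(1-3) c c0] assms(1,2) by (simp add: crit)
  ultimately show ?thesis unfolding I_def by blast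
qed

end
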